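(* Let $\Omega$ be a John domain in $\mathbb R^n$, with $n\ge2$. Assume that $q\in[1,\infty]$, $\alpha,\beta\in\mathbb R$ are $L^1$-admissible. **(I)** The embedding $W^1L^{(1,q;\alpha,\beta)}(\Omega)\hookrightarrow\mathcal L^{\widehat\psi_1(\cdot)}(\Omega)$ holds, where $\widehat\psi_1\colon(0,\infty)\to(0,\infty)$ is an admissible function obeying, near $0$, - $\widehat\psi_1(r)\approx r^{1-n}\log^{-\frac1q-\alpha}(\frac er)\log\log^{-\beta}(\frac er)$ if $q\in[1,\infty]$, $\alpha>-\frac1q$, $\beta\in\mathbb R$; - $\widehat\psi_1(r)\approx r^{1-n}\log\log^{-\frac1q-\beta}(\frac er)$ if $q\in[1,\infty]$, $\alpha=-\frac1q$, $\beta>-\frac1q$; - $\widehat\psi_1(r)\approx r^{1-n}\log\log\log^{-\frac1q}(\frac er)$ if $q\in[1,\infty)$, $\alpha=\beta=-\frac1q$. Moreover, $\widehat\psi_1$ is (up to multiplicative constants) the optimal admissible function in this embedding: if $\varphi$ is an admissible function such that $W^1L^{(1,q;\alpha,\beta)}(\Omega)\hookrightarrow\mathcal L^{\varphi(\cdot)}(\Omega)$, then $\mathcal L^{\widehat\psi_1(\cdot)}(\Omega)\hookrightarrow\mathcal L^{\varphi(\cdot)}(\Omega)$. **(II)** If $m\in\{2,\dots,n\}$, then $W^mL^{(1,q;\alpha,\beta)}(\Omega)\hookrightarrow\mathcal L^{\widehat\psi_m(\cdot)}(\Omega)$, where $\widehat\psi_m\colon(0,\infty)\to(0,\infty)$ is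 an admissible function obeying, near $0$, - $\widehat\psi_m(r)\approx r^{m-n}\log^{-\frac1q-\alpha}(\frac er)\log\log^{-\beta}(\frac er)$ if $q\in[1,\infty]$, $\alpha>-\frac1q$, $\beta\in\mathbb R$; - $\widehat\psi_m(r)\approx r^{m-n}\log\log^{-\frac1q-\beta}(\frac er)$ if $q\in[1,\infty]$, $\alpha=-\frac1q$, $\beta>-\frac1q$; - $\widehat\psi_m(r)\approx r^{m-n}\log\log\log^{-\frac1q}(\frac er)$ if $q\in[1,\infty)$, $\alpha=\beta=-\frac1q$. Moreover, $\widehat\psi_m$ is (up to multiplicative constants) the optimal admissible function in this embedding (in the same sense, with $W^1$ replaced by $W^m$).
   Context: Conventions: $\frac1\infty=0$. $\log^a(x)=(\log x)^a$, $\log\log^a(x)=(\log\log x)^a$, $\log\log\log^a(x)=(\log\log\log x)^a$. For positive functions, "$A\approx B$ near $0$" means that $c^{-1}B\le A\le cB$ on $(0,r_0)$ for some $c,r_0>0$. The arrow $\hookrightarrow$ denotes continuous embedding: inclusion together with the bound of the target (semi-)norm by a constant times the (semi-)norm of the domain space. For measurable $u$ on $E$: $u^*(s)=\inf\{t\ge0:|\{x\in E:|u(x)|>t\}|\le s\}$, $u^{**}(s)=\frac1s\int_0^su^*(t)\,dt$. Let $\ell(s)=1+|\log s|$, $\ell\ell(s)=1+\log\ell(s)$ and $\|f\|_{L^{(1,q;\alpha,\beta)}(0,1)}=\|s^{1-\frac1q}\ell^\alpha(s)\ell\ell^\beta(s)f^{**}(s)\|_{L^q(0,1)}$. $X(\Omega)$,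 with $X=L^{(1,q;\alpha,\beta)}$, is the space of measurable $u$ on $\Omega$ with $\|u\|_{X(\Omega)}=\|u^*(|\Omega|\,\cdot)\|_{X(0,1)}<\infty$. $(q,\alpha,\beta)$ is $L^1$-admissible if one of the following holds: $q\in[1,\infty],\alpha>-\frac1q,\beta\in\mathbb R$; $q\in[1,\infty],\alpha=-\frac1q,\beta>-\frac1q$; $q\in[1,\infty),\alpha=\beta=-\frac1q$. $W^mX(\Omega)$ is the space of $m$-times weakly differentiable $u$ on $\Omega$ with $|\nabla^ku|\in X(\Omega)$ for $k=0,\dots,m$, normed by $\sum_{k=0}^m\||\nabla^ku|\|_{X(\Omega)}$, where $\nabla^ku$ is the vector of all $k$-th order weak derivatives. A function $\varphi\colon(0,\infty)\to(0,\infty)$ is admissible if $\inf_{r\in[a,\infty)}\varphi(r)>0$ for every $a\in(0,\infty)$. The Campanato type space $\mathcal L^{\varphi(\cdot)}(\Omega)$ is the space of $u\in L^1_{\rm loc}(\Omega)$ with finite semi-norm $|u|_{\mathcal L^{\varphi(\cdot)}(\Omega)}=\sup_{B\subset\Omega}\frac1{\varphi(|B|^{1/n})}\frac1{|B|}\int_B|u-u_B|\,dx$, the supremum being over open balls $B\subset\Omega$ and $u_B$ being the average of $u$ over $B$. For bounded $\Omega$, only the behaviour of $\varphi$ near $0$, up to multiplicative constants, matters. A domain is a connected open set. A bounded domain $\Omega$ is a John domain if there exist $x_0\in\Omega$ and $c\in(0,1)$ such that every $x\in\Omega$ can be joined to $x_0$ by a rectifiable curve $\gamma_x\colon[0,\ell_x]\to\Omega$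 parametrized by arc length, $\gamma_x(0)=x$, $\gamma_x(\ell_x)=x_0$, with $\operatorname{dist}(\gamma_x(r),\partial\Omega)\ge c\,r$ for $r\in[0,\ell_x]$.
   Formalization: Optimality is asserted for admissible functions ψ̂_m that are also bounded above on compact subintervals of (0,∞); for admissible functions blowing up at a positive radius it can fail. The embeddings are asserted for all admissible ψ̂_m with the stated behaviour near 0. *)

theory Defs
  imports "HOL-Analysis.Analysis" "HOL-Probability.Essential_Supremum"
begin

section \<open>Rearrangements and the function norms\<close>

text \<open>All norms take values in \<^typ>\<open>ennreal\<close>; a space consists of the functions on which its norm
  (or semi-norm) is finite. Functions on a set are total functions whose values outside the set are
  irrelevant.\<close>

definition rearr :: "'a measure \<Rightarrow> ('a \<Rightarrow> ennreal) \<Rightarrow> real \<Rightarrow> ennreal" where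
  "rearr M f s =
     (INF t\<in>{t::real. 0 \<le> t \<and> emeasure M {x \<in> space M. ennreal t < f x} \<le> ennreal s}. ennreal t)"

definition rearr_avg :: "'a measure \<Rightarrow> ('a \<Rightarrow> ennreal) \<Rightarrow> real \<Rightarrow> ennreal" where
  "rearr_avg M f s = (\<integral>\<^sup>+t\<in>{0<..<s}. rearr M f t \<partial>lebesgue) / ennreal s"

text \<open>The number $1/q$, with the convention $1/\infty = 0$ (as \<^term>\<open>1 / top = (0::ennreal)\<close>).\<close>

definition recip :: "ennreal \<Rightarrow> real" where
  "recip q = enn2real (1 / q)"

definition ennpowr :: "ennreal \<Rightarrow> real \<Rightarrow> ennreal" where
  "ennpowr x p = (if x = top then top else ennreal (enn2real x powr p))" \<comment> \<open>only used for \<open>p > 0\<close>\<close>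

definition Lq_norm :: "ennreal \<Rightarrow> 'a measure \<Rightarrow> ('a \<Rightarrow> ennreal) \<Rightarrow> ennreal" where
  "Lq_norm q M f =
     (if q = top then esssup M f
      else ennpowr (\<integral>\<^sup>+x. ennpowr (f x) (enn2real q) \<partial>M) (recip q))"

definition ell :: "real \<Rightarrow> real" where
  "ell s = 1 + \<bar>ln s\<bar>"

definition ellell :: "real \<Rightarrow> real" where
  "ellell s = 1 + ln (ell s)"

definition LZ_norm01 :: "ennreal \<Rightarrow> real \<Rightarrow> real \<Rightarrow> (real \<Rightarrow> ennreal) \<Rightarrow> ennreal" where
  "LZ_norm01 q \<alpha> \<beta> f =
     Lq_norm q (lebesgue_on {0<..<1})
       (\<lambda>s. ennreal (s powr (1 - recip q) * ell s powr \<alpha> * ellell s powr \<beta>)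
             * rearr_avg (lebesgue_on {0<..<1}) f s)"

definition LZ_norm :: "ennreal \<Rightarrow> real \<Rightarrow> real \<Rightarrow> (real^'n) set \<Rightarrow> (real^'n \<Rightarrow> real) \<Rightarrow> ennreal" where
  "LZ_norm q \<alpha> \<beta> \<Omega> u =
     LZ_norm01 q \<alpha> \<beta> (\<lambda>s. rearr (lebesgue_on \<Omega>) (\<lambda>x. ennreal \<bar>u x\<bar>) (measure lebesgue \<Omega> * s))"

definition LZ_space :: "ennreal \<Rightarrow> real \<Rightarrow> real \<Rightarrow> (real^'n) set \<Rightarrow> (real^'n \<Rightarrow> real) set" where
  "LZ_space q \<alpha> \<beta> \<Omega> =
     {u. u \<in> borel_measurable (lebesgue_on \<Omega>) \<and> LZ_norm q \<alpha> \<beta> \<Omega> u < top}"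

definition L1_admissible :: "ennreal \<Rightarrow> real \<Rightarrow> real \<Rightarrow> bool" where
  "L1_admissible q \<alpha> \<beta> \<longleftrightarrow>
     (1 \<le> q \<and> \<alpha> > - recip q) \<or>
     (1 \<le> q \<and> \<alpha> = - recip q \<and> \<beta> > - recip q) \<or>
     (1 \<le> q \<and> q < top \<and> \<alpha> = - recip q \<and> \<beta> = - recip q)"


section \<open>Weak derivatives and Sobolev spaces\<close>

definition L1loc :: "(real^'n) set \<Rightarrow> (real^'n \<Rightarrow> real) set" where
  "L1loc \<Omega> = {u. \<forall>K. compact K \<and> K \<subseteq> \<Omega> \<longrightarrow> u absolutely_integrable_on K}"

text \<open>A list of coordinate indices \<open>[i\<^sub>1, \<dots>, i\<^sub>k]\<close> stands for the iterated partial derivative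
  \<open>\<partial>\<^bsub>i\<^sub>1\<^esub> \<dots> \<partial>\<^bsub>i\<^sub>k\<^esub>\<close> of order \<open>k\<close>.\<close>

fun iter_partial :: "'n list \<Rightarrow> (real^'n \<Rightarrow> real) \<Rightarrow> real^'n \<Rightarrow> real" where
  "iter_partial [] f = f"
| "iter_partial (i # is) f = (\<lambda>x. frechet_derivative (iter_partial is f) (at x) (axis i 1))"

text \<open>Differentiability of all iterated partial derivatives entails their continuity, so this is
  membership in \<open>C\<^sup>\<infinity>\<close>.\<close>

definition smooth :: "(real^'n \<Rightarrow> real) \<Rightarrow> bool" where
  "smooth f \<longleftrightarrow> (\<forall>is x. iter_partial is f differentiable (at x))"

definition test_function :: "(real^'n) set \<Rightarrow> (real^'n \<Rightarrow> real) \<Rightarrow> bool" where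
  "test_function \<Omega> \<eta> \<longleftrightarrow>
     smooth \<eta> \<and> compact (closure {x. \<eta> x \<noteq> 0}) \<and> closure {x. \<eta> x \<noteq> 0} \<subseteq> \<Omega>"

definition has_weak_deriv ::
  "(real^'n) set \<Rightarrow> 'n list \<Rightarrow> (real^'n \<Rightarrow> real) \<Rightarrow> (real^'n \<Rightarrow> real) \<Rightarrow> bool" where
  "has_weak_deriv \<Omega> is u v \<longleftrightarrow>
     u \<in> L1loc \<Omega> \<and> v \<in> L1loc \<Omega> \<and>
     (\<forall>\<eta>. test_function \<Omega> \<eta> \<longrightarrow>
        (LINT x:\<Omega>|lebesgue. u x * iter_partial is \<eta> x)
          = (- 1) ^ length is * (LINT x:\<Omega>|lebesgue. v x * \<eta> x))"

text \<open>Weak derivatives are unique almost everywhere, and all quantities formed from them below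
  are insensitive to null sets, so any representative may be chosen.\<close>

definition weak_deriv :: "(real^'n) set \<Rightarrow> 'n list \<Rightarrow> (real^'n \<Rightarrow> real) \<Rightarrow> real^'n \<Rightarrow> real" where
  "weak_deriv \<Omega> is u = (SOME v. has_weak_deriv \<Omega> is u v)"

definition weakly_differentiable :: "nat \<Rightarrow> (real^'n) set \<Rightarrow> (real^'n \<Rightarrow> real) \<Rightarrow> bool" where
  "weakly_differentiable m \<Omega> u \<longleftrightarrow> (\<forall>is. length is \<le> m \<longrightarrow> (\<exists>v. has_weak_deriv \<Omega> is u v))"

definition grad_abs :: "nat \<Rightarrow> (real^'n) set \<Rightarrow> (real^'n \<Rightarrow> real) \<Rightarrow> real^'n \<Rightarrow> real" where
  "grad_abs k \<Omega> u x = sqrt (\<Sum>is\<in>{is. length is = k}. (weak_deriv \<Omega> is u x)\<^sup>2)"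

definition Sobolev_space ::
  "nat \<Rightarrow> ennreal \<Rightarrow> real \<Rightarrow> real \<Rightarrow> (real^'n) set \<Rightarrow> (real^'n \<Rightarrow> real) set" where
  "Sobolev_space m q \<alpha> \<beta> \<Omega> =
     {u. weakly_differentiable m \<Omega> u \<and> (\<forall>k\<le>m. grad_abs k \<Omega> u \<in> LZ_space q \<alpha> \<beta> \<Omega>)}"

definition Sobolev_norm ::
  "nat \<Rightarrow> ennreal \<Rightarrow> real \<Rightarrow> real \<Rightarrow> (real^'n) set \<Rightarrow> (real^'n \<Rightarrow> real) \<Rightarrow> ennreal" where
  "Sobolev_norm m q \<alpha> \<beta> \<Omega> u = (\<Sum>k\<le>m. LZ_norm q \<alpha> \<beta> \<Omega> (grad_abs k \<Omega> u))"


section \<open>Campanato type spaces\<close>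

definition admissible :: "(real \<Rightarrow> real) \<Rightarrow> bool" where
  "admissible \<phi> \<longleftrightarrow> (\<forall>r>0. \<phi> r > 0) \<and> (\<forall>a>0. (INF r\<in>{a..}. \<phi> r) > 0)"

definition mean :: "(real^'n) set \<Rightarrow> (real^'n \<Rightarrow> real) \<Rightarrow> real" where
  "mean B u = (LINT x:B|lebesgue. u x) / measure lebesgue B"

text \<open>A function in \<open>L\<^sup>1\<^sub>l\<^sub>o\<^sub>c(\<Omega>)\<close> need not be integrable on a ball touching the boundary of \<open>\<Omega>\<close>.
  On such a ball \<^const>\<open>mean\<close> is the default value 0 and the integral below is infinite.\<close>

definition Campanato_seminorm ::
  "(real \<Rightarrow> real) \<Rightarrow> (real^'n) set \<Rightarrow> (real^'n \<Rightarrow> real) \<Rightarrow> ennreal" where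
  "Campanato_seminorm \<phi> \<Omega> u =
     (SUP B\<in>{ball x r |x r. 0 < r \<and> ball x r \<subseteq> \<Omega>}.
        ennreal (1 / \<phi> (measure lebesgue B powr (1 / CARD('n))))
          * (ennreal (1 / measure lebesgue B) * (\<integral>\<^sup>+x\<in>B. ennreal \<bar>u x - mean B u\<bar> \<partial>lebesgue)))"

definition Campanato_space :: "(real \<Rightarrow> real) \<Rightarrow> (real^'n) set \<Rightarrow> (real^'n \<Rightarrow> real) set" where
  "Campanato_space \<phi> \<Omega> = {u \<in> L1loc \<Omega>. Campanato_seminorm \<phi> \<Omega> u < top}"

definition embeds :: "'f set \<Rightarrow> ('f \<Rightarrow> ennreal) \<Rightarrow> 'f set \<Rightarrow> ('f \<Rightarrow> ennreal) \<Rightarrow> bool" where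
  "embeds A NA B NB \<longleftrightarrow> A \<subseteq> B \<and> (\<exists>C::real. \<forall>u\<in>A. NB u \<le> ennreal C * NA u)"

abbreviation Sobolev_into_Campanato ::
  "nat \<Rightarrow> ennreal \<Rightarrow> real \<Rightarrow> real \<Rightarrow> (real \<Rightarrow> real) \<Rightarrow> (real^'n) set \<Rightarrow> bool" where
  "Sobolev_into_Campanato m q \<alpha> \<beta> \<phi> \<Omega> \<equiv>
     embeds (Sobolev_space m q \<alpha> \<beta> \<Omega>) (Sobolev_norm m q \<alpha> \<beta> \<Omega>)
            (Campanato_space \<phi> \<Omega>) (Campanato_seminorm \<phi> \<Omega>)"

abbreviation Campanato_into_Campanato ::
  "(real \<Rightarrow> real) \<Rightarrow> (real \<Rightarrow> real) \<Rightarrow> (real^'n) set \<Rightarrow> bool" where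
  "Campanato_into_Campanato \<psi> \<phi> \<Omega> \<equiv>
     embeds (Campanato_space \<psi> \<Omega>) (Campanato_seminorm \<psi> \<Omega>)
            (Campanato_space \<phi> \<Omega>) (Campanato_seminorm \<phi> \<Omega>)"

definition equiv_near_0 :: "(real \<Rightarrow> real) \<Rightarrow> (real \<Rightarrow> real) \<Rightarrow> bool" where
  "equiv_near_0 A B \<longleftrightarrow>
     (\<exists>c>0. \<exists>r0>0. \<forall>r\<in>{0<..<r0}. inverse c * B r \<le> A r \<and> A r \<le> c * B r)"

definition obeys_near_0 :: "nat \<Rightarrow> nat \<Rightarrow> ennreal \<Rightarrow> real \<Rightarrow> real \<Rightarrow> (real \<Rightarrow> real) \<Rightarrow> bool" where
  "obeys_near_0 n m q \<alpha> \<beta> \<psi> \<longleftrightarrow>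
     (1 \<le> q \<and> \<alpha> > - recip q \<longrightarrow>
        equiv_near_0 \<psi> (\<lambda>r. r powr (real m - real n)
          * ln (exp 1 / r) powr (- recip q - \<alpha>) * ln (ln (exp 1 / r)) powr (- \<beta>))) \<and>
     (1 \<le> q \<and> \<alpha> = - recip q \<and> \<beta> > - recip q \<longrightarrow>
        equiv_near_0 \<psi> (\<lambda>r. r powr (real m - real n)
          * ln (ln (exp 1 / r)) powr (- recip q - \<beta>))) \<and>
     (1 \<le> q \<and> q < top \<and> \<alpha> = - recip q \<and> \<beta> = - recip q \<longrightarrow>
        equiv_near_0 \<psi> (\<lambda>r. r powr (real m - real n)
          * ln (ln (ln (exp 1 / r))) powr (- recip q)))"

text \<open>For bounded \<open>\<Omega>\<close>, only the behaviour of \<open>\<psi>\<close> near 0 is meant to matter. This is the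
  case among admissible functions that are bounded on the compact subintervals of \<open>(0, \<infinity>)\<close>,
  but not if \<open>\<psi>\<close> blows up at a positive radius: arbitrarily weak control of the balls of
  radius close to a given one can enlarge the space.\<close>

definition locally_bounded :: "(real \<Rightarrow> real) \<Rightarrow> bool" where
  "locally_bounded \<psi> \<longleftrightarrow> (\<forall>a b. 0 < a \<longrightarrow> bdd_above (\<psi> ` {a..b}))"


section \<open>John domains\<close>

definition curve_length :: "(real \<Rightarrow> real^'n) \<Rightarrow> real \<Rightarrow> real \<Rightarrow> ennreal" where
  "curve_length \<gamma> a b =
     (SUP ts\<in>{ts. sorted ts \<and> set ts \<subseteq> {a..b}}.
        \<Sum>i<length ts - 1. ennreal (dist (\<gamma> (ts ! i)) (\<gamma> (ts ! Suc i))))"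

definition arc_length_param :: "(real \<Rightarrow> real^'n) \<Rightarrow> real \<Rightarrow> bool" where
  "arc_length_param \<gamma> l \<longleftrightarrow>
     0 \<le> l \<and> continuous_on {0..l} \<gamma> \<and> (\<forall>r\<in>{0..l}. curve_length \<gamma> 0 r = ennreal r)"

definition John_domain :: "(real^'n) set \<Rightarrow> bool" where
  "John_domain \<Omega> \<longleftrightarrow>
     open \<Omega> \<and> connected \<Omega> \<and> bounded \<Omega> \<and>
     (\<exists>x0\<in>\<Omega>. \<exists>c\<in>{0<..<1::real}. \<forall>x\<in>\<Omega>. \<exists>\<gamma> l.
        arc_length_param \<gamma> l \<and> \<gamma> ` {0..l} \<subseteq> \<Omega> \<and> \<gamma> 0 = x \<and> \<gamma> l = x0 \<and>
        (\<forall>r\<in>{0..l}. infdist (\<gamma> r) (frontier \<Omega>) \<ge> c * r))"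

end

theory Submission
  imports Defs "HOL-Real_Asymp.Real_Asymp"
begin

text \<open>By the Hardy-Littlewood inequality, a bound for \<open>u\<close> in \<open>L\<^bsup>(1,q;\<alpha>,\<beta>)\<^esup>\<close> amounts to
  \<open>\<integral>\<^bsub>E\<^esub> |u| \<le> C \<parallel>u\<parallel> / \<Gamma>(|E|)\<close>, where \<open>\<Gamma>(s)\<close> is the \<open>L\<^sup>q(s, 1)\<close> norm of the weight, and the
  norm of an indicator function is comparable to \<open>|E| \<Gamma>(|E|)\<close>. The three cases of the theorem are the
  three possible growth rates of \<open>\<Gamma>\<close> at \<open>0\<close>. For \<open>m = 1\<close> the embedding follows by inserting this into
  the Poincare inequality on balls. For \<open>m \<ge> 2\<close> the integral of a derivative of lower order over a
  small ball is estimated through its oscillation and its mean, and the mean by comparison with the mean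
  over a ball of fixed size along a chain of balls of growing radii that follows a John curve. The
  rates are attained, up to constants, by \<open>\<eta>((x - x\<^sub>0) / r)\<close> with a fixed bump function \<open>\<eta>\<close>; the
  balls of radius bounded away from \<open>0\<close> are handled by the local boundedness of \<open>\<psi>\<close> and the lower bound
  for an admissible \<open>\<phi>\<close>.\<close>


section \<open>Smooth bump functions\<close>

text \<open>Everything is read off the distribution function \<mu> of |u|: s times the maximal
  function at s is the integral of \<open>min s \<mu>\<close> over all levels. This grows with s, so
  a bound for an integral over a small set holds on all of (s, 1) at once and can be pulled out of
  the weighted norm; what remains of the norm is \<Gamma>. \<Gamma> has no closed form in general.
  \<open>log_primitive\<close> is therefore chosen so that its derivative is the weight up to a
  factor with a positive limit. The borderline \<alpha> = \<beta> = -1/q leads to the weight 1/(y (1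
  + ln y)), whose primitive is one more iterated logarithm. The Poincare inequality says nothing
  about means, and this is the obstacle for m > 1. Means over balls of radius r are bounded by
  r^(-e) / \<Gamma> with e >= 1, where e >= 1 comes from m <= n: doubling r at least halves r^(-e),
  while the slowly varying \<Gamma> loses at most a factor 3/2, so the contributions along a chain
  form a geometric series of ratio 3/4. Optimality is a pointwise matter: one bump at each small
  radius forces a lower bound for \<phi> by a multiple of \<psi>, and such a comparison implies the
  embedding of the Campanato spaces.\<close>

definition flat_exp :: "real poly \<Rightarrow> real \<Rightarrow> real" where
  "flat_exp p t = (if t > 0 then poly p (1 / t) * exp (- (1 / t)) else 0)"

lemma poly_mult_exp_neg_tendsto_0:
  "((\<lambda>y. poly p y * exp (- y)) \<longlongrightarrow> (0::real)) at_top"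
proof -
  have "((\<lambda>y. \<Sum>i\<le>degree p. coeff p i * (y ^ i / exp y)) \<longlongrightarrow> (\<Sum>i\<le>degree p. coeff p i * 0)) at_top"
    by (intro tendsto_sum tendsto_mult tendsto_const tendsto_power_div_exp_0)
  then show ?thesis
    by (simp add: poly_altdef sum_distrib_right exp_minus divide_inverse mult.assoc)
qed

text \<open>For t > 0 put y = 1/t: differentiating p(y) exp(-y) in t brings out y^2 (p - p')(y), the
  polynomial in the statement. At t = 0 the right difference quotient is y p(y) exp(-y), which tends
  to 0 as y grows.\<close>

lemma flat_exp_has_derivative:
  "(flat_exp p has_real_derivative flat_exp ([:0, 0, 1:] * (p - pderiv p)) t) (at t)"
proof -
  consider "t > 0" | "t < 0" | "t = 0" by linarith
  then show ?thesis
  proof cases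
    case 1
    have "((\<lambda>t. poly p (1 / t) * exp (- (1 / t))) has_real_derivative
            flat_exp ([:0, 0, 1:] * (p - pderiv p)) t) (at t)"
      using 1 unfolding flat_exp_def
      by (auto intro!: derivative_eq_intros poly_DERIV[THEN DERIV_chain2] simp: field_simps power2_eq_square)
    then show ?thesis
      by (rule DERIV_cong_ev[THEN iffD1, rotated 3, OF _ refl _ refl])
         (use 1 in \<open>auto simp: flat_exp_def eventually_nhds intro!: exI[of _ "{0<..}"]\<close>)
  next
    case 2
    have "((\<lambda>t. 0) has_real_derivative 0) (at t)" by simp
    then have "(flat_exp p has_real_derivative 0) (at t)"
      by (rule DERIV_cong_ev[THEN iffD1, rotated 3, OF _ refl _ refl])
         (use 2 in \<open>auto simp: flat_exp_def eventually_nhds intro!: exI[of _ "{..<0}"]\<close>)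
    then show ?thesis using 2 by (simp add: flat_exp_def)
  next
    case 3
    have "((\<lambda>h. poly ([:0, 1:] * p) (inverse h) * exp (- inverse h)) \<longlongrightarrow> 0) (at_right (0::real))"
      by (rule filterlim_compose[OF poly_mult_exp_neg_tendsto_0 filterlim_inverse_at_top_right])
    then have r: "((\<lambda>h. flat_exp p h / h) \<longlongrightarrow> 0) (at_right 0)"
      by (rule Lim_transform_eventually)
         (auto simp: eventually_at_filter flat_exp_def field_simps)
    have l: "((\<lambda>h. flat_exp p h / h) \<longlongrightarrow> 0) (at_left 0)"
      by (rule Lim_transform_eventually[OF tendsto_const])
         (auto simp: eventually_at_filter flat_exp_def)
    have "((\<lambda>h. flat_exp p h / h) \<longlongrightarrow> 0) (at 0)"
      using l r filterlim_split_at by blast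
    then show ?thesis
      using 3 by (simp add: has_field_derivative_iff flat_exp_def[of _ 0])
  qed
qed

text \<open>Allowing an arbitrary polynomial in \<open>1 / t\<close> makes this class closed under partial derivatives.\<close>

inductive_set bumps :: "(real^'n \<Rightarrow> real) set" where
  base: "(\<lambda>x. flat_exp p (c * (x $ i - a))) \<in> bumps"
| add: "f \<in> bumps \<Longrightarrow> g \<in> bumps \<Longrightarrow> (\<lambda>x. f x + g x) \<in> bumps"
| mult: "f \<in> bumps \<Longrightarrow> g \<in> bumps \<Longrightarrow> (\<lambda>x. f x * g x) \<in> bumps"

lemma bumps_partials:
  fixes f :: "real^'n \<Rightarrow> real"
  assumes "f \<in> bumps"
  shows "\<exists>D. (\<forall>x. (f has_derivative D x) (at x)) \<and> (\<forall>i. (\<lambda>x. D x (axis i 1)) \<in> bumps)"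
  using assms
proof induction
  case (base p c i a)
  let ?q = "[:0, 0, 1:] * (p - pderiv p)"
  let ?D = "\<lambda>x h. flat_exp ?q (c * (x $ i - a)) * (c * h $ i)"
  have "((\<lambda>x. flat_exp p (c * (x $ i - a))) has_derivative ?D x) (at x)" for x :: "real^'n"
  proof -
    have "((\<lambda>x. c * (x $ i - a)) has_derivative (\<lambda>h. c * h $ i)) (at x)"
      by (auto intro!: derivative_eq_intros bounded_linear.has_derivative[OF bounded_linear_vec_nth])
    from DERIV_compose_FDERIV[OF flat_exp_has_derivative this]
    show ?thesis by (simp add: mult_ac)
  qed
  moreover have "(\<lambda>x. ?D x (axis j 1)) \<in> bumps" for j :: 'n
  proof -
    \<comment> \<open>The factor c of the chain rule is absorbed into the polynomial, and for j
      different from i the polynomial becomes zero, so every partial derivative is again a base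
      function.\<close>
    have "(\<lambda>x. ?D x (axis j 1)) = (\<lambda>x. flat_exp (smult (if j = i then c else 0) ?q) (c * (x $ i - a)))"
      by (auto simp: fun_eq_iff flat_exp_def axis_def)
    then show ?thesis by (metis bumps.base)
  qed
  ultimately show ?case by (intro exI[of _ ?D]) simp
next
  case (add f g)
  then obtain D E where *: "\<And>x. (f has_derivative D x) (at x)" "\<And>i. (\<lambda>x. D x (axis i 1)) \<in> bumps"
     "\<And>x. (g has_derivative E x) (at x)" "\<And>i. (\<lambda>x. E x (axis i 1)) \<in> bumps" by blast
  show ?case
    by (rule exI[of _ "\<lambda>x h. D x h + E x h"]) (auto intro!: has_derivative_add * bumps.add)
next
  case (mult f g)
  then obtain D E where *: "\<And>x. (f has_derivative D x) (at x)" "\<And>i. (\<lambda>x. D x (axis i 1)) \<in> bumps"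
     "\<And>x. (g has_derivative E x) (at x)" "\<And>i. (\<lambda>x. E x (axis i 1)) \<in> bumps" by blast
  show ?case
    by (rule exI[of _ "\<lambda>x h. f x * E x h + D x h * g x"])
       (auto intro!: has_derivative_mult * bumps.add bumps.mult mult.hyps)
qed

lemma iter_partial_bumps:
  assumes "f \<in> bumps" shows "iter_partial ks f \<in> bumps"
proof (induction ks)
  case Nil then show ?case using assms by simp
next
  case (Cons i ks)
  from bumps_partials[OF this] obtain D where
    D: "\<And>x. (iter_partial ks f has_derivative D x) (at x)" "\<And>i. (\<lambda>x. D x (axis i 1)) \<in> bumps"
    by blast
  have "iter_partial (i # ks) f = (\<lambda>x. D x (axis i 1))"
    using frechet_derivative_at[OF D(1)] by (simp add: fun_eq_iff)
  then show ?case using D(2) by simp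
qed

lemma smooth_bumps: "f \<in> bumps \<Longrightarrow> smooth f"
  unfolding smooth_def using iter_partial_bumps bumps_partials differentiableI by blast

lemma smoothD: "smooth f \<Longrightarrow> iter_partial ks f differentiable (at x)"
  by (simp add: smooth_def)

lemma smooth_continuous: "smooth f \<Longrightarrow> continuous_on S (iter_partial ks f)"
  by (simp add: smoothD differentiable_imp_continuous_within continuous_at_imp_continuous_on)

lemma smooth_measurable [measurable_dest]: "smooth f \<Longrightarrow> f \<in> borel_measurable borel"
  using smooth_continuous[of f UNIV "[]"] by (simp add: borel_measurable_continuous_onI)

lemma iter_partial_append: "iter_partial (ks @ js) f = iter_partial ks (iter_partial js f)"
  by (induction ks) auto

lemma smooth_iter_partial: "smooth f \<Longrightarrow> smooth (iter_partial ks f)"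
  by (simp add: smooth_def flip: iter_partial_append)

text \<open>The complement of the closed support is open, so each further derivative is taken of a
  function vanishing in a whole neighbourhood.\<close>

lemma iter_partial_outside_support:
  assumes "x \<notin> closure {x. f x \<noteq> 0}"
  shows "iter_partial ks f x = 0"
  using assms
proof (induction ks arbitrary: x)
  case Nil
  then have "x \<notin> {x. f x \<noteq> 0}" by (meson closure_subset contra_subsetD)
  then show ?case by simp
next
  case (Cons i ks)
  have "(iter_partial ks f has_derivative (\<lambda>_. 0)) (at x)"
  proof (rule has_derivative_transform_within_open)
    show "((\<lambda>_. 0) has_derivative (\<lambda>_. 0)) (at x)" by simp
    show "open (- closure {x. f x \<noteq> 0})" by (simp add: open_Compl)
    show "x \<in> - closure {x. f x \<noteq> 0}" using Cons.prems by simp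
    show "0 = iter_partial ks f y" if "y \<in> - closure {x. f x \<noteq> 0}" for y
      using Cons.IH[of y] that by simp
  qed
  from frechet_derivative_at[OF this] have "frechet_derivative (iter_partial ks f) (at x) = (\<lambda>_. 0)" ..
  then show ?case by simp
qed

lemma support_iter_partial: "closure {x. iter_partial ks f x \<noteq> 0} \<subseteq> closure {x. f x \<noteq> 0}"
proof (rule closure_minimal)
  show "{x. iter_partial ks f x \<noteq> 0} \<subseteq> closure {x. f x \<noteq> 0}"
    using iter_partial_outside_support by blast
qed simp

lemma test_function_iter_partial:
  assumes "test_function \<Omega> \<eta>" shows "test_function \<Omega> (iter_partial ks \<eta>)"
proof -
  have "compact (closure {x. iter_partial ks \<eta> x \<noteq> 0})"
    unfolding compact_closure
    by (rule bounded_subset[of "closure {x. \<eta> x \<noteq> 0}"])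
       (use assms support_iter_partial[of ks \<eta>] closure_subset[of "{x. iter_partial ks \<eta> x \<noteq> 0}"]
         in \<open>auto simp: test_function_def compact_imp_bounded\<close>)
  then show ?thesis
    using assms support_iter_partial[of ks \<eta>] by (auto simp: test_function_def smooth_iter_partial)
qed

lemma test_function_iter_partial_bounded:
  fixes \<eta> :: "real^'n \<Rightarrow> real"
  assumes "test_function \<Omega> \<eta>"
  obtains M where "M \<ge> 0" "\<And>x. \<bar>iter_partial ks \<eta> x\<bar> \<le> M"
proof -
  let ?K = "closure {x. \<eta> x \<noteq> 0}"
  have "compact (iter_partial ks \<eta> ` ?K)"
    using assms by (intro compact_continuous_image smooth_continuous) (auto simp: test_function_def)
  then obtain M where M: "\<And>x. x \<in> ?K \<Longrightarrow> \<bar>iter_partial ks \<eta> x\<bar> \<le> M"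
    using bounded_iff compact_imp_bounded by (metis imageI real_norm_def)
  show thesis
  proof (rule that[of "max M 0"])
    show "\<bar>iter_partial ks \<eta> x\<bar> \<le> max M 0" for x
      using M[of x] iter_partial_outside_support[of x \<eta> ks] by (cases "x \<in> ?K") auto
  qed simp
qed

lemma test_function_mono: "test_function A \<eta> \<Longrightarrow> A \<subseteq> B \<Longrightarrow> test_function B \<eta>"
  by (auto simp: test_function_def)

lemma test_function_outside: "test_function A \<eta> \<Longrightarrow> x \<notin> A \<Longrightarrow> iter_partial ks \<eta> x = 0"
  using iter_partial_outside_support[of x \<eta> ks] by (auto simp: test_function_def)

text \<open>Applied with c = 1 to translates of test functions and with c = 1 / r to the rescaled
  bump, where the powers of c produce the factor r^(-m) in the Sobolev norm.\<close>

lemma iter_partial_affine: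
  fixes f :: "real^'n \<Rightarrow> real"
  assumes "smooth f"
  shows "iter_partial ks (\<lambda>x. f (c *\<^sub>R x + a)) = (\<lambda>x. c ^ length ks * iter_partial ks f (c *\<^sub>R x + a))"
proof (induction ks)
  case (Cons i ks)
  have "frechet_derivative (\<lambda>x. c ^ length ks * iter_partial ks f (c *\<^sub>R x + a)) (at x) (axis i 1)
      = c ^ Suc (length ks) * iter_partial (i # ks) f (c *\<^sub>R x + a)" for x
  proof -
    let ?D = "frechet_derivative (iter_partial ks f) (at (c *\<^sub>R x + a))"
    have D: "(iter_partial ks f has_derivative ?D) (at (c *\<^sub>R x + a))"
      using smoothD[OF assms] frechet_derivative_works by blast
    have A: "((\<lambda>x. c *\<^sub>R x + a) has_derivative (\<lambda>h. c *\<^sub>R h)) (at x)"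
      by (auto intro!: derivative_eq_intros)
    have "((\<lambda>x. c ^ length ks * iter_partial ks f (c *\<^sub>R x + a)) has_derivative
        (\<lambda>h. c ^ length ks * ?D (c *\<^sub>R h))) (at x)"
      by (intro has_derivative_mult_right
            has_derivative_compose[where f = "\<lambda>x. c *\<^sub>R x + a" and g = "iter_partial ks f", OF A D])
    moreover have "?D (c *\<^sub>R h) = c * ?D h" for h
      using D has_derivative_bounded_linear linear_simps(5) by (metis real_scaleR_def)
    ultimately show ?thesis
      by (subst frechet_derivative_at[symmetric]) (auto simp: mult_ac)
  qed
  then show ?case using Cons by simp
qed simp

lemma smooth_affine:
  fixes f :: "real^'n \<Rightarrow> real"
  assumes "smooth f" shows "smooth (\<lambda>x. f (c *\<^sub>R x + a))"
  unfolding smooth_def iter_partial_affine[OF assms]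
proof (intro allI)
  fix ks x
  have "(iter_partial ks f \<circ> (\<lambda>x. c *\<^sub>R x + a)) differentiable at x"
    by (intro differentiable_chain_at smoothD[OF assms]) (auto intro!: derivative_intros)
  then show "(\<lambda>x. c ^ length ks * iter_partial ks f (c *\<^sub>R x + a)) differentiable at x"
    by (auto simp: o_def)
qed

section \<open>Bump functions on boxes\<close>

definition box_bump :: "real \<Rightarrow> real^'n \<Rightarrow> real^'n \<Rightarrow> real^'n \<Rightarrow> real" where
  "box_bump k a b x = (\<Prod>i\<in>UNIV. flat_exp 1 (k * (x $ i - a $ i)) * flat_exp 1 (k * (b $ i - x $ i)))"

lemma prod_bumps:
  assumes "finite I" "I \<noteq> {}" "\<And>i. i \<in> I \<Longrightarrow> f i \<in> bumps"
  shows "(\<lambda>x. \<Prod>i\<in>I. f i x) \<in> bumps"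
  using assms by (induction rule: finite_ne_induct) (auto intro: bumps.mult)

lemma smooth_box_bump:
  fixes a b :: "real^'n"
  shows "smooth (box_bump k a b)"
proof -
  have *: "(\<lambda>x::real^'n. flat_exp 1 (k * (b $ i - x $ i))) \<in> bumps" for i :: 'n
    using bumps.base[of 1 "-k" i "b $ i"] by (simp add: algebra_simps)
  show ?thesis
    unfolding box_bump_def[abs_def]
    by (intro smooth_bumps prod_bumps bumps.mult bumps.base *) auto
qed

lemma flat_exp_1_bounds: "0 \<le> flat_exp 1 t" "flat_exp 1 t \<le> 1" "flat_exp 1 t > 0 \<longleftrightarrow> t > 0"
  by (auto simp: flat_exp_def)

lemma box_bump_bounds: "0 \<le> box_bump k a b x" "box_bump k a b x \<le> 1"
  unfolding box_bump_def
  by (auto intro!: prod_nonneg prod_le_1 mult_le_one flat_exp_1_bounds mult_nonneg_nonneg)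

lemma box_bump_pos_iff:
  assumes "k > 0" shows "box_bump k a b x > 0 \<longleftrightarrow> x \<in> box a b"
proof -
  have "box_bump k a b x > 0 \<longleftrightarrow> (\<forall>i. flat_exp 1 (k * (x $ i - a $ i)) * flat_exp 1 (k * (b $ i - x $ i)) \<noteq> 0)"
    using box_bump_bounds(1)[of k a b x] unfolding box_bump_def by (simp add: order_less_le eq_commute[of 0])
  also have "\<dots> \<longleftrightarrow> (\<forall>i. flat_exp 1 (k * (x $ i - a $ i)) > 0 \<and> flat_exp 1 (k * (b $ i - x $ i)) > 0)"
    using flat_exp_1_bounds(1) by (simp add: order_less_le eq_commute[of 0])
  also have "\<dots> \<longleftrightarrow> x \<in> box a b"
    using assms by (simp add: flat_exp_1_bounds mem_box_cart zero_less_mult_iff)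
  finally show ?thesis .
qed

lemma test_function_box_bump:
  assumes "k > 0" "cbox a b \<subseteq> \<Omega>" shows "test_function \<Omega> (box_bump k a b)"
proof -
  have "{x. box_bump k a b x \<noteq> 0} = box a b"
  proof (rule set_eqI)
    show "x \<in> {x. box_bump k a b x \<noteq> 0} \<longleftrightarrow> x \<in> box a b" for x
      using box_bump_pos_iff[OF assms(1), of a b x] box_bump_bounds(1)[of k a b x] by auto
  qed
  moreover have "closure (box a b) \<subseteq> cbox a b"
    by (rule closure_minimal) (auto simp: mem_box_cart less_imp_le)
  ultimately show ?thesis
    using assms by (auto simp: test_function_def smooth_box_bump compact_closure bounded_box)
qed

text \<open>Since \<open>flat_exp 1 (k * t)\<close> is exp(-1/(k t)) for t > 0, the parameter k only
  steepens the edges: the values inside tend to 1 while the set of positivity stays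
  \<open>box a b\<close>.\<close>

lemma box_bump_tendsto:
  fixes a b :: "real^'n"
  shows "(\<lambda>k. box_bump (real (Suc k)) a b x) \<longlonglongrightarrow> indicator (box a b) x"
proof (cases "x \<in> box a b")
  case True
  have *: "(\<lambda>k. flat_exp 1 (real (Suc k) * t)) \<longlonglongrightarrow> 1" if "t > 0" for t
  proof -
    have "(\<lambda>k. exp (- (inverse (real (Suc k)) * inverse t))) \<longlonglongrightarrow> exp (- (0 * inverse t))"
      by (intro tendsto_intros LIMSEQ_inverse_real_of_nat)
    then show ?thesis using that by (simp add: flat_exp_def divide_inverse)
  qed
  have "(\<lambda>k. box_bump (real (Suc k)) a b x) \<longlonglongrightarrow> (\<Prod>i\<in>(UNIV::'n set). 1 * 1)"
    unfolding box_bump_def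
    by (intro tendsto_prod tendsto_mult *) (use True in \<open>auto simp: mem_box_cart\<close>)
  then show ?thesis using True by simp
next
  case False
  then have "box_bump (real (Suc k)) a b x = 0" for k
    using box_bump_pos_iff[of "real (Suc k)" a b x] box_bump_bounds(1)[of "real (Suc k)" a b x] by linarith
  then show ?thesis using False by simp
qed

section \<open>Translations and the fundamental lemma of the calculus of variations\<close>

lemma nn_integral_lborel_translate:
  fixes f :: "'a::euclidean_space \<Rightarrow> ennreal"
  assumes [measurable]: "f \<in> borel_measurable borel"
  shows "(\<integral>\<^sup>+x. f (a + x) \<partial>lborel) = (\<integral>\<^sup>+x. f x \<partial>lborel)"
proof -
  have "(\<integral>\<^sup>+x. f x \<partial>lborel) = (\<integral>\<^sup>+x. f x \<partial>distr lborel borel ((+) a))"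
    by (simp add: lborel_distr_plus)
  also have "\<dots> = (\<integral>\<^sup>+x. f (a + x) \<partial>lborel)"
    by (subst nn_integral_distr) auto
  finally show ?thesis ..
qed

lemma integral_lborel_translate:
  fixes f :: "'a::euclidean_space \<Rightarrow> real"
  assumes [measurable]: "f \<in> borel_measurable borel"
  shows "(\<integral>x. f (a + x) \<partial>lborel) = (\<integral>x. f x \<partial>lborel)"
proof -
  have "(\<integral>x. f x \<partial>lborel) = (\<integral>x. f x \<partial>distr lborel borel ((+) a))"
    by (simp add: lborel_distr_plus)
  also have "\<dots> = (\<integral>x. f (a + x) \<partial>lborel)"
    by (subst integral_distr) auto
  finally show ?thesis ..
qed

lemma integrable_lborel_translate:
  fixes f :: "'a::euclidean_space \<Rightarrow> real"
  assumes "integrable lborel f"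
  shows "integrable lborel (\<lambda>x. f (a + x))"
proof -
  have "integrable (distr lborel borel ((+) a)) f"
    using assms by (simp add: lborel_distr_plus)
  then show ?thesis
    by (subst (asm) integrable_distr_eq) (use assms in auto)
qed

lemma box_Int_box_cart:
  fixes a b c d :: "real^'n"
  shows "box a b \<inter> box c d = box (\<chi> i. max (a $ i) (c $ i)) (\<chi> i. min (b $ i) (d $ i))"
  by (auto simp: mem_box_cart)

text \<open>Open boxes form an intersection-stable generator of the Borel sets, so vanishing
  integrals spread from boxes to all Borel sets by Dynkin's argument. The support condition makes
  the total integral one over a box, which the step for complements requires.\<close>

lemma AE_zero_if_box_integrals_zero:
  fixes f :: "real^'n \<Rightarrow> real"
  assumes f: "integrable lborel f"
    and box0: "\<And>a b. (\<integral>x. indicator (box a b) x * f x \<partial>lborel) = 0"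
    and supp: "\<And>x. x \<notin> box l u \<Longrightarrow> f x = 0"
  shows "AE x in lborel. f x = 0"
proof (rule sigma_finite_measure.density_zero[OF sigma_finite_lborel f])
  let ?E = "range (\<lambda>(a, b). box a b :: (real^'n) set)"
  have total: "(\<integral>x. f x \<partial>lborel) = 0"
  proof -
    have "(\<integral>x. f x \<partial>lborel) = (\<integral>x. indicator (box l u) x * f x \<partial>lborel)"
      using supp by (intro Bochner_Integration.integral_cong) (auto simp: indicator_def)
    then show ?thesis using box0 by simp
  qed
  have si: "set_integrable lborel A f" if "A \<in> sets borel" for A
    unfolding set_integrable_def using f that by (intro integrable_mult_indicator) auto
  fix A :: "(real^'n) set"
  assume "A \<in> sets lborel"
  then have A: "A \<in> sigma_sets UNIV ?E"
    by (simp add: borel_eq_box)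
  have Int: "Int_stable ?E"
    by (auto simp: Int_stable_def box_Int_box_cart)
  have subset_Pow_UNIV: "?E \<subseteq> Pow UNIV" by simp
  have bs: "X \<in> sets borel" if "X \<in> sigma_sets UNIV ?E" for X :: "(real^'n) set"
    using that by (simp add: borel_eq_box)
  show "set_lebesgue_integral lborel A f = 0"
    using Int subset_Pow_UNIV A
  proof (induction A rule: sigma_sets_induct_disjoint)
    case (basic A)
    then show ?case using box0 by (auto simp: set_lebesgue_integral_def)
  next
    case empty
    then show ?case by (simp add: set_lebesgue_integral_def)
  next
    case (compl A)
    have "set_lebesgue_integral lborel (A \<union> (UNIV - A)) f
        = set_lebesgue_integral lborel A f + set_lebesgue_integral lborel (UNIV - A) f"
      using bs[OF compl.hyps] by (intro set_integral_Un si) auto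
    then show ?case using compl total by (simp add: set_lebesgue_integral_def)
  next
    case (union A)
    have "set_lebesgue_integral lborel (\<Union>i. A i) f = (\<Sum>i. set_lebesgue_integral lborel (A i) f)"
      using union.hyps bs
      by (intro lebesgue_integral_countable_add si) (auto simp: disjoint_family_on_def image_subset_iff
            intro!: sets.countable_UN)
    then show ?case using union by simp
  qed
qed

text \<open>The fundamental lemma of the calculus of variations: indicators of boxes are limits of test
  functions, so \<open>g\<close> integrates to zero over every box compactly contained in \<open>D\<close>.\<close>

lemma AE_zero_if_test_integrals_zero:
  fixes g :: "real^'n \<Rightarrow> real"
  assumes g: "integrable lborel g" and "open D"
    and zero: "\<And>\<eta>. test_function D \<eta> \<Longrightarrow> (\<integral>x. g x * \<eta> x \<partial>lborel) = 0"
  shows "AE x in lborel. x \<in> D \<longrightarrow> g x = 0"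
proof -
  have box0: "(\<integral>x. indicator (box a b) x * g x \<partial>lborel) = 0" if "cbox a b \<subseteq> D" for a b
  proof -
    have "(\<lambda>k. \<integral>x. g x * box_bump (real (Suc k)) a b x \<partial>lborel)
        \<longlonglongrightarrow> (\<integral>x. g x * indicator (box a b) x \<partial>lborel)"
    proof (rule integral_dominated_convergence[where w = "\<lambda>x. \<bar>g x\<bar>"])
      show "AE x in lborel. (\<lambda>k. g x * box_bump (real (Suc k)) a b x) \<longlonglongrightarrow> g x * indicator (box a b) x"
        by (intro AE_I2 tendsto_mult tendsto_const box_bump_tendsto)
      show "AE x in lborel. norm (g x * box_bump (real (Suc k)) a b x) \<le> \<bar>g x\<bar>" for k
        using box_bump_bounds[of "real (Suc k)" a b] by (auto simp: abs_mult mult_left_le)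
      show "(\<lambda>x. g x * box_bump (real (Suc k)) a b x) \<in> borel_measurable lborel" for k
        using g smooth_measurable[OF smooth_box_bump] by measurable
    qed (use g in auto)
    moreover have "(\<integral>x. g x * box_bump (real (Suc k)) a b x \<partial>lborel) = 0" for k
      by (intro zero test_function_box_bump that) simp
    ultimately have "(\<integral>x. g x * indicator (box a b) x \<partial>lborel) = 0"
      by (simp add: LIMSEQ_const_iff)
    then show ?thesis by (simp add: mult.commute)
  qed
  obtain \<D> where \<D>: "countable \<D>" "\<D> \<subseteq> Pow D" "\<And>X. X \<in> \<D> \<Longrightarrow> \<exists>a b. X = cbox a b" "\<Union>\<D> = D"
    using open_countable_Union_open_cbox[OF \<open>open D\<close>] by metis
  have "AE x in lborel. x \<in> X \<longrightarrow> g x = 0" if "X \<in> \<D>" for X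
  proof -
    obtain l u where X: "X = cbox l u" using \<D>(3) \<open>X \<in> \<D>\<close> by blast
    have sub: "cbox l u \<subseteq> D" using \<D>(2) \<open>X \<in> \<D>\<close> X by auto
    have "AE x in lborel. indicator (box l u) x * g x = 0"
    proof (rule AE_zero_if_box_integrals_zero[where l = l and u = u])
      show "integrable lborel (\<lambda>x. indicator (box l u) x * g x)"
        using integrable_mult_indicator[OF _ g, of "box l u"] by simp
      \<comment> \<open>Cutting an arbitrary box down to \<open>box l u\<close> gives a box whose
        closed version lies in \<open>cbox l u\<close>, hence in D, so \<open>box0\<close> applies
        to it.\<close>
      fix a b :: "real^'n"
      let ?a = "\<chi> i. max (a $ i) (l $ i)" and ?b = "\<chi> i. min (b $ i) (u $ i)"
      have "cbox ?a ?b \<subseteq> cbox l u" by (auto simp: mem_box_cart)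
      then have "(\<integral>x. indicator (box ?a ?b) x * g x \<partial>lborel) = 0" using box0 sub by blast
      then show "(\<integral>x. indicator (box a b) x * (indicator (box l u) x * g x) \<partial>lborel) = 0"
        unfolding box_Int_box_cart[symmetric] by (simp add: indicator_inter_arith mult.assoc)
    qed auto
    moreover have "AE x in lborel. x \<notin> cbox l u - box l u"
    proof -
      have "cbox l u - box l u \<in> null_sets lebesgue"
        using negligible_frontier_interval negligible_iff_null_sets by blast
      then have "cbox l u - box l u \<in> null_sets lborel"
        by (simp add: null_sets_def)
      then show ?thesis by (rule AE_not_in)
    qed
    ultimately show ?thesis by eventually_elim (auto simp: X indicator_def split: if_splits)
  qed
  then have "AE x in lborel. \<forall>X\<in>\<D>. x \<in> X \<longrightarrow> g x = 0"
    using AE_ball_countable[OF \<D>(1), of "\<lambda>x X. x \<in> X \<longrightarrow> g x = 0" lborel] by blast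
  then show ?thesis by eventually_elim (use \<D>(4) in blast)
qed

lemma directional_derivative_eq_sum:
  fixes \<eta> :: "real^'n \<Rightarrow> real"
  assumes "smooth \<eta>"
  shows "(\<eta> has_derivative (\<lambda>h. \<Sum>i\<in>UNIV. h $ i * iter_partial [i] \<eta> x)) (at x)"
proof -
  let ?D = "frechet_derivative \<eta> (at x)"
  have D: "(\<eta> has_derivative ?D) (at x)"
    using smoothD[OF assms, of "[]"] by (simp add: frechet_derivative_works)
  then have lin: "linear ?D" by (rule has_derivative_linear)
  have "?D h = (\<Sum>i\<in>UNIV. h $ i * iter_partial [i] \<eta> x)" for h
  proof -
    have "?D h = ?D (\<Sum>i\<in>UNIV. h $ i *\<^sub>R axis i 1)"
      using basis_expansion[of h] by (simp add: scalar_mult_eq_scaleR)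
    also have "\<dots> = (\<Sum>i\<in>UNIV. h $ i * ?D (axis i 1))"
      by (simp add: linear_sum[OF lin] linear_cmul[OF lin])
    finally show ?thesis by simp
  qed
  then show ?thesis by (intro has_derivative_eq_rhs[OF D] ext)
qed

lemma test_function_translate:
  fixes \<eta> :: "real^'n \<Rightarrow> real"
  assumes "test_function A \<eta>" "\<And>x. x \<in> A \<Longrightarrow> x + a \<in> B"
  shows "test_function B (\<lambda>x. \<eta> (x - a))"
proof -
  have *: "{x. \<eta> (x - a) \<noteq> 0} = (\<lambda>x. x + a) ` {x. \<eta> x \<noteq> 0}"
    by (force simp: image_iff)
  have cl: "closure {x. \<eta> (x - a) \<noteq> 0} = (\<lambda>x. x + a) ` closure {x. \<eta> x \<noteq> 0}"
    unfolding * using closure_translation[of a "{x. \<eta> x \<noteq> 0}"] by (simp add: add.commute)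
  have "smooth (\<lambda>x. \<eta> (1 *\<^sub>R x + (- a)))"
    using assms(1) by (intro smooth_affine) (simp add: test_function_def)
  moreover have "compact ((\<lambda>x. x + a) ` closure {x. \<eta> x \<noteq> 0})"
    using assms(1) by (intro compact_continuous_image continuous_intros) (simp add: test_function_def)
  ultimately show ?thesis
    using assms unfolding test_function_def cl by auto
qed

lemma iter_partial_translate:
  fixes \<eta> :: "real^'n \<Rightarrow> real"
  assumes "smooth \<eta>"
  shows "iter_partial ks (\<lambda>x. \<eta> (x - a)) x = iter_partial ks \<eta> (x - a)"
  using iter_partial_affine[OF assms, of ks 1 "- a"] by (simp add: fun_eq_iff)

section \<open>The Poincare inequality\<close>

lemma test_function_mult_integrable:
  fixes f \<eta> :: "real^'n \<Rightarrow> real"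
  assumes f: "integrable lborel f" and \<eta>: "test_function B \<eta>"
  shows "integrable lborel (\<lambda>x. f x * iter_partial ks \<eta> (x - a))"
proof -
  obtain M where M: "M \<ge> 0" "\<And>x. \<bar>iter_partial ks \<eta> x\<bar> \<le> M"
    using test_function_iter_partial_bounded[OF \<eta>] by metis
  have [measurable]: "iter_partial ks \<eta> \<in> borel_measurable borel"
    using \<eta> by (intro smooth_measurable smooth_iter_partial) (simp add: test_function_def)
  show ?thesis
  proof (rule Bochner_Integration.integrable_bound[of _ "\<lambda>x. M * f x"])
    show "AE x in lborel. norm (f x * iter_partial ks \<eta> (x - a)) \<le> norm (M * f x)"
      using M(1) M(2)[THEN mult_left_mono, of "\<bar>f _\<bar>"]
      by (auto simp: abs_mult mult.commute intro!: AE_I2)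
  qed (use f in auto)
qed

text \<open>Both sides integrate to the same value against every test function on \<open>B \<inter> (B - h)\<close>: shift
  the weak derivative onto the test function along the segment and integrate in \<open>t\<close>.\<close>

lemma AE_diff_eq_integral_weak_gradient:
  fixes v :: "real^'n \<Rightarrow> real" and w :: "'n \<Rightarrow> real^'n \<Rightarrow> real"
  assumes B: "open B" "convex B"
    and v: "integrable lborel v" and w: "\<And>i. integrable lborel (w i)"
    and weak: "\<And>\<eta> i. test_function B \<eta> \<Longrightarrow>
      (\<integral>x. v x * iter_partial [i] \<eta> x \<partial>lborel) = - (\<integral>x. w i x * \<eta> x \<partial>lborel)"
  shows "AE x in lborel. x \<in> B \<and> x + h \<in> B \<longrightarrow>
    v (x + h) - v x = (\<integral>t. indicator {0..1} t * (\<Sum>i\<in>UNIV. h $ i * w i (x + t *\<^sub>R h)) \<partial>lborel)"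
proof -
  define D where "D = {x. x \<in> B \<and> x + h \<in> B}"
  define F where "F = (\<lambda>t x. indicator {0..1::real} t * (\<Sum>i\<in>UNIV. h $ i * w i (x + t *\<^sub>R h)))"
  have [measurable]: "v \<in> borel_measurable borel" "\<And>i. w i \<in> borel_measurable borel"
    using v w by auto
  have openD: "open D"
  proof -
    have "D = B \<inter> (\<lambda>x. x + h) -` B" by (auto simp: D_def)
    moreover have "open ((\<lambda>x. x + h) -` B)"
      by (rule open_vimage[OF B(1)]) (intro continuous_intros)
    ultimately show ?thesis using B(1) by auto
  qed
  have D_move: "x + t *\<^sub>R h \<in> B" if "x \<in> D" "0 \<le> t" "t \<le> 1" for x t
  proof -
    have "(1 - t) *\<^sub>R x + t *\<^sub>R (x + h) \<in> B"
      using that B(2) by (intro convexD) (auto simp: D_def)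
    then show ?thesis by (simp add: algebra_simps)
  qed
  have Fw: "integrable lborel (\<lambda>x. w i (x + t *\<^sub>R h))" for i t
    using integrable_lborel_translate[OF w, of i "t *\<^sub>R h"] by (simp add: add.commute)
  \<comment> \<open>By translation invariance all slices with t in [0, 1] have the same norm; this
    gives the joint integrability that Fubini requires.\<close>
  have F_int: "integrable (lborel \<Otimes>\<^sub>M lborel) (\<lambda>(t, x). F t x)"
  proof -
    have "integrable (lborel \<Otimes>\<^sub>M lborel) (\<lambda>(t, x). indicator {0..1::real} t * (h $ i * w i (x + t *\<^sub>R h)))" for i
    proof (rule lborel_pair.Fubini_integrable)
      show "(\<lambda>(t, x). indicator {0..1::real} t * (h $ i * w i (x + t *\<^sub>R h))) \<in> borel_measurable (lborel \<Otimes>\<^sub>M lborel)"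
        by measurable
      have "(\<integral>x. norm (case (t, x) of (t, x) \<Rightarrow> indicator {0..1::real} t * (h $ i * w i (x + t *\<^sub>R h))) \<partial>lborel)
         = indicator {0..1} t * (\<bar>h $ i\<bar> * (\<integral>x. \<bar>w i x\<bar> \<partial>lborel))" for t
        using integral_lborel_translate[of "\<lambda>x. \<bar>w i x\<bar>" "t *\<^sub>R h"]
        by (simp add: abs_mult add.commute)
      then show "integrable lborel (\<lambda>t. \<integral>x. norm (case (t, x) of (t, x) \<Rightarrow> indicator {0..1::real} t * (h $ i * w i (x + t *\<^sub>R h))) \<partial>lborel)"
        by simp
      show "AE t in lborel. integrable lborel (\<lambda>x. case (t, x) of (t, x) \<Rightarrow> indicator {0..1::real} t * (h $ i * w i (x + t *\<^sub>R h)))"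
        using Fw by (intro AE_I2) simp
    qed
    then have "integrable (lborel \<Otimes>\<^sub>M lborel) (\<lambda>z. \<Sum>i\<in>UNIV. (\<lambda>(t, x). indicator {0..1::real} t * (h $ i * w i (x + t *\<^sub>R h))) z)"
      by (intro Bochner_Integration.integrable_sum)
    then show ?thesis
      by (simp add: F_def sum_distrib_left case_prod_unfold)
  qed
  have W_int: "integrable lborel (\<lambda>x. \<integral>t. F t x \<partial>lborel)"
    using lborel_pair.integrable_snd[of F] F_int by simp
  have vh: "integrable lborel (\<lambda>x. v (x + h))"
    using integrable_lborel_translate[OF v, of h] by (simp add: add.commute)
  have "AE x in lborel. x \<in> D \<longrightarrow> v (x + h) - v x - (\<integral>t. F t x \<partial>lborel) = 0"
  proof (rule AE_zero_if_test_integrals_zero[OF _ openD])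
    show "integrable lborel (\<lambda>x. v (x + h) - v x - (\<integral>t. F t x \<partial>lborel))"
      using W_int v vh by auto
    fix \<eta> :: "real^'n \<Rightarrow> real" assume \<eta>: "test_function D \<eta>"
    then have sm: "smooth \<eta>" by (simp add: test_function_def)
    have [measurable]: "iter_partial ks \<eta> \<in> borel_measurable borel" for ks
      using sm by (intro smooth_measurable smooth_iter_partial)
    have [measurable]: "\<eta> \<in> borel_measurable borel" using smooth_measurable[OF sm] .
    obtain M where M: "M \<ge> 0" "\<And>x. \<bar>\<eta> x\<bar> \<le> M"
      using test_function_iter_partial_bounded[OF \<eta>, of "[]"] by auto
    have "\<forall>i. \<exists>N\<ge>0. \<forall>x. \<bar>iter_partial [i] \<eta> x\<bar> \<le> N"
      using test_function_iter_partial_bounded[OF \<eta>] by metis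
    then obtain N where N: "\<And>i. N i \<ge> 0" "\<And>i x. \<bar>iter_partial [i] \<eta> x\<bar> \<le> N i" by metis
    have \<eta>_int: "integrable lborel (\<lambda>x. g x * \<eta> (x - a))" if "integrable lborel g" for g a
      using test_function_mult_integrable[OF that \<eta>, of "[]"] by simp
    \<comment> \<open>\<open>G\<close> arises from \<open>F\<close> times \<eta> by translating x by
      t h and moving the weak derivatives onto the test function, which costs a sign.\<close>
    define G where "G = (\<lambda>t y. indicator {0..1::real} t * (v y * (\<Sum>i\<in>UNIV. h $ i * iter_partial [i] \<eta> (y - t *\<^sub>R h))))"
    have slice: "(\<integral>x. F t x * \<eta> x \<partial>lborel) = - (\<integral>y. G t y \<partial>lborel)" for t
    proof (cases "t \<in> {0..1}")
      case True
      \<comment> \<open>Convexity of B enters here: points of D moved by t h stay in B, so the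
        translated function may be inserted into the weak formulation on B.\<close>
      have tt: "test_function B (\<lambda>x. \<eta> (x - t *\<^sub>R h))"
        using True by (intro test_function_translate[OF \<eta>] D_move) auto
      have "(\<integral>x. w i (x + t *\<^sub>R h) * \<eta> x \<partial>lborel) = - (\<integral>y. v y * iter_partial [i] \<eta> (y - t *\<^sub>R h) \<partial>lborel)" for i
      proof -
        have "(\<integral>x. w i (x + t *\<^sub>R h) * \<eta> x \<partial>lborel) = (\<integral>x. w i x * \<eta> (x - t *\<^sub>R h) \<partial>lborel)"
          using integral_lborel_translate[of "\<lambda>x. w i x * \<eta> (x - t *\<^sub>R h)" "t *\<^sub>R h"]
          by (simp add: add.commute)
        also have "\<dots> = - (\<integral>y. v y * iter_partial [i] (\<lambda>x. \<eta> (x - t *\<^sub>R h)) y \<partial>lborel)"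
          using weak[OF tt, of i] by simp
        finally show ?thesis by (simp only: iter_partial_translate[OF sm])
      qed
      moreover have "integrable lborel (\<lambda>x. w i (x + t *\<^sub>R h) * \<eta> x)" for i
        using \<eta>_int[OF Fw, of i t 0] by simp
      moreover have "integrable lborel (\<lambda>y. v y * iter_partial [i] \<eta> (y - t *\<^sub>R h))" for i
        by (rule test_function_mult_integrable[OF v \<eta>])
      ultimately show ?thesis
        using True by (simp add: F_def G_def sum_distrib_right sum_distrib_left mult.assoc
            mult.left_commute[of "v _"] sum_negf)
    qed (simp add: F_def G_def)
    have F\<eta>_int: "integrable (lborel \<Otimes>\<^sub>M lborel) (\<lambda>(t, x). F t x * \<eta> x)"
    proof (rule Bochner_Integration.integrable_bound[of _ "\<lambda>z. M * (\<lambda>(t, x). F t x) z"])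
      show "AE z in lborel \<Otimes>\<^sub>M lborel. norm (case z of (t, x) \<Rightarrow> F t x * \<eta> x) \<le> norm (M * (case z of (t, x) \<Rightarrow> F t x))"
        using M by (auto simp: abs_mult mult.commute intro!: AE_I2 mult_right_mono)
    next
      show "(\<lambda>(t, x). F t x * \<eta> x) \<in> borel_measurable (lborel \<Otimes>\<^sub>M lborel)"
        unfolding F_def by measurable
    qed (use F_int in simp)
    have G_int: "integrable (lborel \<Otimes>\<^sub>M lborel) (\<lambda>(t, y). G t y)"
    proof (rule Bochner_Integration.integrable_bound)
      let ?C = "\<Sum>i\<in>UNIV. \<bar>h $ i\<bar> * N i"
      show "integrable (lborel \<Otimes>\<^sub>M lborel) (\<lambda>(t, y). ?C * (indicator {0..1::real} t * v y))"
      proof (rule lborel_pair.Fubini_integrable)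
        show "integrable lborel (\<lambda>t. \<integral>y. norm (case (t, y) of (t, y) \<Rightarrow> ?C * (indicator {0..1::real} t * v y)) \<partial>lborel)"
          by (simp add: abs_mult)
      qed (use v in auto)
      have "\<bar>\<Sum>i\<in>UNIV. h $ i * iter_partial [i] \<eta> z\<bar> \<le> \<bar>?C\<bar>" for z
      proof -
        have "\<bar>\<Sum>i\<in>UNIV. h $ i * iter_partial [i] \<eta> z\<bar> \<le> ?C"
          by (rule order_trans[OF sum_abs]) (intro sum_mono, use N in \<open>auto simp: abs_mult intro!: mult_left_mono\<close>)
        then show ?thesis by simp
      qed
      then show "AE z in lborel \<Otimes>\<^sub>M lborel. norm (case z of (t, y) \<Rightarrow> G t y)
          \<le> norm (case z of (t, y) \<Rightarrow> ?C * (indicator {0..1::real} t * v y))"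
        unfolding G_def
        by (intro AE_I2) (auto simp: abs_mult mult.commute[of "\<bar>?C\<bar>"] split: split_indicator intro!: mult_left_mono)
      show "(\<lambda>(t, y). G t y) \<in> borel_measurable (lborel \<Otimes>\<^sub>M lborel)"
        unfolding G_def by measurable
    qed
    \<comment> \<open>The sum is the derivative in t of \<open>- \<eta> (y - t *\<^sub>R h)\<close>,
      so only the end points t = 0 and t = 1 contribute.\<close>
    have FTC: "(\<integral>t. G t y \<partial>lborel) = v y * (\<eta> y - \<eta> (y - h))" for y
    proof -
      have der: "((\<lambda>t. - \<eta> (y - t *\<^sub>R h)) has_real_derivative (\<Sum>i\<in>UNIV. h $ i * iter_partial [i] \<eta> (y - t *\<^sub>R h))) (at t)" for t
      proof -
        have A: "((\<lambda>t. y - t *\<^sub>R h) has_derivative (\<lambda>s. - (s *\<^sub>R h))) (at t)"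
          by (auto intro!: derivative_eq_intros)
        have "((\<lambda>t. - \<eta> (y - t *\<^sub>R h)) has_derivative
            (\<lambda>s. - (\<Sum>i\<in>UNIV. (- (s *\<^sub>R h)) $ i * iter_partial [i] \<eta> (y - t *\<^sub>R h)))) (at t)"
          by (intro has_derivative_minus has_derivative_compose[where f = "\<lambda>t. y - t *\<^sub>R h" and g = \<eta>, OF A]
                directional_derivative_eq_sum[OF sm])
        then show ?thesis
          unfolding has_field_derivative_def
          by (rule has_derivative_eq_rhs) (auto simp: fun_eq_iff sum_negf sum_distrib_left sum_distrib_right mult_ac)
      qed
      have cont: "isCont (\<lambda>t. \<Sum>i\<in>UNIV. h $ i * iter_partial [i] \<eta> (y - t *\<^sub>R h)) t" for t
      proof -
        have "continuous_on UNIV (\<lambda>t. iter_partial [i] \<eta> (y - t *\<^sub>R h))" for i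
          by (rule continuous_on_compose2[OF smooth_continuous[OF sm]]) (auto intro!: continuous_intros)
        then have "isCont (\<lambda>t. iter_partial [i] \<eta> (y - t *\<^sub>R h)) t" for i
          by (simp add: continuous_on_eq_continuous_at)
        then show ?thesis by (intro continuous_intros)
      qed
      have "(\<integral>t. (\<Sum>i\<in>UNIV. h $ i * iter_partial [i] \<eta> (y - t *\<^sub>R h)) * indicator {0..1} t \<partial>lborel)
         = - \<eta> (y - 1 *\<^sub>R h) - - \<eta> (y - 0 *\<^sub>R h)"
        by (rule integral_FTC_Icc_real) (use der cont in auto)
      then have "v y * (\<integral>t. (\<Sum>i\<in>UNIV. h $ i * iter_partial [i] \<eta> (y - t *\<^sub>R h)) * indicator {0..1} t \<partial>lborel)
         = v y * (\<eta> y - \<eta> (y - h))" by simp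
      moreover have "(\<integral>t. G t y \<partial>lborel) = v y * (\<integral>t. (\<Sum>i\<in>UNIV. h $ i * iter_partial [i] \<eta> (y - t *\<^sub>R h)) * indicator {0..1} t \<partial>lborel)"
        unfolding G_def by (subst integral_mult_right_zero[symmetric]) (simp add: mult_ac)
      ultimately show ?thesis by simp
    qed
    have "(\<integral>x. (\<integral>t. F t x \<partial>lborel) * \<eta> x \<partial>lborel) = (\<integral>x. (\<integral>t. F t x * \<eta> x \<partial>lborel) \<partial>lborel)"
      by simp
    also have "\<dots> = (\<integral>t. (\<integral>x. F t x * \<eta> x \<partial>lborel) \<partial>lborel)"
      by (rule lborel_pair.Fubini_integral[OF F\<eta>_int])
    also have "\<dots> = - (\<integral>t. (\<integral>y. G t y \<partial>lborel) \<partial>lborel)"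
      by (simp add: slice)
    also have "\<dots> = - (\<integral>y. (\<integral>t. G t y \<partial>lborel) \<partial>lborel)"
      by (simp add: lborel_pair.Fubini_integral[OF G_int])
    also have "\<dots> = (\<integral>y. v y * \<eta> (y - h) \<partial>lborel) - (\<integral>y. v y * \<eta> y \<partial>lborel)"
      using \<eta>_int[OF v, of h] \<eta>_int[OF v, of 0] by (simp add: FTC right_diff_distrib)
    also have "(\<integral>y. v y * \<eta> (y - h) \<partial>lborel) = (\<integral>x. v (x + h) * \<eta> x \<partial>lborel)"
      using integral_lborel_translate[of "\<lambda>y. v y * \<eta> (y - h)" h] by (simp add: add.commute)
    finally have eq: "(\<integral>x. (\<integral>t. F t x \<partial>lborel) * \<eta> x \<partial>lborel)
        = (\<integral>x. v (x + h) * \<eta> x \<partial>lborel) - (\<integral>x. v x * \<eta> x \<partial>lborel)" .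
    show "(\<integral>x. (v (x + h) - v x - (\<integral>t. F t x \<partial>lborel)) * \<eta> x \<partial>lborel) = 0"
      using \<eta>_int[OF v, of 0] \<eta>_int[OF vh, of 0] \<eta>_int[OF W_int, of 0]
      by (simp add: left_diff_distrib eq)
  qed
  then show ?thesis
    by eventually_elim (simp add: D_def F_def)
qed

text \<open>Put y = x + h; only h of norm below 2r contribute. For such h the difference of v is an
  average of derivatives along a segment, times at most 2r, and the segment stays in the convex set
  B. Each translate by t h has the same integral, so every h costs at most 2r times the integral on
  the right, and integrating over h adds the volume of the ball of radius 2r.\<close>

lemma double_oscillation_le_gradient:
  fixes v :: "real^'n \<Rightarrow> real" and w :: "'n \<Rightarrow> real^'n \<Rightarrow> real"
  assumes B_def: "B = ball c r" and r: "r > 0"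
    and v: "integrable lborel v" and w: "\<And>i. integrable lborel (w i)"
    and weak: "\<And>\<eta> i. test_function B \<eta> \<Longrightarrow>
      (\<integral>x. v x * iter_partial [i] \<eta> x \<partial>lborel) = - (\<integral>x. w i x * \<eta> x \<partial>lborel)"
  shows "(\<integral>\<^sup>+x. (\<integral>\<^sup>+y. indicator B x * indicator B y * ennreal \<bar>v x - v y\<bar> \<partial>lborel) \<partial>lborel)
    \<le> ennreal (2 * r) * emeasure lborel (ball (0::real^'n) (2 * r))
        * (\<integral>\<^sup>+x. indicator B x * (\<Sum>i\<in>UNIV. ennreal \<bar>w i x\<bar>) \<partial>lborel)"
proof -
  have [measurable]: "v \<in> borel_measurable borel" "\<And>i. w i \<in> borel_measurable borel" "B \<in> sets borel"
    using v w by (auto simp: B_def)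
  define S where "S = (\<integral>\<^sup>+x. indicator B x * (\<Sum>i\<in>UNIV. ennreal \<bar>w i x\<bar>) \<partial>lborel)"
  define g where "g = (\<lambda>x h. indicator B x * indicator B (x + h) * ennreal \<bar>v x - v (x + h)\<bar>)"
  have [measurable]: "(\<lambda>(x, h). g x h) \<in> borel_measurable (lborel \<Otimes>\<^sub>M lborel)"
    unfolding g_def by measurable
  have slice: "(\<integral>\<^sup>+x. g x h \<partial>lborel) \<le> indicator (ball 0 (2 * r)) h * (ennreal (2 * r) * S)" for h
  proof (cases "norm h < 2 * r")
    case False
    have "g x h = 0" for x
    proof -
      have "\<not> (x \<in> B \<and> x + h \<in> B)"
      proof
        assume "x \<in> B \<and> x + h \<in> B"
        then have "norm (c - x) < r" "norm (c - (x + h)) < r" by (auto simp: B_def dist_norm)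
        moreover have "h = (c - x) - (c - (x + h))" by simp
        ultimately show False using False norm_triangle_ineq4[of "c - x" "c - (x + h)"] by simp
      qed
      then show ?thesis by (auto simp: g_def)
    qed
    then show ?thesis by simp
  next
    case True
    have AE: "AE x in lborel. x \<in> B \<and> x + h \<in> B \<longrightarrow>
      v (x + h) - v x = (\<integral>t. indicator {0..1} t * (\<Sum>i\<in>UNIV. h $ i * w i (x + t *\<^sub>R h)) \<partial>lborel)"
      by (rule AE_diff_eq_integral_weak_gradient[OF _ _ v w weak]) (auto simp: B_def)
    define F where "F = (\<lambda>t x. indicator {0..1::real} t * (ennreal (2 * r) *
        (indicator B (x + t *\<^sub>R h) * (\<Sum>i\<in>UNIV. ennreal \<bar>w i (x + t *\<^sub>R h)\<bar>))))"
    have [measurable]: "(\<lambda>(t, x). F t x) \<in> borel_measurable (lborel \<Otimes>\<^sub>M lborel)"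
      unfolding F_def by measurable
    have "AE x in lborel. g x h \<le> (\<integral>\<^sup>+t. F t x \<partial>lborel)"
      using AE
    proof eventually_elim
      case (elim x)
      show ?case
      proof (cases "x \<in> B \<and> x + h \<in> B")
        case False then show ?thesis by (auto simp: g_def)
      next
        case xB: True
        have "g x h = ennreal (norm (v (x + h) - v x))"
          using xB by (simp add: g_def abs_minus_commute)
        also have "v (x + h) - v x = (\<integral>t. indicator {0..1} t * (\<Sum>i\<in>UNIV. h $ i * w i (x + t *\<^sub>R h)) \<partial>lborel)"
          using elim xB by blast
        also have "ennreal (norm \<dots>) \<le> (\<integral>\<^sup>+t. norm (indicator {0..1::real} t * (\<Sum>i\<in>UNIV. h $ i * w i (x + t *\<^sub>R h))) \<partial>lborel)"
        proof (cases "integrable lborel (\<lambda>t. indicator {0..1::real} t * (\<Sum>i\<in>UNIV. h $ i * w i (x + t *\<^sub>R h)))")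
          case True then show ?thesis by (rule integral_norm_bound_ennreal)
        next
          \<comment> \<open>A Bochner integral that does not exist has the default value 0, so the
            bound is trivial.\<close>
          case False then show ?thesis by (simp add: not_integrable_integral_eq)
        qed
        also have "\<dots> \<le> (\<integral>\<^sup>+t. F t x \<partial>lborel)"
        proof (rule nn_integral_mono)
          fix t :: real
          show "ennreal (norm (indicator {0..1::real} t * (\<Sum>i\<in>UNIV. h $ i * w i (x + t *\<^sub>R h)))) \<le> F t x"
          proof (cases "t \<in> {0..1}")
            case t: True
            have "(1 - t) *\<^sub>R x + t *\<^sub>R (x + h) \<in> B"
              using t xB by (intro convexD) (auto simp: B_def)
            then have tB: "x + t *\<^sub>R h \<in> B" by (simp add: algebra_simps)
            have "\<bar>\<Sum>i\<in>UNIV. h $ i * w i (x + t *\<^sub>R h)\<bar> \<le> (\<Sum>i\<in>UNIV. 2 * r * \<bar>w i (x + t *\<^sub>R h)\<bar>)"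
              by (rule order_trans[OF sum_abs]) (intro sum_mono,
                use True component_le_norm_cart[of h] in \<open>auto simp: abs_mult intro!: mult_right_mono intro: order_trans[OF _ less_imp_le]\<close>)
            also have "\<dots> = 2 * r * (\<Sum>i\<in>UNIV. \<bar>w i (x + t *\<^sub>R h)\<bar>)"
              by (simp add: sum_distrib_left)
            finally have "ennreal \<bar>\<Sum>i\<in>UNIV. h $ i * w i (x + t *\<^sub>R h)\<bar> \<le> ennreal (2 * r * (\<Sum>i\<in>UNIV. \<bar>w i (x + t *\<^sub>R h)\<bar>))"
              by (rule ennreal_leI)
            then show ?thesis using t tB r
              by (simp add: F_def ennreal_mult' sum_ennreal)
          qed (simp add: F_def)
        qed
        finally show ?thesis .
      qed
    qed
    then have "(\<integral>\<^sup>+x. g x h \<partial>lborel) \<le> (\<integral>\<^sup>+x. (\<integral>\<^sup>+t. F t x \<partial>lborel) \<partial>lborel)"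
      by (rule nn_integral_mono_AE)
    also have "\<dots> = (\<integral>\<^sup>+t. (\<integral>\<^sup>+x. F t x \<partial>lborel) \<partial>lborel)"
      by (rule lborel_pair.Fubini') measurable
    also have "\<dots> = (\<integral>\<^sup>+t. ennreal (2 * r) * S * indicator {0..1::real} t \<partial>lborel)"
    proof (rule nn_integral_cong)
      fix t :: real
      have "(\<integral>\<^sup>+x. indicator B (x + t *\<^sub>R h) * (\<Sum>i\<in>UNIV. ennreal \<bar>w i (x + t *\<^sub>R h)\<bar>) \<partial>lborel) = S"
        unfolding S_def
        using nn_integral_lborel_translate[of "\<lambda>x. indicator B x * (\<Sum>i\<in>UNIV. ennreal \<bar>w i x\<bar>)" "t *\<^sub>R h"]
        by (simp add: add.commute)
      then show "(\<integral>\<^sup>+x. F t x \<partial>lborel) = ennreal (2 * r) * S * indicator {0..1} t"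
        unfolding F_def by (simp add: nn_integral_cmult mult_ac)
    qed
    also have "\<dots> = ennreal (2 * r) * S"
      by (subst nn_integral_cmult_indicator) auto
    finally show ?thesis using True by simp
  qed
  have "(\<integral>\<^sup>+x. (\<integral>\<^sup>+y. indicator B x * indicator B y * ennreal \<bar>v x - v y\<bar> \<partial>lborel) \<partial>lborel)
      = (\<integral>\<^sup>+x. (\<integral>\<^sup>+h. g x h \<partial>lborel) \<partial>lborel)"
  proof (rule nn_integral_cong)
    fix x :: "real^'n"
    have "(\<lambda>y. indicator B x * indicator B y * ennreal \<bar>v x - v y\<bar>) \<in> borel_measurable borel" by measurable
    from nn_integral_lborel_translate[OF this, of x]
    show "(\<integral>\<^sup>+y. indicator B x * indicator B y * ennreal \<bar>v x - v y\<bar> \<partial>lborel) = (\<integral>\<^sup>+h. g x h \<partial>lborel)"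
      by (simp add: g_def)
  qed
  also have "\<dots> = (\<integral>\<^sup>+h. (\<integral>\<^sup>+x. g x h \<partial>lborel) \<partial>lborel)"
    by (rule lborel_pair.Fubini'[symmetric]) measurable
  also have "\<dots> \<le> (\<integral>\<^sup>+h. ennreal (2 * r) * S * indicator (ball (0::real^'n) (2 * r)) h \<partial>lborel)"
    using slice by (intro nn_integral_mono) (simp add: mult_ac)
  also have "\<dots> = ennreal (2 * r) * S * emeasure lborel (ball (0::real^'n) (2 * r))"
    by (subst nn_integral_cmult_indicator) auto
  finally show ?thesis by (simp add: S_def mult_ac)
qed

text \<open>Fubini and translations are applied to Borel functions over \<open>lborel\<close>,
  whereas the spaces consist of Lebesgue measurable functions; this is the passage between the
  two.\<close>

lemma lborel_representative:
  fixes v :: "real^'n \<Rightarrow> real"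
  assumes "set_integrable lebesgue \<Omega> v"
  obtains v' where "integrable lborel v'" "AE x in lebesgue. indicator \<Omega> x * v x = v' x"
proof -
  from assms have int: "integrable lebesgue (\<lambda>x. indicator \<Omega> x * v x)"
    by (simp add: set_integrable_def)
  then have "(\<lambda>x. indicator \<Omega> x * v x) \<in> borel_measurable (completion lborel)" by auto
  from completion_ex_borel_measurable_real[OF this] obtain v' where
    v': "v' \<in> borel_measurable lborel" "AE x in lborel. indicator \<Omega> x * v x = v' x" by blast
  have AE: "AE x in lebesgue. indicator \<Omega> x * v x = v' x"
    using v'(2) by (rule AE_completion)
  have "integrable lebesgue v'"
    by (rule integrable_cong_AE_imp[OF int]) (use v'(1) AE in \<open>auto simp: measurable_completion\<close>)
  then have "integrable lborel v'"
    using integrable_completion[OF v'(1)] by simp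
  then show thesis using AE that by blast
qed

text \<open>The deviation from the mean is an average of v(x) - v(y) over y, which reduces the claim
  to the double integral bounded by \<open>double_oscillation_le_gradient\<close>, divided by the
  volume of the ball. The constant is 2r times the ratio of the volumes of the balls of radius 2r
  and r.\<close>

lemma poincare_ball:
  fixes v :: "real^'n \<Rightarrow> real" and w :: "'n \<Rightarrow> real^'n \<Rightarrow> real"
  assumes "open \<Omega>" and B: "ball c r \<subseteq> \<Omega>" and r: "r > 0"
    and v: "set_integrable lebesgue \<Omega> v" and w: "\<And>i. set_integrable lebesgue \<Omega> (w i)"
    and weak: "\<And>i. has_weak_deriv \<Omega> [i] v (w i)"
  shows "(\<integral>\<^sup>+x\<in>ball c r. ennreal \<bar>v x - mean (ball c r) v\<bar> \<partial>lebesgue)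
    \<le> ennreal (2 ^ (CARD('n) + 1) * r) * (\<integral>\<^sup>+x\<in>ball c r. (\<Sum>i\<in>UNIV. ennreal \<bar>w i x\<bar>) \<partial>lebesgue)"
proof -
  let ?B = "ball c r"
  obtain v' where v': "integrable lborel v'" "AE x in lebesgue. indicator \<Omega> x * v x = v' x"
    using lborel_representative[OF v] .
  have "\<forall>i. \<exists>w'. integrable lborel w' \<and> (AE x in lebesgue. indicator \<Omega> x * w i x = w' x)"
    using lborel_representative[OF w] by metis
  then obtain w' where w': "\<And>i. integrable lborel (w' i)"
    "\<And>i. AE x in lebesgue. indicator \<Omega> x * w i x = w' i x" by metis
  have [measurable]: "v' \<in> borel_measurable borel" "\<And>i. w' i \<in> borel_measurable borel"
    using v' w' by auto
  have AEw: "AE x in lebesgue. \<forall>i\<in>UNIV. indicator \<Omega> x * w i x = w' i x"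
    using w'(2) by (intro AE_finite_allI) auto
  have mB: "measure lebesgue ?B > 0"
    using content_ball_pos[OF r, of c] by simp
  have weak': "(\<integral>x. v' x * iter_partial [i] \<eta> x \<partial>lborel) = - (\<integral>x. w' i x * \<eta> x \<partial>lborel)"
    if "test_function ?B \<eta>" for \<eta> i
  proof -
    have \<eta>: "test_function \<Omega> \<eta>" using that B by (rule test_function_mono)
    then have sm: "smooth \<eta>" by (simp add: test_function_def)
    have to_lborel: "(LINT x:\<Omega>|lebesgue. u x * k x) = (\<integral>x. u' x * k x \<partial>lborel)"
      if "set_integrable lebesgue \<Omega> u" "AE x in lebesgue. indicator \<Omega> x * u x = u' x"
        "integrable lborel u'" "k \<in> borel_measurable borel" for u u' k :: "real^'n \<Rightarrow> real"
    proof -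
      have mu: "(\<lambda>x. indicator \<Omega> x * u x) \<in> borel_measurable lebesgue"
        using that(1) by (auto simp: set_integrable_def)
      have mk: "k \<in> borel_measurable lebesgue" using that(4) by (simp add: measurable_completion)
      have mu': "u' \<in> borel_measurable lebesgue" using that(3) by (auto intro: measurable_completion)
      have "(LINT x:\<Omega>|lebesgue. u x * k x) = (\<integral>x. (indicator \<Omega> x * u x) * k x \<partial>lebesgue)"
        by (simp add: set_lebesgue_integral_def mult.assoc)
      also have "\<dots> = (\<integral>x. u' x * k x \<partial>lebesgue)"
        using that(2) mu mk mu' by (intro integral_cong_AE) auto
      also have "\<dots> = (\<integral>x. u' x * k x \<partial>lborel)"
        using that(3,4) by (intro integral_completion) auto
      finally show ?thesis .
    qed
    have "(LINT x:\<Omega>|lebesgue. v x * iter_partial [i] \<eta> x) = - (LINT x:\<Omega>|lebesgue. w i x * \<eta> x)"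
      using weak[of i] \<eta> unfolding has_weak_deriv_def by auto
    then show ?thesis
      using to_lborel[OF v v'(2,1) smooth_measurable[OF smooth_iter_partial[OF sm]], of "[i]"]
        to_lborel[OF w w'(2,1) smooth_measurable[OF sm], of i]
      by (simp del: iter_partial.simps)
  qed
  define m where "m = measure lebesgue ?B"
  have v'B: "integrable lborel (\<lambda>x. indicator ?B x * v' x)"
    using integrable_mult_indicator[OF _ v'(1), of ?B] by simp
  have mean: "mean ?B v = (\<integral>y. indicator ?B y * v' y \<partial>lborel) / m"
  proof -
    have "(LINT x:?B|lebesgue. v x) = (\<integral>y. indicator ?B y * v' y \<partial>lebesgue)"
      unfolding set_lebesgue_integral_def
    proof (rule integral_cong_AE)
      have "set_integrable lebesgue ?B v" by (rule set_integrable_subset[OF v _ B]) simp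
      then show "(\<lambda>x. indicator ?B x *\<^sub>R v x) \<in> borel_measurable lebesgue"
        by (auto simp: set_integrable_def)
      show "(\<lambda>y. indicator ?B y * v' y) \<in> borel_measurable lebesgue"
        using v'B by (auto intro: measurable_completion)
      show "AE x in lebesgue. indicat_real ?B x *\<^sub>R v x = indicat_real ?B x * v' x"
        using v'(2) by eventually_elim (use B in \<open>auto simp: indicator_def split: if_splits\<close>)
    qed
    also have "\<dots> = (\<integral>y. indicator ?B y * v' y \<partial>lborel)"
      using v'B by (intro integral_completion) auto
    finally show ?thesis by (simp add: mean_def m_def)
  qed
  have mpos: "m > 0" using mB by (simp add: m_def)
  \<comment> \<open>The mean is taken inside the absolute value pointwise in x; integrating this
    over the ball produces the symmetric double integral.\<close>
  have pt: "ennreal \<bar>v' x - mean ?B v\<bar> \<le> ennreal (1 / m) * (\<integral>\<^sup>+y. indicator ?B y * ennreal \<bar>v' x - v' y\<bar> \<partial>lborel)" for x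
  proof -
    have ci: "integrable lborel (\<lambda>y. indicator ?B y * v' x)"
      using emeasure_lborel_ball_finite[of c r]
      by (intro integrable_mult_left integrable_real_indicator) (auto simp: infinity_ennreal_def)
    have "v' x - mean ?B v = (1 / m) * (\<integral>y. indicator ?B y * (v' x - v' y) \<partial>lborel)"
    proof -
      have "(\<integral>y. indicator ?B y * (v' x - v' y) \<partial>lborel)
          = (\<integral>y. indicator ?B y * v' x \<partial>lborel) - (\<integral>y. indicator ?B y * v' y \<partial>lborel)"
        using ci v'B by (simp add: right_diff_distrib)
      also have "(\<integral>y. indicator ?B y * v' x \<partial>lborel) = m * v' x"
        by (simp add: m_def)
      finally show ?thesis using mpos by (simp add: mean field_simps)
    qed
    then have "\<bar>v' x - mean ?B v\<bar> = (1 / m) * norm (\<integral>y. indicator ?B y * (v' x - v' y) \<partial>lborel)"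
      using mpos by (simp add: abs_mult)
    also have "ennreal \<dots> \<le> ennreal (1 / m) * (\<integral>\<^sup>+y. norm (indicator ?B y * (v' x - v' y)) \<partial>lborel)"
    proof -
      have "integrable lborel (\<lambda>y. indicator ?B y * (v' x - v' y))"
        using ci v'B by (simp add: right_diff_distrib)
      note integral_norm_bound_ennreal[OF this]
      moreover have "ennreal ((1 / m) * norm (\<integral>y. indicator ?B y * (v' x - v' y) \<partial>lborel))
          = ennreal (1 / m) * ennreal (norm (\<integral>y. indicator ?B y * (v' x - v' y) \<partial>lborel))"
        using mpos by (intro ennreal_mult) auto
      ultimately show ?thesis by (simp only: mult_left_mono zero_le)
    qed
    also have "(\<integral>\<^sup>+y. norm (indicator ?B y * (v' x - v' y)) \<partial>lborel) = (\<integral>\<^sup>+y. indicator ?B y * ennreal \<bar>v' x - v' y\<bar> \<partial>lborel)"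
      by (intro nn_integral_cong) (auto simp: indicator_def)
    finally show ?thesis .
  qed
  have "(\<integral>\<^sup>+x\<in>?B. ennreal \<bar>v x - mean ?B v\<bar> \<partial>lebesgue) = (\<integral>\<^sup>+x. indicator ?B x * ennreal \<bar>v' x - mean ?B v\<bar> \<partial>lebesgue)"
    using v'(2) B by (intro nn_integral_cong_AE) (auto simp: indicator_def elim!: eventually_mono split: if_splits)
  also have "\<dots> = (\<integral>\<^sup>+x. indicator ?B x * ennreal \<bar>v' x - mean ?B v\<bar> \<partial>lborel)"
    by (rule nn_integral_completion)
  also have "\<dots> \<le> (\<integral>\<^sup>+x. ennreal (1 / m) * (\<integral>\<^sup>+y. indicator ?B x * indicator ?B y * ennreal \<bar>v' x - v' y\<bar> \<partial>lborel) \<partial>lborel)"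
  proof (rule nn_integral_mono)
    fix x show "indicator ?B x * ennreal \<bar>v' x - mean ?B v\<bar>
       \<le> ennreal (1 / m) * (\<integral>\<^sup>+y. indicator ?B x * indicator ?B y * ennreal \<bar>v' x - v' y\<bar> \<partial>lborel)"
      using pt[of x] by (cases "x \<in> ?B") (auto simp: indicator_def)
  qed
  also have "\<dots> = ennreal (1 / m) * (\<integral>\<^sup>+x. (\<integral>\<^sup>+y. indicator ?B x * indicator ?B y * ennreal \<bar>v' x - v' y\<bar> \<partial>lborel) \<partial>lborel)"
  proof (rule nn_integral_cmult)
    have [measurable]: "?B \<in> sets borel" by simp
    show "(\<lambda>x. \<integral>\<^sup>+y. indicator ?B x * indicator ?B y * ennreal \<bar>v' x - v' y\<bar> \<partial>lborel) \<in> borel_measurable lborel"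
      by measurable
  qed
  also have "\<dots> \<le> ennreal (1 / m) * (ennreal (2 * r) * emeasure lborel (ball (0::real^'n) (2 * r))
        * (\<integral>\<^sup>+x. indicator ?B x * (\<Sum>i\<in>UNIV. ennreal \<bar>w' i x\<bar>) \<partial>lborel))"
    by (intro mult_left_mono double_oscillation_le_gradient[OF refl r v'(1) w'(1) weak']) auto
  also have "(\<integral>\<^sup>+x. indicator ?B x * (\<Sum>i\<in>UNIV. ennreal \<bar>w' i x\<bar>) \<partial>lborel)
      = (\<integral>\<^sup>+x. indicator ?B x * (\<Sum>i\<in>UNIV. ennreal \<bar>w' i x\<bar>) \<partial>lebesgue)"
    by (rule nn_integral_completion[symmetric])
  also have "\<dots> = (\<integral>\<^sup>+x\<in>?B. (\<Sum>i\<in>UNIV. ennreal \<bar>w i x\<bar>) \<partial>lebesgue)"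
    using AEw B by (intro nn_integral_cong_AE)
      (auto simp: indicator_def elim!: eventually_mono split: if_splits intro!: sum.cong)
  also have "ennreal (1 / m) * (ennreal (2 * r) * emeasure lborel (ball (0::real^'n) (2 * r)) * (\<integral>\<^sup>+x\<in>?B. (\<Sum>i\<in>UNIV. ennreal \<bar>w i x\<bar>) \<partial>lebesgue))
     = ennreal (2 ^ (CARD('n) + 1) * r) * (\<integral>\<^sup>+x\<in>?B. (\<Sum>i\<in>UNIV. ennreal \<bar>w i x\<bar>) \<partial>lebesgue)"
  proof -
    define U where "U = unit_ball_vol (real CARD('n))"
    have U: "U > 0" by (simp add: U_def)
    have m: "m = U * r ^ CARD('n)"
      using content_ball[of r c] r by (simp add: m_def U_def)
    have e: "emeasure lborel (ball (0::real^'n) (2 * r)) = ennreal (U * (2 * r) ^ CARD('n))"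
      using emeasure_ball[of "2 * r" "0::real^'n"] r by (simp add: U_def)
    have "(1 / m) * (2 * r * (U * (2 * r) ^ CARD('n))) = 2 ^ (CARD('n) + 1) * r"
      using U r by (simp add: m power_mult_distrib)
    then have "ennreal (1 / m) * (ennreal (2 * r) * ennreal (U * (2 * r) ^ CARD('n))) = ennreal (2 ^ (CARD('n) + 1) * r)"
      using U r mpos by (subst ennreal_mult'[symmetric], simp)+ simp
    then show ?thesis by (simp only: e mult.assoc[symmetric])
  qed
  finally show ?thesis .
qed

section \<open>Weak derivatives\<close>

lemma test_function_measurable:
  assumes "test_function \<Omega> \<eta>"
  shows "iter_partial ks \<eta> \<in> borel_measurable borel"
  using assms by (intro smooth_measurable smooth_iter_partial) (simp add: test_function_def)

lemma L1loc_test_integrable: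
  fixes u :: "real^'n \<Rightarrow> real"
  assumes u: "u \<in> L1loc \<Omega>" and \<eta>: "test_function \<Omega> \<eta>"
  shows "set_integrable lebesgue \<Omega> (\<lambda>x. u x * iter_partial ks \<eta> x)"
proof -
  let ?K = "closure {x. \<eta> x \<noteq> 0}"
  have K: "compact ?K" "?K \<subseteq> \<Omega>" using \<eta> by (auto simp: test_function_def)
  have uK: "integrable lebesgue (\<lambda>x. indicator ?K x *\<^sub>R u x)"
    using u K by (auto simp: L1loc_def set_integrable_def)
  obtain M where M: "M \<ge> 0" "\<And>x. \<bar>iter_partial ks \<eta> x\<bar> \<le> M"
    using test_function_iter_partial_bounded[OF \<eta>] by metis
  have m: "iter_partial ks \<eta> \<in> borel_measurable lebesgue"
    using test_function_measurable[OF \<eta>] by (simp add: measurable_completion)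
  have "integrable lebesgue (\<lambda>x. (indicator ?K x *\<^sub>R u x) * iter_partial ks \<eta> x)"
  proof (rule Bochner_Integration.integrable_bound[of _ "\<lambda>x. M * (indicator ?K x *\<^sub>R u x)"])
    show "integrable lebesgue (\<lambda>x. M * (indicator ?K x *\<^sub>R u x))" using uK by simp
    show "(\<lambda>x. (indicator ?K x *\<^sub>R u x) * iter_partial ks \<eta> x) \<in> borel_measurable lebesgue"
      using uK m by (intro borel_measurable_times) auto
    show "AE x in lebesgue. norm ((indicator ?K x *\<^sub>R u x) * iter_partial ks \<eta> x) \<le> norm (M * (indicator ?K x *\<^sub>R u x))"
    proof (rule AE_I2)
      fix x
      have "\<bar>indicator ?K x *\<^sub>R u x\<bar> * \<bar>iter_partial ks \<eta> x\<bar> \<le> \<bar>indicator ?K x *\<^sub>R u x\<bar> * M"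
        by (intro mult_left_mono M) auto
      then show "norm ((indicator ?K x *\<^sub>R u x) * iter_partial ks \<eta> x) \<le> norm (M * (indicator ?K x *\<^sub>R u x))"
        using M(1) by (simp only: real_norm_def abs_mult) (simp add: mult.commute)
    qed
  qed
  moreover have "(indicator ?K x *\<^sub>R u x) * iter_partial ks \<eta> x = indicator \<Omega> x *\<^sub>R (u x * iter_partial ks \<eta> x)" for x
  proof (cases "x \<in> ?K")
    case True then show ?thesis using K(2) by (auto simp: indicator_def)
  next
    case False
    then have "iter_partial ks \<eta> x = 0" by (rule iter_partial_outside_support)
    then show ?thesis by simp
  qed
  ultimately show ?thesis by (simp only: set_integrable_def)
qed

text \<open>\<Omega> is a countable union of closed boxes. On each of them g is integrable and has a
  Borel representative, to which the fundamental lemma applies on the open box; the faces of the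
  boxes are null sets.\<close>

lemma L1loc_AE_zero:
  fixes g :: "real^'n \<Rightarrow> real"
  assumes "open \<Omega>" and g: "g \<in> L1loc \<Omega>"
    and zero: "\<And>\<eta>. test_function \<Omega> \<eta> \<Longrightarrow> (LINT x:\<Omega>|lebesgue. g x * \<eta> x) = 0"
  shows "AE x in lebesgue. x \<in> \<Omega> \<longrightarrow> g x = 0"
proof -
  obtain \<D> where \<D>: "countable \<D>" "\<D> \<subseteq> Pow \<Omega>" "\<And>X. X \<in> \<D> \<Longrightarrow> \<exists>a b. X = cbox a b" "\<Union>\<D> = \<Omega>"
    using open_countable_Union_open_cbox[OF \<open>open \<Omega>\<close>] by metis
  have "AE x in lebesgue. x \<in> X \<longrightarrow> g x = 0" if "X \<in> \<D>" for X
  proof -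
    obtain l u where X: "X = cbox l u" using \<D>(3) \<open>X \<in> \<D>\<close> by blast
    have sub: "cbox l u \<subseteq> \<Omega>" using \<D>(2) \<open>X \<in> \<D>\<close> X by auto
    have gX: "set_integrable lebesgue (cbox l u) g" using g sub by (auto simp: L1loc_def)
    obtain g' where g': "integrable lborel g'" "AE x in lebesgue. indicator (cbox l u) x * g x = g' x"
      using lborel_representative[OF gX] .
    have "AE x in lborel. x \<in> box l u \<longrightarrow> g' x = 0"
    proof (rule AE_zero_if_test_integrals_zero[OF g'(1) open_box])
      fix \<eta> :: "real^'n \<Rightarrow> real" assume \<eta>: "test_function (box l u) \<eta>"
      have bs: "box l u \<subseteq> cbox l u" by (auto simp: mem_box_cart less_imp_le)
      have \<eta>\<Omega>: "test_function \<Omega> \<eta>" using \<eta> bs sub by (meson order_trans test_function_mono)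
      have \<eta>m: "\<eta> \<in> borel_measurable borel" using test_function_measurable[OF \<eta>, of "[]"] by simp
      have "(\<integral>x. g' x * \<eta> x \<partial>lborel) = (\<integral>x. g' x * \<eta> x \<partial>lebesgue)"
        using g'(1) \<eta>m by (intro integral_completion[symmetric]) auto
      also have "\<dots> = (\<integral>x. indicator \<Omega> x *\<^sub>R (g x * \<eta> x) \<partial>lebesgue)"
      proof (rule integral_cong_AE)
        show "(\<lambda>x. g' x * \<eta> x) \<in> borel_measurable lebesgue"
          using g'(1) \<eta>m by (intro measurable_completion) auto
        show "(\<lambda>x. indicator \<Omega> x *\<^sub>R (g x * \<eta> x)) \<in> borel_measurable lebesgue"
          using L1loc_test_integrable[OF g \<eta>\<Omega>, of "[]"] by (auto simp: set_integrable_def)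
        show "AE x in lebesgue. g' x * \<eta> x = indicator \<Omega> x *\<^sub>R (g x * \<eta> x)"
          using g'(2)
        proof eventually_elim
          case (elim x)
          show ?case
          proof (cases "x \<in> box l u")
            case True
            then have "x \<in> cbox l u" "x \<in> \<Omega>" using bs sub by auto
            then show ?thesis using elim by simp
          next
            case False
            then have "\<eta> x = 0" using test_function_outside[OF \<eta>, of x "[]"] by simp
            then show ?thesis by simp
          qed
        qed
      qed
      also have "\<dots> = 0" using zero[OF \<eta>\<Omega>] by (simp add: set_lebesgue_integral_def)
      finally show "(\<integral>x. g' x * \<eta> x \<partial>lborel) = 0" .
    qed
    then have "AE x in lebesgue. x \<in> box l u \<longrightarrow> g' x = 0" by (rule AE_completion)
    moreover have "AE x in lebesgue. x \<notin> cbox l u - box l u"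
      using negligible_frontier_interval negligible_iff_null_sets AE_not_in by blast
    ultimately show ?thesis using g'(2)
      by eventually_elim (auto simp: X)
  qed
  then have "AE x in lebesgue. \<forall>X\<in>\<D>. x \<in> X \<longrightarrow> g x = 0"
    using AE_ball_countable[OF \<D>(1), of "\<lambda>x X. x \<in> X \<longrightarrow> g x = 0" lebesgue] by blast
  then show ?thesis by eventually_elim (use \<D>(4) in blast)
qed

text \<open>As \<open>weak_deriv\<close> is an arbitrary choice, this is what identifies it with u
  itself for the empty list and with classical derivatives for test functions.\<close>

lemma has_weak_deriv_unique:
  fixes u :: "real^'n \<Rightarrow> real"
  assumes "open \<Omega>" "has_weak_deriv \<Omega> ks u v" "has_weak_deriv \<Omega> ks u w"
  shows "AE x in lebesgue. x \<in> \<Omega> \<longrightarrow> v x = w x"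
proof -
  have vw: "v \<in> L1loc \<Omega>" "w \<in> L1loc \<Omega>" using assms by (auto simp: has_weak_deriv_def)
  have "AE x in lebesgue. x \<in> \<Omega> \<longrightarrow> v x - w x = 0"
  proof (rule L1loc_AE_zero[OF assms(1)])
    show "(\<lambda>x. v x - w x) \<in> L1loc \<Omega>"
      using vw by (auto simp: L1loc_def intro!: set_integral_diff(1))
    fix \<eta> :: "real^'n \<Rightarrow> real" assume \<eta>: "test_function \<Omega> \<eta>"
    have 1: "(LINT x:\<Omega>|lebesgue. u x * iter_partial ks \<eta> x) = (- 1) ^ length ks * (LINT x:\<Omega>|lebesgue. v x * \<eta> x)"
      using assms(2) \<eta> unfolding has_weak_deriv_def by blast
    have 2: "(LINT x:\<Omega>|lebesgue. u x * iter_partial ks \<eta> x) = (- 1) ^ length ks * (LINT x:\<Omega>|lebesgue. w x * \<eta> x)"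
      using assms(3) \<eta> unfolding has_weak_deriv_def by blast
    have "(- 1) ^ length ks * (LINT x:\<Omega>|lebesgue. v x * \<eta> x) = (- 1) ^ length ks * (LINT x:\<Omega>|lebesgue. w x * \<eta> x)"
      by (rule trans[OF 1[symmetric] 2])
    then have "(LINT x:\<Omega>|lebesgue. v x * \<eta> x) = (LINT x:\<Omega>|lebesgue. w x * \<eta> x)" by simp
    then show "(LINT x:\<Omega>|lebesgue. (v x - w x) * \<eta> x) = 0"
      using L1loc_test_integrable[OF vw(1) \<eta>, of "[]"] L1loc_test_integrable[OF vw(2) \<eta>, of "[]"]
      by (simp add: left_diff_distrib set_integral_diff(2))
  qed
  then show ?thesis by eventually_elim simp
qed

text \<open>The new index goes to the end of the list because there it acts on the test function
  first: the derivative of \<eta> in direction i is again a test function, and the definition of the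
  weak derivative along \<open>ks\<close> can be applied to it.\<close>

lemma has_weak_deriv_snoc:
  fixes u :: "real^'n \<Rightarrow> real"
  assumes v: "has_weak_deriv \<Omega> ks u v" and w: "has_weak_deriv \<Omega> (ks @ [i]) u w"
  shows "has_weak_deriv \<Omega> [i] v w"
  unfolding has_weak_deriv_def
proof (intro conjI allI impI)
  show "v \<in> L1loc \<Omega>" "w \<in> L1loc \<Omega>" using v w by (auto simp: has_weak_deriv_def)
  fix \<eta> :: "real^'n \<Rightarrow> real" assume \<eta>: "test_function \<Omega> \<eta>"
  have "(LINT x:\<Omega>|lebesgue. u x * iter_partial ks (iter_partial [i] \<eta>) x)
      = (- 1) ^ length ks * (LINT x:\<Omega>|lebesgue. v x * iter_partial [i] \<eta> x)"
    using v test_function_iter_partial[OF \<eta>, of "[i]"] unfolding has_weak_deriv_def by blast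
  moreover have "(LINT x:\<Omega>|lebesgue. u x * iter_partial (ks @ [i]) \<eta> x)
      = (- 1) ^ length (ks @ [i]) * (LINT x:\<Omega>|lebesgue. w x * \<eta> x)"
    using w \<eta> unfolding has_weak_deriv_def by blast
  ultimately have "(- 1) ^ length ks * (LINT x:\<Omega>|lebesgue. v x * iter_partial [i] \<eta> x)
      = (- 1) ^ length (ks @ [i]) * (LINT x:\<Omega>|lebesgue. w x * \<eta> x)"
    by (simp only: iter_partial_append)
  then have "(- 1) ^ length ks * (LINT x:\<Omega>|lebesgue. v x * iter_partial [i] \<eta> x)
      = (- 1) ^ length ks * (- (LINT x:\<Omega>|lebesgue. w x * \<eta> x))"
    by (simp del: iter_partial.simps)
  then have "(LINT x:\<Omega>|lebesgue. v x * iter_partial [i] \<eta> x) = - (LINT x:\<Omega>|lebesgue. w x * \<eta> x)"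
    by (subst (asm) mult_left_cancel) auto
  then show "(LINT x:\<Omega>|lebesgue. v x * iter_partial [i] \<eta> x) = (- 1) ^ length [i] * (LINT x:\<Omega>|lebesgue. w x * \<eta> x)"
    by (simp del: iter_partial.simps)
qed

lemma has_weak_deriv_weak_deriv:
  assumes "weakly_differentiable m \<Omega> u" "length ks \<le> m"
  shows "has_weak_deriv \<Omega> ks u (weak_deriv \<Omega> ks u)"
  using assms unfolding weakly_differentiable_def weak_deriv_def by (metis someI_ex)

text \<open>Local integrability speaks of compact sets only. Exhausting \<Omega> by finite unions of
  closed boxes exhibits v, cut off outside \<Omega>, as a pointwise limit of measurable
  functions.\<close>

lemma L1loc_measurable:
  fixes v :: "real^'n \<Rightarrow> real"
  assumes "open \<Omega>" and v: "v \<in> L1loc \<Omega>"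
  shows "v \<in> borel_measurable (lebesgue_on \<Omega>)"
proof -
  obtain \<D> where \<D>: "countable \<D>" "\<D> \<subseteq> Pow \<Omega>" "\<And>X. X \<in> \<D> \<Longrightarrow> \<exists>a b. X = cbox a b" "\<Union>\<D> = \<Omega>"
    using open_countable_Union_open_cbox[OF \<open>open \<Omega>\<close>] by metis
  show ?thesis
  proof (cases "\<D> = {}")
    case True
    then have "\<Omega> = {}" using \<D>(4) by simp
    then show ?thesis by (simp add: measurable_def space_restrict_space)
  next
    case False
    define Q where "Q = from_nat_into \<D>"
    have Q: "Q i \<in> \<D>" for i using False by (simp add: Q_def from_nat_into)
    have UQ: "(\<Union>i. Q i) = \<Omega>"
      using range_from_nat_into[OF False \<D>(1)] \<D>(4) by (simp add: Q_def)
    define K where "K j = (\<Union>i\<le>j. Q i)" for j :: nat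
    have K: "compact (K j)" "K j \<subseteq> \<Omega>" for j
    proof -
      have "compact (Q i)" for i using Q[of i] \<D>(3) compact_cbox by metis
      then show "compact (K j)" unfolding K_def by (intro compact_UN) auto
      show "K j \<subseteq> \<Omega>" using Q \<D>(2) by (auto simp: K_def)
    qed
    have "(\<lambda>x. indicator \<Omega> x *\<^sub>R v x) \<in> borel_measurable lebesgue"
    proof (rule borel_measurable_LIMSEQ_metric)
      show "(\<lambda>x. indicator (K j) x *\<^sub>R v x) \<in> borel_measurable lebesgue" for j
        using v K[of j] by (auto simp: L1loc_def set_integrable_def)
      show "(\<lambda>j. indicator (K j) x *\<^sub>R v x) \<longlonglongrightarrow> indicator \<Omega> x *\<^sub>R v x" for x
      proof (cases "x \<in> \<Omega>")
        case True
        then obtain i where "x \<in> Q i" using UQ by blast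
        then have "\<forall>j\<ge>i. indicator (K j) x *\<^sub>R v x = indicator \<Omega> x *\<^sub>R v x"
          using True by (auto simp: K_def indicator_def)
        then show ?thesis
          by (intro tendsto_eventually) (auto simp: eventually_sequentially)
      next
        case False
        then have "x \<notin> K j" for j using K(2) by blast
        then show ?thesis using False by simp
      qed
    qed
    then show ?thesis
      using \<open>open \<Omega>\<close> by (subst borel_measurable_restrict_space_iff) (auto simp: mult.commute)
  qed
qed

text \<open>For the product F = f g, the integral of F(x + e) - F(x) over all x is 0, where e is the
  i-th unit vector. By the fundamental theorem along the segment, Fubini and translation invariance
  it is also the integral of G, the i-th partial derivative of F.\<close>

lemma integral_iter_partial_swap_single:
  fixes f g :: "real^'n \<Rightarrow> real"
  assumes f: "test_function UNIV f" and g: "test_function UNIV g"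
  shows "(\<integral>x. f x * iter_partial [i] g x \<partial>lborel) = - (\<integral>x. iter_partial [i] f x * g x \<partial>lborel)"
proof -
  let ?e = "axis i 1 :: real^'n"
  have smf: "smooth f" and smg: "smooth g" using f g by (auto simp: test_function_def)
  have [measurable]: "iter_partial ks f \<in> borel_measurable borel" "iter_partial ks g \<in> borel_measurable borel" for ks
    using f g by (auto intro: test_function_measurable)
  define F where "F x = f x * g x" for x
  define G where "G x = f x * iter_partial [i] g x + iter_partial [i] f x * g x" for x
  have ct: "integrable lborel (\<lambda>x. iter_partial ks f x * iter_partial ls g x)" for ks ls
  proof -
    have "integrable lborel (iter_partial ks f)"
    proof -
      let ?K = "closure {x. f x \<noteq> 0}"
      have "integrable lborel (\<lambda>x. indicator ?K x *\<^sub>R iter_partial ks f x)"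
        using f by (intro borel_integrable_compact smooth_continuous smf) (auto simp: test_function_def)
      moreover have "(\<lambda>x. indicator ?K x *\<^sub>R iter_partial ks f x) = iter_partial ks f"
        using iter_partial_outside_support[of _ f ks] by (auto simp: indicator_def fun_eq_iff)
      ultimately show ?thesis by (simp only:)
    qed
    from test_function_mult_integrable[OF this g, of ls 0] show ?thesis by simp
  qed
  have F_int: "integrable lborel F" using ct[of "[]" "[]"] by (simp add: F_def[abs_def])
  have G_int: "integrable lborel G"
    unfolding G_def using ct[of "[]" "[i]"] ct[of "[i]" "[]"] by (intro Bochner_Integration.integrable_add) (simp_all del: iter_partial.simps(2))
  have [measurable]: "G \<in> borel_measurable borel" "F \<in> borel_measurable borel" using F_int G_int by auto
  have der: "((\<lambda>t. F (x + t *\<^sub>R ?e)) has_real_derivative G (x + t *\<^sub>R ?e)) (at t)" for x t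
  proof -
    have A: "((\<lambda>t. x + t *\<^sub>R ?e) has_derivative (\<lambda>s. s *\<^sub>R ?e)) (at t)"
      by (auto intro!: derivative_eq_intros)
    have D: "((\<lambda>t. h (x + t *\<^sub>R ?e)) has_real_derivative iter_partial [i] h (x + t *\<^sub>R ?e)) (at t)" if "smooth h" for h
    proof -
      have s: "(\<Sum>j\<in>UNIV. (s *\<^sub>R ?e) $ j * iter_partial [j] h y) = iter_partial [i] h y * s" for s y
      proof -
        have "(\<Sum>j\<in>UNIV. (s *\<^sub>R ?e) $ j * iter_partial [j] h y) = (\<Sum>j\<in>UNIV. if j = i then s * iter_partial [i] h y else 0)"
          by (intro sum.cong) (auto simp: axis_def)
        then show ?thesis by (simp add: mult.commute del: iter_partial.simps)
      qed
      have "((\<lambda>t. h (x + t *\<^sub>R ?e)) has_derivative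
          (\<lambda>s. \<Sum>j\<in>UNIV. (s *\<^sub>R ?e) $ j * iter_partial [j] h (x + t *\<^sub>R ?e))) (at t)"
        by (rule has_derivative_compose[where f = "\<lambda>t. x + t *\<^sub>R ?e" and g = h, OF A directional_derivative_eq_sum[OF that]])
      then show ?thesis unfolding has_field_derivative_def s .
    qed
    show ?thesis unfolding F_def G_def
      using DERIV_mult[OF D[OF smf] D[OF smg]] by (simp only: add.commute mult.commute)
  qed
  have cont: "isCont (\<lambda>t. G (x + t *\<^sub>R ?e)) t" for x t
  proof -
    have "continuous_on UNIV (\<lambda>t. iter_partial ks h (x + t *\<^sub>R ?e))" if "smooth h" for ks h
      by (rule continuous_on_compose2[OF smooth_continuous[OF that]]) (auto intro!: continuous_intros)
    then have c: "isCont (\<lambda>t. iter_partial ks h (x + t *\<^sub>R ?e)) t" if "smooth h" for ks h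
      using that by (simp add: continuous_on_eq_continuous_at)
    show ?thesis unfolding G_def
      using c[OF smf, of "[]"] c[OF smf, of "[i]"] c[OF smg, of "[]"] c[OF smg, of "[i]"]
      by (intro continuous_intros) (simp_all del: iter_partial.simps(2))
  qed
  have FTC: "(\<integral>t. G (x + t *\<^sub>R ?e) * indicator {0..1} t \<partial>lborel) = F (x + ?e) - F x" for x
  proof -
    have "(\<integral>t. G (x + t *\<^sub>R ?e) * indicator {0..1} t \<partial>lborel) = F (x + 1 *\<^sub>R ?e) - F (x + 0 *\<^sub>R ?e)"
      by (rule integral_FTC_Icc_real) (use der cont in auto)
    then show ?thesis by simp
  qed
  have tr: "(\<integral>x. G (x + t *\<^sub>R ?e) \<partial>lborel) = (\<integral>x. G x \<partial>lborel)" for t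
    using integral_lborel_translate[of G "t *\<^sub>R ?e"] by (simp add: add.commute)
  have Gt_int: "integrable lborel (\<lambda>x. G (x + t *\<^sub>R ?e))" for t
    using integrable_lborel_translate[OF G_int, of "t *\<^sub>R ?e"] by (simp add: add.commute)
  have prod: "integrable (lborel \<Otimes>\<^sub>M lborel) (\<lambda>(t, x). G (x + t *\<^sub>R ?e) * indicator {0..1::real} t)"
  proof (rule lborel_pair.Fubini_integrable)
    show "(\<lambda>(t, x). G (x + t *\<^sub>R ?e) * indicator {0..1::real} t) \<in> borel_measurable (lborel \<Otimes>\<^sub>M lborel)"
      by measurable
    have "(\<integral>x. norm (case (t, x) of (t, x) \<Rightarrow> G (x + t *\<^sub>R ?e) * indicator {0..1::real} t) \<partial>lborel)
       = indicator {0..1} t * (\<integral>x. \<bar>G x\<bar> \<partial>lborel)" for t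
      using integral_lborel_translate[of "\<lambda>x. \<bar>G x\<bar>" "t *\<^sub>R ?e"]
      by (simp add: abs_mult add.commute mult.commute)
    then show "integrable lborel (\<lambda>t. \<integral>x. norm (case (t, x) of (t, x) \<Rightarrow> G (x + t *\<^sub>R ?e) * indicator {0..1::real} t) \<partial>lborel)"
      by simp
    show "AE t in lborel. integrable lborel (\<lambda>x. case (t, x) of (t, x) \<Rightarrow> G (x + t *\<^sub>R ?e) * indicator {0..1::real} t)"
      using Gt_int by (intro AE_I2) simp
  qed
  have "0 = (\<integral>x. F (x + ?e) - F x \<partial>lborel)"
    using integrable_lborel_translate[OF F_int, of ?e] integral_lborel_translate[of F ?e] F_int
    by (simp add: add.commute)
  also have "\<dots> = (\<integral>x. (\<integral>t. G (x + t *\<^sub>R ?e) * indicator {0..1} t \<partial>lborel) \<partial>lborel)"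
    by (simp only: FTC)
  also have "\<dots> = (\<integral>t. (\<integral>x. G (x + t *\<^sub>R ?e) * indicator {0..1} t \<partial>lborel) \<partial>lborel)"
    by (rule lborel_pair.Fubini_integral[OF prod])
  also have "\<dots> = (\<integral>t. indicator {0..1} t * (\<integral>x. G x \<partial>lborel) \<partial>(lborel :: real measure))"
    by (simp add: tr mult.commute)
  also have "\<dots> = (\<integral>x. G x \<partial>lborel)"
    by simp
  finally have "(\<integral>x. G x \<partial>lborel) = 0" by simp
  moreover have "(\<integral>x. G x \<partial>lborel) = (\<integral>x. f x * iter_partial [i] g x \<partial>lborel) + (\<integral>x. iter_partial [i] f x * g x \<partial>lborel)"
    unfolding G_def using ct[of "[]" "[i]"] ct[of "[i]" "[]"]
    by (intro Bochner_Integration.integral_add) (simp_all del: iter_partial.simps(2))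
  ultimately show ?thesis by linarith
qed

text \<open>The outermost derivative of g is moved first and thus becomes the innermost one on f;
  this is where \<open>rev\<close> comes from.\<close>

lemma integral_iter_partial_swap:
  fixes f g :: "real^'n \<Rightarrow> real"
  assumes f: "test_function UNIV f" and g: "test_function UNIV g"
  shows "(\<integral>x. f x * iter_partial ks g x \<partial>lborel)
    = (- 1) ^ length ks * (\<integral>x. iter_partial (rev ks) f x * g x \<partial>lborel)"
  using f
proof (induction ks arbitrary: f)
  case (Cons i ks)
  have "(\<integral>x. f x * iter_partial (i # ks) g x \<partial>lborel) = (\<integral>x. f x * iter_partial [i] (iter_partial ks g) x \<partial>lborel)"
    by simp
  also have "\<dots> = - (\<integral>x. iter_partial [i] f x * iter_partial ks g x \<partial>lborel)"
    by (rule integral_iter_partial_swap_single[OF Cons.prems test_function_iter_partial[OF g]])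
  also have "\<dots> = - ((- 1) ^ length ks * (\<integral>x. iter_partial (rev ks) (iter_partial [i] f) x * g x \<partial>lborel))"
    by (subst Cons.IH[OF test_function_iter_partial[OF Cons.prems]]) (rule refl)
  also have "\<dots> = (- 1) ^ length (i # ks) * (\<integral>x. iter_partial (rev (i # ks)) f x * g x \<partial>lborel)"
    by (simp only: rev.simps iter_partial_append list.size power_Suc add_Suc_right add_0_right)
  finally show ?case .
qed simp

lemma smooth_L1loc:
  fixes f :: "real^'n \<Rightarrow> real"
  assumes "smooth f" shows "iter_partial ks f \<in> L1loc \<Omega>"
  unfolding L1loc_def
proof (clarify)
  fix K :: "(real^'n) set" assume K: "compact K"
  have "integrable lborel (\<lambda>x. indicator K x *\<^sub>R iter_partial ks f x)"
    by (intro borel_integrable_compact K smooth_continuous assms)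
  then have "integrable lebesgue (\<lambda>x. indicator K x *\<^sub>R iter_partial ks f x)"
    by (subst integrable_completion) auto
  then show "iter_partial ks f absolutely_integrable_on K" by (simp add: set_integrable_def)
qed

text \<open>Since f and its derivatives vanish outside \<Omega>, the set integrals are integrals
  over the whole space, where integration by parts has no boundary terms.\<close>

lemma test_function_has_weak_deriv:
  fixes f :: "real^'n \<Rightarrow> real"
  assumes f: "test_function \<Omega> f"
  shows "has_weak_deriv \<Omega> ks f (iter_partial (rev ks) f)"
  unfolding has_weak_deriv_def
proof (intro conjI allI impI)
  have sm: "smooth f" using f by (simp add: test_function_def)
  show "f \<in> L1loc \<Omega>" "iter_partial (rev ks) f \<in> L1loc \<Omega>"
    using smooth_L1loc[OF sm, of "[]"] smooth_L1loc[OF sm, of "rev ks"] by auto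
  fix \<eta> :: "real^'n \<Rightarrow> real" assume \<eta>: "test_function \<Omega> \<eta>"
  have red: "(LINT x:\<Omega>|lebesgue. iter_partial js f x * iter_partial ls \<eta> x) = (\<integral>x. iter_partial js f x * iter_partial ls \<eta> x \<partial>lborel)" for js ls
  proof -
    have [measurable]: "iter_partial js f \<in> borel_measurable borel" "iter_partial ls \<eta> \<in> borel_measurable borel"
      using f \<eta> by (auto intro: test_function_measurable)
    have e: "indicator \<Omega> x *\<^sub>R (iter_partial js f x * iter_partial ls \<eta> x) = iter_partial js f x * iter_partial ls \<eta> x" for x
      using test_function_outside[OF f, of x js] by (auto simp: indicator_def)
    have "(LINT x:\<Omega>|lebesgue. iter_partial js f x * iter_partial ls \<eta> x) = (\<integral>x. iter_partial js f x * iter_partial ls \<eta> x \<partial>lebesgue)"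
      unfolding set_lebesgue_integral_def e ..
    also have "\<dots> = (\<integral>x. iter_partial js f x * iter_partial ls \<eta> x \<partial>lborel)"
      by (rule integral_completion) measurable
    finally show ?thesis .
  qed
  show "(LINT x:\<Omega>|lebesgue. f x * iter_partial ks \<eta> x) = (- 1) ^ length ks * (LINT x:\<Omega>|lebesgue. iter_partial (rev ks) f x * \<eta> x)"
    using red[of "[]" ks] red[of "rev ks" "[]"]
      integral_iter_partial_swap[OF test_function_mono[OF f] test_function_mono[OF \<eta>], of ks]
    by simp
qed

section \<open>Rearrangements and function norms\<close>

text \<open>The distribution function and the rearrangement are generalised inverses. One direction
  is the definition of the infimum. For the other, the superlevel set at \<tau> is the increasing
  union of those at \<tau> + 1/(k+1), so the strict inequality of measures persists at a slightly
  higher level, which then bounds the infimum from below.\<close>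

lemma rearr_greater_iff:
  assumes [measurable]: "f \<in> borel_measurable M" and "0 \<le> \<tau>"
  shows "ennreal \<tau> < rearr M f s \<longleftrightarrow> ennreal s < emeasure M {x \<in> space M. ennreal \<tau> < f x}"
proof
  assume less: "ennreal s < emeasure M {x \<in> space M. ennreal \<tau> < f x}"
  let ?A = "\<lambda>k. {x \<in> space M. ennreal (\<tau> + 1 / real (Suc k)) < f x}"
  have "{x \<in> space M. ennreal \<tau> < f x} = (\<Union>k. ?A k)"
  proof safe
    fix x assume x: "x \<in> space M" "ennreal \<tau> < f x"
    obtain c where c: "ennreal \<tau> < c" "c < f x" using dense[OF x(2)] by blast
    then have c_top: "c \<noteq> top" by auto
    define c' where "c' = enn2real c"
    have cc: "c = ennreal c'" "c' \<ge> 0" using c_top by (auto simp: c'_def less_top[symmetric])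
    then have "\<tau> < c'" using c(1) \<open>0 \<le> \<tau>\<close> by (simp add: ennreal_less_iff)
    then obtain k where "1 / real (Suc k) < c' - \<tau>"
      using reals_Archimedean[of "c' - \<tau>"] by (auto simp: inverse_eq_divide)
    then have "ennreal (\<tau> + 1 / real (Suc k)) \<le> c" unfolding cc by (intro ennreal_leI) simp
    then show "x \<in> (\<Union>k. ?A k)" using c(2) x(1) by (auto intro: le_less_trans)
  next
    fix x k assume "ennreal (\<tau> + 1 / real (Suc k)) < f x"
    moreover have "ennreal \<tau> \<le> ennreal (\<tau> + 1 / real (Suc k))" by (intro ennreal_leI) simp
    ultimately show "ennreal \<tau> < f x" by (rule le_less_trans[rotated])
  qed
  moreover have "incseq ?A"
  proof (rule incseq_SucI, safe)
    fix k x assume "ennreal (\<tau> + 1 / real (Suc k)) < f x"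
    moreover have "ennreal (\<tau> + 1 / real (Suc (Suc k))) \<le> ennreal (\<tau> + 1 / real (Suc k))"
      by (intro ennreal_leI) (simp add: field_simps)
    ultimately show "ennreal (\<tau> + 1 / real (Suc (Suc k))) < f x" by (rule le_less_trans[rotated])
  qed
  ultimately have "emeasure M {x \<in> space M. ennreal \<tau> < f x} = (SUP k. emeasure M (?A k))"
    by (subst SUP_emeasure_incseq) auto
  with less obtain k where k: "ennreal s < emeasure M (?A k)"
    by (auto simp: less_SUP_iff)
  have "ennreal (\<tau> + 1 / real (Suc k)) \<le> rearr M f s"
    unfolding rearr_def
  proof (rule INF_greatest)
    fix t :: real assume "t \<in> {t. 0 \<le> t \<and> emeasure M {x \<in> space M. ennreal t < f x} \<le> ennreal s}"
    then have t: "0 \<le> t" "emeasure M {x \<in> space M. ennreal t < f x} \<le> ennreal s" by auto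
    show "ennreal (\<tau> + 1 / real (Suc k)) \<le> ennreal t"
    proof (rule ccontr)
      assume "\<not> ?thesis"
      then have "ennreal t \<le> ennreal (\<tau> + 1 / real (Suc k))" by simp
      then have "emeasure M (?A k) \<le> emeasure M {x \<in> space M. ennreal t < f x}"
        by (intro emeasure_mono) (auto intro: le_less_trans)
      with k t(2) show False by (meson leD order_trans)
    qed
  qed
  moreover have "ennreal \<tau> < ennreal (\<tau> + 1 / real (Suc k))"
    using \<open>0 \<le> \<tau>\<close> by (subst ennreal_less_iff) auto
  ultimately show "ennreal \<tau> < rearr M f s" by (rule less_le_trans[rotated])
next
  assume less: "ennreal \<tau> < rearr M f s"
  show "ennreal s < emeasure M {x \<in> space M. ennreal \<tau> < f x}"
  proof (rule ccontr)
    assume "\<not> ?thesis"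
    then have "rearr M f s \<le> ennreal \<tau>"
      unfolding rearr_def using \<open>0 \<le> \<tau>\<close> by (intro INF_lower) auto
    with less show False by (simp add: leD)
  qed
qed

lemma rearr_measurable:
  assumes "f \<in> borel_measurable M"
  shows "rearr M f \<in> borel_measurable borel"
proof (rule borel_measurableI_greater)
  fix y :: ennreal
  show "{x \<in> space borel. y < rearr M f x} \<in> sets borel"
  proof (cases y)
    case (real \<tau>)
    then have "{x \<in> space borel. y < rearr M f x} = {s. ennreal s < emeasure M {x \<in> space M. ennreal \<tau> < f x}}"
      using rearr_greater_iff[OF assms] by auto
    also have "\<dots> \<in> sets borel" by measurable
    finally show ?thesis .
  qed simp
qed

lemma emeasure_lborel_Ici_top: "emeasure lborel {0::real..} = top"
proof (rule ccontr)
  assume "emeasure lborel {0::real..} \<noteq> top"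
  then obtain a where a: "emeasure lborel {0::real..} = ennreal a" "a \<ge> 0"
    by (cases "emeasure lborel {0::real..}") auto
  have "emeasure lborel {0..a + 1} \<le> emeasure lborel {0::real..}"
    by (rule emeasure_mono) auto
  then show False using a by simp
qed

lemma emeasure_lborel_below:
  fixes y :: ennreal
  shows "emeasure lborel {\<tau>. 0 \<le> \<tau> \<and> ennreal \<tau> < y} = y"
proof (cases y)
  case (real a)
  then have "{\<tau>. 0 \<le> \<tau> \<and> ennreal \<tau> < y} = {0..<a}"
    by (auto simp: ennreal_less_iff)
  then show ?thesis using real by simp
next
  case top
  then have "{\<tau>. 0 \<le> \<tau> \<and> ennreal \<tau> < y} = {0..}" by auto
  then show ?thesis using top emeasure_lborel_Ici_top by simp
qed

lemma measurable_distribution [measurable (raw)]: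
  assumes "sigma_finite_measure M" and [measurable]: "f \<in> borel_measurable M"
  shows "(\<lambda>\<tau>. emeasure M {x \<in> space M. ennreal \<tau> < f x}) \<in> borel_measurable borel"
proof -
  interpret sigma_finite_measure M by fact
  have "(\<lambda>\<tau>. emeasure M {x \<in> space M. ennreal \<tau> < f x})
      = (\<lambda>\<tau>. \<integral>\<^sup>+x. indicator {x \<in> space M. ennreal \<tau> < f x} x \<partial>M)"
    by (intro ext nn_integral_indicator[symmetric]) measurable
  also have "\<dots> = (\<lambda>\<tau>. \<integral>\<^sup>+x. (if ennreal \<tau> < f x then 1 else 0) \<partial>M)"
    by (intro ext nn_integral_cong) (auto simp: indicator_def)
  also have "\<dots> \<in> borel_measurable borel" by measurable
  finally show ?thesis .
qed

lemma nn_integral_layer_cake: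
  assumes "sigma_finite_measure M" and [measurable]: "f \<in> borel_measurable M"
  shows "(\<integral>\<^sup>+x. f x \<partial>M)
    = (\<integral>\<^sup>+\<tau>. emeasure M {x \<in> space M. ennreal \<tau> < f x} * indicator {0..} \<tau> \<partial>lborel)"
proof -
  interpret M: sigma_finite_measure M by fact
  interpret P: pair_sigma_finite M lborel ..
  have "(\<integral>\<^sup>+x. f x \<partial>M) = (\<integral>\<^sup>+x. (\<integral>\<^sup>+\<tau>. (if 0 \<le> \<tau> \<and> ennreal \<tau> < f x then 1 else 0) \<partial>lborel) \<partial>M)"
  proof (rule nn_integral_cong)
    fix x
    have "f x = (\<integral>\<^sup>+\<tau>. indicator {\<tau>. 0 \<le> \<tau> \<and> ennreal \<tau> < f x} \<tau> \<partial>lborel)"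
      by (subst nn_integral_indicator) (simp_all add: emeasure_lborel_below)
    then show "f x = (\<integral>\<^sup>+\<tau>. (if 0 \<le> \<tau> \<and> ennreal \<tau> < f x then 1 else 0) \<partial>lborel)"
      by (simp add: indicator_def of_bool_def)
  qed
  also have "\<dots> = (\<integral>\<^sup>+\<tau>. (\<integral>\<^sup>+x. (if 0 \<le> \<tau> \<and> ennreal \<tau> < f x then 1 else 0) \<partial>M) \<partial>lborel)"
    by (rule P.Fubini'[symmetric]) measurable
  also have "\<dots> = (\<integral>\<^sup>+\<tau>. emeasure M {x \<in> space M. ennreal \<tau> < f x} * indicator {0..} \<tau> \<partial>lborel)"
  proof (rule nn_integral_cong)
    fix \<tau> :: real
    have "(\<integral>\<^sup>+x. (if 0 \<le> \<tau> \<and> ennreal \<tau> < f x then 1 else 0) \<partial>M)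
       = (\<integral>\<^sup>+x. indicator {x \<in> space M. ennreal \<tau> < f x} x * indicator {0..} \<tau> \<partial>M)"
      by (intro nn_integral_cong) (auto simp: indicator_def)
    also have "\<dots> = emeasure M {x \<in> space M. ennreal \<tau> < f x} * indicator {0..} \<tau>"
      by (subst nn_integral_multc) auto
    finally show "(\<integral>\<^sup>+x. (if 0 \<le> \<tau> \<and> ennreal \<tau> < f x then 1 else 0) \<partial>M)
       = emeasure M {x \<in> space M. ennreal \<tau> < f x} * indicator {0..} \<tau>" .
  qed
  finally show ?thesis .
qed

lemma emeasure_initial_segment:
  fixes A :: ennreal
  assumes "0 \<le> s"
  shows "emeasure lborel {t. 0 < t \<and> t < s \<and> ennreal t < A} = min (ennreal s) A"
proof (cases A)
  case (real a)
  then have "{t. 0 < t \<and> t < s \<and> ennreal t < A} = {0<..<min s a}"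
    by (auto simp: ennreal_less_iff)
  then show ?thesis using real assms by (simp add: min_def)
next
  case top
  then have "{t. 0 < t \<and> t < s \<and> ennreal t < A} = {0<..<s}" by auto
  then show ?thesis using top assms by (simp add: min_def)
qed

text \<open>Layer cake for the rearrangement cut off at s: by \<open>rearr_greater_iff\<close> its
  superlevel set at \<tau> is an initial interval of length \<open>min s \<mu>\<close>, with \<mu>
  the measure of the superlevel set of f.\<close>

lemma nn_integral_rearr:
  assumes f: "f \<in> borel_measurable M" and "0 \<le> s"
  shows "(\<integral>\<^sup>+t\<in>{0<..<s}. rearr M f t \<partial>lebesgue)
    = (\<integral>\<^sup>+\<tau>. min (ennreal s) (emeasure M {x \<in> space M. ennreal \<tau> < f x}) * indicator {0..} \<tau> \<partial>lborel)"
proof -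
  have [measurable]: "rearr M f \<in> borel_measurable borel" by (rule rearr_measurable[OF f])
  have "(\<integral>\<^sup>+t\<in>{0<..<s}. rearr M f t \<partial>lebesgue) = (\<integral>\<^sup>+t\<in>{0<..<s}. rearr M f t \<partial>lborel)"
    by (rule nn_integral_completion)
  also have "\<dots> = (\<integral>\<^sup>+\<tau>. emeasure lborel {t \<in> space lborel. ennreal \<tau> < rearr M f t * indicator {0<..<s} t} * indicator {0..} \<tau> \<partial>lborel)"
    by (rule nn_integral_layer_cake) (auto intro: sigma_finite_lborel)
  also have "\<dots> = (\<integral>\<^sup>+\<tau>. min (ennreal s) (emeasure M {x \<in> space M. ennreal \<tau> < f x}) * indicator {0..} \<tau> \<partial>lborel)"
  proof (rule nn_integral_cong)
    fix \<tau> :: real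
    show "emeasure lborel {t \<in> space lborel. ennreal \<tau> < rearr M f t * indicator {0<..<s} t} * indicator {0..} \<tau>
      = min (ennreal s) (emeasure M {x \<in> space M. ennreal \<tau> < f x}) * indicator {0..} \<tau>"
    proof (cases "0 \<le> \<tau>")
      case True
      then have "{t \<in> space lborel. ennreal \<tau> < rearr M f t * indicator {0<..<s} t}
         = {t. 0 < t \<and> t < s \<and> ennreal t < emeasure M {x \<in> space M. ennreal \<tau> < f x}}"
        using rearr_greater_iff[OF f True] by (auto simp: indicator_def split: if_splits)
      then show ?thesis using emeasure_initial_segment[OF \<open>0 \<le> s\<close>] by simp
    qed simp
  qed
  finally show ?thesis .
qed

lemma ennreal_mult_min:
  fixes a b c :: ennreal
  shows "c * min a b = min (c * a) (c * b)"
proof (cases "a \<le> b")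
  case True
  then show ?thesis using mult_left_mono[OF True, of c] by (simp add: min_def)
next
  case False
  then have "b \<le> a" by simp
  then show ?thesis using mult_left_mono[OF \<open>b \<le> a\<close>, of c] by (simp add: min.absorb2)
qed

text \<open>The norm rearranges twice: first u, then the rescaled rearrangement as a function on (0,
  1). By \<open>rearr_greater_iff\<close> the latter has distribution function \<mu> / V, which is
  at most 1, so the second rearrangement loses nothing and the factor V restores \<mu>.\<close>

lemma measure_mult_nn_integral_rearr_rearr:
  fixes u :: "real^'n \<Rightarrow> ennreal" and \<Omega> :: "(real^'n) set"
  assumes [measurable]: "u \<in> borel_measurable (lebesgue_on \<Omega>)" and \<Omega>: "\<Omega> \<in> lmeasurable"
    and V: "measure lebesgue \<Omega> > 0" and t: "0 \<le> t" "t \<le> 1"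
  shows "ennreal (measure lebesgue \<Omega>) * (\<integral>\<^sup>+r\<in>{0<..<t}.
      rearr (lebesgue_on {0<..<1}) (\<lambda>s. rearr (lebesgue_on \<Omega>) u (measure lebesgue \<Omega> * s)) r \<partial>lebesgue)
    = (\<integral>\<^sup>+\<tau>. min (ennreal (measure lebesgue \<Omega> * t))
         (emeasure (lebesgue_on \<Omega>) {x \<in> space (lebesgue_on \<Omega>). ennreal \<tau> < u x}) * indicator {0..} \<tau> \<partial>lborel)"
proof -
  define V where "V = measure lebesgue \<Omega>"
  define \<mu> where "\<mu> = (\<lambda>\<tau>. emeasure (lebesgue_on \<Omega>) {x \<in> space (lebesgue_on \<Omega>). ennreal \<tau> < u x})"
  define f where "f = (\<lambda>s. rearr (lebesgue_on \<Omega>) u (V * s))"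
  have Vpos: "V > 0" using V by (simp add: V_def)
  interpret finite_measure "lebesgue_on \<Omega>" using \<Omega> by (rule finite_measure_lebesgue_on)
  have \<mu>_meas[measurable]: "\<mu> \<in> borel_measurable borel"
    unfolding \<mu>_def by (intro measurable_distribution) (auto intro: sigma_finite_measure_axioms)
  have \<mu>_le: "\<mu> \<tau> \<le> ennreal V" for \<tau>
  proof -
    have "\<mu> \<tau> \<le> emeasure (lebesgue_on \<Omega>) (space (lebesgue_on \<Omega>))"
      unfolding \<mu>_def by (rule emeasure_space)
    also have "\<dots> = ennreal V"
      using \<Omega> by (simp add: emeasure_restrict_space fmeasurableD V_def emeasure_eq_measure2)
    finally show ?thesis .
  qed
  have r_meas: "rearr (lebesgue_on \<Omega>) u \<in> borel_measurable borel"
    by (rule rearr_measurable) simp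
  have f_borel: "f \<in> borel_measurable borel"
    unfolding f_def using r_meas by (rule measurable_compose[rotated]) simp
  have f_meas: "f \<in> borel_measurable (lebesgue_on {0<..<1})"
    by (intro measurable_restrict_space1 measurable_completion) (simp add: f_borel)
  have V_cancel: "ennreal V * ennreal s < A \<longleftrightarrow> ennreal s < A / ennreal V" for s A
  proof (cases A)
    case (real a)
    then show ?thesis using Vpos by (cases "s \<ge> 0")
      (auto simp: divide_ennreal ennreal_less_iff field_simps ennreal_neg ennreal_mult[symmetric] ennreal_zero_less_divide)
  next
    case top
    then show ?thesis using Vpos by (simp add: ennreal_top_divide ennreal_mult_less_top)
  qed
  have dist_f: "emeasure (lebesgue_on {0<..<1}) {s \<in> space (lebesgue_on {0<..<1}). ennreal \<tau> < f s} = \<mu> \<tau> / ennreal V"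
    if "0 \<le> \<tau>" for \<tau>
  proof -
    have set_eq: "{s \<in> space (lebesgue_on {0<..<1}). ennreal \<tau> < f s} = {s. 0 < s \<and> s < 1 \<and> ennreal s < \<mu> \<tau> / ennreal V}"
      using rearr_greater_iff[of u "lebesgue_on \<Omega>" \<tau>] that Vpos
      by (auto simp: f_def \<mu>_def ennreal_mult' V_cancel)
    have "emeasure (lebesgue_on {0<..<1}) {s. 0 < s \<and> s < 1 \<and> ennreal s < \<mu> \<tau> / ennreal V}
        = emeasure lebesgue {s. 0 < s \<and> s < 1 \<and> ennreal s < \<mu> \<tau> / ennreal V}"
      by (subst emeasure_restrict_space) auto
    also have "\<dots> = emeasure lborel {s. 0 < s \<and> s < 1 \<and> ennreal s < \<mu> \<tau> / ennreal V}"
    proof -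
      have "{s. 0 < s \<and> s < 1 \<and> ennreal s < \<mu> \<tau> / ennreal V} \<in> sets borel" by measurable
      then show ?thesis by simp
    qed
    also have "\<dots> = min (ennreal 1) (\<mu> \<tau> / ennreal V)"
      by (rule emeasure_initial_segment) simp
    also have "\<dots> = \<mu> \<tau> / ennreal V"
      using \<mu>_le[of \<tau>] Vpos by (auto intro!: min_absorb2 simp: divide_le_posI_ennreal)
    finally show ?thesis unfolding set_eq .
  qed
  have "(\<integral>\<^sup>+r\<in>{0<..<t}. rearr (lebesgue_on {0<..<1}) f r \<partial>lebesgue)
     = (\<integral>\<^sup>+\<tau>. min (ennreal t) (\<mu> \<tau> / ennreal V) * indicator {0..} \<tau> \<partial>lborel)"
    unfolding nn_integral_rearr[OF f_meas t(1)]
  proof (rule nn_integral_cong)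
    fix \<tau> :: real
    show "min (ennreal t) (emeasure (lebesgue_on {0<..<1}) {s \<in> space (lebesgue_on {0<..<1}). ennreal \<tau> < f s}) * indicator {0..} \<tau>
       = min (ennreal t) (\<mu> \<tau> / ennreal V) * indicator {0..} \<tau>"
      using dist_f[of \<tau>] by (cases "0 \<le> \<tau>") auto
  qed
  then have "ennreal V * (\<integral>\<^sup>+r\<in>{0<..<t}. rearr (lebesgue_on {0<..<1}) f r \<partial>lebesgue)
     = (\<integral>\<^sup>+\<tau>. ennreal V * (min (ennreal t) (\<mu> \<tau> / ennreal V) * indicator {0..} \<tau>) \<partial>lborel)"
    by (simp add: nn_integral_cmult)
  also have "\<dots> = (\<integral>\<^sup>+\<tau>. min (ennreal (V * t)) (\<mu> \<tau>) * indicator {0..} \<tau> \<partial>lborel)"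
  proof (rule nn_integral_cong)
    fix \<tau>
    have "ennreal V * (\<mu> \<tau> / ennreal V) = \<mu> \<tau>"
      using Vpos \<mu>_le[of \<tau>]
      by (cases "\<mu> \<tau>") (auto simp: divide_ennreal ennreal_mult[symmetric] top_unique)
    then have "ennreal V * min (ennreal t) (\<mu> \<tau> / ennreal V) = min (ennreal (V * t)) (\<mu> \<tau>)"
      using Vpos by (simp add: ennreal_mult_min ennreal_mult')
    then show "ennreal V * (min (ennreal t) (\<mu> \<tau> / ennreal V) * indicator {0..} \<tau>)
       = min (ennreal (V * t)) (\<mu> \<tau>) * indicator {0..} \<tau>"
      by (simp add: mult.assoc[symmetric])
  qed
  finally show ?thesis by (simp add: f_def V_def \<mu>_def)
qed

section \<open>Comparison of L^q norms with explicit weights\<close>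

lemma ennpowr_mono: "p > 0 \<Longrightarrow> x \<le> y \<Longrightarrow> ennpowr x p \<le> ennpowr y p"
  by (cases x; cases y) (auto simp: ennpowr_def top_unique intro!: ennreal_leI powr_mono2)

lemma ennpowr_measurable [measurable]: "(\<lambda>x. ennpowr x p) \<in> borel_measurable borel"
  unfolding ennpowr_def by measurable

lemma ennpowr_ennreal: "x \<ge> 0 \<Longrightarrow> ennpowr (ennreal x) p = ennreal (x powr p)"
  by (simp add: ennpowr_def)

lemma ennpowr_mult: "p > 0 \<Longrightarrow> ennpowr (x * y) p = ennpowr x p * ennpowr y p"
  by (cases x; cases y)
     (auto simp: ennpowr_def ennreal_mult[symmetric] powr_mult ennreal_mult_top ennreal_top_mult)

lemma ennpowr_ennpowr:
  assumes "p > 0" shows "ennpowr (ennpowr x p) (1 / p) = x"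
  using assms by (cases x) (auto simp: ennpowr_def powr_powr)

lemma recip_finite:
  assumes "1 \<le> q" "q < top"
  shows "recip q = 1 / enn2real q" "enn2real q \<ge> 1"
proof -
  obtain p where p: "q = ennreal p" "p \<ge> 0" using assms(2) by (cases q) auto
  then have "p \<ge> 1" using assms(1) by (metis ennreal_1 ennreal_le_iff)
  then have "1 / q = ennreal (1 / p)"
    using p by (metis divide_ennreal ennreal_1 less_le_trans zero_le_one zero_less_one)
  then show "recip q = 1 / enn2real q" "enn2real q \<ge> 1"
    using p \<open>p \<ge> 1\<close> by (simp_all add: recip_def)
qed

lemma Lq_norm_finite:
  assumes "1 \<le> q" "q < top"
  shows "Lq_norm q M f = ennpowr (\<integral>\<^sup>+x. ennpowr (f x) (enn2real q) \<partial>M) (1 / enn2real q)"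
  using assms recip_finite[OF assms] by (auto simp: Lq_norm_def)

lemma nn_integral_lebesgue_on:
  assumes "S \<in> sets lebesgue"
  shows "(\<integral>\<^sup>+x. f x \<partial>lebesgue_on S) = (\<integral>\<^sup>+x\<in>S. f x \<partial>lebesgue)"
  using assms by (subst nn_integral_restrict_space) auto

text \<open>Z is extended real because it will be the integral of |u| over a set, whose finiteness
  is only a consequence of this estimate. For the same reason V stays a factor on the right instead
  of a divisor on the left.\<close>

lemma Lq_norm_lower_finite:
  fixes f :: "real \<Rightarrow> ennreal" and g :: "real \<Rightarrow> real" and Z :: ennreal
  assumes q: "1 \<le> q" "q < top" and t0: "0 < t0" and V: "V > 0" and N: "N \<ge> 0"
    and g: "g \<in> borel_measurable borel" "\<And>t. g t \<ge> 0"
    and f: "f \<in> borel_measurable (lebesgue_on {0<..<1})"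
    and le: "\<And>t. t0 < t \<Longrightarrow> t < 1 \<Longrightarrow> Z * ennreal (g t) \<le> ennreal V * f t"
    and int: "ennreal (N powr enn2real q) \<le> (\<integral>\<^sup>+t\<in>{t0<..<1}. ennreal (g t powr enn2real q) \<partial>lborel)"
  shows "Z * ennreal N \<le> ennreal V * Lq_norm q (lebesgue_on {0<..<1}) f"
proof -
  define p where "p = enn2real q"
  have p: "p \<ge> 1" using recip_finite[OF q] by (simp add: p_def)
  define Y where "Y = ennpowr (ennreal V) p"
  note [measurable] = g(1)
  have "ennpowr (Z * ennreal N) p = ennpowr Z p * ennreal (N powr p)"
    using p N by (simp add: ennpowr_mult ennpowr_ennreal)
  also have "\<dots> \<le> ennpowr Z p * (\<integral>\<^sup>+t\<in>{t0<..<1}. ennreal (g t powr p) \<partial>lborel)"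
    using int by (simp add: p_def mult_left_mono)
  also have "\<dots> = (\<integral>\<^sup>+t. ennpowr Z p * (ennreal (g t powr p) * indicator {t0<..<1} t) \<partial>lborel)"
    by (subst nn_integral_cmult) auto
  also have "\<dots> = (\<integral>\<^sup>+t. ennpowr Z p * (ennreal (g t powr p) * indicator {t0<..<1} t) \<partial>lebesgue)"
    by (rule nn_integral_completion[symmetric])
  also have "\<dots> \<le> (\<integral>\<^sup>+t. Y * ennpowr (f t) p * indicator {0<..<1} t \<partial>lebesgue)"
  proof (rule nn_integral_mono)
    fix t :: real
    show "ennpowr Z p * (ennreal (g t powr p) * indicator {t0<..<1} t) \<le> Y * ennpowr (f t) p * indicator {0<..<1} t"
    proof (cases "t \<in> {t0<..<1}")
      case True
      have "ennpowr Z p * ennreal (g t powr p) = ennpowr (Z * ennreal (g t)) p"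
        using p g(2) by (simp add: ennpowr_mult ennpowr_ennreal)
      also have "\<dots> \<le> ennpowr (ennreal V * f t) p"
        using p True le by (intro ennpowr_mono) auto
      also have "\<dots> = Y * ennpowr (f t) p" using p by (simp add: ennpowr_mult Y_def)
      finally show ?thesis using True t0 by simp
    qed simp
  qed
  also have "\<dots> = (\<integral>\<^sup>+t. Y * ennpowr (f t) p \<partial>lebesgue_on {0<..<1})"
    by (simp add: nn_integral_lebesgue_on)
  also have "\<dots> = Y * (\<integral>\<^sup>+t. ennpowr (f t) p \<partial>lebesgue_on {0<..<1})"
    by (rule nn_integral_cmult) (use f in measurable)
  finally have "ennpowr (ennpowr (Z * ennreal N) p) (1 / p)
     \<le> ennpowr (Y * (\<integral>\<^sup>+t. ennpowr (f t) p \<partial>lebesgue_on {0<..<1})) (1 / p)"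
    using p by (intro ennpowr_mono) auto
  then show ?thesis
    using p by (simp add: ennpowr_ennpowr ennpowr_mult Y_def Lq_norm_finite[OF q] p_def[symmetric])
qed

text \<open>The interval (t0, t1) has positive measure and therefore contains a point where f does
  not exceed its essential supremum. A separate t1 is allowed since g will be bounded below by N
  only close to t0.\<close>

lemma Lq_norm_lower_top:
  fixes f :: "real \<Rightarrow> ennreal" and g :: "real \<Rightarrow> real" and Z :: ennreal
  assumes t: "0 < t0" "t0 < t1" "t1 \<le> 1" and V: "V > 0"
    and le: "\<And>t. t0 < t \<Longrightarrow> t < 1 \<Longrightarrow> Z * ennreal (g t) \<le> ennreal V * f t"
    and N: "\<And>t. t0 < t \<Longrightarrow> t < t1 \<Longrightarrow> N \<le> g t"
  shows "Z * ennreal N \<le> ennreal V * Lq_norm top (lebesgue_on {0<..<1}) f"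
proof -
  have "AE t in lebesgue_on {0<..<1}. f t \<le> esssup (lebesgue_on {0<..<1}) f"
    by (rule esssup_AE)
  then have AE: "AE t in lebesgue. t \<in> {0<..<1} \<longrightarrow> f t \<le> esssup (lebesgue_on {0<..<1}) f"
    by (subst (asm) AE_restrict_space_iff) auto
  have "\<exists>t. t \<in> {t0<..<t1} \<and> f t \<le> esssup (lebesgue_on {0<..<1}) f"
  proof (rule ccontr)
    assume *: "\<not> ?thesis"
    have "AE t in lebesgue. t \<notin> {t0<..<t1}"
      using AE by eventually_elim (use * t in fastforce)
    then have "emeasure lebesgue {t0<..<t1} = 0"
      by (subst (asm) AE_iff_measurable[of "{t0<..<t1}"]) auto
    then show False using t by simp
  qed
  then obtain t where tt: "t0 < t" "t < t1" "f t \<le> esssup (lebesgue_on {0<..<1}) f" by auto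
  have "Z * ennreal N \<le> Z * ennreal (g t)" using N tt by (intro mult_left_mono ennreal_leI) auto
  also have "\<dots> \<le> ennreal V * f t" using le tt t by auto
  also have "\<dots> \<le> ennreal V * Lq_norm top (lebesgue_on {0<..<1}) f"
    using tt by (intro mult_left_mono) (auto simp: Lq_norm_def)
  finally show ?thesis .
qed

lemma Lq_norm_upper_finite:
  fixes f :: "real \<Rightarrow> ennreal" and g :: "real \<Rightarrow> real"
  assumes q: "1 \<le> q" "q < top" and N: "N \<ge> 0" and K: "K \<ge> 0"
    and g: "g \<in> borel_measurable borel" "\<And>t. g t \<ge> 0"
    and le: "\<And>t. 0 < t \<Longrightarrow> t < 1 \<Longrightarrow> f t \<le> ennreal K * ennreal (g t)"
    and int: "(\<integral>\<^sup>+t\<in>{0<..<1}. ennreal (g t powr enn2real q) \<partial>lborel) \<le> ennreal (N powr enn2real q)"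
  shows "Lq_norm q (lebesgue_on {0<..<1}) f \<le> ennreal (K * N)"
proof -
  define p where "p = enn2real q"
  have p: "p \<ge> 1" using recip_finite[OF q] by (simp add: p_def)
  note [measurable] = g(1)
  have "(\<integral>\<^sup>+t. ennpowr (f t) p \<partial>lebesgue_on {0<..<1}) = (\<integral>\<^sup>+t\<in>{0<..<1}. ennpowr (f t) p \<partial>lebesgue)"
    by (simp add: nn_integral_lebesgue_on)
  also have "\<dots> \<le> (\<integral>\<^sup>+t. ennreal (K powr p) * (ennreal (g t powr p) * indicator {0<..<1} t) \<partial>lebesgue)"
  proof (rule nn_integral_mono)
    fix t :: real
    show "ennpowr (f t) p * indicator {0<..<1} t \<le> ennreal (K powr p) * (ennreal (g t powr p) * indicator {0<..<1} t)"
    proof (cases "t \<in> {0<..<1}")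
      case True
      have "ennpowr (f t) p \<le> ennpowr (ennreal K * ennreal (g t)) p"
        using p True le by (intro ennpowr_mono) auto
      also have "\<dots> = ennreal (K powr p) * ennreal (g t powr p)"
        using p K g(2) by (simp add: ennpowr_mult ennpowr_ennreal)
      finally show ?thesis using True by simp
    qed simp
  qed
  also have "\<dots> = (\<integral>\<^sup>+t. ennreal (K powr p) * (ennreal (g t powr p) * indicator {0<..<1} t) \<partial>lborel)"
    by (rule nn_integral_completion)
  also have "\<dots> = ennreal (K powr p) * (\<integral>\<^sup>+t\<in>{0<..<1}. ennreal (g t powr p) \<partial>lborel)"
    by (subst nn_integral_cmult) auto
  also have "\<dots> \<le> ennreal (K powr p) * ennreal (N powr p)"
    using int by (simp add: p_def mult_left_mono)
  also have "\<dots> = ennpowr (ennreal (K * N)) p"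
    unfolding ennreal_mult[OF K N] using K N p by (simp add: ennpowr_mult ennpowr_ennreal)
  finally have "ennpowr (\<integral>\<^sup>+t. ennpowr (f t) p \<partial>lebesgue_on {0<..<1}) (1 / p) \<le> ennpowr (ennpowr (ennreal (K * N)) p) (1 / p)"
    using p by (intro ennpowr_mono) auto
  then show ?thesis
    using p by (simp add: ennpowr_ennpowr Lq_norm_finite[OF q] p_def[symmetric])
qed

lemma Lq_norm_upper_top:
  assumes "f \<in> borel_measurable (lebesgue_on {0<..<1})"
    and "\<And>t. 0 < t \<Longrightarrow> t < 1 \<Longrightarrow> f t \<le> A"
  shows "Lq_norm top (lebesgue_on {0<..<1::real}) f \<le> A"
  unfolding Lq_norm_def using assms by (auto intro!: esssup_I AE_I2)

text \<open>In classical terms this is the maximal function of the rearrangement of u at |\<Omega>|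
  s; the rearrangement hidden in \<open>rearr_avg\<close> is harmless by
  \<open>measure_mult_nn_integral_rearr_rearr\<close>.\<close>

definition maximal_rearr :: "(real^'n) set \<Rightarrow> (real^'n \<Rightarrow> real) \<Rightarrow> real \<Rightarrow> ennreal" where
  "maximal_rearr \<Omega> u = rearr_avg (lebesgue_on {0<..<1})
     (\<lambda>s. rearr (lebesgue_on \<Omega>) (\<lambda>x. ennreal \<bar>u x\<bar>) (measure lebesgue \<Omega> * s))"

lemma LZ_norm_eq:
  "LZ_norm q \<alpha> \<beta> \<Omega> u = Lq_norm q (lebesgue_on {0<..<1})
     (\<lambda>s. ennreal (s powr (1 - recip q) * ell s powr \<alpha> * ellell s powr \<beta>) * maximal_rearr \<Omega> u s)"
  by (simp add: LZ_norm_def LZ_norm01_def maximal_rearr_def)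

context
  fixes \<Omega> :: "(real^'n) set" and u :: "real^'n \<Rightarrow> real"
  assumes \<Omega>: "\<Omega> \<in> lmeasurable" and V: "measure lebesgue \<Omega> > 0"
    and u: "u \<in> borel_measurable (lebesgue_on \<Omega>)"
begin

text \<open>The right-hand side depends on u only through its distribution function and is monotone
  in it; the estimates below are all derived from this formula.\<close>

lemma maximal_rearr_eq:
  assumes "0 < t" "t \<le> 1"
  shows "ennreal (measure lebesgue \<Omega> * t) * maximal_rearr \<Omega> u t
    = (\<integral>\<^sup>+\<tau>. min (ennreal (measure lebesgue \<Omega> * t))
         (emeasure (lebesgue_on \<Omega>) {x \<in> space (lebesgue_on \<Omega>). ennreal \<tau> < ennreal \<bar>u x\<bar>}) * indicator {0..} \<tau> \<partial>lborel)"
proof -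
  have "ennreal t * (I / ennreal t) = I" for I
    using assms by (cases I) (auto simp: divide_ennreal ennreal_mult[symmetric] ennreal_top_divide ennreal_mult_top)
  then show ?thesis
    using measure_mult_nn_integral_rearr_rearr[of "\<lambda>x. ennreal \<bar>u x\<bar>", OF _ \<Omega> V, of t] u assms
    by (simp add: maximal_rearr_def rearr_avg_def ennreal_mult mult.assoc)
qed

lemma sigma_finite_lebesgue_on: "sigma_finite_measure (lebesgue_on \<Omega>)"
proof -
  interpret finite_measure "lebesgue_on \<Omega>" using \<Omega> by (rule finite_measure_lebesgue_on)
  show ?thesis by (rule sigma_finite_measure_axioms)
qed

text \<open>The Hardy-Littlewood inequality for an indicator function: the superlevel sets of |u|
  restricted to B have measure at most |B| and at most that of the superlevel sets of |u|.\<close>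

lemma nn_integral_le_maximal_rearr:
  assumes B: "B \<in> sets lebesgue" "B \<subseteq> \<Omega>" and t: "0 < t" "t \<le> 1"
    and m: "measure lebesgue B \<le> measure lebesgue \<Omega> * t"
  shows "(\<integral>\<^sup>+x\<in>B. ennreal \<bar>u x\<bar> \<partial>lebesgue) \<le> ennreal (measure lebesgue \<Omega> * t) * maximal_rearr \<Omega> u t"
proof -
  have \<Omega>s: "\<Omega> \<in> sets lebesgue" using \<Omega> by auto
  have Bl: "B \<in> lmeasurable" by (rule fmeasurableI2[OF \<Omega> B(2,1)])
  have Bon: "B \<in> sets (lebesgue_on \<Omega>)" using B \<Omega>s by (auto simp: sets_restrict_space_iff)
  have [measurable]: "u \<in> borel_measurable (lebesgue_on \<Omega>)" by (rule u)
  note [measurable] = Bon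
  have "(\<integral>\<^sup>+x\<in>B. ennreal \<bar>u x\<bar> \<partial>lebesgue) = (\<integral>\<^sup>+x. ennreal \<bar>u x\<bar> * indicator B x \<partial>lebesgue_on \<Omega>)"
    using B by (subst nn_integral_lebesgue_on[OF \<Omega>s]) (auto intro!: nn_integral_cong simp: indicator_def)
  also have "\<dots> = (\<integral>\<^sup>+\<tau>. emeasure (lebesgue_on \<Omega>) {x \<in> space (lebesgue_on \<Omega>). ennreal \<tau> < ennreal \<bar>u x\<bar> * indicator B x} * indicator {0..} \<tau> \<partial>lborel)"
    by (rule nn_integral_layer_cake[OF sigma_finite_lebesgue_on]) measurable
  also have "\<dots> \<le> (\<integral>\<^sup>+\<tau>. min (ennreal (measure lebesgue \<Omega> * t))
         (emeasure (lebesgue_on \<Omega>) {x \<in> space (lebesgue_on \<Omega>). ennreal \<tau> < ennreal \<bar>u x\<bar>}) * indicator {0..} \<tau> \<partial>lborel)"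
  proof (rule nn_integral_mono)
    fix \<tau> :: real
    have "emeasure (lebesgue_on \<Omega>) {x \<in> space (lebesgue_on \<Omega>). ennreal \<tau> < ennreal \<bar>u x\<bar> * indicator B x}
        \<le> emeasure (lebesgue_on \<Omega>) B"
      by (rule emeasure_mono[OF _ Bon]) (auto simp: indicator_def split: if_splits)
    also have "\<dots> = ennreal (measure lebesgue B)"
      using Bl B \<Omega>s by (simp add: emeasure_restrict_space emeasure_eq_measure2 del: emeasure_completion)
    also have "\<dots> \<le> ennreal (measure lebesgue \<Omega> * t)" using m by (rule ennreal_leI)
    finally have 1: "emeasure (lebesgue_on \<Omega>) {x \<in> space (lebesgue_on \<Omega>). ennreal \<tau> < ennreal \<bar>u x\<bar> * indicator B x}
        \<le> ennreal (measure lebesgue \<Omega> * t)" .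
    have 2: "emeasure (lebesgue_on \<Omega>) {x \<in> space (lebesgue_on \<Omega>). ennreal \<tau> < ennreal \<bar>u x\<bar> * indicator B x}
        \<le> emeasure (lebesgue_on \<Omega>) {x \<in> space (lebesgue_on \<Omega>). ennreal \<tau> < ennreal \<bar>u x\<bar>}"
    proof (rule emeasure_mono)
      show "{x \<in> space (lebesgue_on \<Omega>). ennreal \<tau> < ennreal \<bar>u x\<bar>} \<in> sets (lebesgue_on \<Omega>)" by measurable
    qed (auto simp: indicator_def split: if_splits)
    show "emeasure (lebesgue_on \<Omega>) {x \<in> space (lebesgue_on \<Omega>). ennreal \<tau> < ennreal \<bar>u x\<bar> * indicator B x} * indicator {0..} \<tau>
      \<le> min (ennreal (measure lebesgue \<Omega> * t)) (emeasure (lebesgue_on \<Omega>) {x \<in> space (lebesgue_on \<Omega>). ennreal \<tau> < ennreal \<bar>u x\<bar>}) * indicator {0..} \<tau>"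
      using 1 2 by (intro mult_right_mono) auto
  qed
  also have "\<dots> = ennreal (measure lebesgue \<Omega> * t) * maximal_rearr \<Omega> u t"
    by (rule maximal_rearr_eq[OF t, symmetric])
  finally show ?thesis .
qed

text \<open>As \<mu> is at most |\<Omega>| and t at most 1, the product t \<mu> is below both
  entries of the minimum. This controls the full L^1 norm, from which balls of radius bounded away
  from 0 are treated.\<close>

lemma nn_integral_le_maximal_rearr_whole:
  assumes t: "0 < t" "t \<le> 1"
  shows "ennreal t * (\<integral>\<^sup>+x\<in>\<Omega>. ennreal \<bar>u x\<bar> \<partial>lebesgue) \<le> ennreal (measure lebesgue \<Omega> * t) * maximal_rearr \<Omega> u t"
proof -
  have \<Omega>s: "\<Omega> \<in> sets lebesgue" using \<Omega> by auto
  define \<mu> where "\<mu> = (\<lambda>\<tau>. emeasure (lebesgue_on \<Omega>) {x \<in> space (lebesgue_on \<Omega>). ennreal \<tau> < ennreal \<bar>u x\<bar>})"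
  have [measurable]: "u \<in> borel_measurable (lebesgue_on \<Omega>)" by (rule u)
  have [measurable]: "\<mu> \<in> borel_measurable borel"
    unfolding \<mu>_def by (intro measurable_distribution sigma_finite_lebesgue_on) measurable
  have \<mu>_le: "\<mu> \<tau> \<le> ennreal (measure lebesgue \<Omega>)" for \<tau>
  proof -
    have "\<mu> \<tau> \<le> emeasure (lebesgue_on \<Omega>) (space (lebesgue_on \<Omega>))"
      unfolding \<mu>_def by (rule emeasure_space)
    also have "\<dots> = ennreal (measure lebesgue \<Omega>)"
      using \<Omega> by (simp add: emeasure_restrict_space fmeasurableD emeasure_eq_measure2 del: emeasure_completion)
    finally show ?thesis .
  qed
  have "(\<integral>\<^sup>+x\<in>\<Omega>. ennreal \<bar>u x\<bar> \<partial>lebesgue) = (\<integral>\<^sup>+x. ennreal \<bar>u x\<bar> \<partial>lebesgue_on \<Omega>)"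
    by (simp add: nn_integral_lebesgue_on[OF \<Omega>s])
  also have "\<dots> = (\<integral>\<^sup>+\<tau>. \<mu> \<tau> * indicator {0..} \<tau> \<partial>lborel)"
    unfolding \<mu>_def by (rule nn_integral_layer_cake[OF sigma_finite_lebesgue_on]) measurable
  finally have "ennreal t * (\<integral>\<^sup>+x\<in>\<Omega>. ennreal \<bar>u x\<bar> \<partial>lebesgue) = (\<integral>\<^sup>+\<tau>. ennreal t * (\<mu> \<tau> * indicator {0..} \<tau>) \<partial>lborel)"
    by (simp add: nn_integral_cmult)
  also have "\<dots> \<le> (\<integral>\<^sup>+\<tau>. min (ennreal (measure lebesgue \<Omega> * t)) (\<mu> \<tau>) * indicator {0..} \<tau> \<partial>lborel)"
  proof (rule nn_integral_mono)
    fix \<tau> :: real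
    obtain m where m: "\<mu> \<tau> = ennreal m" "m \<ge> 0" "m \<le> measure lebesgue \<Omega>"
      using \<mu>_le[of \<tau>] V by (cases "\<mu> \<tau>") (auto simp: top_unique)
    have "ennreal t * \<mu> \<tau> \<le> min (ennreal (measure lebesgue \<Omega> * t)) (\<mu> \<tau>)"
      using m t V by (auto simp: ennreal_mult[symmetric] mult.commute mult_left_le intro!: ennreal_leI mult_right_mono)
    then show "ennreal t * (\<mu> \<tau> * indicator {0..} \<tau>) \<le> min (ennreal (measure lebesgue \<Omega> * t)) (\<mu> \<tau>) * indicator {0..} \<tau>"
      by (auto simp: indicator_def)
  qed
  also have "\<dots> = ennreal (measure lebesgue \<Omega> * t) * maximal_rearr \<Omega> u t"
    unfolding \<mu>_def by (rule maximal_rearr_eq[OF t, symmetric])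
  finally show ?thesis .
qed

text \<open>The distribution function is at most |E| below the level K and 0 from there on, so the
  integral in \<open>maximal_rearr_eq\<close> runs over [0, K) only.\<close>

lemma maximal_rearr_le:
  assumes E: "E \<in> lmeasurable" and K: "K \<ge> 0" and t: "0 < t" "t \<le> 1"
    and le: "AE x in lebesgue. x \<in> \<Omega> \<longrightarrow> \<bar>u x\<bar> \<le> K * indicator E x"
  shows "maximal_rearr \<Omega> u t \<le> ennreal (K * min 1 (measure lebesgue E / (measure lebesgue \<Omega> * t)))"
proof -
  let ?V = "measure lebesgue \<Omega>" and ?e = "measure lebesgue E"
  have \<Omega>s: "\<Omega> \<in> sets lebesgue" using \<Omega> by auto
  have [measurable]: "u \<in> borel_measurable (lebesgue_on \<Omega>)" by (rule u)
  have AE': "AE x in lebesgue_on \<Omega>. \<bar>u x\<bar> \<le> K * indicator E x"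
    using le \<Omega>s by (subst AE_restrict_space_iff) auto
  have "ennreal (?V * t) * maximal_rearr \<Omega> u t
    = (\<integral>\<^sup>+\<tau>. min (ennreal (?V * t))
         (emeasure (lebesgue_on \<Omega>) {x \<in> space (lebesgue_on \<Omega>). ennreal \<tau> < ennreal \<bar>u x\<bar>}) * indicator {0..} \<tau> \<partial>lborel)"
    by (rule maximal_rearr_eq[OF t])
  also have "\<dots> \<le> (\<integral>\<^sup>+\<tau>. ennreal (min (?V * t) ?e) * indicator {0..<K} \<tau> \<partial>lborel)"
  proof (rule nn_integral_mono)
    fix \<tau> :: real
    let ?\<mu> = "emeasure (lebesgue_on \<Omega>) {x \<in> space (lebesgue_on \<Omega>). ennreal \<tau> < ennreal \<bar>u x\<bar>}"
    consider "\<tau> < 0" | "K \<le> \<tau>" | "0 \<le> \<tau>" "\<tau> < K" by linarith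
    then show "min (ennreal (?V * t)) ?\<mu> * indicator {0..} \<tau> \<le> ennreal (min (?V * t) ?e) * indicator {0..<K} \<tau>"
    proof cases
      case 2
      have "?\<mu> = 0"
      proof (rule AE_iff_measurable[THEN iffD1, rotated 2])
        show "AE x in lebesgue_on \<Omega>. \<not> (ennreal \<tau> < ennreal \<bar>u x\<bar>)"
          using AE'
        proof eventually_elim
          case (elim x)
          have "K * indicator E x \<le> K" using K by (simp add: indicator_def)
          then have "\<bar>u x\<bar> \<le> \<tau>" using elim 2 by linarith
          then show ?case by (simp add: ennreal_leI leD)
        qed
        show "{x \<in> space (lebesgue_on \<Omega>). ennreal \<tau> < ennreal \<bar>u x\<bar>} \<in> sets (lebesgue_on \<Omega>)" by measurable
      qed auto
      then show ?thesis by simp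
    next
      case 3
      have "?\<mu> \<le> emeasure (lebesgue_on \<Omega>) (E \<inter> \<Omega>)"
      proof (rule emeasure_mono_AE)
        show "AE x in lebesgue_on \<Omega>. x \<in> {x \<in> space (lebesgue_on \<Omega>). ennreal \<tau> < ennreal \<bar>u x\<bar>} \<longrightarrow> x \<in> E \<inter> \<Omega>"
          using AE'
        proof eventually_elim
          case (elim x)
          then show ?case using 3 by (cases "x \<in> E") (auto simp: ennreal_less_iff)
        qed
        show "E \<inter> \<Omega> \<in> sets (lebesgue_on \<Omega>)" using E \<Omega>s by (auto simp: sets_restrict_space)
      qed
      also have "\<dots> = emeasure lebesgue (E \<inter> \<Omega>)"
        using E \<Omega>s by (subst emeasure_restrict_space) (auto simp: sets_restrict_space)
      also have "\<dots> \<le> emeasure lebesgue E" using E by (intro emeasure_mono) auto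
      also have "\<dots> = ennreal ?e" using E by (simp add: emeasure_eq_measure2 del: emeasure_completion)
      finally have "?\<mu> \<le> ennreal ?e" .
      then have "min (ennreal (?V * t)) ?\<mu> \<le> min (ennreal (?V * t)) (ennreal ?e)"
        by (rule min.mono[OF order_refl])
      also have "\<dots> = ennreal (min (?V * t) ?e)"
        using t by (auto simp: min_def)
      finally show ?thesis using 3 by simp
    qed simp
  qed
  also have "\<dots> = ennreal (min (?V * t) ?e * K)"
    using K V t by (subst nn_integral_cmult_indicator) (auto simp: ennreal_mult[symmetric])
  also have "\<dots> = ennreal (?V * t) * ennreal (K * min 1 (?e / (?V * t)))"
    using K V t by (subst ennreal_mult[symmetric]) (auto simp: min_def field_simps)
  finally have "ennreal (?V * t) * maximal_rearr \<Omega> u t \<le> ennreal (?V * t) * ennreal (K * min 1 (?e / (?V * t)))" .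
  then show ?thesis
    using V t by (simp add: ennreal_mult_le_mult_iff)
qed

lemma maximal_rearr_measurable:
  "maximal_rearr \<Omega> u \<in> borel_measurable (lebesgue_on {0<..<1})"
proof -
  define \<mu> where "\<mu> = (\<lambda>\<tau>. emeasure (lebesgue_on \<Omega>) {x \<in> space (lebesgue_on \<Omega>). ennreal \<tau> < ennreal \<bar>u x\<bar>})"
  have [measurable]: "u \<in> borel_measurable (lebesgue_on \<Omega>)" by (rule u)
  have [measurable]: "\<mu> \<in> borel_measurable borel"
    unfolding \<mu>_def by (intro measurable_distribution sigma_finite_lebesgue_on) measurable
  define J where "J = (\<lambda>t. (\<integral>\<^sup>+\<tau>. min (ennreal (measure lebesgue \<Omega> * t)) (\<mu> \<tau>) * indicator {0..} \<tau> \<partial>lborel)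
      / ennreal (measure lebesgue \<Omega> * t))"
  have J: "J \<in> borel_measurable borel"
    unfolding J_def by measurable
  have "maximal_rearr \<Omega> u t = J t" if "t \<in> {0<..<1}" for t
  proof -
    have "x = ennreal (measure lebesgue \<Omega> * t) * x / ennreal (measure lebesgue \<Omega> * t)" for x
      using V that by (cases x) (auto simp: divide_ennreal ennreal_mult[symmetric] ennreal_top_divide ennreal_mult_top)
    from this[of "maximal_rearr \<Omega> u t"] show ?thesis
      using that by (subst (asm) maximal_rearr_eq) (auto simp: J_def \<mu>_def)
  qed
  then show ?thesis
    using J by (subst measurable_cong[where g = J])
      (auto intro!: measurable_restrict_space1 measurable_completion)
qed

end

section \<open>Logarithmic weights\<close>

definition log_weight :: "real \<Rightarrow> real \<Rightarrow> real \<Rightarrow> real" where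
  "log_weight a b y = y powr a * (1 + ln y) powr b"

text \<open>A primitive of \<open>log_weight a b\<close> up to bounded factors.\<close>

definition log_primitive :: "real \<Rightarrow> real \<Rightarrow> real \<Rightarrow> real" where
  "log_primitive a b y =
     (if a > -1 then y powr (a + 1) * (1 + ln y) powr b
      else if b > -1 then (1 + ln y) powr (b + 1)
      else 1 + ln (1 + ln y))"

text \<open>The quotient of the derivative of \<open>log_primitive\<close> by
  \<open>log_weight\<close>. Only its positive limit at infinity is used to compare the two.\<close>

definition log_factor :: "real \<Rightarrow> real \<Rightarrow> real \<Rightarrow> real" where
  "log_factor a b y = (if a > -1 then a + 1 + b / (1 + ln y) else if b > -1 then b + 1 else 1)"

lemma log_weight_pos:
  assumes "y \<ge> 1" shows "log_weight a b y > 0"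
proof -
  have "1 + ln y > 0" using ln_ge_zero[OF assms] by linarith
  then show ?thesis using assms by (simp add: log_weight_def)
qed

lemma log_primitive_pos:
  assumes "y \<ge> 1" shows "log_primitive a b y > 0"
proof -
  have 1: "1 + ln y \<ge> 1" using ln_ge_zero[OF assms] by linarith
  have "1 + ln (1 + ln y) > 0" using ln_ge_zero[OF 1] by linarith
  moreover have "1 + ln y > 0" using 1 by linarith
  ultimately show ?thesis using assms by (auto simp: log_primitive_def intro!: mult_pos_pos)
qed

lemma log_weight_measurable [measurable]: "log_weight a b \<in> borel_measurable borel"
  unfolding log_weight_def[abs_def] by measurable

lemma log_primitive_measurable [measurable]: "log_primitive a b \<in> borel_measurable borel"
  unfolding log_primitive_def[abs_def] by measurable

lemma log_factor_measurable [measurable]: "log_factor a b \<in> borel_measurable borel"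
  unfolding log_factor_def[abs_def] by measurable

lemma log_primitive_has_derivative:
  assumes ab: "a > -1 \<or> a = -1 \<and> b \<ge> -1" and y: "y \<ge> 1"
  shows "(log_primitive a b has_real_derivative log_factor a b y * log_weight a b y) (at y)"
proof -
  have ln: "1 + ln y > 0" using ln_ge_zero[OF y] by linarith
  have L: "((\<lambda>y. 1 + ln y) has_real_derivative 1 / y) (at y)"
    using y by (auto intro!: derivative_eq_intros)
  have P: "((\<lambda>y. (1 + ln y) powr d) has_real_derivative d * (1 + ln y) powr (d - 1) * (1 / y)) (at y)" for d
    using DERIV_fun_powr[OF L ln, of d] by simp
  consider "a > -1" | "a = -1" "b > -1" | "a = -1" "b = -1" using ab by linarith
  then show ?thesis
  proof cases
    case 1
    have A: "((\<lambda>y. y powr (a + 1)) has_real_derivative (a + 1) * y powr (a + 1 - 1) * 1) (at y)"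
      using DERIV_fun_powr[OF DERIV_ident, of y "a + 1"] y by simp
    have e: "y powr (a + 1) = y * y powr a" "(1 + ln y) powr (b - 1) = (1 + ln y) powr b / (1 + ln y)"
      using y ln by (auto simp: powr_add powr_diff)
    have "((\<lambda>y. y powr (a + 1) * (1 + ln y) powr b) has_real_derivative
       (a + 1 + b / (1 + ln y)) * (y powr a * (1 + ln y) powr b)) (at y)"
    proof (rule DERIV_cong[OF DERIV_mult[OF A P]])
      have "(a + 1) * R * Q + b * (Q / L) * (1 / y) * (y * R) = (a + 1 + b / L) * (R * Q)"
        if "L > 0" for R Q L :: real
        using y that by (simp add: field_simps)
      from this[OF ln, of "y powr a" "(1 + ln y) powr b"]
      show "(a + 1) * y powr (a + 1 - 1) * 1 * (1 + ln y) powr b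
          + b * (1 + ln y) powr (b - 1) * (1 / y) * y powr (a + 1)
        = (a + 1 + b / (1 + ln y)) * (y powr a * (1 + ln y) powr b)"
        by (simp only: e mult_1_right add_diff_cancel_right')
    qed
    then show ?thesis using 1 by (simp add: log_primitive_def[abs_def] log_factor_def log_weight_def)
  next
    case 2
    have "((\<lambda>y. (1 + ln y) powr (b + 1)) has_real_derivative (b + 1) * (y powr (-1) * (1 + ln y) powr b)) (at y)"
      by (rule DERIV_cong[OF P]) (use y in \<open>simp add: powr_minus_divide\<close>)
    then show ?thesis using 2 by (simp add: log_primitive_def[abs_def] log_factor_def log_weight_def)
  next
    case 3
    have "((\<lambda>y. 1 + ln (1 + ln y)) has_real_derivative (y powr (-1) * (1 + ln y) powr (-1))) (at y)"
      by (rule DERIV_cong[OF DERIV_add[OF DERIV_const DERIV_chain2[OF DERIV_ln[OF ln] L]]])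
         (use y ln in \<open>simp add: powr_minus_divide field_simps\<close>)
    then show ?thesis using 3 by (simp add: log_primitive_def[abs_def] log_factor_def log_weight_def)
  qed
qed

lemma log_weight_le_primitive:
  assumes ab: "a > -1 \<or> a = -1 \<and> b \<ge> -1" and y: "y \<ge> 1"
  shows "y * log_weight a b y \<le> log_primitive a b y"
proof -
  have ln: "1 + ln y \<ge> 1" using ln_ge_zero[OF y] by linarith
  consider "a > -1" | "a = -1" "b > -1" | "a = -1" "b = -1" using ab by linarith
  then show ?thesis
  proof cases
    case 1
    then show ?thesis using y by (simp add: log_weight_def log_primitive_def powr_add mult_ac)
  next
    case 2
    have "(1 + ln y) powr b \<le> (1 + ln y) powr (b + 1)" using ln by (intro powr_mono) auto
    then show ?thesis using 2 y by (simp add: log_weight_def log_primitive_def powr_minus_divide)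
  next
    case 3
    have "1 / (1 + ln y) \<le> 1" using ln by (simp add: field_simps)
    moreover have "ln (1 + ln y) \<ge> 0" using ln by simp
    moreover have "y * log_weight a b y = 1 / (1 + ln y)" "log_primitive a b y = 1 + ln (1 + ln y)"
      using 3 y ln by (simp_all add: log_weight_def log_primitive_def powr_minus_divide)
    ultimately show ?thesis by linarith
  qed
qed

lemma log_primitive_at_top:
  assumes ab: "a > -1 \<or> a = -1 \<and> b \<ge> -1"
  shows "filterlim (log_primitive a b) at_top at_top"
proof -
  consider "a > -1" | "a = -1" "b > -1" | "a = -1" "b = -1" using ab by linarith
  then show ?thesis
  proof cases
    case 1
    then have "a + 1 > 0" by simp
    then have "filterlim (\<lambda>y. y powr (a + 1) * (1 + ln y) powr b) at_top at_top" by real_asymp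
    then show ?thesis using 1 by (simp add: log_primitive_def[abs_def])
  next
    case 2
    then have "b + 1 > 0" by simp
    then have "filterlim (\<lambda>y. (1 + ln y) powr (b + 1)) at_top at_top" by real_asymp
    then show ?thesis using 2 by (simp add: log_primitive_def[abs_def])
  next
    case 3
    have "filterlim (\<lambda>y::real. 1 + ln y) at_top at_top"
      by (intro filterlim_tendsto_add_at_top[OF tendsto_const] ln_at_top)
    then have "filterlim (\<lambda>y::real. ln (1 + ln y)) at_top at_top"
      by (rule filterlim_compose[OF ln_at_top])
    then have "filterlim (\<lambda>y::real. 1 + ln (1 + ln y)) at_top at_top"
      by (intro filterlim_tendsto_add_at_top[OF tendsto_const])
    then show ?thesis using 3 by (simp add: log_primitive_def[abs_def])
  qed
qed

lemma log_factor_tendsto: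
  assumes ab: "a > -1 \<or> a = -1 \<and> b \<ge> -1"
  obtains k where "k > 0" "(log_factor a b \<longlongrightarrow> k) at_top"
proof -
  consider "a > -1" | "a = -1" "b > -1" | "a = -1" "b = -1" using ab by linarith
  then show thesis
  proof cases
    case 1
    have "((\<lambda>y. a + 1 + b / (1 + ln y)) \<longlongrightarrow> a + 1) at_top" by real_asymp
    then show thesis using 1 that[of "a + 1"] by (simp add: log_factor_def[abs_def])
  qed (use that[of "b + 1"] that[of 1] in \<open>auto simp: log_factor_def[abs_def]\<close>)
qed

text \<open>With k the limit of \<open>log_factor\<close>, the factor eventually lies between k/2
  and 2k, and c is small enough for both directions. For y >= 4k the factor is also at most y/2, and
  y times the weight is at most the primitive. The resulting 1/2 leaves room for the negative term
  in the derivative of \<open>t powr p * log_primitive a b (ell t)\<close>.\<close>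

lemma log_primitive_bounds:
  assumes ab: "a > -1 \<or> a = -1 \<and> b \<ge> -1"
  obtains Y c where "Y \<ge> 1" "c > 0"
    "\<And>y. y \<ge> Y \<Longrightarrow> c * log_weight a b y \<le> log_factor a b y * log_weight a b y"
    "\<And>y. y \<ge> Y \<Longrightarrow> c * (log_factor a b y * log_weight a b y) \<le> log_weight a b y"
    "\<And>y. y \<ge> Y \<Longrightarrow> log_factor a b y * log_weight a b y \<le> log_primitive a b y / 2"
proof -
  obtain k where k: "k > 0" "(log_factor a b \<longlongrightarrow> k) at_top" using log_factor_tendsto[OF ab] .
  have "eventually (\<lambda>y. log_factor a b y > k / 2 \<and> log_factor a b y < 2 * k) at_top"
    using k(1) by (intro eventually_conj order_tendstoD[OF k(2)]) auto
  then obtain Y1 where Y1: "\<And>y. y \<ge> Y1 \<Longrightarrow> log_factor a b y > k / 2 \<and> log_factor a b y < 2 * k"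
    by (auto simp: eventually_at_top_linorder)
  define Y where "Y = max (max 1 Y1) (4 * k)"
  define c where "c = min (k / 2) (1 / (2 * k))"
  have c: "c > 0" "c \<le> k / 2" "c * (2 * k) \<le> 1"
    using k(1) by (auto simp: c_def field_simps min_def)
  show thesis
  proof (rule that[of Y c])
    show "Y \<ge> 1" "c > 0" using c by (auto simp: Y_def)
    fix y assume y: "y \<ge> Y"
    then have y1: "y \<ge> 1" "y \<ge> 4 * k" "log_factor a b y > k / 2" "log_factor a b y < 2 * k"
      using Y1[of y] by (auto simp: Y_def)
    have w: "log_weight a b y > 0" by (rule log_weight_pos[OF y1(1)])
    show "c * log_weight a b y \<le> log_factor a b y * log_weight a b y"
      using w c y1 by (intro mult_right_mono) auto
    have "c * log_factor a b y \<le> c * (2 * k)" using c y1 by (intro mult_left_mono) auto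
    then have "c * log_factor a b y \<le> 1" using c by linarith
    then show "c * (log_factor a b y * log_weight a b y) \<le> log_weight a b y"
      using mult_right_mono[of "c * log_factor a b y" 1 "log_weight a b y"] w by (simp add: mult_ac)
    have "log_factor a b y * log_weight a b y \<le> (y / 2) * log_weight a b y"
      using w y1 by (intro mult_right_mono) auto
    also have "\<dots> \<le> log_primitive a b y / 2"
      using log_weight_le_primitive[OF ab y1(1)] by simp
    finally show "log_factor a b y * log_weight a b y \<le> log_primitive a b y / 2" .
  qed
qed

section \<open>Integrals of logarithmic weights in the variable \<open>ell t\<close>\<close>

lemma ell_eq: "0 < t \<Longrightarrow> t \<le> 1 \<Longrightarrow> ell t = 1 - ln t"
  by (simp add: ell_def)

lemma ell_ge_1: "ell t \<ge> 1"
  by (simp add: ell_def)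

lemma ell_measurable [measurable]: "ell \<in> borel_measurable borel"
  unfolding ell_def[abs_def] by measurable

lemma ell_antimono: "0 < s \<Longrightarrow> s \<le> t \<Longrightarrow> t \<le> 1 \<Longrightarrow> ell t \<le> ell s"
  by (simp add: ell_eq)

lemma eventually_ell_ge:
  obtains s where "0 < s" "s < 1" "\<And>t. 0 < t \<Longrightarrow> t \<le> s \<Longrightarrow> ell t \<ge> Y"
proof
  let ?s = "exp (- \<bar>Y\<bar> - 1)"
  show "0 < ?s" "?s < 1" by auto
  fix t :: real assume "0 < t" "t \<le> ?s"
  moreover from this have "t \<le> 1" by (meson \<open>?s < 1\<close> less_imp_le order_trans)
  moreover have "ln t \<le> ln ?s" using calculation by (subst ln_le_cancel_iff) auto
  ultimately show "ell t \<ge> Y" by (simp add: ell_eq)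
qed

lemma log_primitive_ell_has_derivative:
  assumes ab: "a > -1 \<or> a = -1 \<and> b \<ge> -1" and t: "0 < t" "t < 1"
  shows "((\<lambda>t. log_primitive a b (1 - ln t)) has_real_derivative
    - (log_factor a b (ell t) * log_weight a b (ell t) / t)) (at t)"
proof -
  have "1 - ln t \<ge> 1" using t by simp
  from log_primitive_has_derivative[OF ab this]
  have "((\<lambda>t. log_primitive a b (1 - ln t)) has_real_derivative
     (log_factor a b (1 - ln t) * log_weight a b (1 - ln t)) * (- (1 / t))) (at t)"
    by (rule DERIV_chain2) (use t in \<open>auto intro!: derivative_eq_intros\<close>)
  then show ?thesis using t by (simp add: ell_eq)
qed

lemma eventually_log_primitive_ell_ge:
  assumes ab: "a > -1 \<or> a = -1 \<and> b \<ge> -1"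
  obtains s where "0 < s" "s < 1" "\<And>t. 0 < t \<Longrightarrow> t \<le> s \<Longrightarrow> log_primitive a b (ell t) \<ge> M"
proof -
  obtain Y where Y: "\<And>y. y \<ge> Y \<Longrightarrow> log_primitive a b y \<ge> M"
    using log_primitive_at_top[OF ab] by (auto simp: filterlim_at_top eventually_at_top_linorder)
  obtain s where "0 < s" "s < 1" "\<And>t. 0 < t \<Longrightarrow> t \<le> s \<Longrightarrow> ell t \<ge> Y"
    using eventually_ell_ge by blast
  then show thesis using that Y by blast
qed

text \<open>On [s, t0] the weight dominates c times the derivative of minus the primitive, so the
  integral is at least c times the difference of the primitive at s and at t0. As the primitive
  tends to infinity, for small s the value at t0 is at most half of that at s.\<close>

lemma nn_integral_log_weight_lower:
  assumes ab: "a > -1 \<or> a = -1 \<and> b \<ge> -1"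
  obtains s1 c where "0 < s1" "s1 < 1" "c > 0"
    "\<And>s. 0 < s \<Longrightarrow> s \<le> s1 \<Longrightarrow> ennreal (c * log_primitive a b (ell s))
      \<le> (\<integral>\<^sup>+t\<in>{s<..<1}. ennreal (log_weight a b (ell t) / t) \<partial>lborel)"
proof -
  obtain Y c where Y: "Y \<ge> 1" "c > 0"
    "\<And>y. y \<ge> Y \<Longrightarrow> c * log_weight a b y \<le> log_factor a b y * log_weight a b y"
    "\<And>y. y \<ge> Y \<Longrightarrow> c * (log_factor a b y * log_weight a b y) \<le> log_weight a b y"
    "\<And>y. y \<ge> Y \<Longrightarrow> log_factor a b y * log_weight a b y \<le> log_primitive a b y / 2"
    using log_primitive_bounds[OF ab] by blast
  obtain t0 where t0: "0 < t0" "t0 < 1" "\<And>t. 0 < t \<Longrightarrow> t \<le> t0 \<Longrightarrow> ell t \<ge> Y"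
    using eventually_ell_ge by blast
  obtain s0 where s0: "0 < s0" "s0 < 1" "\<And>t. 0 < t \<Longrightarrow> t \<le> s0 \<Longrightarrow> log_primitive a b (ell t) \<ge> 2 * log_primitive a b (ell t0)"
    using eventually_log_primitive_ell_ge[OF ab] by blast
  let ?f = "\<lambda>t. log_factor a b (ell t) * log_weight a b (ell t) / t"
  show thesis
  proof (rule that[of "min s0 (t0 / 2)" "c / 2"])
    fix s assume s: "0 < s" "s \<le> min s0 (t0 / 2)"
    have fpos: "?f t \<ge> 0" if "s \<le> t" "t \<le> t0" for t
    proof -
      have "ell t \<ge> Y" using t0(3)[of t] s that by auto
      then have "0 \<le> log_factor a b (ell t) * log_weight a b (ell t)"
        using Y(3)[of "ell t"] log_weight_pos[OF ell_ge_1, of a b t] Y(2)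
        by (meson less_imp_le mult_nonneg_nonneg order_trans)
      then show ?thesis using s that by simp
    qed
    have FTC: "(\<integral>\<^sup>+t. ennreal (?f t) * indicator {s..t0} t \<partial>lborel)
        = ennreal (- log_primitive a b (1 - ln t0) - - log_primitive a b (1 - ln s))"
    proof (rule nn_integral_FTC_Icc[where F = "\<lambda>t. - log_primitive a b (1 - ln t)"])
      fix t assume "t \<in> {s..t0}"
        then have t: "s \<le> t" "t \<le> t0" by auto
      show "((\<lambda>t. - log_primitive a b (1 - ln t)) has_real_derivative ?f t) (at t)"
        using DERIV_minus[OF log_primitive_ell_has_derivative[OF ab, of t]] s t t0 by simp
    qed (use s fpos in auto)
    have e: "1 - ln t0 = ell t0" "1 - ln s = ell s" using t0 s by (auto simp: ell_eq)
    have "c / 2 * log_primitive a b (ell s) \<le> c * (log_primitive a b (ell s) - log_primitive a b (ell t0))"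
      using s0(3)[of s] s Y(2) by (simp add: field_simps)
    then have "ennreal (c / 2 * log_primitive a b (ell s)) \<le> ennreal (c * (log_primitive a b (ell s) - log_primitive a b (ell t0)))"
      by (rule ennreal_leI)
    also have "\<dots> = ennreal c * (\<integral>\<^sup>+t. ennreal (?f t) * indicator {s..t0} t \<partial>lborel)"
      using Y(2) by (simp add: FTC e ennreal_mult')
    also have "\<dots> = (\<integral>\<^sup>+t. ennreal c * (ennreal (?f t) * indicator {s..t0} t) \<partial>lborel)"
      by (rule nn_integral_cmult[symmetric]) measurable
    also have "\<dots> \<le> (\<integral>\<^sup>+t. ennreal (log_weight a b (ell t) / t) * indicator {s<..<1} t \<partial>lborel)"
    proof (rule nn_integral_mono_AE)
      have "AE t in lborel. t \<noteq> s" by (rule AE_lborel_singleton)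
      then show "AE t in lborel. ennreal c * (ennreal (?f t) * indicator {s..t0} t)
         \<le> ennreal (log_weight a b (ell t) / t) * indicator {s<..<1} t"
      proof eventually_elim
        case (elim t)
        show ?case
        proof (cases "t \<in> {s..t0}")
          case True
          then have "ell t \<ge> Y" using t0(3)[of t] s by auto
          from Y(4)[OF this] have "c * ?f t \<le> log_weight a b (ell t) / t"
            using s True by (simp add: divide_right_mono)
          then show ?thesis using True elim t0 Y(2) fpos[of t]
            by (simp add: ennreal_mult[symmetric] ennreal_leI)
        qed simp
      qed
    qed
    finally show "ennreal (c / 2 * log_primitive a b (ell s))
      \<le> (\<integral>\<^sup>+t\<in>{s<..<1}. ennreal (log_weight a b (ell t) / t) \<partial>lborel)" .
  qed (use s0 t0 Y in auto)
qed

lemma bounded_continuous_ell: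
  assumes "0 < t0" "t0 < 1"
  obtains M where "M > 0" "\<And>t. t0 \<le> t \<Longrightarrow> t < 1 \<Longrightarrow> log_weight a b (ell t) \<le> M"
proof -
  have "continuous_on {t0..1} (\<lambda>t. log_weight a b (1 - ln t))"
  proof -
    have "1 - ln t > 0 \<and> 1 + ln (1 - ln t) > 0" if "t \<in> {t0..1}" for t
    proof -
      have "1 - ln t \<ge> 1" using that assms by simp
      then show ?thesis using ln_ge_zero[of "1 - ln t"] by linarith
    qed
    then show ?thesis unfolding log_weight_def
      using assms by (intro continuous_intros) (auto simp: less_le)
  qed
  then have "compact ((\<lambda>t. log_weight a b (1 - ln t)) ` {t0..1})"
    by (intro compact_continuous_image) auto
  then obtain M where M: "\<And>t. t \<in> {t0..1} \<Longrightarrow> \<bar>log_weight a b (1 - ln t)\<bar> \<le> M"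
    by (metis (mono_tags, lifting) bounded_iff compact_imp_bounded imageI real_norm_def)
  show thesis
  proof (rule that[of "max M 1"])
    show "log_weight a b (ell t) \<le> max M 1" if "t0 \<le> t" "t < 1" for t
      using M[of t] that assms by (simp add: ell_eq)
  qed simp
qed

text \<open>The fundamental theorem is available on closed intervals away from 0 only, since ln is
  singular there; monotone convergence fills the gap.\<close>

lemma nn_integral_le_if_truncations_le:
  fixes f :: "real \<Rightarrow> real"
  assumes [measurable]: "f \<in> borel_measurable borel"
    and le: "\<And>\<epsilon>. 0 < \<epsilon> \<Longrightarrow> \<epsilon> < s \<Longrightarrow> (\<integral>\<^sup>+t. ennreal (f t) * indicator {\<epsilon>..s} t \<partial>lborel) \<le> A" and "0 < s"
  shows "(\<integral>\<^sup>+t. ennreal (f t) * indicator {0<..s} t \<partial>lborel) \<le> A"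
proof -
  \<comment> \<open>The double successor keeps \<open>?e k\<close> strictly below s also for k =
    0.\<close>
  let ?e = "\<lambda>k. s / real (Suc (Suc k))"
  have "(\<integral>\<^sup>+t. ennreal (f t) * indicator {0<..s} t \<partial>lborel)
     = (\<integral>\<^sup>+t. (SUP k. ennreal (f t) * indicator {?e k..s} t) \<partial>lborel)"
  proof (rule nn_integral_cong)
    fix t :: real
    show "ennreal (f t) * indicator {0<..s} t = (SUP k. ennreal (f t) * indicator {?e k..s} t)"
    proof (cases "t \<in> {0<..s}")
      case True
      have "(\<lambda>k. s / real (Suc k)) \<longlonglongrightarrow> 0" by real_asymp
      then have "eventually (\<lambda>k. s / real (Suc k) < t) sequentially"
        using True by (intro order_tendstoD) auto
      then obtain k where "s / real (Suc k) < t" by (auto simp: eventually_sequentially)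
      moreover have "?e k \<le> s / real (Suc k)" using \<open>0 < s\<close> by (intro divide_left_mono) auto
      ultimately have "?e k \<le> t" by linarith
      then have "ennreal (f t) = ennreal (f t) * indicator {?e k..s} t" using True by simp
      also have "\<dots> \<le> (SUP k. ennreal (f t) * indicator {?e k..s} t)" by (rule SUP_upper) simp
      finally have "ennreal (f t) \<le> (SUP k. ennreal (f t) * indicator {?e k..s} t)" .
      moreover have "(SUP k. ennreal (f t) * indicator {?e k..s} t) \<le> ennreal (f t)"
        by (rule SUP_least) (simp add: indicator_def)
      ultimately show ?thesis using True by (simp add: antisym)
    next
      case False
      have "indicator {?e k..s} t = (0::ennreal)" for k
      proof -
        have "?e k > 0" using \<open>0 < s\<close> by simp
        then show ?thesis using False by (auto simp: indicator_def)
      qed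
      then show ?thesis using False by simp
    qed
  qed
  also have "\<dots> = (SUP k. (\<integral>\<^sup>+t. ennreal (f t) * indicator {?e k..s} t \<partial>lborel))"
  proof (rule nn_integral_monotone_convergence_SUP)
    show "incseq (\<lambda>k t. ennreal (f t) * indicator {?e k..s} t)"
    proof (rule incseq_SucI, rule le_funI)
      fix k t
      have "?e (Suc k) \<le> ?e k" using \<open>0 < s\<close> by (intro divide_left_mono) auto
      then show "ennreal (f t) * indicator {?e k..s} t \<le> ennreal (f t) * indicator {?e (Suc k)..s} t"
        by (auto simp: indicator_def)
    qed
  qed measurable
  also have "\<dots> \<le> A"
  proof (intro SUP_least le)
    fix k
    show "0 < ?e k" using \<open>0 < s\<close> by simp
    have "s * 1 < s * real (Suc (Suc k))" using \<open>0 < s\<close> by (intro mult_strict_left_mono) auto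
    then show "?e k < s" by (simp add: divide_less_eq)
  qed
  finally show ?thesis .
qed

text \<open>The weight near \<open>0\<close> is controlled by the derivative of \<open>t powr p * log_primitive a b (ell t)\<close>,
  the weight on \<open>(s, 1)\<close> by the derivative of \<open>- log_primitive a b (ell t)\<close>.\<close>

lemma nn_integral_log_weight_upper:
  assumes ab: "a > -1 \<or> a = -1 \<and> b \<ge> -1" and p: "p \<ge> 1"
  obtains s1 C where "0 < s1" "s1 < 1" "C > 0"
    "\<And>s. 0 < s \<Longrightarrow> s \<le> s1 \<Longrightarrow>
      (\<integral>\<^sup>+t\<in>{0<..<1}. ennreal (min t s powr p * (log_weight a b (ell t) / t)) \<partial>lborel)
       \<le> ennreal (C * (s powr p * log_primitive a b (ell s)))"
proof -
  obtain Y c where Y: "Y \<ge> 1" "c > 0"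
    "\<And>y. y \<ge> Y \<Longrightarrow> c * log_weight a b y \<le> log_factor a b y * log_weight a b y"
    "\<And>y. y \<ge> Y \<Longrightarrow> c * (log_factor a b y * log_weight a b y) \<le> log_weight a b y"
    "\<And>y. y \<ge> Y \<Longrightarrow> log_factor a b y * log_weight a b y \<le> log_primitive a b y / 2"
    using log_primitive_bounds[OF ab] by blast
  obtain t0 where t0: "0 < t0" "t0 < 1" "\<And>t. 0 < t \<Longrightarrow> t \<le> t0 \<Longrightarrow> ell t \<ge> Y"
    using eventually_ell_ge by blast
  obtain s0 where s0: "0 < s0" "s0 < 1" "\<And>t. 0 < t \<Longrightarrow> t \<le> s0 \<Longrightarrow> log_primitive a b (ell t) \<ge> 1"
    using eventually_log_primitive_ell_ge[OF ab] by blast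
  obtain M where M: "M > 0" "\<And>t. t0 \<le> t \<Longrightarrow> t < 1 \<Longrightarrow> log_weight a b (ell t) \<le> M"
    using bounded_continuous_ell[OF t0(1,2)] by blast
  let ?k = "\<lambda>t. log_factor a b (ell t) * log_weight a b (ell t)"
  have kpos: "?k t \<ge> 0" if "0 < t" "t \<le> t0" for t
    using Y(3)[OF t0(3)[OF that]] log_weight_pos[OF ell_ge_1, of a b t] Y(2)
    by (meson less_imp_le mult_nonneg_nonneg order_trans)
  show thesis
  \<comment> \<open>One summand for each of the ranges (0, s], [s, t0] and (t0, 1): the first two
    come from the fundamental theorem, the third from the bound M of the weight.\<close>
  proof (rule that[of "min s0 (t0 / 2)" "1 / c + 1 / c + M / t0"])
    fix s assume s: "0 < s" "s \<le> min s0 (t0 / 2)"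
    let ?H = "log_primitive a b (ell s)"
    let ?w = "\<lambda>t. log_weight a b (ell t) / t"
    have H1: "?H \<ge> 1" using s0(3)[of s] s by auto
    have e: "1 - ln t0 = ell t0" "1 - ln s = ell s" using t0 s by (auto simp: ell_eq)
    have I1: "(\<integral>\<^sup>+t. ennreal (t powr p * ?w t) * indicator {0<..s} t \<partial>lborel) \<le> ennreal (1 / c * (s powr p * ?H))"
    proof (rule nn_integral_le_if_truncations_le)
      fix \<epsilon> assume \<epsilon>: "0 < \<epsilon>" "\<epsilon> < s"
      let ?f = "\<lambda>t. t powr (p - 1) * (p * log_primitive a b (ell t) - ?k t)"
      \<comment> \<open>\<open>?f\<close> is the derivative of t^p times the primitive. As p >= 1,
        and the subtracted term \<open>?k t\<close> is at most half of the primitive, the bracket is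
        still at least \<open>?k t\<close>, hence at least c times the weight.\<close>
      have wf: "c * (t powr p * ?w t) \<le> ?f t" if "\<epsilon> \<le> t" "t \<le> s" for t
      proof -
        have t: "0 < t" "t \<le> t0" using that \<epsilon> s t0 by auto
        note Yt = Y(3)[OF t0(3)[OF t]] Y(5)[OF t0(3)[OF t]]
        have "1 * log_primitive a b (ell t) \<le> p * log_primitive a b (ell t)"
          using p log_primitive_pos[OF ell_ge_1, of a b t] by (intro mult_right_mono) auto
        then have "c * log_weight a b (ell t) \<le> p * log_primitive a b (ell t) - ?k t"
          using Yt by linarith
        then have "t powr (p - 1) * (c * log_weight a b (ell t)) \<le> ?f t"
          by (intro mult_left_mono) auto
        moreover have "t powr p = t * t powr (p - 1)"
          using t by (simp add: powr_diff)
        ultimately show ?thesis using t by (simp add: mult_ac)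
      qed
      have "(\<integral>\<^sup>+t. ennreal (t powr p * ?w t) * indicator {\<epsilon>..s} t \<partial>lborel)
         \<le> (\<integral>\<^sup>+t. ennreal (1 / c) * (ennreal (?f t) * indicator {\<epsilon>..s} t) \<partial>lborel)"
      proof (rule nn_integral_mono)
        fix t
        show "ennreal (t powr p * ?w t) * indicator {\<epsilon>..s} t \<le> ennreal (1 / c) * (ennreal (?f t) * indicator {\<epsilon>..s} t)"
        proof (cases "t \<in> {\<epsilon>..s}")
          case True
          then have "t powr p * ?w t \<le> 1 / c * ?f t" using wf[of t] Y(2) by (simp add: field_simps)
          then show ?thesis using True Y(2) by (simp add: ennreal_mult'[symmetric] ennreal_leI del: times_divide_eq_left)
        qed simp
      qed
      also have "\<dots> = ennreal (1 / c) * (\<integral>\<^sup>+t. ennreal (?f t) * indicator {\<epsilon>..s} t \<partial>lborel)"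
        by (rule nn_integral_cmult) measurable
      also have "(\<integral>\<^sup>+t. ennreal (?f t) * indicator {\<epsilon>..s} t \<partial>lborel)
          = ennreal (s powr p * log_primitive a b (1 - ln s) - \<epsilon> powr p * log_primitive a b (1 - ln \<epsilon>))"
      proof (rule nn_integral_FTC_Icc[where F = "\<lambda>t. t powr p * log_primitive a b (1 - ln t)"])
        fix t assume "t \<in> {\<epsilon>..s}"
        then have t: "\<epsilon> \<le> t" "t \<le> s" by auto
        then have t': "0 < t" "t < 1" using \<epsilon> s t0 by auto
        show "((\<lambda>t. t powr p * log_primitive a b (1 - ln t)) has_real_derivative ?f t) (at t)"
          using t' by (auto intro!: derivative_eq_intros log_primitive_ell_has_derivative[OF ab]
              simp: ell_eq powr_diff field_simps)
        have "0 \<le> c * (t powr p * ?w t)"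
          using t' Y(2) log_weight_pos[OF ell_ge_1, of a b t] by simp
        then show "0 \<le> ?f t" using wf[OF t] by linarith
      qed (use \<epsilon> in auto)
      also have "\<dots> \<le> ennreal (s powr p * ?H)"
      proof (rule ennreal_leI)
        have "1 - ln \<epsilon> \<ge> 1" using \<epsilon> s t0 by simp
        then show "s powr p * log_primitive a b (1 - ln s) - \<epsilon> powr p * log_primitive a b (1 - ln \<epsilon>) \<le> s powr p * ?H"
          using log_primitive_pos[of "1 - ln \<epsilon>" a b] by (simp add: e)
      qed
      also have "ennreal (1 / c) * ennreal (s powr p * ?H) = ennreal (1 / c * (s powr p * ?H))"
        using Y(2) by (simp add: ennreal_mult'[symmetric] del: times_divide_eq_left)
      finally show "(\<integral>\<^sup>+t. ennreal (t powr p * ?w t) * indicator {\<epsilon>..s} t \<partial>lborel) \<le> ennreal (1 / c * (s powr p * ?H))"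
        by (simp add: mult_left_mono)
    qed (use s in auto)
    have I2: "(\<integral>\<^sup>+t. ennreal (?w t) * indicator {s..t0} t \<partial>lborel) \<le> ennreal (1 / c * ?H)"
    proof -
      have "(\<integral>\<^sup>+t. ennreal (?w t) * indicator {s..t0} t \<partial>lborel)
          \<le> (\<integral>\<^sup>+t. ennreal (1 / c) * (ennreal (?k t / t) * indicator {s..t0} t) \<partial>lborel)"
      proof (rule nn_integral_mono)
        fix t
        show "ennreal (?w t) * indicator {s..t0} t \<le> ennreal (1 / c) * (ennreal (?k t / t) * indicator {s..t0} t)"
        proof (cases "t \<in> {s..t0}")
          case True
          then have "0 < t" "t \<le> t0" using s by auto
          from Y(3)[OF t0(3)[OF this]] have "?w t \<le> 1 / c * (?k t / t)"
            using Y(2) \<open>0 < t\<close> by (simp add: field_simps)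
          then show ?thesis using True Y(2) by (simp add: ennreal_mult'[symmetric] ennreal_leI del: times_divide_eq_left times_divide_eq_right)
        qed simp
      qed
      also have "\<dots> = ennreal (1 / c) * (\<integral>\<^sup>+t. ennreal (?k t / t) * indicator {s..t0} t \<partial>lborel)"
        by (rule nn_integral_cmult) measurable
      also have "(\<integral>\<^sup>+t. ennreal (?k t / t) * indicator {s..t0} t \<partial>lborel)
        = ennreal (- log_primitive a b (1 - ln t0) - - log_primitive a b (1 - ln s))"
      proof (rule nn_integral_FTC_Icc[where F = "\<lambda>t. - log_primitive a b (1 - ln t)"])
        fix t assume "t \<in> {s..t0}"
        then have t: "s \<le> t" "t \<le> t0" by auto
        show "((\<lambda>t. - log_primitive a b (1 - ln t)) has_real_derivative ?k t / t) (at t)"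
          using DERIV_minus[OF log_primitive_ell_has_derivative[OF ab, of t]] s t t0 by simp
        show "0 \<le> ?k t / t" using kpos[of t] s t by simp
      qed (use s in auto)
      also have "\<dots> \<le> ennreal ?H"
        using log_primitive_pos[OF ell_ge_1, of a b t0] by (intro ennreal_leI) (simp add: e)
      also have "ennreal (1 / c) * ennreal ?H = ennreal (1 / c * ?H)"
        using Y(2) by (simp add: ennreal_mult'[symmetric] del: times_divide_eq_left)
      finally show ?thesis by (simp add: mult_left_mono)
    qed
    have I3: "(\<integral>\<^sup>+t. ennreal (?w t) * indicator {t0<..<1} t \<partial>lborel) \<le> ennreal (M / t0 * ?H)"
    proof -
      have "(\<integral>\<^sup>+t. ennreal (?w t) * indicator {t0<..<1} t \<partial>lborel) \<le> (\<integral>\<^sup>+t. ennreal (M / t0) * indicator {t0<..<1} t \<partial>lborel)"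
      proof (rule nn_integral_mono)
        fix t
        show "ennreal (?w t) * indicator {t0<..<1} t \<le> ennreal (M / t0) * indicator {t0<..<1} t"
          using M(2)[of t] M(1) t0 by (auto simp: indicator_def intro!: ennreal_leI frac_le)
      qed
      also have "\<dots> = ennreal (M / t0) * ennreal (1 - t0)"
        using t0 by (subst nn_integral_cmult_indicator) auto
      also have "\<dots> = ennreal (M / t0 * (1 - t0))" using M t0 by (simp add: ennreal_mult'[symmetric])
      also have "\<dots> \<le> ennreal (M / t0 * ?H)" using M t0 H1 by (intro ennreal_leI mult_left_mono) auto
      finally show ?thesis .
    qed
    have "(\<integral>\<^sup>+t\<in>{0<..<1}. ennreal (min t s powr p * ?w t) \<partial>lborel)
      \<le> (\<integral>\<^sup>+t. ennreal (t powr p * ?w t) * indicator {0<..s} t + ennreal (s powr p) * (ennreal (?w t) * indicator {s..t0} t)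
            + ennreal (s powr p) * (ennreal (?w t) * indicator {t0<..<1} t) \<partial>lborel)"
      (is "_ \<le> (\<integral>\<^sup>+t. ?R t \<partial>lborel)")
    proof (rule nn_integral_mono)
      fix t :: real
      consider "t \<le> 0 \<or> t \<ge> 1" | "0 < t" "t < 1" "t \<le> s" | "0 < t" "t < 1" "s < t" by linarith
      then show "ennreal (min t s powr p * ?w t) * indicator {0<..<1} t \<le> ?R t"
      proof cases
        case 1
        then have "indicator {0<..<1} t = (0::ennreal)" by auto
        then show ?thesis by simp
      next
        case 2
        then show ?thesis by (simp add: add_increasing2 min_def)
      next
        case 3
        then show ?thesis using t0 s
          by (cases "t \<le> t0") (auto simp: ennreal_mult'[symmetric] min_def)
      qed
    qed
    also have "\<dots> = (\<integral>\<^sup>+t. ennreal (t powr p * ?w t) * indicator {0<..s} t \<partial>lborel)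
        + ennreal (s powr p) * (\<integral>\<^sup>+t. ennreal (?w t) * indicator {s..t0} t \<partial>lborel)
        + ennreal (s powr p) * (\<integral>\<^sup>+t. ennreal (?w t) * indicator {t0<..<1} t \<partial>lborel)"
      by (simp add: nn_integral_add nn_integral_cmult)
    also have "\<dots> \<le> ennreal (1 / c * (s powr p * ?H)) + ennreal (s powr p) * ennreal (1 / c * ?H)
        + ennreal (s powr p) * ennreal (M / t0 * ?H)"
      by (intro add_mono mult_left_mono I1 I2 I3) auto
    also have "\<dots> = ennreal ((1 / c + 1 / c + M / t0) * (s powr p * ?H))"
      using H1 Y(2) M t0
      by (simp add: ennreal_mult'[symmetric] ennreal_plus[symmetric] algebra_simps del: ennreal_plus)
    finally show "(\<integral>\<^sup>+t\<in>{0<..<1}. ennreal (min t s powr p * ?w t) \<partial>lborel)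
       \<le> ennreal ((1 / c + 1 / c + M / t0) * (s powr p * ?H))" .
  qed (use s0 t0 Y M in \<open>auto intro!: add_pos_pos\<close>)
qed

text \<open>The counterpart of the integral estimate for q = top. Write P(t) for the primitive at
  \<open>ell t\<close>. Near 0 the product t P(t) is nondecreasing, which settles t <= s; P itself
  is nonincreasing, which settles s < t <= t0; beyond t0 it is bounded while P(s) >= 1.\<close>

lemma log_primitive_min_mult_le:
  assumes ab: "a > -1 \<or> a = -1 \<and> b \<ge> -1"
  obtains s1 C where "0 < s1" "s1 < 1" "C > 0"
    "\<And>s t. 0 < s \<Longrightarrow> s \<le> s1 \<Longrightarrow> 0 < t \<Longrightarrow> t < 1 \<Longrightarrow>
      min t s * log_primitive a b (ell t) \<le> C * (s * log_primitive a b (ell s))"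
proof -
  obtain Y c where Y: "Y \<ge> 1" "c > 0"
    "\<And>y. y \<ge> Y \<Longrightarrow> c * log_weight a b y \<le> log_factor a b y * log_weight a b y"
    "\<And>y. y \<ge> Y \<Longrightarrow> c * (log_factor a b y * log_weight a b y) \<le> log_weight a b y"
    "\<And>y. y \<ge> Y \<Longrightarrow> log_factor a b y * log_weight a b y \<le> log_primitive a b y / 2"
    using log_primitive_bounds[OF ab] by blast
  obtain t0 where t0: "0 < t0" "t0 < 1" "\<And>t. 0 < t \<Longrightarrow> t \<le> t0 \<Longrightarrow> ell t \<ge> Y"
    using eventually_ell_ge by blast
  obtain s0 where s0: "0 < s0" "s0 < 1" "\<And>t. 0 < t \<Longrightarrow> t \<le> s0 \<Longrightarrow> log_primitive a b (ell t) \<ge> 1"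
    using eventually_log_primitive_ell_ge[OF ab] by blast
  let ?P = "\<lambda>t. log_primitive a b (1 - ln t)" and ?k = "\<lambda>t. log_factor a b (ell t) * log_weight a b (ell t)"
  have P: "?P t = log_primitive a b (ell t)" if "0 < t" "t < 1" for t using that by (simp add: ell_eq)
  have k: "0 \<le> ?k t" "?k t \<le> log_primitive a b (ell t)" if "0 < t" "t \<le> t0" for t
  proof -
    note Y' = t0(3)[OF that]
    show "0 \<le> ?k t" using Y(3)[OF Y'] log_weight_pos[OF ell_ge_1, of a b t] Y(2)
      by (meson less_imp_le mult_nonneg_nonneg order_trans)
    show "?k t \<le> log_primitive a b (ell t)"
      using Y(5)[OF Y'] log_primitive_pos[OF ell_ge_1, of a b t] by linarith
  qed
  have "continuous_on {t0..1} ?P"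
  proof (rule continuous_at_imp_continuous_on, rule ballI)
    fix t assume "t \<in> {t0..1}"
    then have "1 - ln t \<ge> 1" "t > 0" using t0 by auto
    then have "isCont (log_primitive a b) (1 - ln t)"
      using log_primitive_has_derivative[OF ab] DERIV_isCont by blast
    moreover have "isCont (\<lambda>t. 1 - ln t) t"
      using \<open>t > 0\<close> by (auto intro!: continuous_intros)
    ultimately show "isCont ?P t" by (rule isCont_o2[rotated])
  qed
  then have "compact (?P ` {t0..1})"
    by (intro compact_continuous_image) auto
  then have "bounded (?P ` {t0..1})" by (rule compact_imp_bounded)
  then obtain M where M: "\<forall>y\<in>?P ` {t0..1}. norm y \<le> M"
    unfolding bounded_iff by blast
  have M': "log_primitive a b (ell t) \<le> max M 1" if "t0 \<le> t" "t < 1" for t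
  proof -
    have "norm (?P t) \<le> M" using M[rule_format, of "?P t"] that by auto
    then show ?thesis using P[of t] that t0 by simp
  qed
  show thesis
  proof (rule that[of "min s0 t0" "max M 1"])
    fix s t :: real assume s: "0 < s" "s \<le> min s0 t0" and t: "0 < t" "t < 1"
    have H1: "log_primitive a b (ell s) \<ge> 1" using s0(3)[of s] s by auto
    have C: "s * log_primitive a b (ell s) \<le> max M 1 * (s * log_primitive a b (ell s))"
      using s H1 mult_right_mono[of 1 "max M 1" "s * log_primitive a b (ell s)"] by simp
    consider "t \<le> s" | "s < t" "t \<le> t0" | "s < t" "t0 < t" by linarith
    then show "min t s * log_primitive a b (ell t) \<le> max M 1 * (s * log_primitive a b (ell s))"
    proof cases
      case 1
      have "t * ?P t \<le> s * ?P s"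
      proof (rule DERIV_nonneg_imp_nondecreasing[OF 1])
        fix x assume x: "t \<le> x" "x \<le> s"
        then have x': "0 < x" "x < 1" "x \<le> t0" using s t t0 by auto
        have "((\<lambda>x. x * ?P x) has_real_derivative 1 * ?P x + - (?k x / x) * x) (at x)"
          by (intro DERIV_mult DERIV_ident log_primitive_ell_has_derivative[OF ab] x')
        then have "((\<lambda>x. x * ?P x) has_real_derivative log_primitive a b (ell x) - ?k x) (at x)"
          using x' P[of x] by simp
        then show "\<exists>y. ((\<lambda>x. x * ?P x) has_real_derivative y) (at x) \<and> 0 \<le> y"
          using k(2)[of x] x' by (intro exI conjI) auto
      qed
      moreover have "s < 1" using s t0 by simp
      ultimately have "min t s * log_primitive a b (ell t) \<le> s * log_primitive a b (ell s)"
        using 1 P[of t] P[of s] t s by (simp add: min.absorb1)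
      then show ?thesis using C by (rule order_trans)
    next
      case 2
      have "- ?P s \<le> - ?P t"
      proof (rule DERIV_nonneg_imp_nondecreasing[where f = "\<lambda>x. - ?P x" and a = s and b = t])
        fix x assume x: "s \<le> x" "x \<le> t"
        then have x': "0 < x" "x < 1" "x \<le> t0" using s t t0 2 by auto
        have "((\<lambda>x. - ?P x) has_real_derivative - (- (?k x / x))) (at x)"
          by (intro DERIV_minus log_primitive_ell_has_derivative[OF ab] x')
        then show "\<exists>y. ((\<lambda>x. - ?P x) has_real_derivative y) (at x) \<and> 0 \<le> y"
          using k(1)[of x] x' by (intro exI[of _ "?k x / x"]) simp
      qed (use 2 in auto)
      then have "min t s * log_primitive a b (ell t) \<le> s * log_primitive a b (ell s)"
        using P[of t] P[of s] t s 2 by (simp add: min.absorb2)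
      then show ?thesis using C by (rule order_trans)
    next
      case 3
      have "log_primitive a b (ell t) \<le> max M 1 * log_primitive a b (ell s)"
      proof -
        have "max M 1 * 1 \<le> max M 1 * log_primitive a b (ell s)" using H1 by (intro mult_left_mono) auto
        moreover have "log_primitive a b (ell t) \<le> max M 1" using 3 t by (intro M') auto
        ultimately show ?thesis by linarith
      qed
      then have "s * log_primitive a b (ell t) \<le> s * (max M 1 * log_primitive a b (ell s))"
        using s by (intro mult_left_mono) auto
      then show ?thesis using 3 by (simp add: min_def mult_ac)
    qed
  qed (use s0 t0 in auto)
qed

text \<open>Up to constants, \<open>lz_gauge q \<alpha> \<beta> (ell s)\<close> is the \<open>L\<^sup>q\<close> norm over \<open>(s, 1)\<close> of \<open>base_weight\<close>,
  defined below.\<close>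

definition lz_gauge :: "ennreal \<Rightarrow> real \<Rightarrow> real \<Rightarrow> real \<Rightarrow> real" where
  "lz_gauge q \<alpha> \<beta> y =
     (if \<alpha> > - recip q then y powr (recip q + \<alpha>) * (1 + ln y) powr \<beta>
      else if \<beta> > - recip q then (1 + ln y) powr (recip q + \<beta>)
      else (1 + ln (1 + ln y)) powr recip q)"

lemma recip_top [simp]: "recip top = 0"
  by (simp add: recip_def)

text \<open>For finite q with p = \<open>enn2real q\<close>, admissibility says precisely that the
  weight with exponents \<alpha> p and \<beta> p has a divergent integral at infinity, which makes
  \<open>log_primitive\<close> its growth. For q = top the third alternative is excluded and both
  remaining ones make the weight itself unbounded at 0.\<close>

lemma L1_admissible_cases:
  assumes "L1_admissible q \<alpha> \<beta>"
  obtains (finite) "1 \<le> q" "q < top" "enn2real q \<ge> 1" "recip q = 1 / enn2real q"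
      "\<alpha> * enn2real q > -1 \<or> \<alpha> * enn2real q = -1 \<and> \<beta> * enn2real q \<ge> -1"
  | (infinite) "q = top" "\<alpha> > 0 \<or> \<alpha> = 0 \<and> \<beta> > 0"
proof (cases "q = top")
  case True
  then show thesis using assms infinite by (auto simp: L1_admissible_def)
next
  case False
  then have q: "1 \<le> q" "q < top" using assms by (auto simp: L1_admissible_def less_top)
  note r = recip_finite[OF q]
  define p where "p = enn2real q"
  have p: "p \<ge> 1" "recip q = 1 / p" using r by (auto simp: p_def)
  have "\<alpha> > - (1 / p) \<or> \<alpha> = - (1 / p) \<and> \<beta> \<ge> - (1 / p)"
    using assms p(2) by (auto simp: L1_admissible_def)
  then have "\<alpha> * p > -1 \<or> \<alpha> * p = -1 \<and> \<beta> * p \<ge> -1"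
    using p(1) by (auto simp: field_simps)
  then show thesis using finite q r by (simp add: p_def)
qed

lemma gauge_finite:
  assumes "p \<ge> 1" "recip q = 1 / p" "\<alpha> * p > -1 \<or> \<alpha> * p = -1 \<and> \<beta> * p \<ge> -1" "y \<ge> 1"
  shows "lz_gauge q \<alpha> \<beta> y = log_primitive (\<alpha> * p) (\<beta> * p) y powr (1 / p)"
proof -
  have L: "1 + ln y > 0" using ln_ge_zero[OF assms(4)] by linarith
  have 1: "\<alpha> > - recip q \<longleftrightarrow> \<alpha> * p > -1" "\<beta> > - recip q \<longleftrightarrow> \<beta> * p > -1"
    unfolding assms(2) using assms(1) by (auto simp: field_simps)
  have e: "(\<alpha> * p + 1) * (1 / p) = recip q + \<alpha>" "(\<beta> * p + 1) * (1 / p) = recip q + \<beta>" "\<beta> * p * (1 / p) = \<beta>"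
    using assms(1,2) by (auto simp: field_simps)
  show ?thesis
    unfolding lz_gauge_def log_primitive_def 1
    using assms(4) L by (auto simp: powr_mult powr_powr e simp del: times_divide_eq_right times_divide_eq_left)
      (simp_all add: assms(2))
qed

text \<open>For q = top the gauge is the weight and not an integral of it. Lowering one exponent by
  1 still presents it as a \<open>log_primitive\<close>, so that the monotonicity facts carry
  over.\<close>

lemma gauge_infinite:
  assumes "\<alpha> > 0 \<or> \<alpha> = 0 \<and> \<beta> > 0" "y \<ge> 1"
  shows "lz_gauge top \<alpha> \<beta> y = y powr \<alpha> * (1 + ln y) powr \<beta>"
    "lz_gauge top \<alpha> \<beta> y = log_primitive (\<alpha> - 1) (if \<alpha> > 0 then \<beta> else \<beta> - 1) y"
  using assms by (auto simp: lz_gauge_def log_primitive_def)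

lemma gauge_pos:
  assumes "y \<ge> 1" shows "lz_gauge q \<alpha> \<beta> y > 0"
proof -
  have L: "1 + ln y \<ge> 1" using ln_ge_zero[OF assms] by linarith
  have "1 + ln (1 + ln y) > 0" using ln_ge_zero[OF L] by linarith
  moreover have "1 + ln y > 0" using L by linarith
  ultimately show ?thesis using assms by (auto simp: lz_gauge_def intro!: mult_pos_pos)
qed

text \<open>The weight of the norm divided by t. The factor t is left to the maximal function,
  because t times the maximal function is the monotone quantity that bounds integrals over
  sets.\<close>

definition base_weight :: "ennreal \<Rightarrow> real \<Rightarrow> real \<Rightarrow> real \<Rightarrow> real" where
  "base_weight q \<alpha> \<beta> t = t powr (- recip q) * ell t powr \<alpha> * ellell t powr \<beta>"

lemma base_weight_measurable [measurable]: "base_weight q \<alpha> \<beta> \<in> borel_measurable borel"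
  unfolding base_weight_def[abs_def] ellell_def[abs_def] by measurable

lemma base_weight_nonneg: "base_weight q \<alpha> \<beta> t \<ge> 0"
  by (simp add: base_weight_def)

lemma weight_eq_base:
  "0 < t \<Longrightarrow> t powr (1 - recip q) * ell t powr \<alpha> * ellell t powr \<beta> = t * base_weight q \<alpha> \<beta> t"
  by (simp add: base_weight_def powr_diff powr_minus_divide)

lemma base_weight_finite:
  assumes "p \<ge> 1" "recip q = 1 / p" "0 < t"
  shows "base_weight q \<alpha> \<beta> t powr p = log_weight (\<alpha> * p) (\<beta> * p) (ell t) / t"
proof -
  have "(t powr (- recip q)) powr p = 1 / t"
    unfolding powr_powr assms(2) using assms(1,3) by (simp add: powr_minus_divide)
  moreover have "(ell t powr \<alpha> * ellell t powr \<beta>) powr p = log_weight (\<alpha> * p) (\<beta> * p) (ell t)"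
    by (simp add: powr_mult powr_powr log_weight_def ellell_def)
  moreover have "base_weight q \<alpha> \<beta> t powr p = (t powr (- recip q)) powr p * (ell t powr \<alpha> * ellell t powr \<beta>) powr p"
    unfolding base_weight_def mult.assoc by (rule powr_mult)
  ultimately show ?thesis by simp
qed

lemma base_weight_infinite:
  assumes "\<alpha> > 0 \<or> \<alpha> = 0 \<and> \<beta> > 0" "0 < t"
  shows "base_weight top \<alpha> \<beta> t = lz_gauge top \<alpha> \<beta> (ell t)"
  using assms ell_ge_1[of t] by (simp add: base_weight_def gauge_infinite(1) ellell_def)

section \<open>Two-sided estimates of the Lorentz-Zygmund norm\<close>

lemma Lq_norm_lower_gauge:
  assumes adm: "L1_admissible q \<alpha> \<beta>"
  obtains s1 c where "0 < s1" "s1 < 1" "c > 0"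
    "\<And>s V f Z. 0 < s \<Longrightarrow> s \<le> s1 \<Longrightarrow> V > 0 \<Longrightarrow> f \<in> borel_measurable (lebesgue_on {0<..<1}) \<Longrightarrow>
      (\<And>t. s < t \<Longrightarrow> t < 1 \<Longrightarrow> Z * ennreal (base_weight q \<alpha> \<beta> t) \<le> ennreal V * f t) \<Longrightarrow>
      Z * ennreal (c * lz_gauge q \<alpha> \<beta> (ell s)) \<le> ennreal V * Lq_norm q (lebesgue_on {0<..<1}) f"
  using adm
proof (cases rule: L1_admissible_cases)
  case finite
  define p where "p = enn2real q"
  have p: "p \<ge> 1" "recip q = 1 / p" "\<alpha> * p > -1 \<or> \<alpha> * p = -1 \<and> \<beta> * p \<ge> -1"
    using finite by (auto simp: p_def)
  obtain s1 c where sc: "0 < s1" "s1 < 1" "c > 0"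
    "\<And>s. 0 < s \<Longrightarrow> s \<le> s1 \<Longrightarrow> ennreal (c * log_primitive (\<alpha> * p) (\<beta> * p) (ell s))
      \<le> (\<integral>\<^sup>+t\<in>{s<..<1}. ennreal (log_weight (\<alpha> * p) (\<beta> * p) (ell t) / t) \<partial>lborel)"
    using nn_integral_log_weight_lower[OF p(3)] by blast
  show thesis
  proof (rule that[of s1 "c powr (1 / p)"])
    fix s V f Z
    assume s: "0 < s" "s \<le> s1" and V: "(V::real) > 0" and f: "f \<in> borel_measurable (lebesgue_on {0<..<1::real})"
      and le: "\<And>t. s < t \<Longrightarrow> t < 1 \<Longrightarrow> Z * ennreal (base_weight q \<alpha> \<beta> t) \<le> ennreal V * f t"
    let ?N = "c powr (1 / p) * lz_gauge q \<alpha> \<beta> (ell s)"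
    show "Z * ennreal ?N \<le> ennreal V * Lq_norm q (lebesgue_on {0<..<1}) f"
    proof (rule Lq_norm_lower_finite[OF finite(1,2) s(1) V _ base_weight_measurable base_weight_nonneg f le])
      show "?N \<ge> 0" using gauge_pos[OF ell_ge_1, of q \<alpha> \<beta> s] by simp
      have P: "log_primitive (\<alpha> * p) (\<beta> * p) (ell s) > 0" by (rule log_primitive_pos[OF ell_ge_1])
      have "?N powr p = c * log_primitive (\<alpha> * p) (\<beta> * p) (ell s)"
        using p(1) sc(3) P by (simp add: gauge_finite[OF p ell_ge_1] powr_mult powr_powr)
      moreover have "(\<integral>\<^sup>+t\<in>{s<..<1}. ennreal (base_weight q \<alpha> \<beta> t powr p) \<partial>lborel)
          = (\<integral>\<^sup>+t\<in>{s<..<1}. ennreal (log_weight (\<alpha> * p) (\<beta> * p) (ell t) / t) \<partial>lborel)"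
        using s by (intro nn_integral_cong) (auto simp: indicator_def base_weight_finite[OF p(1,2)])
      ultimately show "ennreal (?N powr enn2real q) \<le> (\<integral>\<^sup>+t\<in>{s<..<1}. ennreal (base_weight q \<alpha> \<beta> t powr enn2real q) \<partial>lborel)"
        using sc(4)[OF s] by (simp add: p_def)
    qed
  qed (use sc in auto)
next
  case infinite
  show thesis
  \<comment> \<open>For q = top the value at s itself is needed, but only points t > s are
    available. By continuity the weight exceeds half of its value at s immediately to the right of
    s.\<close>
  proof (rule that[of "1 / 2" "1 / 2"])
    fix s V f Z
    assume s: "0 < s" "s \<le> 1 / 2" and V: "(V::real) > 0" and f: "f \<in> borel_measurable (lebesgue_on {0<..<1::real})"
      and le: "\<And>t. s < t \<Longrightarrow> t < 1 \<Longrightarrow> Z * ennreal (base_weight q \<alpha> \<beta> t) \<le> ennreal V * f t"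
    let ?g = "\<lambda>t. lz_gauge top \<alpha> \<beta> (ell t)"
    have g: "?g t = (1 - ln t) powr \<alpha> * (1 + ln (1 - ln t)) powr \<beta>" if "0 < t" "t < 1" for t
      using gauge_infinite(1)[OF infinite(2) ell_ge_1[of t]] that by (simp add: ell_eq)
    have "1 - ln s > 0" "1 + ln (1 - ln s) > 0"
    proof -
      have "1 - ln s \<ge> 1" using s by simp
      then show "1 - ln s > 0" "1 + ln (1 - ln s) > 0" using ln_ge_zero[of "1 - ln s"] by linarith+
    qed
    then have "isCont (\<lambda>t. (1 - ln t) powr \<alpha> * (1 + ln (1 - ln t)) powr \<beta>) s"
      using s by (intro continuous_intros) auto
    then have "((\<lambda>t. (1 - ln t) powr \<alpha> * (1 + ln (1 - ln t)) powr \<beta>) \<longlongrightarrow> ?g s) (at s)"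
      using g[of s] s by (simp add: isCont_def)
    then have "eventually (\<lambda>t. (1 - ln t) powr \<alpha> * (1 + ln (1 - ln t)) powr \<beta> > 1 / 2 * ?g s) (at s)"
      using gauge_pos[OF ell_ge_1, of top \<alpha> \<beta> s] by (intro order_tendstoD(1)) auto
    then obtain d where d: "d > 0" "\<And>t. t \<noteq> s \<Longrightarrow> dist t s < d \<Longrightarrow> (1 - ln t) powr \<alpha> * (1 + ln (1 - ln t)) powr \<beta> > 1 / 2 * ?g s"
      by (auto simp: eventually_at)
    have "Z * ennreal (1 / 2 * ?g s) \<le> ennreal V * Lq_norm top (lebesgue_on {0<..<1}) f"
    proof (rule Lq_norm_lower_top[of s "min 1 (s + d)", OF s(1) _ _ V le[unfolded infinite(1)]])
      fix t assume t: "s < t" "t < min 1 (s + d)"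
      then show "1 / 2 * ?g s \<le> base_weight top \<alpha> \<beta> t"
        using d(2)[of t] g[of t] s by (simp add: base_weight_infinite[OF infinite(2)] dist_real_def)
    qed (use s d in auto)
    then show "Z * ennreal (1 / 2 * lz_gauge q \<alpha> \<beta> (ell s)) \<le> ennreal V * Lq_norm q (lebesgue_on {0<..<1}) f"
      by (simp only: infinite(1))
  qed auto
qed

lemma LZ_weight_measurable:
  assumes "\<Omega> \<in> lmeasurable" "measure lebesgue \<Omega> > 0" "u \<in> borel_measurable (lebesgue_on \<Omega>)"
  shows "(\<lambda>s. ennreal (s powr (1 - recip q) * ell s powr \<alpha> * ellell s powr \<beta>) * maximal_rearr \<Omega> u s)
    \<in> borel_measurable (lebesgue_on {0<..<1})"
proof -
  have "(\<lambda>s. ennreal (s powr (1 - recip q) * ell s powr \<alpha> * ellell s powr \<beta>)) \<in> borel_measurable borel"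
    unfolding ellell_def by measurable
  then have "(\<lambda>s. ennreal (s powr (1 - recip q) * ell s powr \<alpha> * ellell s powr \<beta>)) \<in> borel_measurable (lebesgue_on {0<..<1})"
    by (intro measurable_restrict_space1 measurable_completion) simp
  then show ?thesis
    using maximal_rearr_measurable[OF assms] by measurable
qed

lemma LZ_norm_lower:
  fixes \<Omega> :: "(real^'n) set"
  assumes adm: "L1_admissible q \<alpha> \<beta>" and \<Omega>0: "\<Omega> \<in> lmeasurable" "measure lebesgue \<Omega> > 0"
  obtains s1 c where "0 < s1" "s1 < 1" "c > 0"
    "\<And>u B s. u \<in> borel_measurable (lebesgue_on \<Omega>) \<Longrightarrow>
       B \<in> sets lebesgue \<Longrightarrow> B \<subseteq> \<Omega> \<Longrightarrow> 0 < s \<Longrightarrow> s \<le> s1 \<Longrightarrow> measure lebesgue B \<le> measure lebesgue \<Omega> * s \<Longrightarrow>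
       (\<integral>\<^sup>+x\<in>B. ennreal \<bar>u x\<bar> \<partial>lebesgue) * ennreal (c * lz_gauge q \<alpha> \<beta> (ell s))
         \<le> ennreal (measure lebesgue \<Omega>) * LZ_norm q \<alpha> \<beta> \<Omega> u"
    "\<And>u. u \<in> borel_measurable (lebesgue_on \<Omega>) \<Longrightarrow>
       (\<integral>\<^sup>+x\<in>\<Omega>. ennreal \<bar>u x\<bar> \<partial>lebesgue) * ennreal c
         \<le> ennreal (measure lebesgue \<Omega>) * LZ_norm q \<alpha> \<beta> \<Omega> u"
proof -
  obtain s1 c where sc: "0 < s1" "s1 < 1" "c > 0"
    "\<And>s V f Z. 0 < s \<Longrightarrow> s \<le> s1 \<Longrightarrow> V > 0 \<Longrightarrow> f \<in> borel_measurable (lebesgue_on {0<..<1}) \<Longrightarrow>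
      (\<And>t. s < t \<Longrightarrow> t < 1 \<Longrightarrow> Z * ennreal (base_weight q \<alpha> \<beta> t) \<le> ennreal V * f t) \<Longrightarrow>
      Z * ennreal (c * lz_gauge q \<alpha> \<beta> (ell s)) \<le> ennreal V * Lq_norm q (lebesgue_on {0<..<1}) f"
    using Lq_norm_lower_gauge[OF adm] by blast
  \<comment> \<open>The second entry serves the integral over \<Omega>: the estimate is applied at s
    = s1 and the factor t is bounded below by s1. The minimum gives one constant for both
    conclusions.\<close>
  define c' where "c' = min c (s1 * (c * lz_gauge q \<alpha> \<beta> (ell s1)))"
  have c': "c' > 0" "c' \<le> c" "c' \<le> s1 * (c * lz_gauge q \<alpha> \<beta> (ell s1))"
    using sc gauge_pos[OF ell_ge_1, of q \<alpha> \<beta> s1] by (auto simp: c'_def)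
  show thesis
  proof (rule that[of s1 c'])
    fix u :: "real^'n \<Rightarrow> real"
    assume "u \<in> borel_measurable (lebesgue_on \<Omega>)"
    note \<Omega> = \<Omega>0 this
    let ?V = "measure lebesgue \<Omega>"
    note meas = LZ_weight_measurable[OF \<Omega>, of q \<alpha> \<beta>]
    {
      fix B s assume B: "B \<in> sets lebesgue" "B \<subseteq> \<Omega>" and s: "0 < s" "s \<le> s1" and m: "measure lebesgue B \<le> ?V * s"
      let ?Z = "\<integral>\<^sup>+x\<in>B. ennreal \<bar>u x\<bar> \<partial>lebesgue"
      have "?Z * ennreal (c * lz_gauge q \<alpha> \<beta> (ell s)) \<le> ennreal ?V * LZ_norm q \<alpha> \<beta> \<Omega> u"
        unfolding LZ_norm_eq
      proof (rule sc(4)[OF s \<Omega>(2) meas])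
        fix t assume t: "s < t" "t < 1"
        then have "?V * s \<le> ?V * t" using \<Omega>(2) by simp
        then have "?Z \<le> ennreal (?V * t) * maximal_rearr \<Omega> u t"
          using t s m by (intro nn_integral_le_maximal_rearr \<Omega> B) auto
        then have "?Z * ennreal (base_weight q \<alpha> \<beta> t) \<le> ennreal (?V * t) * maximal_rearr \<Omega> u t * ennreal (base_weight q \<alpha> \<beta> t)"
          by (rule mult_right_mono) simp
        also have "\<dots> = ennreal ?V * (ennreal (t * base_weight q \<alpha> \<beta> t) * maximal_rearr \<Omega> u t)"
          using t s \<Omega>(2) base_weight_nonneg[of q \<alpha> \<beta> t] by (simp add: ennreal_mult mult_ac)
        finally show "?Z * ennreal (base_weight q \<alpha> \<beta> t)
            \<le> ennreal ?V * (ennreal (t powr (1 - recip q) * ell t powr \<alpha> * ellell t powr \<beta>) * maximal_rearr \<Omega> u t)"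
          using t s by (simp add: weight_eq_base)
      qed
      moreover have "ennreal (c' * lz_gauge q \<alpha> \<beta> (ell s)) \<le> ennreal (c * lz_gauge q \<alpha> \<beta> (ell s))"
        using c' gauge_pos[OF ell_ge_1, of q \<alpha> \<beta> s] by (intro ennreal_leI mult_right_mono) auto
      ultimately show "?Z * ennreal (c' * lz_gauge q \<alpha> \<beta> (ell s)) \<le> ennreal ?V * LZ_norm q \<alpha> \<beta> \<Omega> u"
        by (meson mult_left_mono order_trans zero_le)
    }
    let ?Z = "\<integral>\<^sup>+x\<in>\<Omega>. ennreal \<bar>u x\<bar> \<partial>lebesgue"
    have "ennreal s1 * ?Z * ennreal (c * lz_gauge q \<alpha> \<beta> (ell s1)) \<le> ennreal ?V * LZ_norm q \<alpha> \<beta> \<Omega> u"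
      unfolding LZ_norm_eq
    proof (rule sc(4)[OF sc(1) order_refl \<Omega>(2) meas])
      fix t assume t: "s1 < t" "t < 1"
      have "ennreal s1 * ?Z \<le> ennreal t * ?Z" using t by (intro mult_right_mono ennreal_leI) auto
      also have "\<dots> \<le> ennreal (?V * t) * maximal_rearr \<Omega> u t"
        using t sc by (intro nn_integral_le_maximal_rearr_whole \<Omega>) auto
      finally have "ennreal s1 * ?Z * ennreal (base_weight q \<alpha> \<beta> t) \<le> ennreal (?V * t) * maximal_rearr \<Omega> u t * ennreal (base_weight q \<alpha> \<beta> t)"
        by (rule mult_right_mono) simp
      also have "\<dots> = ennreal ?V * (ennreal (t * base_weight q \<alpha> \<beta> t) * maximal_rearr \<Omega> u t)"
        using t sc \<Omega>(2) base_weight_nonneg[of q \<alpha> \<beta> t] by (simp add: ennreal_mult mult_ac)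
      finally show "ennreal s1 * ?Z * ennreal (base_weight q \<alpha> \<beta> t)
          \<le> ennreal ?V * (ennreal (t powr (1 - recip q) * ell t powr \<alpha> * ellell t powr \<beta>) * maximal_rearr \<Omega> u t)"
        using t sc by (simp add: weight_eq_base)
    qed
    moreover have "?Z * ennreal c' \<le> ennreal s1 * ?Z * ennreal (c * lz_gauge q \<alpha> \<beta> (ell s1))"
    proof -
      have "?Z * ennreal c' \<le> ?Z * ennreal (s1 * (c * lz_gauge q \<alpha> \<beta> (ell s1)))"
        using c' by (intro mult_left_mono ennreal_leI) auto
      also have "\<dots> = ennreal s1 * ?Z * ennreal (c * lz_gauge q \<alpha> \<beta> (ell s1))"
        using sc gauge_pos[OF ell_ge_1, of q \<alpha> \<beta> s1] by (simp add: ennreal_mult mult_ac)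
      finally show ?thesis .
    qed
    ultimately show "?Z * ennreal c' \<le> ennreal ?V * LZ_norm q \<alpha> \<beta> \<Omega> u" by (rule order_trans[rotated])
  qed (use sc c' in auto)
qed

text \<open>For u bounded by K on a set of relative volume s, t times the maximal function is at
  most K \<open>min t s\<close>. The norm of \<open>min t s\<close> against the base weight is
  comparable to s times the gauge: its part above s is the gauge, and the part below s is of no
  larger order.\<close>

lemma LZ_norm_upper:
  fixes \<Omega> :: "(real^'n) set"
  assumes adm: "L1_admissible q \<alpha> \<beta>" and \<Omega>0: "\<Omega> \<in> lmeasurable" "measure lebesgue \<Omega> > 0"
  obtains s1 C where "0 < s1" "s1 < 1" "C > 0"
    "\<And>u E K s. u \<in> borel_measurable (lebesgue_on \<Omega>) \<Longrightarrow>
       E \<in> lmeasurable \<Longrightarrow> K \<ge> 0 \<Longrightarrow> AE x in lebesgue. x \<in> \<Omega> \<longrightarrow> \<bar>u x\<bar> \<le> K * indicator E x \<Longrightarrow>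
       0 < s \<Longrightarrow> s \<le> s1 \<Longrightarrow> measure lebesgue E = measure lebesgue \<Omega> * s \<Longrightarrow>
       LZ_norm q \<alpha> \<beta> \<Omega> u \<le> ennreal (K * (C * (s * lz_gauge q \<alpha> \<beta> (ell s))))"
proof -
  \<comment> \<open>The absolute value is for negative t, where \<open>min t s\<close> would not be
    the nonnegative majorant that \<open>Lq_norm_upper_finite\<close> asks for on the whole
    line.\<close>
  have bound: "ennreal (t powr (1 - recip q) * ell t powr \<alpha> * ellell t powr \<beta>) * maximal_rearr \<Omega> u t
      \<le> ennreal K * ennreal (base_weight q \<alpha> \<beta> t * \<bar>min t s\<bar>)"
    if "u \<in> borel_measurable (lebesgue_on \<Omega>)" "E \<in> lmeasurable" "K \<ge> 0" "AE x in lebesgue. x \<in> \<Omega> \<longrightarrow> \<bar>u x\<bar> \<le> K * indicator E x"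
       "0 < s" "measure lebesgue E = measure lebesgue \<Omega> * s" "0 < t" "t < 1"
    for u E K s t
  proof -
    have "maximal_rearr \<Omega> u t \<le> ennreal (K * min 1 (measure lebesgue E / (measure lebesgue \<Omega> * t)))"
      using that \<Omega>0 by (intro maximal_rearr_le) auto
    also have "measure lebesgue E / (measure lebesgue \<Omega> * t) = s / t"
      using that \<Omega>0 by simp
    finally have "ennreal (t * base_weight q \<alpha> \<beta> t) * maximal_rearr \<Omega> u t \<le> ennreal (t * base_weight q \<alpha> \<beta> t) * ennreal (K * min 1 (s / t))"
      by (rule mult_left_mono) simp
    also have "\<dots> = ennreal ((t * base_weight q \<alpha> \<beta> t) * (K * min 1 (s / t)))"
      using that base_weight_nonneg[of q \<alpha> \<beta> t] by (intro ennreal_mult[symmetric]) auto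
    also have "(t * base_weight q \<alpha> \<beta> t) * (K * min 1 (s / t)) = K * (base_weight q \<alpha> \<beta> t * \<bar>min t s\<bar>)"
      using that by (simp add: min_def field_simps)
    also have "ennreal \<dots> = ennreal K * ennreal (base_weight q \<alpha> \<beta> t * \<bar>min t s\<bar>)"
      using that base_weight_nonneg[of q \<alpha> \<beta> t] by (intro ennreal_mult) auto
    finally show ?thesis using that by (simp add: weight_eq_base)
  qed
  show thesis
    using adm
  proof (cases rule: L1_admissible_cases)
    case finite
    define p where "p = enn2real q"
    have p: "p \<ge> 1" "recip q = 1 / p" "\<alpha> * p > -1 \<or> \<alpha> * p = -1 \<and> \<beta> * p \<ge> -1"
      using finite by (auto simp: p_def)
    obtain s1 C where sC: "0 < s1" "s1 < 1" "C > 0"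
      "\<And>s. 0 < s \<Longrightarrow> s \<le> s1 \<Longrightarrow>
        (\<integral>\<^sup>+t\<in>{0<..<1}. ennreal (min t s powr p * (log_weight (\<alpha> * p) (\<beta> * p) (ell t) / t)) \<partial>lborel)
         \<le> ennreal (C * (s powr p * log_primitive (\<alpha> * p) (\<beta> * p) (ell s)))"
      using nn_integral_log_weight_upper[OF p(3,1)] by blast
    show thesis
    proof (rule that[of s1 "C powr (1 / p)"])
      fix u :: "real^'n \<Rightarrow> real" and E K s
      assume *: "u \<in> borel_measurable (lebesgue_on \<Omega>)"
       "E \<in> lmeasurable" "(K::real) \<ge> 0" "AE x in lebesgue. x \<in> \<Omega> \<longrightarrow> \<bar>u x\<bar> \<le> K * indicator E x"
       "0 < s" and s1: "s \<le> s1" and E: "measure lebesgue E = measure lebesgue \<Omega> * s"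
      let ?N = "C powr (1 / p) * (s * lz_gauge q \<alpha> \<beta> (ell s))"
      show "LZ_norm q \<alpha> \<beta> \<Omega> u \<le> ennreal (K * ?N)"
        unfolding LZ_norm_eq
      proof (rule Lq_norm_upper_finite[OF finite(1,2) _ *(3) _ _ bound[OF * E]])
        have G: "lz_gauge q \<alpha> \<beta> (ell s) > 0" by (rule gauge_pos[OF ell_ge_1])
        then show "?N \<ge> 0" using * by simp
        show "(\<lambda>t. base_weight q \<alpha> \<beta> t * \<bar>min t s\<bar>) \<in> borel_measurable borel" by measurable
        show "base_weight q \<alpha> \<beta> t * \<bar>min t s\<bar> \<ge> 0" for t
          by (simp add: base_weight_nonneg)
        have "log_primitive (\<alpha> * p) (\<beta> * p) (ell s) > 0" by (rule log_primitive_pos[OF ell_ge_1])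
        then have "?N powr p = C * (s powr p * log_primitive (\<alpha> * p) (\<beta> * p) (ell s))"
          using p(1) sC(3) *(5) by (simp add: gauge_finite[OF p ell_ge_1] powr_mult powr_powr)
        moreover have "(\<integral>\<^sup>+t\<in>{0<..<1}. ennreal ((base_weight q \<alpha> \<beta> t * \<bar>min t s\<bar>) powr p) \<partial>lborel)
           = (\<integral>\<^sup>+t\<in>{0<..<1}. ennreal (min t s powr p * (log_weight (\<alpha> * p) (\<beta> * p) (ell t) / t)) \<partial>lborel)"
          using *(5) by (intro nn_integral_cong)
            (auto simp: indicator_def powr_mult base_weight_nonneg base_weight_finite[OF p(1,2)] mult.commute)
        ultimately show "(\<integral>\<^sup>+t\<in>{0<..<1}. ennreal ((base_weight q \<alpha> \<beta> t * \<bar>min t s\<bar>) powr enn2real q) \<partial>lborel)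
            \<le> ennreal (?N powr enn2real q)"
          using sC(4)[OF *(5) s1] by (simp add: p_def)
      qed
    qed (use sC in auto)
  next
    case infinite
    let ?b = "if \<alpha> > 0 then \<beta> else \<beta> - 1"
    have ab: "\<alpha> - 1 > -1 \<or> \<alpha> - 1 = -1 \<and> ?b \<ge> -1" using infinite(2) by auto
    obtain s1 C where sC: "0 < s1" "s1 < 1" "C > 0"
      "\<And>s t. 0 < s \<Longrightarrow> s \<le> s1 \<Longrightarrow> 0 < t \<Longrightarrow> t < 1 \<Longrightarrow>
        min t s * log_primitive (\<alpha> - 1) ?b (ell t) \<le> C * (s * log_primitive (\<alpha> - 1) ?b (ell s))"
      using log_primitive_min_mult_le[OF ab] by blast
    show thesis
    proof (rule that[of s1 C])
      fix u :: "real^'n \<Rightarrow> real" and E K s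
      assume *: "u \<in> borel_measurable (lebesgue_on \<Omega>)"
       "E \<in> lmeasurable" "(K::real) \<ge> 0" "AE x in lebesgue. x \<in> \<Omega> \<longrightarrow> \<bar>u x\<bar> \<le> K * indicator E x"
       "0 < s" and s1: "s \<le> s1" and E: "measure lebesgue E = measure lebesgue \<Omega> * s"
      have "Lq_norm top (lebesgue_on {0<..<1}) (\<lambda>t. ennreal (t powr (1 - recip q) * ell t powr \<alpha> * ellell t powr \<beta>) * maximal_rearr \<Omega> u t)
          \<le> ennreal (K * (C * (s * lz_gauge q \<alpha> \<beta> (ell s))))"
      proof (rule Lq_norm_upper_top[OF LZ_weight_measurable[OF \<Omega>0 *(1)]])
        fix t :: real assume t: "0 < t" "t < 1"
        note bound[OF * E t]
        also have "\<bar>min t s\<bar> = min t s" using t *(5) by simp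
        also have "ennreal K * ennreal (base_weight q \<alpha> \<beta> t * min t s) = ennreal (K * (base_weight q \<alpha> \<beta> t * min t s))"
          using *(3,5) t base_weight_nonneg[of q \<alpha> \<beta> t] by (intro ennreal_mult[symmetric]) auto
        also have "\<dots> \<le> ennreal (K * (C * (s * lz_gauge q \<alpha> \<beta> (ell s))))"
          using sC(4)[OF *(5) s1 t] *(3) t
          by (intro ennreal_leI mult_left_mono)
             (simp_all add: infinite(1) base_weight_infinite[OF infinite(2)] gauge_infinite(2)[OF infinite(2) ell_ge_1] mult.commute)
        finally show "ennreal (t powr (1 - recip q) * ell t powr \<alpha> * ellell t powr \<beta>) * maximal_rearr \<Omega> u t
           \<le> ennreal (K * (C * (s * lz_gauge q \<alpha> \<beta> (ell s))))" .
      qed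
      then show "LZ_norm q \<alpha> \<beta> \<Omega> u \<le> ennreal (K * (C * (s * lz_gauge q \<alpha> \<beta> (ell s))))"
        unfolding LZ_norm_eq by (simp only: infinite(1))
    qed (use sC in auto)
  qed
qed

section \<open>The gauge at small radii\<close>

lemma gauge_mono:
  assumes adm: "L1_admissible q \<alpha> \<beta>"
  obtains Y where "Y \<ge> 1" "\<And>y z. Y \<le> y \<Longrightarrow> y \<le> z \<Longrightarrow> lz_gauge q \<alpha> \<beta> y \<le> lz_gauge q \<alpha> \<beta> z"
proof -
  have prim: "\<exists>Y\<ge>1. \<forall>y z. Y \<le> y \<longrightarrow> y \<le> z \<longrightarrow> log_primitive a b y \<le> log_primitive a b z"
    if ab: "a > -1 \<or> a = -1 \<and> b \<ge> -1" for a b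
  proof -
    obtain Y c where Y: "Y \<ge> 1" "c > 0"
      "\<And>y. y \<ge> Y \<Longrightarrow> c * log_weight a b y \<le> log_factor a b y * log_weight a b y"
      using log_primitive_bounds[OF ab] by metis
    have "log_primitive a b y \<le> log_primitive a b z" if "Y \<le> y" "y \<le> z" for y z
    proof (rule DERIV_nonneg_imp_nondecreasing[OF that(2)])
      fix x assume "y \<le> x" "x \<le> z"
      then have x: "x \<ge> 1" "x \<ge> Y" using Y(1) that by auto
      have "0 \<le> c * log_weight a b x" using Y(2) log_weight_pos[OF x(1), of a b] by simp
      also have "\<dots> \<le> log_factor a b x * log_weight a b x" by (rule Y(3)[OF x(2)])
      finally show "\<exists>d. (log_primitive a b has_real_derivative d) (at x) \<and> 0 \<le> d"
        using log_primitive_has_derivative[OF ab x(1)] by blast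
    qed
    then show ?thesis using Y(1) by blast
  qed
  show thesis
    using adm
  proof (cases rule: L1_admissible_cases)
    case finite
    define p where "p = enn2real q"
    have p: "p \<ge> 1" "recip q = 1 / p" "\<alpha> * p > -1 \<or> \<alpha> * p = -1 \<and> \<beta> * p \<ge> -1"
      using finite by (auto simp: p_def)
    obtain Y where Y: "Y \<ge> 1" "\<And>y z. Y \<le> y \<Longrightarrow> y \<le> z \<Longrightarrow> log_primitive (\<alpha> * p) (\<beta> * p) y \<le> log_primitive (\<alpha> * p) (\<beta> * p) z"
      using prim[OF p(3)] by blast
    show thesis
    proof (rule that[OF Y(1)])
      fix y z assume yz: "Y \<le> y" "y \<le> z"
      then have "y \<ge> 1" "z \<ge> 1" using Y(1) by auto
      then show "lz_gauge q \<alpha> \<beta> y \<le> lz_gauge q \<alpha> \<beta> z"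
        using Y(2)[OF yz] log_primitive_pos[of y "\<alpha> * p" "\<beta> * p"] p(1)
        by (simp add: gauge_finite[OF p] powr_mono2)
    qed
  next
    case infinite
    let ?b = "if \<alpha> > 0 then \<beta> else \<beta> - 1"
    have ab: "\<alpha> - 1 > -1 \<or> \<alpha> - 1 = -1 \<and> ?b \<ge> -1" using infinite(2) by auto
    obtain Y where Y: "Y \<ge> 1" "\<And>y z. Y \<le> y \<Longrightarrow> y \<le> z \<Longrightarrow> log_primitive (\<alpha> - 1) ?b y \<le> log_primitive (\<alpha> - 1) ?b z"
      using prim[OF ab] by blast
    show thesis
    proof (rule that[OF Y(1)])
      fix y z assume yz: "Y \<le> y" "y \<le> z"
      then have "y \<ge> 1" "z \<ge> 1" using Y(1) by auto
      then show "lz_gauge q \<alpha> \<beta> y \<le> lz_gauge q \<alpha> \<beta> z"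
        using Y(2)[OF yz] unfolding infinite(1) by (simp only: gauge_infinite(2)[OF infinite(2)])
    qed
  qed
qed

text \<open>The denominator of the rates prescribed by \<open>obeys_near_0\<close>: each of them is
  r^(m-n) divided by this function.\<close>

definition log_rate :: "ennreal \<Rightarrow> real \<Rightarrow> real \<Rightarrow> real \<Rightarrow> real" where
  "log_rate q \<alpha> \<beta> r =
     (if \<alpha> > - recip q then ln (exp 1 / r) powr (recip q + \<alpha>) * ln (ln (exp 1 / r)) powr \<beta>
      else if \<beta> > - recip q then ln (ln (exp 1 / r)) powr (recip q + \<beta>)
      else ln (ln (ln (exp 1 / r))) powr recip q)"

lemma eventually_ell_power_eq:
  assumes "K > 0" "n \<ge> 1"
  shows "eventually (\<lambda>r. ell (K * r ^ n) = 1 - ln K - real n * ln r) (at_right 0)"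
proof -
  have "((\<lambda>r::real. K * r ^ n) \<longlongrightarrow> K * 0 ^ n) (at_right 0)"
    by (intro tendsto_intros)
  then have "eventually (\<lambda>r::real. K * r ^ n < 1) (at_right 0)"
    using assms by (intro order_tendstoD(2)[of _ 0]) (auto simp: power_0_left)
  then show ?thesis
    using eventually_at_right_less[of "0::real"]
  proof eventually_elim
    case (elim r)
    then have "0 < K * r ^ n" using assms by simp
    then show ?case using elim assms by (simp add: ell_eq ln_mult ln_realpow)
  qed
qed

text \<open>For small r, \<open>ell (K * r ^ n)\<close> is 1 - ln K - n ln r. Relative to ln(e/r)
  this tends to n, while the iterated logarithms absorb both n and K; hence a power of n appears in
  the first case only and K never.\<close>

lemma gauge_tendsto_log_rate:
  assumes K: "K > 0" and n: "n \<ge> 1"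
  shows "((\<lambda>r. lz_gauge q \<alpha> \<beta> (ell (K * r ^ n)) / log_rate q \<alpha> \<beta> r)
     \<longlongrightarrow> (if \<alpha> > - recip q then real n powr (recip q + \<alpha>) else 1)) (at_right 0)"
proof -
  define k where "k = 1 - ln K"
  define N where "N = real n"
  have N: "N > 0" using n by (simp add: N_def)
  let ?f = "\<lambda>r::real. k - N * ln r"
  have r1: "((\<lambda>r. ?f r / ln (exp 1 / r)) \<longlongrightarrow> N) (at_right 0)"
    using N by real_asymp
  have r2: "((\<lambda>r. (1 + ln (?f r)) / ln (ln (exp 1 / r))) \<longlongrightarrow> 1) (at_right 0)"
    using N by real_asymp
  have r3: "((\<lambda>r. (1 + ln (1 + ln (?f r))) / ln (ln (ln (exp 1 / r)))) \<longlongrightarrow> 1) (at_right 0)"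
    using N by real_asymp
  have e1: "eventually (\<lambda>r. ?f r > 0) (at_right 0)" using N by real_asymp
  have e2: "eventually (\<lambda>r. 1 + ln (?f r) > 0) (at_right 0)" using N by real_asymp
  have e3: "eventually (\<lambda>r. 1 + ln (1 + ln (?f r)) > 0) (at_right 0)" using N by real_asymp
  have g1: "eventually (\<lambda>r::real. ln (exp 1 / r) > 0) (at_right 0)" by real_asymp
  have g2: "eventually (\<lambda>r::real. ln (ln (exp 1 / r)) > 0) (at_right 0)" by real_asymp
  have g3: "eventually (\<lambda>r::real. ln (ln (ln (exp 1 / r))) > 0) (at_right 0)" by real_asymp
  have lim: "((\<lambda>r. lz_gauge q \<alpha> \<beta> (?f r) / log_rate q \<alpha> \<beta> r)
     \<longlongrightarrow> (if \<alpha> > - recip q then real n powr (recip q + \<alpha>) else 1)) (at_right 0)"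
  proof -
    consider "\<alpha> > - recip q" | "\<not> \<alpha> > - recip q" "\<beta> > - recip q" | "\<not> \<alpha> > - recip q" "\<not> \<beta> > - recip q" by linarith
    then show ?thesis
    proof cases
      case 1
      have "((\<lambda>r. (?f r / ln (exp 1 / r)) powr (recip q + \<alpha>) * ((1 + ln (?f r)) / ln (ln (exp 1 / r))) powr \<beta>)
         \<longlongrightarrow> N powr (recip q + \<alpha>) * 1 powr \<beta>) (at_right 0)"
        using N by (intro tendsto_mult tendsto_powr r1 r2 tendsto_const) auto
      moreover have "eventually (\<lambda>r. (?f r / ln (exp 1 / r)) powr (recip q + \<alpha>) * ((1 + ln (?f r)) / ln (ln (exp 1 / r))) powr \<beta>
          = lz_gauge q \<alpha> \<beta> (?f r) / log_rate q \<alpha> \<beta> r) (at_right 0)"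
        using e1 e2 g1 g2 by eventually_elim (use 1 in \<open>simp add: lz_gauge_def log_rate_def powr_divide\<close>)
      ultimately show ?thesis using 1 by (simp add: N_def tendsto_cong)
    next
      case 2
      have "((\<lambda>r. ((1 + ln (?f r)) / ln (ln (exp 1 / r))) powr (recip q + \<beta>)) \<longlongrightarrow> 1 powr (recip q + \<beta>)) (at_right 0)"
        by (intro tendsto_powr r2 tendsto_const) auto
      moreover have "eventually (\<lambda>r. ((1 + ln (?f r)) / ln (ln (exp 1 / r))) powr (recip q + \<beta>)
          = lz_gauge q \<alpha> \<beta> (?f r) / log_rate q \<alpha> \<beta> r) (at_right 0)"
        using e2 g2 by eventually_elim (use 2 in \<open>simp add: lz_gauge_def log_rate_def powr_divide\<close>)
      ultimately show ?thesis using 2 by (simp add: tendsto_cong)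
    next
      case 3
      have "((\<lambda>r. ((1 + ln (1 + ln (?f r))) / ln (ln (ln (exp 1 / r)))) powr recip q) \<longlongrightarrow> 1 powr recip q) (at_right 0)"
        by (intro tendsto_powr r3 tendsto_const) auto
      moreover have "eventually (\<lambda>r. ((1 + ln (1 + ln (?f r))) / ln (ln (ln (exp 1 / r)))) powr recip q
          = lz_gauge q \<alpha> \<beta> (?f r) / log_rate q \<alpha> \<beta> r) (at_right 0)"
        using e3 g3 by eventually_elim (use 3 in \<open>simp add: lz_gauge_def log_rate_def powr_divide\<close>)
      ultimately show ?thesis using 3 by (simp add: tendsto_cong)
    qed
  qed
  have "eventually (\<lambda>r. lz_gauge q \<alpha> \<beta> (?f r) / log_rate q \<alpha> \<beta> r = lz_gauge q \<alpha> \<beta> (ell (K * r ^ n)) / log_rate q \<alpha> \<beta> r) (at_right 0)"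
    using eventually_ell_power_eq[OF K n] by eventually_elim (simp add: k_def N_def)
  from Lim_transform_eventually[OF lim this] show ?thesis .
qed

text \<open>Replacing r by 2r replaces K by 2^n K, which does not change the limit against
  \<open>log_rate\<close>, so the quotient of the two gauges tends to 1. The constant 3/2 is one
  that is still below 1 after multiplication by 1/2, the gain from a power of r.\<close>

lemma gauge_doubling:
  assumes adm: "L1_admissible q \<alpha> \<beta>" and K: "K > 0" and n: "n \<ge> 1"
  obtains r0 where "r0 > 0"
    "\<And>r. 0 < r \<Longrightarrow> r < r0 \<Longrightarrow> lz_gauge q \<alpha> \<beta> (ell (K * r ^ n)) \<le> 3 / 2 * lz_gauge q \<alpha> \<beta> (ell (K * (2 * r) ^ n))"
proof -
  let ?\<kappa> = "if \<alpha> > - recip q then real n powr (recip q + \<alpha>) else 1"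
  have \<kappa>: "?\<kappa> > 0" using n by simp
  have "((\<lambda>r. (lz_gauge q \<alpha> \<beta> (ell (K * r ^ n)) / log_rate q \<alpha> \<beta> r)
        / (lz_gauge q \<alpha> \<beta> (ell ((K * 2 ^ n) * r ^ n)) / log_rate q \<alpha> \<beta> r)) \<longlongrightarrow> ?\<kappa> / ?\<kappa>) (at_right 0)"
    using \<kappa> K by (intro tendsto_divide gauge_tendsto_log_rate n) auto
  then have "eventually (\<lambda>r. (lz_gauge q \<alpha> \<beta> (ell (K * r ^ n)) / log_rate q \<alpha> \<beta> r)
        / (lz_gauge q \<alpha> \<beta> (ell ((K * 2 ^ n) * r ^ n)) / log_rate q \<alpha> \<beta> r) < 3 / 2) (at_right 0)"
    using \<kappa> by (intro order_tendstoD(2)) auto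
  moreover have "eventually (\<lambda>r. lz_gauge q \<alpha> \<beta> (ell (K * r ^ n)) / log_rate q \<alpha> \<beta> r > 0) (at_right 0)"
    using \<kappa> by (intro order_tendstoD(1)[OF gauge_tendsto_log_rate[OF K n]])
  ultimately have "eventually (\<lambda>r. lz_gauge q \<alpha> \<beta> (ell (K * r ^ n)) \<le> 3 / 2 * lz_gauge q \<alpha> \<beta> (ell (K * (2 * r) ^ n))) (at_right 0)"
  proof eventually_elim
    case (elim r)
    have g: "lz_gauge q \<alpha> \<beta> (ell (K * 2 ^ n * r ^ n)) > 0" by (rule gauge_pos[OF ell_ge_1])
    have "log_rate q \<alpha> \<beta> r \<noteq> 0" using elim(2) by auto
    then have "lz_gauge q \<alpha> \<beta> (ell (K * r ^ n)) / lz_gauge q \<alpha> \<beta> (ell ((K * 2 ^ n) * r ^ n)) < 3 / 2"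
      using elim(1) by simp
    then show ?case using g by (simp add: divide_less_eq power_mult_distrib mult.assoc)
  qed
  then obtain r0 where "r0 > 0" "\<And>r. 0 < r \<Longrightarrow> r < r0 \<Longrightarrow> lz_gauge q \<alpha> \<beta> (ell (K * r ^ n)) \<le> 3 / 2 * lz_gauge q \<alpha> \<beta> (ell (K * (2 * r) ^ n))"
    by (auto simp: eventually_at_right_field)
  then show thesis using that by blast
qed

lemma gauge_antimono:
  assumes adm: "L1_admissible q \<alpha> \<beta>" and K: "K > 0" and n: "n \<ge> 1"
  obtains r0 where "r0 > 0"
    "\<And>r R. 0 < r \<Longrightarrow> r \<le> R \<Longrightarrow> R < r0 \<Longrightarrow> lz_gauge q \<alpha> \<beta> (ell (K * R ^ n)) \<le> lz_gauge q \<alpha> \<beta> (ell (K * r ^ n))"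
proof -
  obtain Y where Y: "Y \<ge> 1" "\<And>y z. Y \<le> y \<Longrightarrow> y \<le> z \<Longrightarrow> lz_gauge q \<alpha> \<beta> y \<le> lz_gauge q \<alpha> \<beta> z"
    using gauge_mono[OF adm] by blast
  obtain s where s: "0 < s" "s < 1" "\<And>t. 0 < t \<Longrightarrow> t \<le> s \<Longrightarrow> ell t \<ge> Y"
    using eventually_ell_ge by blast
  have "((\<lambda>r::real. K * r ^ n) \<longlongrightarrow> K * 0 ^ n) (at_right 0)"
    by (intro tendsto_intros)
  then have "eventually (\<lambda>r::real. K * r ^ n < s) (at_right 0)"
    using s n by (intro order_tendstoD(2)[of _ 0]) (auto simp: power_0_left)
  then obtain r0 where r0: "r0 > 0" "\<And>r. 0 < r \<Longrightarrow> r < r0 \<Longrightarrow> K * r ^ n < s"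
    by (auto simp: eventually_at_right_field)
  show thesis
  proof (rule that[OF r0(1)])
    fix r R :: real assume r: "0 < r" "r \<le> R" "R < r0"
    have "K * r ^ n \<le> K * R ^ n" using r K by (intro mult_left_mono power_mono) auto
    moreover have "K * R ^ n < s" "0 < K * R ^ n" "0 < K * r ^ n" using r K r0(2)[of R] by auto
    ultimately show "lz_gauge q \<alpha> \<beta> (ell (K * R ^ n)) \<le> lz_gauge q \<alpha> \<beta> (ell (K * r ^ n))"
      using s by (intro Y(2) s(3) ell_antimono) auto
  qed
qed

lemma log_rate_pos:
  "eventually (\<lambda>r. log_rate q \<alpha> \<beta> r > 0) (at_right 0)"
proof -
  have "eventually (\<lambda>r::real. ln (exp 1 / r) > 0) (at_right 0)" by real_asymp
  moreover have "eventually (\<lambda>r::real. ln (ln (exp 1 / r)) > 0) (at_right 0)" by real_asymp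
  moreover have "eventually (\<lambda>r::real. ln (ln (ln (exp 1 / r))) > 0) (at_right 0)" by real_asymp
  ultimately show ?thesis
    by eventually_elim (auto simp: log_rate_def intro!: mult_pos_pos)
qed

text \<open>From here on the three cases are one: the prescribed rate is r^(m-n) over
  \<open>log_rate\<close>, and the gauge is comparable to \<open>log_rate\<close> whatever K is. The
  freedom in K absorbs the volume of \<Omega>.\<close>

lemma obeys_near_0_gauge:
  assumes adm: "L1_admissible q \<alpha> \<beta>" and K: "K > 0" and n: "n \<ge> 1" and \<psi>: "obeys_near_0 n m q \<alpha> \<beta> \<psi>"
  shows "\<exists>c>0. \<exists>r0>0. \<forall>r. 0 < r \<longrightarrow> r < r0 \<longrightarrow>
    r powr (real m - real n) / lz_gauge q \<alpha> \<beta> (ell (K * r ^ n)) \<le> c * \<psi> r \<and>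
    \<psi> r \<le> c * (r powr (real m - real n) / lz_gauge q \<alpha> \<beta> (ell (K * r ^ n)))"
proof -
  have "equiv_near_0 \<psi> (\<lambda>r. r powr (real m - real n) / log_rate q \<alpha> \<beta> r)"
  proof -
    have q: "1 \<le> q" using adm by (auto simp: L1_admissible_def)
    consider "\<alpha> > - recip q" | "\<alpha> = - recip q" "\<beta> > - recip q" | "q < top" "\<alpha> = - recip q" "\<beta> = - recip q"
      using adm by (auto simp: L1_admissible_def)
    then show ?thesis
    proof cases
      case 1
      then have "(\<lambda>r. r powr (real m - real n) / log_rate q \<alpha> \<beta> r) = (\<lambda>r. r powr (real m - real n)
          * ln (exp 1 / r) powr (- recip q - \<alpha>) * ln (ln (exp 1 / r)) powr (- \<beta>))"
        by (auto simp: log_rate_def powr_minus_divide fun_eq_iff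
            intro!: arg_cong2[where f = times] simp: minus_add_distrib[symmetric] simp del: minus_add_distrib)
          (simp add: powr_diff powr_minus_divide powr_add mult.commute)?
      then show ?thesis using \<psi> q 1 by (simp add: obeys_near_0_def)
    next
      case 2
      then have "(\<lambda>r. r powr (real m - real n) / log_rate q \<alpha> \<beta> r) = (\<lambda>r. r powr (real m - real n)
          * ln (ln (exp 1 / r)) powr (- recip q - \<beta>))"
        by (simp add: log_rate_def powr_diff powr_minus_divide powr_add fun_eq_iff)
      then show ?thesis using \<psi> q 2 by (simp add: obeys_near_0_def)
    next
      case 3
      then have "(\<lambda>r. r powr (real m - real n) / log_rate q \<alpha> \<beta> r) = (\<lambda>r. r powr (real m - real n)
          * ln (ln (ln (exp 1 / r))) powr (- recip q))"
        by (simp add: log_rate_def powr_minus_divide fun_eq_iff)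
      then show ?thesis using \<psi> q 3 by (simp add: obeys_near_0_def)
    qed
  qed
  then obtain c1 r1 where c1: "c1 > 0" "r1 > 0"
    "\<And>r. 0 < r \<Longrightarrow> r < r1 \<Longrightarrow> inverse c1 * (r powr (real m - real n) / log_rate q \<alpha> \<beta> r) \<le> \<psi> r"
    "\<And>r. 0 < r \<Longrightarrow> r < r1 \<Longrightarrow> \<psi> r \<le> c1 * (r powr (real m - real n) / log_rate q \<alpha> \<beta> r)"
    unfolding equiv_near_0_def by (metis greaterThanLessThan_iff)
  let ?\<kappa> = "if \<alpha> > - recip q then real n powr (recip q + \<alpha>) else 1"
  have \<kappa>: "?\<kappa> > 0" using n by simp
  define \<kappa>' where "\<kappa>' = ?\<kappa>"
  have \<kappa>': "\<kappa>' > 0" using \<kappa> by (simp add: \<kappa>'_def)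
  have lim: "((\<lambda>r. lz_gauge q \<alpha> \<beta> (ell (K * r ^ n)) / log_rate q \<alpha> \<beta> r) \<longlongrightarrow> \<kappa>') (at_right 0)"
    using gauge_tendsto_log_rate[OF K n] by (simp add: \<kappa>'_def)
  have "eventually (\<lambda>r. lz_gauge q \<alpha> \<beta> (ell (K * r ^ n)) / log_rate q \<alpha> \<beta> r > \<kappa>' / 2
      \<and> lz_gauge q \<alpha> \<beta> (ell (K * r ^ n)) / log_rate q \<alpha> \<beta> r < 2 * \<kappa>' \<and> log_rate q \<alpha> \<beta> r > 0) (at_right 0)"
    using \<kappa>' by (intro eventually_conj order_tendstoD[OF lim] log_rate_pos) auto
  then obtain r2 where r2: "r2 > 0" "\<And>r. 0 < r \<Longrightarrow> r < r2 \<Longrightarrow> lz_gauge q \<alpha> \<beta> (ell (K * r ^ n)) / log_rate q \<alpha> \<beta> r > \<kappa>' / 2"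
    "\<And>r. 0 < r \<Longrightarrow> r < r2 \<Longrightarrow> lz_gauge q \<alpha> \<beta> (ell (K * r ^ n)) / log_rate q \<alpha> \<beta> r < 2 * \<kappa>'"
    "\<And>r. 0 < r \<Longrightarrow> r < r2 \<Longrightarrow> log_rate q \<alpha> \<beta> r > 0"
    unfolding eventually_at_right_field by metis
  \<comment> \<open>One entry for each inequality, as the quotient of gauge and rate lies between
    \<kappa>' / 2 and 2 \<kappa>'.\<close>
  define c where "c = max (2 / \<kappa>' * c1) (2 * \<kappa>' * c1)"
  have c: "c \<ge> 2 / \<kappa>' * c1" "c \<ge> 2 * \<kappa>' * c1" by (auto simp: c_def)
  show ?thesis
  proof (rule exI[of _ c], intro conjI exI[of _ "min r1 r2"] allI impI)
    show "c > 0" using c1 \<kappa>' c(2) by (meson less_le_trans mult_pos_pos zero_less_numeral)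
    show "min r1 r2 > 0" using c1 r2 by simp
    fix r assume r: "0 < r" "r < min r1 r2"
    define X G P where "X = log_rate q \<alpha> \<beta> r" and "G = lz_gauge q \<alpha> \<beta> (ell (K * r ^ n))" and "P = r powr (real m - real n)"
    have X: "X > 0" using r2(4)[of r] r by (simp add: X_def)
    have G: "G > 0" unfolding G_def by (rule gauge_pos[OF ell_ge_1])
    have P: "P > 0" using r by (simp add: P_def)
    have GX: "\<kappa>' / 2 * X < G" "G < 2 * \<kappa>' * X"
      using r2(2,3)[of r] r X by (auto simp: X_def[symmetric] G_def[symmetric] field_simps)
    have \<psi>1: "P / X \<le> c1 * \<psi> r"
    proof -
      have "inverse c1 * (P / X) \<le> \<psi> r" using c1(3)[of r] r by (simp add: X_def P_def)
      then have "c1 * (inverse c1 * (P / X)) \<le> c1 * \<psi> r" using c1(1) by (intro mult_left_mono) auto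
      moreover have "c1 * (inverse c1 * y) = y" for y using c1(1) by simp
      ultimately show ?thesis by simp
    qed
    have \<psi>2: "\<psi> r \<le> c1 * (P / X)" using c1(4)[of r] r by (simp add: X_def P_def)
    have "0 \<le> P / X" using X P by simp
    then have "0 \<le> c1 * \<psi> r" using \<psi>1 by linarith
    then have \<psi>0: "\<psi> r \<ge> 0" using c1(1) by (simp add: zero_le_mult_iff)
    have "P / G \<le> P / (\<kappa>' / 2 * X)" using GX X G P \<kappa>' by (intro divide_left_mono mult_pos_pos) auto
    also have "\<dots> = 2 / \<kappa>' * (P / X)" by simp
    also have "\<dots> \<le> 2 / \<kappa>' * (c1 * \<psi> r)" using \<psi>1 \<kappa>' by (intro mult_left_mono) auto
    also have "\<dots> \<le> c * \<psi> r" using c(1) \<psi>0 by (simp add: mult.assoc[symmetric] mult_right_mono del: times_divide_eq_left)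
    finally show "P / G \<le> c * \<psi> r" .
    have "P / X = 2 * \<kappa>' * (P / (2 * \<kappa>' * X))" using \<kappa>' by simp
    also have "\<dots> \<le> 2 * \<kappa>' * (P / G)"
      using GX X G P \<kappa>' by (intro mult_left_mono divide_left_mono mult_pos_pos) auto
    finally have "c1 * (P / X) \<le> c1 * (2 * \<kappa>' * (P / G))" using c1 by (intro mult_left_mono) auto
    also have "\<dots> \<le> c * (P / G)" using c(2) P G mult_right_mono[of "2 * \<kappa>' * c1" c "P / G"] by (simp add: mult_ac)
    finally show "\<psi> r \<le> c * (P / G)" using \<psi>2 by linarith
  qed
qed

section \<open>John domains and chains of balls\<close>

text \<open>Appending s and t to a subdivision of [0, s] gives a subdivision of [0, t] whose polygon
  is longer by at least the chord. Taking the supremum over the former yields s plus the chord <=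
  t.\<close>

lemma arc_length_param_dist_le:
  assumes \<gamma>: "arc_length_param \<gamma> l" and st: "0 \<le> s" "s \<le> t" "t \<le> l"
  shows "dist (\<gamma> s) (\<gamma> t) \<le> t - s"
proof -
  let ?d = "dist (\<gamma> s) (\<gamma> t)"
  let ?\<Sigma> = "\<lambda>ts. \<Sum>i<length ts - 1. dist (\<gamma> (ts ! i)) (\<gamma> (ts ! Suc i))"
  have len: "curve_length \<gamma> 0 r = ennreal r" if "0 \<le> r" "r \<le> l" for r
    using \<gamma> that by (auto simp: arc_length_param_def)
  have key: "?\<Sigma> ts + ?d \<le> t" if ts: "sorted ts" "set ts \<subseteq> {0..s}" for ts
  proof -
    let ?us = "ts @ [s, t]"
    have "sorted ?us" using ts st by (fastforce simp: sorted_append)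
    moreover have "set ?us \<subseteq> {0..t}" using ts st by auto
    ultimately have "(\<Sum>i<length ?us - 1. ennreal (dist (\<gamma> (?us ! i)) (\<gamma> (?us ! Suc i)))) \<le> curve_length \<gamma> 0 t"
      unfolding curve_length_def by (intro SUP_upper) auto
    then have "?\<Sigma> ?us \<le> t"
      using len[of t] st by (simp add: sum_ennreal del: length_append)
    moreover have "?\<Sigma> ts + ?d \<le> ?\<Sigma> ?us"
    proof -
      \<comment> \<open>Index \<open>length ts\<close> is the segment from s to t. The segment
        joining the last point of \<open>ts\<close> to s, if there is one, is discarded.\<close>
      have "?\<Sigma> ts + ?d = (\<Sum>i\<in>{..<length ts - 1} \<union> {length ts}. dist (\<gamma> (?us ! i)) (\<gamma> (?us ! Suc i)))"
        by (subst sum.union_disjoint) (auto simp: nth_append intro!: sum.cong)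
      also have "\<dots> \<le> ?\<Sigma> ?us" by (rule sum_mono2) auto
      finally show ?thesis .
    qed
    ultimately show ?thesis by linarith
  qed
  have d: "?d \<le> t" using key[of "[]"] by simp
  have "ennreal s = curve_length \<gamma> 0 s" using len[of s] st by simp
  also have "\<dots> \<le> ennreal (t - ?d)"
    unfolding curve_length_def
  proof (rule SUP_least)
    fix ts assume "ts \<in> {ts. sorted ts \<and> set ts \<subseteq> {0..s}}"
    then have "?\<Sigma> ts \<le> t - ?d" using key[of ts] by simp
    then show "(\<Sum>i<length ts - 1. ennreal (dist (\<gamma> (ts ! i)) (\<gamma> (ts ! Suc i)))) \<le> ennreal (t - ?d)"
      by (simp add: sum_ennreal ennreal_leI)
  qed
  finally show ?thesis using d by (simp add: ennreal_le_iff)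
qed

text \<open>A segment from y to a point outside \<Omega> meets the frontier, and no farther from y
  than its end point.\<close>

lemma ball_infdist_frontier_subset:
  fixes y :: "'a::real_normed_vector"
  assumes "y \<in> \<Omega>" shows "ball y (infdist y (frontier \<Omega>)) \<subseteq> \<Omega>"
proof
  fix z assume z: "z \<in> ball y (infdist y (frontier \<Omega>))"
  show "z \<in> \<Omega>"
  proof (rule ccontr)
    assume "z \<notin> \<Omega>"
    then have "closed_segment y z \<inter> frontier \<Omega> \<noteq> {}"
      using assms by (intro connected_Int_frontier) (auto intro: ends_in_segment)
    then obtain w where w: "w \<in> closed_segment y z" "w \<in> frontier \<Omega>" by blast
    have "infdist y (frontier \<Omega>) \<le> dist y w" using w(2) by (rule infdist_le)
    also have "\<dots> \<le> dist y z" using segment_bound1[OF w(1)] by (simp add: dist_norm norm_minus_commute)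
    finally show False using z by simp
  qed
qed

text \<open>Following the John curve of the centre of a ball \<open>B\<close> for a length comparable to the radius of \<open>B\<close>
  leads, through boundedly many comparable balls, to a ball of twice the radius.\<close>

lemma John_domain_doubling_chain:
  fixes \<Omega> :: "(real^'n) set"
  assumes "John_domain \<Omega>"
  obtains d \<kappa> :: real and N :: nat where "d > 0" "0 < \<kappa>" "\<kappa> \<le> 1 / 4"
    "\<And>x r. 0 < r \<Longrightarrow> 2 * r \<le> d \<Longrightarrow> ball x r \<subseteq> \<Omega> \<Longrightarrow>
       \<exists>y. y 0 = x \<and> (\<forall>i\<le>N. ball (y i) (2 * (\<kappa> * r)) \<subseteq> \<Omega>) \<and>
         (\<forall>i<N. dist (y i) (y (Suc i)) \<le> \<kappa> * r) \<and> ball (y N) (2 * r) \<subseteq> \<Omega>"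
proof -
  from assms obtain x0 c where open\<Omega>: "open \<Omega>" and x0: "x0 \<in> \<Omega>" and c: "0 < c" "c < 1"
    and curve: "\<And>x. x \<in> \<Omega> \<Longrightarrow> \<exists>\<gamma> l. arc_length_param \<gamma> l \<and> \<gamma> ` {0..l} \<subseteq> \<Omega> \<and> \<gamma> 0 = x \<and> \<gamma> l = x0 \<and>
        (\<forall>r\<in>{0..l}. infdist (\<gamma> r) (frontier \<Omega>) \<ge> c * r)"
    unfolding John_domain_def by auto
  obtain d where d: "d > 0" "ball x0 d \<subseteq> \<Omega>" using open\<Omega> x0 open_contains_ball by blast
  \<comment> \<open>At arc length t <= r/2 the ball B itself contains a ball of radius r - t >= r/2
    around the curve point; for t > r/2 the John condition provides radius c t > c r/2. Both are at
    least 2 \<kappa> r. N steps of length \<kappa> r lead to arc length at least 2r/c, where the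
    John radius is 2r.\<close>
  define \<kappa> where "\<kappa> = c / 4"
  define N where "N = nat \<lceil>8 / c\<^sup>2\<rceil>"
  show thesis
  proof (rule that[of d \<kappa> N])
    fix x r assume r: "0 < r" "2 * r \<le> d" and B: "ball x r \<subseteq> \<Omega>"
    then have "x \<in> \<Omega>" by auto
    from curve[OF this] obtain \<gamma> l where \<gamma>: "arc_length_param \<gamma> l" "\<gamma> ` {0..l} \<subseteq> \<Omega>" "\<gamma> 0 = x" "\<gamma> l = x0"
      "\<And>t. t \<in> {0..l} \<Longrightarrow> infdist (\<gamma> t) (frontier \<Omega>) \<ge> c * t" by blast
    have l: "l \<ge> 0" using \<gamma>(1) by (simp add: arc_length_param_def)
    \<comment> \<open>A curve that ends too early makes the chain rest at x0, whose ball of radius d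
      contains the ball of radius 2r.\<close>
    define t where "t i = min l (real i * (\<kappa> * r))" for i :: nat
    have \<kappa>r: "\<kappa> * r > 0" using c r by (simp add: \<kappa>_def)
    have t: "t i \<in> {0..l}" for i using l \<kappa>r by (simp add: t_def)
    have far: "ball (\<gamma> s) (c * s) \<subseteq> \<Omega>" if "s \<in> {0..l}" for s
      using ball_infdist_frontier_subset[of "\<gamma> s" \<Omega>] \<gamma>(2) \<gamma>(5)[OF that] that
      by (meson image_subset_iff order_trans subset_ball)
    have near: "ball (\<gamma> s) (r - s) \<subseteq> \<Omega>" if "s \<in> {0..l}" for s
    proof -
      have "dist x (\<gamma> s) \<le> s" using arc_length_param_dist_le[OF \<gamma>(1), of 0 s] that \<gamma>(3) by simp
      have "ball (\<gamma> s) (r - s) \<subseteq> ball x r"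
      proof
        fix z assume "z \<in> ball (\<gamma> s) (r - s)"
        then show "z \<in> ball x r"
          using dist_triangle[of x z "\<gamma> s"] \<open>dist x (\<gamma> s) \<le> s\<close> by simp
      qed
      with B show ?thesis by simp
    qed
    have 1: "ball (\<gamma> (t i)) (2 * (\<kappa> * r)) \<subseteq> \<Omega>" for i
    proof (cases "t i \<le> r / 2")
      case True
      have "c * r \<le> r" using c r mult_right_mono[of c 1 r] by simp
      then have "2 * (\<kappa> * r) \<le> r - t i" using True by (simp add: \<kappa>_def)
      then show ?thesis using near[OF t[of i]] by (meson order_trans subset_ball)
    next
      case False
      then have "c * (r / 2) \<le> c * t i" using c by (intro mult_left_mono) auto
      then have "2 * (\<kappa> * r) \<le> c * t i" by (simp add: \<kappa>_def)
      then show ?thesis using far[OF t[of i]] by (meson order_trans subset_ball)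
    qed
    have 2: "dist (\<gamma> (t i)) (\<gamma> (t (Suc i))) \<le> \<kappa> * r" for i
    proof -
      have "t i \<le> t (Suc i)" "t (Suc i) - t i \<le> \<kappa> * r"
        using \<kappa>r by (auto simp: t_def min_def algebra_simps)
      then show ?thesis
        using arc_length_param_dist_le[OF \<gamma>(1), of "t i" "t (Suc i)"] t[of i] t[of "Suc i"] by auto
    qed
    have 3: "ball (\<gamma> (t N)) (2 * r) \<subseteq> \<Omega>"
    proof (cases "l \<le> real N * (\<kappa> * r)")
      case True
      then have "\<gamma> (t N) = x0" using \<gamma>(4) by (simp add: t_def)
      then show ?thesis using d(2) r(2) by (metis order_trans subset_ball)
    next
      case False
      then have tN: "t N = real N * (\<kappa> * r)" by (simp add: t_def)
      have "8 / c\<^sup>2 \<le> real N" by (simp add: N_def)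
      then have "8 / c\<^sup>2 * (c * (\<kappa> * r)) \<le> real N * (c * (\<kappa> * r))"
        using c \<kappa>r by (intro mult_right_mono) auto
      moreover have "8 / c\<^sup>2 * (c * (\<kappa> * r)) = 2 * r"
        using c by (simp add: \<kappa>_def power2_eq_square)
      ultimately have "2 * r \<le> c * t N" by (simp add: tN mult_ac)
      then show ?thesis using far[OF t[of N]] by (meson order_trans subset_ball)
    qed
    show "\<exists>y. y 0 = x \<and> (\<forall>i\<le>N. ball (y i) (2 * (\<kappa> * r)) \<subseteq> \<Omega>) \<and>
         (\<forall>i<N. dist (y i) (y (Suc i)) \<le> \<kappa> * r) \<and> ball (y N) (2 * r) \<subseteq> \<Omega>"
      using 1 2 3 \<gamma>(3) l by (intro exI[of _ "\<lambda>i. \<gamma> (t i)"]) (auto simp: t_def)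
  qed (use d c in \<open>auto simp: \<kappa>_def\<close>)
qed

section \<open>Means over balls along a chain\<close>

lemma measure_ball_pos: "r > 0 \<Longrightarrow> measure lebesgue (ball (c::real^'n) r) > 0"
  using content_ball_pos[of r c] by simp

lemma measure_ball_eq: "r \<ge> 0 \<Longrightarrow> measure lebesgue (ball (c::real^'n) r) = unit_ball_vol (real CARD('n)) * r ^ CARD('n)"
  using content_ball[of r c] by simp

lemma ball_lmeasurable: "ball (c::real^'n) r \<in> lmeasurable"
  by simp

lemma set_integrable_const_ball: "set_integrable lebesgue (ball (c::real^'n) r) (\<lambda>_. k :: real)"
  unfolding set_integrable_def
  by (simp add: lmeasurable_iff_integrable[symmetric])

definition oscillation :: "(real^'n) set \<Rightarrow> (real^'n \<Rightarrow> real) \<Rightarrow> real" where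
  "oscillation B v = (LINT x:B|lebesgue. \<bar>v x - mean B v\<bar>)"

text \<open>The difference is the average over the small ball of v minus a constant, namely the mean
  over the large ball, and its integral is bounded by the one over the large ball.\<close>

lemma mean_diff_le:
  fixes v :: "real^'n \<Rightarrow> real"
  assumes v: "set_integrable lebesgue (ball y R) v" and sub: "ball z r \<subseteq> ball y R" and r: "0 < r"
  shows "\<bar>mean (ball z r) v - mean (ball y R) v\<bar> \<le> oscillation (ball y R) v / measure lebesgue (ball z r)"
proof -
  let ?B = "ball y R" and ?b = "ball z r"
  let ?m = "mean ?B v" and ?\<mu> = "measure lebesgue ?b"
  have \<mu>: "?\<mu> > 0" by (rule measure_ball_pos[OF r])
  have vb: "set_integrable lebesgue ?b v" by (rule set_integrable_subset[OF v _ sub]) simp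
  have db: "set_integrable lebesgue ?b (\<lambda>x. v x - ?m)" "set_integrable lebesgue ?B (\<lambda>x. v x - ?m)"
    using vb v set_integrable_const_ball by (auto intro: set_integral_diff)
  have "(LINT x:?b|lebesgue. ?m) = ?\<mu> * ?m"
    using emeasure_lborel_ball_finite[of z r] by (subst set_integral_const) auto
  then have "?\<mu> * (mean ?b v - ?m) = (LINT x:?b|lebesgue. v x) - (LINT x:?b|lebesgue. ?m)"
    using \<mu> by (auto simp: mean_def right_diff_distrib)
  also have "\<dots> = (LINT x:?b|lebesgue. v x - ?m)"
    using vb set_integrable_const_ball by (simp add: set_integral_diff)
  finally have "?\<mu> * \<bar>mean ?b v - ?m\<bar> = \<bar>LINT x:?b|lebesgue. v x - ?m\<bar>"
    using \<mu> by (metis abs_mult abs_of_pos)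
  also have "\<dots> \<le> (LINT x:?b|lebesgue. \<bar>v x - ?m\<bar>)"
  proof -
    have "\<bar>LINT x:?b|lebesgue. v x - ?m\<bar> \<le> (\<integral>x. norm (indicator ?b x *\<^sub>R (v x - ?m)) \<partial>lebesgue)"
      unfolding set_lebesgue_integral_def real_norm_def[symmetric] by (rule integral_norm_bound)
    also have "\<dots> = (LINT x:?b|lebesgue. \<bar>v x - ?m\<bar>)"
      unfolding set_lebesgue_integral_def by (intro Bochner_Integration.integral_cong) (auto simp: abs_mult)
    finally show ?thesis .
  qed
  also have "\<dots> \<le> oscillation ?B v"
    unfolding oscillation_def set_lebesgue_integral_def
  proof (rule integral_mono)
    show "integrable lebesgue (\<lambda>x. indicator ?b x *\<^sub>R \<bar>v x - ?m\<bar>)" "integrable lebesgue (\<lambda>x. indicator ?B x *\<^sub>R \<bar>v x - ?m\<bar>)"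
      using db[THEN set_integrable_abs] by (simp_all only: set_integrable_def)
    show "indicator ?b x *\<^sub>R \<bar>v x - ?m\<bar> \<le> indicator ?B x *\<^sub>R \<bar>v x - ?m\<bar>" for x
      using sub by (auto simp: indicator_def)
  qed
  finally show ?thesis using \<mu> by (simp add: field_simps)
qed

text \<open>One chain leads from radius r to 2r and changes the mean by at most A C1 H(r). Since H
  shrinks by \<theta> < 1 per doubling, the total change up to a fixed radius is a geometric sum
  dominated by its first term, and at that radius the mean is bounded by the integral over \<Omega>.
  H stays abstract so that only comparability, decay and a lower bound away from 0 have to be
  checked.\<close>

lemma chain_mean_bound:
  fixes \<Omega> :: "(real^'n) set" and H :: "real \<Rightarrow> real"
  assumes \<Omega>: "John_domain \<Omega>" and R0: "R0 > 0"
    and Hpos: "\<And>r. 0 < r \<Longrightarrow> r \<le> R0 \<Longrightarrow> H r > 0"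
    and Hcomp: "\<And>\<kappa>. 0 < \<kappa> \<Longrightarrow> \<exists>D. \<forall>r R. 0 < r \<longrightarrow> \<kappa> * r \<le> R \<longrightarrow> R \<le> 2 * r \<longrightarrow> 2 * r \<le> R0 \<longrightarrow> H R \<le> D * H r"
    and Hdec: "\<And>r. 0 < r \<Longrightarrow> 2 * r \<le> R0 \<Longrightarrow> H (2 * r) \<le> \<theta> * H r" and \<theta>: "0 \<le> \<theta>" "\<theta> < 1"
    and Hlow: "\<And>\<rho>. 0 < \<rho> \<Longrightarrow> \<exists>h>0. \<forall>r. \<rho> \<le> r \<longrightarrow> r \<le> R0 \<longrightarrow> h \<le> H r"
  obtains R1 C where "0 < R1" "R1 \<le> R0" "C \<ge> 0"
    "\<And>v A x r. set_integrable lebesgue \<Omega> v \<Longrightarrow> A \<ge> 0 \<Longrightarrow>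
      (\<And>y R. 0 < R \<Longrightarrow> R \<le> R0 \<Longrightarrow> ball y R \<subseteq> \<Omega> \<Longrightarrow> oscillation (ball y R) v \<le> A * H R * measure lebesgue (ball y R)) \<Longrightarrow>
      (LINT x:\<Omega>|lebesgue. \<bar>v x\<bar>) \<le> A \<Longrightarrow> 0 < r \<Longrightarrow> r \<le> R1 \<Longrightarrow> ball x r \<subseteq> \<Omega> \<Longrightarrow>
      \<bar>mean (ball x r) v\<bar> \<le> A * (C * H r)"
proof -
  obtain d \<kappa> N where dk: "d > 0" "0 < \<kappa>" "\<kappa> \<le> 1 / 4"
    "\<And>x r. 0 < r \<Longrightarrow> 2 * r \<le> d \<Longrightarrow> ball x r \<subseteq> \<Omega> \<Longrightarrow>
       \<exists>y. y 0 = x \<and> (\<forall>i\<le>N. ball (y i) (2 * (\<kappa> * r)) \<subseteq> \<Omega>) \<and>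
         (\<forall>i<N. dist (y i) (y (Suc i)) \<le> \<kappa> * r) \<and> ball (y N) (2 * r) \<subseteq> \<Omega>"
    using John_domain_doubling_chain[OF \<Omega>] by metis
  have open\<Omega>: "open \<Omega>" using \<Omega> by (simp add: John_domain_def)
  define n where "n = CARD('n)"
  define R1 where "R1 = min R0 d"
  have R1: "0 < R1" "R1 \<le> R0" "R1 \<le> d" using R0 dk by (auto simp: R1_def)
  obtain h where h: "h > 0" and Hlow': "\<And>r. R1 / 2 \<le> r \<Longrightarrow> r \<le> R0 \<Longrightarrow> h \<le> H r"
    using Hlow[of "R1 / 2"] R1 by auto
  obtain D0 where D0: "\<And>r R. 0 < r \<Longrightarrow> \<kappa> * r \<le> R \<Longrightarrow> R \<le> 2 * r \<Longrightarrow> 2 * r \<le> R0 \<Longrightarrow> H R \<le> D0 * H r"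
    using Hcomp[OF dk(2)] by blast
  define D where "D = max D0 1"
  have D: "D \<ge> 1" "\<And>r R. 0 < r \<Longrightarrow> \<kappa> * r \<le> R \<Longrightarrow> R \<le> 2 * r \<Longrightarrow> 2 * r \<le> R0 \<Longrightarrow> H R \<le> D * H r"
  proof -
    fix r R :: real assume *: "0 < r" "\<kappa> * r \<le> R" "R \<le> 2 * r" "2 * r \<le> R0"
    have "H r > 0" using * by (intro Hpos) auto
    then have "D0 * H r \<le> D * H r" by (intro mult_right_mono) (auto simp: D_def)
    then show "H R \<le> D * H r" using D0[OF *] by linarith
  qed (simp add: D_def)
  define \<omega> where "\<omega> = unit_ball_vol (real n)"
  have \<omega>: "\<omega> > 0" by (simp add: \<omega>_def)
  have mb: "measure lebesgue (ball (y::real^'n) R) = \<omega> * R ^ n" if "R \<ge> 0" for y R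
    using measure_ball_eq[OF that, of y] by (simp add: \<omega>_def n_def)
  \<comment> \<open>The summands are the descent from radius r to \<kappa> r, the N steps, each
    comparing two neighbouring balls with a ball of radius 2 \<kappa> r that contains both, and the
    ascent to radius 2r. The powers are ratios of volumes; D compares H at these radii with
    H(r).\<close>
  define C1 where "C1 = (1 / \<kappa>) ^ n + real N * (2 * (2 ^ n * D)) + D * (2 / \<kappa>) ^ n"
  have C1: "C1 \<ge> 0" using D dk by (auto simp: C1_def intro!: add_nonneg_nonneg)
  define L where "L = 1 / (\<omega> * (R1 / 2) ^ n)"
  have L: "L > 0" using \<omega> R1 by (simp add: L_def)
  \<comment> \<open>The first entry closes the induction, as C \<theta> + C1 <= C. The second starts
    it at radii from R1 / 2 on, where H >= h and the mean is at most A L.\<close>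
  define C where "C = max (C1 / (1 - \<theta>)) (L / h)"
  have C: "C \<ge> 0" "C1 \<le> C * (1 - \<theta>)" "L \<le> C * h"
  proof -
    show "C \<ge> 0" using L h by (auto simp: C_def le_max_iff_disj)
    have "C1 / (1 - \<theta>) \<le> C" "L / h \<le> C" by (auto simp: C_def)
    then show "C1 \<le> C * (1 - \<theta>)" "L \<le> C * h" using \<theta> h by (auto simp: field_simps)
  qed
  show thesis
  proof (rule that[OF R1(1,2) C(1)])
    fix v A x r
    assume v: "set_integrable lebesgue \<Omega> v" and A: "A \<ge> 0"
      and osc: "\<And>y R. 0 < R \<Longrightarrow> R \<le> R0 \<Longrightarrow> ball y R \<subseteq> \<Omega> \<Longrightarrow> oscillation (ball y R) v \<le> A * H R * measure lebesgue (ball y R)"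
      and whole: "(LINT x:\<Omega>|lebesgue. \<bar>v x\<bar>) \<le> A"
      and r: "0 < r" "r \<le> R1" and B: "ball x r \<subseteq> \<Omega>"
    have vb: "set_integrable lebesgue (ball y R) v" if "ball y R \<subseteq> \<Omega>" for y R
      by (rule set_integrable_subset[OF v _ that]) simp
    have md: "\<bar>mean (ball z \<rho>) v - mean (ball y R) v\<bar> \<le> A * H R * (R / \<rho>) ^ n"
      if "ball y R \<subseteq> \<Omega>" "ball z \<rho> \<subseteq> ball y R" "0 < \<rho>" "0 < R" "R \<le> R0" for y z \<rho> R
    proof -
      have "\<bar>mean (ball z \<rho>) v - mean (ball y R) v\<bar> \<le> oscillation (ball y R) v / measure lebesgue (ball z \<rho>)"
        using that by (intro mean_diff_le vb) auto
      also have "\<dots> \<le> A * H R * measure lebesgue (ball y R) / measure lebesgue (ball z \<rho>)"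
        using that by (intro divide_right_mono osc) auto
      also have "\<dots> = A * H R * (\<omega> * R ^ n) / (\<omega> * \<rho> ^ n)"
        using that by (simp only: mb less_imp_le)
      also have "\<dots> = A * H R * (R / \<rho>) ^ n"
        using \<omega> by (simp add: power_divide)
      finally show ?thesis .
    qed
    have step: "\<exists>z. ball z (2 * r) \<subseteq> \<Omega> \<and> \<bar>mean (ball x r) v\<bar> \<le> \<bar>mean (ball z (2 * r)) v\<bar> + A * (C1 * H r)"
      if r: "0 < r" "2 * r \<le> R1" and B: "ball x r \<subseteq> \<Omega>" for x r
    proof -
      have Hr: "H r > 0" using r R1 by (intro Hpos) auto
      obtain y where y: "y 0 = x" "\<And>i. i \<le> N \<Longrightarrow> ball (y i) (2 * (\<kappa> * r)) \<subseteq> \<Omega>"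
         "\<And>i. i < N \<Longrightarrow> dist (y i) (y (Suc i)) \<le> \<kappa> * r" "ball (y N) (2 * r) \<subseteq> \<Omega>"
        using dk(4)[of r x] r R1 B by auto
      have \<kappa>r: "0 < \<kappa> * r" "\<kappa> * r \<le> r / 4" using dk r by auto
      have \<kappa>R: "2 * (\<kappa> * r) \<le> R0" "2 * (\<kappa> * r) \<le> 2 * r" "\<kappa> * r \<le> 2 * (\<kappa> * r)" "\<kappa> * r \<le> r" "2 * r \<le> R0" "r \<le> R0"
        using \<kappa>r r R1 by linarith+
      let ?M = "\<lambda>i. mean (ball (y i) (\<kappa> * r)) v"
      have a: "\<bar>?M 0 - mean (ball x r) v\<bar> \<le> A * ((1 / \<kappa>) ^ n * H r)"
      proof -
        have "\<bar>?M 0 - mean (ball x r) v\<bar> \<le> A * H r * (r / (\<kappa> * r)) ^ n"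
          using \<kappa>R \<kappa>r(1) r B by (intro md) (auto simp: y(1) intro!: subset_ball)
        also have "r / (\<kappa> * r) = 1 / \<kappa>" using r by simp
        finally show ?thesis by (simp add: mult_ac)
      qed
      have b: "\<bar>?M i - ?M (Suc i)\<bar> \<le> A * (2 * (2 ^ n * D) * H r)" if i: "i < N" for i
      proof -
        let ?B = "ball (y i) (2 * (\<kappa> * r))"
        have HR: "H (2 * (\<kappa> * r)) \<le> D * H r" using \<kappa>R \<kappa>r(1) r by (intro D) auto
        have q: "2 * (\<kappa> * r) / (\<kappa> * r) = 2" using \<kappa>r by (metis less_irrefl nonzero_mult_div_cancel_right)
        have sub: "ball (y (Suc i)) (\<kappa> * r) \<subseteq> ?B"
        proof
          fix z assume "z \<in> ball (y (Suc i)) (\<kappa> * r)"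
          then show "z \<in> ?B" using dist_triangle[of "y i" z "y (Suc i)"] y(3)[OF i] by simp
        qed
        have "\<bar>?M i - mean ?B v\<bar> \<le> A * H (2 * (\<kappa> * r)) * (2 * (\<kappa> * r) / (\<kappa> * r)) ^ n"
          by (rule md[OF _ _ \<kappa>r(1) _ \<kappa>R(1)]) (use \<kappa>r(1) y(2)[of i] i \<kappa>R(3) in \<open>auto intro!: subset_ball\<close>)
        moreover have "\<bar>?M (Suc i) - mean ?B v\<bar> \<le> A * H (2 * (\<kappa> * r)) * (2 * (\<kappa> * r) / (\<kappa> * r)) ^ n"
          by (rule md[OF _ sub \<kappa>r(1) _ \<kappa>R(1)]) (use \<kappa>r(1) y(2)[of i] i in auto)
        moreover have "A * H (2 * (\<kappa> * r)) * 2 ^ n \<le> A * (D * H r) * 2 ^ n"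
          using A HR by (intro mult_right_mono mult_left_mono) auto
        ultimately show ?thesis unfolding q by (simp add: algebra_simps)
      qed
      have c: "\<bar>?M 0 - ?M k\<bar> \<le> real k * (A * (2 * (2 ^ n * D) * H r))" if "k \<le> N" for k
        using that
      proof (induction k)
        case (Suc k)
        then show ?case using b[of k] by (simp add: algebra_simps)
      qed simp
      have e: "\<bar>?M N - mean (ball (y N) (2 * r)) v\<bar> \<le> A * (D * (2 / \<kappa>) ^ n * H r)"
      proof -
        have "\<bar>?M N - mean (ball (y N) (2 * r)) v\<bar> \<le> A * H (2 * r) * (2 * r / (\<kappa> * r)) ^ n"
          using \<kappa>R \<kappa>r(1) r y(4) by (intro md) (auto intro!: subset_ball)
        also have "2 * r / (\<kappa> * r) = 2 / \<kappa>" using r by simp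
        also have "A * H (2 * r) * (2 / \<kappa>) ^ n \<le> A * (D * H r) * (2 / \<kappa>) ^ n"
          using A dk r \<kappa>R by (intro mult_right_mono mult_left_mono D) auto
        finally show ?thesis by (simp add: mult_ac)
      qed
      have "\<bar>mean (ball x r) v\<bar> \<le> \<bar>mean (ball (y N) (2 * r)) v\<bar>
          + (A * ((1 / \<kappa>) ^ n * H r) + real N * (A * (2 * (2 ^ n * D) * H r)) + A * (D * (2 / \<kappa>) ^ n * H r))"
        using a c[of N] e by linarith
      also have "\<dots> = \<bar>mean (ball (y N) (2 * r)) v\<bar> + A * (C1 * H r)"
        by (simp add: C1_def algebra_simps)
      finally show ?thesis using y(4) by blast
    qed
    have large: "\<bar>mean (ball x r) v\<bar> \<le> A * L" if r: "R1 / 2 \<le> r" and B: "ball x r \<subseteq> \<Omega>" for x r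
    proof -
      have r0: "r > 0" using r R1 by linarith
      have "\<bar>LINT x:ball x r|lebesgue. v x\<bar> \<le> (LINT x:\<Omega>|lebesgue. \<bar>v x\<bar>)"
      proof -
        have "\<bar>LINT x:ball x r|lebesgue. v x\<bar> \<le> (\<integral>z. norm (indicator (ball x r) z *\<^sub>R v z) \<partial>lebesgue)"
          unfolding set_lebesgue_integral_def real_norm_def[symmetric] by (rule integral_norm_bound)
        also have "\<dots> \<le> (LINT x:\<Omega>|lebesgue. \<bar>v x\<bar>)"
          unfolding set_lebesgue_integral_def
        proof (rule integral_mono)
          show "integrable lebesgue (\<lambda>z. norm (indicator (ball x r) z *\<^sub>R v z))"
            using vb[OF B] by (auto simp: set_integrable_def)
          show "integrable lebesgue (\<lambda>x. indicator \<Omega> x *\<^sub>R \<bar>v x\<bar>)"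
            using set_integrable_abs[OF v] by (simp add: set_integrable_def)
          show "norm (indicator (ball x r) z *\<^sub>R v z) \<le> indicator \<Omega> z *\<^sub>R \<bar>v z\<bar>" for z
            using B by (auto simp: indicator_def)
        qed
        finally show ?thesis .
      qed
      with whole have "\<bar>LINT x:ball x r|lebesgue. v x\<bar> \<le> A" by linarith
      moreover have "\<bar>mean (ball x r) v\<bar> = \<bar>LINT x:ball x r|lebesgue. v x\<bar> * (1 / (\<omega> * r ^ n))"
        using mb[of r x] r0 \<omega> by (simp add: mean_def abs_mult del: content_ball)
      moreover have "1 / (\<omega> * r ^ n) \<le> L"
        unfolding L_def using \<omega> R1 r by (intro divide_left_mono mult_left_mono power_mono mult_pos_pos) auto
      ultimately show ?thesis
        using A \<omega> r0 by (simp only:) (intro mult_mono, auto)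
    qed
    \<comment> \<open>Here k bounds the number of doublings that lead to a radius of at least R1 /
      2.\<close>
    have "\<bar>mean (ball x r) v\<bar> \<le> A * (C * H r)"
      if "R1 / 2 ^ Suc k \<le> r" "0 < r" "r \<le> R1" "ball x r \<subseteq> \<Omega>" for k x r
      using that
    proof (induction k arbitrary: x r)
      case 0
      have "L \<le> C * h" by (rule C)
      also have "\<dots> \<le> C * H r" using 0 R1 C by (intro mult_left_mono Hlow') auto
      finally have "A * L \<le> A * (C * H r)" using A by (rule mult_left_mono)
      then show ?case using large[of r x] 0 by simp
    next
      case (Suc k)
      show ?case
      proof (cases "2 * r \<le> R1")
        case True
        from step[OF Suc.prems(2) True Suc.prems(4)] obtain z where
          z: "ball z (2 * r) \<subseteq> \<Omega>" "\<bar>mean (ball x r) v\<bar> \<le> \<bar>mean (ball z (2 * r)) v\<bar> + A * (C1 * H r)" by blast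
        have Hr: "H r > 0" using Suc.prems R1 by (intro Hpos) auto
        have "\<bar>mean (ball z (2 * r)) v\<bar> \<le> A * (C * H (2 * r))"
          using Suc.prems True z(1) by (intro Suc.IH) (auto simp: field_simps)
        also have "\<dots> \<le> A * (C * (\<theta> * H r))"
          using A C Suc.prems True R1 by (intro mult_left_mono Hdec) auto
        finally have "\<bar>mean (ball x r) v\<bar> \<le> A * (C * (\<theta> * H r)) + A * (C1 * H r)" using z(2) by linarith
        also have "A * (C1 * H r) \<le> A * (C * (1 - \<theta>) * H r)"
          using A C Hr by (intro mult_left_mono mult_right_mono) auto
        finally show ?thesis by (simp add: algebra_simps)
      next
        case False
        then have "\<bar>mean (ball x r) v\<bar> \<le> A * L" using Suc.prems by (intro large) auto
        also have "\<dots> \<le> A * (C * H r)"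
        proof -
          have "L \<le> C * h" by (rule C)
          also have "\<dots> \<le> C * H r" using Suc.prems False R1 C by (intro mult_left_mono Hlow') auto
          finally show ?thesis using A by (rule mult_left_mono)
        qed
        finally show ?thesis .
      qed
    qed
    moreover obtain k where "R1 / 2 ^ Suc k \<le> r"
    proof -
      obtain k where "(1 / 2) ^ k < r / R1" using real_arch_pow_inv[of "r / R1" "1 / 2"] r R1 by auto
      then have "R1 / 2 ^ k < r" using R1 by (simp add: field_simps power_one_over)
      moreover have "R1 / 2 ^ Suc k \<le> R1 / 2 ^ k" using R1 by (simp add: field_simps)
      ultimately show thesis using that[of k] by linarith
    qed
    ultimately show "\<bar>mean (ball x r) v\<bar> \<le> A * (C * H r)" using r B by blast
  qed
qed

section \<open>The embedding\<close>

lemma abs_weak_deriv_le_grad_abs: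
  fixes u :: "real^'n \<Rightarrow> real"
  shows "\<bar>weak_deriv \<Omega> ks u x\<bar> \<le> grad_abs (length ks) \<Omega> u x"
proof -
  have fin: "finite {is :: 'n list. length is = length ks}"
    using finite_lists_length_eq[of "UNIV :: 'n set" "length ks"] by simp
  have "(weak_deriv \<Omega> ks u x)\<^sup>2 \<le> (\<Sum>is\<in>{is. length is = length ks}. (weak_deriv \<Omega> is u x)\<^sup>2)"
    by (rule member_le_sum[of ks "{is. length is = length ks}" "\<lambda>is. (weak_deriv \<Omega> is u x)\<^sup>2"]) (use fin in auto)
  then have "sqrt ((weak_deriv \<Omega> ks u x)\<^sup>2) \<le> grad_abs (length ks) \<Omega> u x"
    unfolding grad_abs_def by (rule real_sqrt_le_mono)
  then show ?thesis by simp
qed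

lemma bounded_open_lmeasurable:
  fixes \<Omega> :: "(real^'n) set"
  assumes "open \<Omega>" "bounded \<Omega>" "\<Omega> \<noteq> {}"
  shows "\<Omega> \<in> lmeasurable" "measure lebesgue \<Omega> > 0"
proof -
  show 1: "\<Omega> \<in> lmeasurable" using assms by (simp add: lmeasurable_open)
  obtain x r where r: "r > 0" "ball x r \<subseteq> \<Omega>" using assms openE by blast
  have "measure lebesgue (ball x r) \<le> measure lebesgue \<Omega>"
    using 1 r by (intro measure_mono_fmeasurable) auto
  then show "measure lebesgue \<Omega> > 0" using measure_ball_pos[OF r(1), of x] by linarith
qed

lemma Sobolev_norm_finite:
  assumes "u \<in> Sobolev_space m q \<alpha> \<beta> \<Omega>"
  shows "Sobolev_norm m q \<alpha> \<beta> \<Omega> u = ennreal (enn2real (Sobolev_norm m q \<alpha> \<beta> \<Omega> u))"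
proof -
  have "Sobolev_norm m q \<alpha> \<beta> \<Omega> u < top"
    using assms by (auto simp: Sobolev_norm_def Sobolev_space_def LZ_space_def)
  then show ?thesis by simp
qed

lemma LZ_norm_le_Sobolev_norm: "k \<le> m \<Longrightarrow> LZ_norm q \<alpha> \<beta> \<Omega> (grad_abs k \<Omega> u) \<le> Sobolev_norm m q \<alpha> \<beta> \<Omega> u"
  unfolding Sobolev_norm_def by (rule member_le_sum) auto

lemma admissible_lower_bound:
  assumes "admissible \<phi>" "a > 0"
  obtains p where "p > 0" "\<And>r. a \<le> r \<Longrightarrow> p \<le> \<phi> r"
proof
  show "(INF r\<in>{a..}. \<phi> r) > 0" using assms by (simp add: admissible_def)
  have "bdd_below (\<phi> ` {a..})"
    using assms by (intro bdd_belowI[of _ 0]) (auto simp: admissible_def less_imp_le)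
  then show "(INF r\<in>{a..}. \<phi> r) \<le> \<phi> r" if "a \<le> r" for r
    using that by (intro cINF_lower) auto
qed

lemma ennreal_le_of_mult_le:
  assumes "I * ennreal a \<le> ennreal b" "a > 0"
  shows "I \<le> ennreal (b / a)"
proof (cases I)
  case (real i)
  then have "ennreal (i * a) \<le> ennreal b" using assms by (simp add: ennreal_mult)
  then have "i * a \<le> b \<or> i * a \<le> 0" using real assms(2)
    by (cases "b \<ge> 0") (auto simp: ennreal_le_iff ennreal_neg)
  then show ?thesis
  proof
    assume "i * a \<le> b" then show ?thesis using real assms(2) by (auto intro!: ennreal_leI simp: field_simps)
  next
    assume "i * a \<le> 0" then have "i = 0" using real assms(2) by (simp add: mult_le_0_iff)
    then show ?thesis using real by simp
  qed
next
  case top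
  then show ?thesis using assms by (simp add: ennreal_top_mult top_unique)
qed

lemma nn_integral_eq_oscillation:
  fixes v :: "real^'n \<Rightarrow> real"
  assumes v: "set_integrable lebesgue (ball x r) v"
  shows "(\<integral>\<^sup>+y\<in>ball x r. ennreal \<bar>v y - mean (ball x r) v\<bar> \<partial>lebesgue) = ennreal (oscillation (ball x r) v)"
proof -
  let ?B = "ball x r"
  have "set_integrable lebesgue ?B (\<lambda>y. v y - mean ?B v)"
    using v set_integrable_const_ball by (auto intro: set_integral_diff)
  then have "set_integrable lebesgue ?B (\<lambda>y. \<bar>v y - mean ?B v\<bar>)" by (rule set_integrable_abs)
  then have int: "integrable lebesgue (\<lambda>y. indicator ?B y * \<bar>v y - mean ?B v\<bar>)"
    by (simp add: set_integrable_def)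
  have "(\<integral>\<^sup>+y\<in>?B. ennreal \<bar>v y - mean ?B v\<bar> \<partial>lebesgue) = (\<integral>\<^sup>+y. ennreal (indicator ?B y * \<bar>v y - mean ?B v\<bar>) \<partial>lebesgue)"
    by (intro nn_integral_cong) (auto simp: indicator_def)
  also have "\<dots> = ennreal (\<integral>y. indicator ?B y * \<bar>v y - mean ?B v\<bar> \<partial>lebesgue)"
    by (rule nn_integral_eq_integral[OF int]) auto
  finally show ?thesis by (simp add: oscillation_def set_lebesgue_integral_def)
qed

lemma nn_integral_eq_oscillation_subset:
  fixes v :: "real^'n \<Rightarrow> real"
  assumes "set_integrable lebesgue \<Omega> v" "ball x r \<subseteq> \<Omega>"
  shows "(\<integral>\<^sup>+y\<in>ball x r. ennreal \<bar>v y - mean (ball x r) v\<bar> \<partial>lebesgue) = ennreal (oscillation (ball x r) v)"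
  by (rule nn_integral_eq_oscillation, rule set_integrable_subset[OF assms(1) _ assms(2)]) simp

section \<open>Sobolev functions on a fixed John domain\<close>

context
  fixes \<Omega> :: "(real^'n) set" and q :: ennreal and \<alpha> \<beta> :: real
  assumes John: "John_domain \<Omega>" and adm: "L1_admissible q \<alpha> \<beta>"
begin

definition "domain_volume = measure lebesgue \<Omega>"
definition "ball_const = unit_ball_vol (real CARD('n))"
text \<open>The argument of \<open>ell\<close> is the volume of a ball of radius r relative to that
  of \<Omega>, the point at which the norm estimates evaluate the gauge.\<close>

definition "ball_gauge r = lz_gauge q \<alpha> \<beta> (ell (ball_const / domain_volume * r ^ CARD('n)))"
definition "Sobolev_norm_real m u = enn2real (Sobolev_norm m q \<alpha> \<beta> \<Omega> u)"

lemma John_domain_facts: "open \<Omega>" "bounded \<Omega>" "\<Omega> \<noteq> {}" "\<Omega> \<in> lmeasurable" "\<Omega> \<in> sets lebesgue" "domain_volume > 0"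
proof -
  show *: "open \<Omega>" "bounded \<Omega>" "\<Omega> \<noteq> {}" using John by (auto simp: John_domain_def)
  show "\<Omega> \<in> lmeasurable" "domain_volume > 0" using bounded_open_lmeasurable[OF *] by (auto simp: domain_volume_def)
  then show "\<Omega> \<in> sets lebesgue" by auto
qed

lemma ball_const_pos: "ball_const > 0" by (simp add: ball_const_def)

lemma ball_gauge_pos: "ball_gauge r > 0" unfolding ball_gauge_def by (rule gauge_pos[OF ell_ge_1])

lemma Sobolev_norm_real_nonneg: "Sobolev_norm_real m u \<ge> 0" by (simp add: Sobolev_norm_real_def)

lemma measure_ball_const: "r \<ge> 0 \<Longrightarrow> measure lebesgue (ball (x::real^'n) r) = ball_const * r ^ CARD('n)"
  using measure_ball_eq[of r x] by (simp add: ball_const_def)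

text \<open>A single weak derivative is dominated by \<open>grad_abs\<close>, whose norm is one
  summand of the Sobolev norm, so \<open>LZ_norm_lower\<close> applies to a ball as well as to
  \<Omega>. The second bound will supply the means over balls of fixed size.\<close>

lemma weak_deriv_integral_bounds:
  obtains C R where "C \<ge> 0" "R > 0"
    "\<And>m u ks x r. u \<in> Sobolev_space m q \<alpha> \<beta> \<Omega> \<Longrightarrow> length ks \<le> m \<Longrightarrow> 0 < r \<Longrightarrow> r \<le> R \<Longrightarrow> ball x r \<subseteq> \<Omega> \<Longrightarrow>
       (\<integral>\<^sup>+y\<in>ball x r. ennreal \<bar>weak_deriv \<Omega> ks u y\<bar> \<partial>lebesgue) \<le> ennreal (C * Sobolev_norm_real m u / ball_gauge r)"
    "\<And>m u ks. u \<in> Sobolev_space m q \<alpha> \<beta> \<Omega> \<Longrightarrow> length ks \<le> m \<Longrightarrow>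
       (\<integral>\<^sup>+y\<in>\<Omega>. ennreal \<bar>weak_deriv \<Omega> ks u y\<bar> \<partial>lebesgue) \<le> ennreal (C * Sobolev_norm_real m u)"
proof -
  obtain s1 c where sc: "0 < s1" "s1 < 1" "c > 0"
    "\<And>u B s. u \<in> borel_measurable (lebesgue_on \<Omega>) \<Longrightarrow>
       B \<in> sets lebesgue \<Longrightarrow> B \<subseteq> \<Omega> \<Longrightarrow> 0 < s \<Longrightarrow> s \<le> s1 \<Longrightarrow> measure lebesgue B \<le> domain_volume * s \<Longrightarrow>
       (\<integral>\<^sup>+x\<in>B. ennreal \<bar>u x\<bar> \<partial>lebesgue) * ennreal (c * lz_gauge q \<alpha> \<beta> (ell s))
         \<le> ennreal domain_volume * LZ_norm q \<alpha> \<beta> \<Omega> u"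
    "\<And>u. u \<in> borel_measurable (lebesgue_on \<Omega>) \<Longrightarrow>
       (\<integral>\<^sup>+x\<in>\<Omega>. ennreal \<bar>u x\<bar> \<partial>lebesgue) * ennreal c \<le> ennreal domain_volume * LZ_norm q \<alpha> \<beta> \<Omega> u"
    unfolding domain_volume_def using LZ_norm_lower[OF adm John_domain_facts(4) John_domain_facts(6)[unfolded domain_volume_def]] by blast
  define n where "n = CARD('n)"
  have n: "n \<ge> 1" unfolding n_def by (simp add: Suc_leI)
  have VP: "domain_volume > 0" by (rule John_domain_facts)
  \<comment> \<open>For r <= 1 also r^n <= r, so a linear bound on r keeps the relative volume of
    the ball below s1.\<close>
  define R where "R = min 1 (s1 * domain_volume / ball_const)"
  have R: "R > 0" "R \<le> 1" "R \<le> s1 * domain_volume / ball_const" using sc VP ball_const_pos by (auto simp: R_def)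
  have grad: "grad_abs (length ks) \<Omega> u \<in> borel_measurable (lebesgue_on \<Omega>)"
     "ennreal domain_volume * LZ_norm q \<alpha> \<beta> \<Omega> (grad_abs (length ks) \<Omega> u) \<le> ennreal (domain_volume * Sobolev_norm_real m u)"
    if "u \<in> Sobolev_space m q \<alpha> \<beta> \<Omega>" "length ks \<le> m" for m u ks
  proof -
    show "grad_abs (length ks) \<Omega> u \<in> borel_measurable (lebesgue_on \<Omega>)"
      using that by (auto simp: Sobolev_space_def LZ_space_def)
    have "LZ_norm q \<alpha> \<beta> \<Omega> (grad_abs (length ks) \<Omega> u) \<le> ennreal (Sobolev_norm_real m u)"
      using LZ_norm_le_Sobolev_norm[OF that(2)] Sobolev_norm_finite[OF that(1)] by (metis Sobolev_norm_real_def)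
    then show "ennreal domain_volume * LZ_norm q \<alpha> \<beta> \<Omega> (grad_abs (length ks) \<Omega> u) \<le> ennreal (domain_volume * Sobolev_norm_real m u)"
      using VP by (simp add: ennreal_mult' mult_left_mono)
  qed
  have dom: "(\<integral>\<^sup>+y\<in>B. ennreal \<bar>weak_deriv \<Omega> ks u y\<bar> \<partial>lebesgue) \<le> (\<integral>\<^sup>+y\<in>B. ennreal \<bar>grad_abs (length ks) \<Omega> u y\<bar> \<partial>lebesgue)" for B u ks
    by (intro nn_integral_mono mult_right_mono ennreal_leI order_trans[OF abs_weak_deriv_le_grad_abs]) auto
  show thesis
  proof (rule that[of "domain_volume / c" R])
    fix m u x r and ks :: "'n list"
    assume u: "u \<in> Sobolev_space m q \<alpha> \<beta> \<Omega>" "length ks \<le> m"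
    {
      assume r: "0 < r" "r \<le> R" and B: "ball x r \<subseteq> \<Omega>"
      let ?s = "ball_const / domain_volume * r ^ n"
      have "r ^ n \<le> r ^ 1" using r R n by (intro power_decreasing) auto
      then have "?s \<le> ball_const / domain_volume * r" using ball_const_pos VP by (intro mult_left_mono) auto
      also have "\<dots> \<le> ball_const / domain_volume * (s1 * domain_volume / ball_const)" using r R ball_const_pos VP by (intro mult_left_mono) auto
      also have "\<dots> = s1" using ball_const_pos VP by simp
      finally have s: "0 < ?s" "?s \<le> s1" using r ball_const_pos VP by auto
      have "measure lebesgue (ball x r) \<le> domain_volume * ?s" using measure_ball_const[of r x] r VP by (simp add: n_def)
      then have "(\<integral>\<^sup>+y\<in>ball x r. ennreal \<bar>grad_abs (length ks) \<Omega> u y\<bar> \<partial>lebesgue) * ennreal (c * lz_gauge q \<alpha> \<beta> (ell ?s))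
         \<le> ennreal (domain_volume * Sobolev_norm_real m u)"
        using sc(4)[OF grad(1)[OF u] _ B s] grad(2)[OF u] by (meson order_trans lmeasurable_ball fmeasurableD)
      then have "(\<integral>\<^sup>+y\<in>ball x r. ennreal \<bar>grad_abs (length ks) \<Omega> u y\<bar> \<partial>lebesgue) \<le> ennreal (domain_volume * Sobolev_norm_real m u / (c * ball_gauge r))"
        using sc(3) ball_gauge_pos[of r] by (intro ennreal_le_of_mult_le) (auto simp: ball_gauge_def n_def)
      then show "(\<integral>\<^sup>+y\<in>ball x r. ennreal \<bar>weak_deriv \<Omega> ks u y\<bar> \<partial>lebesgue) \<le> ennreal (domain_volume / c * Sobolev_norm_real m u / ball_gauge r)"
        by (intro order_trans[OF dom]) (simp add: mult_ac)
    }
    have "(\<integral>\<^sup>+y\<in>\<Omega>. ennreal \<bar>grad_abs (length ks) \<Omega> u y\<bar> \<partial>lebesgue) \<le> ennreal (domain_volume * Sobolev_norm_real m u / c)"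
      using sc(3) order_trans[OF sc(5)[OF grad(1)[OF u]] grad(2)[OF u]] by (intro ennreal_le_of_mult_le)
    then show "(\<integral>\<^sup>+y\<in>\<Omega>. ennreal \<bar>weak_deriv \<Omega> ks u y\<bar> \<partial>lebesgue) \<le> ennreal (domain_volume / c * Sobolev_norm_real m u)"
      by (intro order_trans[OF dom]) simp
  qed (use sc VP R in auto)
qed

lemma weak_deriv_integral_whole:
  "\<exists>C\<ge>0. \<forall>m u ks. u \<in> Sobolev_space m q \<alpha> \<beta> \<Omega> \<longrightarrow> length ks \<le> m \<longrightarrow>
     (\<integral>\<^sup>+y\<in>\<Omega>. ennreal \<bar>weak_deriv \<Omega> ks u y\<bar> \<partial>lebesgue) \<le> ennreal (C * Sobolev_norm_real m u)"
proof (rule weak_deriv_integral_bounds)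
  fix C R :: real
  assume C: "C \<ge> 0" and *: "\<And>m u ks. u \<in> Sobolev_space m q \<alpha> \<beta> \<Omega> \<Longrightarrow> length ks \<le> m \<Longrightarrow>
       (\<integral>\<^sup>+y\<in>\<Omega>. ennreal \<bar>weak_deriv \<Omega> ks u y\<bar> \<partial>lebesgue) \<le> ennreal (C * Sobolev_norm_real m u)"
  show ?thesis
    by (rule exI[of _ C]) (use C * in simp)
qed

text \<open>Membership in \<open>L1loc\<close> gives no control near the boundary of \<Omega>;
  integrability over all of \<Omega> comes from the finite norm.\<close>

lemma weak_deriv_facts:
  assumes u: "u \<in> Sobolev_space m q \<alpha> \<beta> \<Omega>" and ks: "length ks \<le> m"
  shows "has_weak_deriv \<Omega> ks u (weak_deriv \<Omega> ks u)" "set_integrable lebesgue \<Omega> (weak_deriv \<Omega> ks u)"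
proof -
  show h: "has_weak_deriv \<Omega> ks u (weak_deriv \<Omega> ks u)"
    using u ks by (intro has_weak_deriv_weak_deriv) (auto simp: Sobolev_space_def)
  then have "weak_deriv \<Omega> ks u \<in> borel_measurable (lebesgue_on \<Omega>)"
    by (intro L1loc_measurable John_domain_facts) (simp add: has_weak_deriv_def)
  then have "(\<lambda>x. indicator \<Omega> x *\<^sub>R weak_deriv \<Omega> ks u x) \<in> borel_measurable lebesgue"
    using John_domain_facts(5) by (subst (asm) borel_measurable_restrict_space_iff) auto
  moreover have "(\<integral>\<^sup>+y\<in>\<Omega>. ennreal \<bar>weak_deriv \<Omega> ks u y\<bar> \<partial>lebesgue) < \<infinity>"
  proof -
    obtain C where "\<forall>m u ks. u \<in> Sobolev_space m q \<alpha> \<beta> \<Omega> \<longrightarrow> length ks \<le> m \<longrightarrow>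
       (\<integral>\<^sup>+y\<in>\<Omega>. ennreal \<bar>weak_deriv \<Omega> ks u y\<bar> \<partial>lebesgue) \<le> ennreal (C * Sobolev_norm_real m u)"
      using weak_deriv_integral_whole by (elim exE conjE)
    from this[rule_format, OF u ks] show ?thesis by (rule le_less_trans) simp
  qed
  moreover have "(\<integral>\<^sup>+y\<in>\<Omega>. ennreal \<bar>weak_deriv \<Omega> ks u y\<bar> \<partial>lebesgue)
      = (\<integral>\<^sup>+y. ennreal (norm (indicator \<Omega> y *\<^sub>R weak_deriv \<Omega> ks u y)) \<partial>lebesgue)"
    by (intro nn_integral_cong) (auto simp: indicator_def)
  ultimately show "set_integrable lebesgue \<Omega> (weak_deriv \<Omega> ks u)"
    unfolding set_integrable_def integrable_iff_bounded by simp
qed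

text \<open>The space restricts \<open>weak_deriv \<Omega> []\<close>, a representative chosen by
  \<open>SOME\<close>, rather than u. Uniqueness of weak derivatives transfers integrability back to
  u.\<close>

lemma Sobolev_integrable:
  assumes u: "u \<in> Sobolev_space m q \<alpha> \<beta> \<Omega>"
  shows "set_integrable lebesgue \<Omega> u" "AE x in lebesgue. x \<in> \<Omega> \<longrightarrow> weak_deriv \<Omega> [] u x = u x"
proof -
  note h = weak_deriv_facts[OF u, of "[]", simplified]
  have "u \<in> L1loc \<Omega>" using h(1) by (simp add: has_weak_deriv_def)
  then have "has_weak_deriv \<Omega> [] u u" by (simp add: has_weak_deriv_def)
  then show AE: "AE x in lebesgue. x \<in> \<Omega> \<longrightarrow> weak_deriv \<Omega> [] u x = u x"
    by (intro has_weak_deriv_unique[OF John_domain_facts(1) h(1)])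
  have "u \<in> borel_measurable (lebesgue_on \<Omega>)"
    by (rule L1loc_measurable[OF John_domain_facts(1)]) fact
  then have "(\<lambda>x. indicator \<Omega> x *\<^sub>R u x) \<in> borel_measurable lebesgue"
    using John_domain_facts(5) by (subst (asm) borel_measurable_restrict_space_iff) auto
  then show "set_integrable lebesgue \<Omega> u"
    unfolding set_integrable_def
    by (rule integrable_cong_AE_imp[OF h(2)[unfolded set_integrable_def]])
       (use AE in \<open>auto simp: indicator_def elim!: eventually_mono\<close>)
qed

lemma oscillation_le_partials:
  fixes v :: "real^'n \<Rightarrow> real"
  assumes v: "set_integrable lebesgue \<Omega> v" and w: "\<And>i. set_integrable lebesgue \<Omega> (w i)" "\<And>i. has_weak_deriv \<Omega> [i] v (w i)"
    and B: "ball x r \<subseteq> \<Omega>" "r > 0"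
    and le: "\<And>i. (\<integral>\<^sup>+y\<in>ball x r. ennreal \<bar>w i y\<bar> \<partial>lebesgue) \<le> ennreal A" and A: "A \<ge> 0"
  shows "oscillation (ball x r) v \<le> 2 ^ (CARD('n) + 1) * real CARD('n) * r * A"
proof -
  have wm: "(\<lambda>y. ennreal \<bar>w i y\<bar> * indicator (ball x r) y) \<in> borel_measurable lebesgue" for i
  proof -
    have "set_integrable lebesgue (ball x r) (w i)" by (rule set_integrable_subset[OF w(1) _ B(1)]) simp
    then have "(\<lambda>y. ennreal \<bar>indicator (ball x r) y *\<^sub>R w i y\<bar>) \<in> borel_measurable lebesgue"
      by (auto simp: set_integrable_def)
    moreover have "(\<lambda>y. ennreal \<bar>indicator (ball x r) y *\<^sub>R w i y\<bar>) = (\<lambda>y. ennreal \<bar>w i y\<bar> * indicator (ball x r) y)"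
      by (auto simp: fun_eq_iff indicator_def)
    ultimately show ?thesis by (simp only:)
  qed
  have "ennreal (oscillation (ball x r) v) = (\<integral>\<^sup>+y\<in>ball x r. ennreal \<bar>v y - mean (ball x r) v\<bar> \<partial>lebesgue)"
    by (rule nn_integral_eq_oscillation_subset[OF v B(1), symmetric])
  also have "\<dots> \<le> ennreal (2 ^ (CARD('n) + 1) * r) * (\<integral>\<^sup>+y\<in>ball x r. (\<Sum>i\<in>UNIV. ennreal \<bar>w i y\<bar>) \<partial>lebesgue)"
    by (rule poincare_ball[OF John_domain_facts(1) B v w])
  also have "(\<integral>\<^sup>+y\<in>ball x r. (\<Sum>i\<in>UNIV. ennreal \<bar>w i y\<bar>) \<partial>lebesgue) = (\<Sum>i\<in>UNIV. (\<integral>\<^sup>+y\<in>ball x r. ennreal \<bar>w i y\<bar> \<partial>lebesgue))"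
    unfolding sum_distrib_right by (rule nn_integral_sum) (rule wm)
  also have "\<dots> \<le> (\<Sum>i\<in>(UNIV::'n set). ennreal A)"
    by (intro sum_mono le)
  also have "\<dots> = ennreal (real CARD('n) * A)"
    using A by (simp add: ennreal_of_nat_eq_real_of_nat ennreal_mult)
  also have "ennreal (2 ^ (CARD('n) + 1) * r) * ennreal (real CARD('n) * A) = ennreal (2 ^ (CARD('n) + 1) * real CARD('n) * r * A)"
    using B A by (subst ennreal_mult[symmetric]) (auto simp: mult_ac)
  finally have "ennreal (oscillation (ball x r) v) \<le> ennreal (2 ^ (CARD('n) + 1) * real CARD('n) * r * A)"
    by (simp add: mult_left_mono)
  then show ?thesis using A B by (simp add: ennreal_le_iff)
qed

lemma ball_gauge_comparisons:
  obtains R where "R > 0" "\<And>r. 0 < r \<Longrightarrow> 2 * r \<le> R \<Longrightarrow> ball_gauge r \<le> 3 / 2 * ball_gauge (2 * r)"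
    "\<And>r s. 0 < r \<Longrightarrow> r \<le> s \<Longrightarrow> s \<le> R \<Longrightarrow> ball_gauge s \<le> ball_gauge r"
proof -
  have K: "ball_const / domain_volume > 0" using ball_const_pos John_domain_facts by simp
  have n: "CARD('n) \<ge> 1" by (simp add: Suc_leI)
  obtain r1 where r1: "r1 > 0" "\<And>r. 0 < r \<Longrightarrow> r < r1 \<Longrightarrow> ball_gauge r \<le> 3 / 2 * ball_gauge (2 * r)"
    unfolding ball_gauge_def using gauge_doubling[OF adm K n] by blast
  obtain r2 where r2: "r2 > 0" "\<And>r s. 0 < r \<Longrightarrow> r \<le> s \<Longrightarrow> s < r2 \<Longrightarrow> ball_gauge s \<le> ball_gauge r"
    unfolding ball_gauge_def using gauge_antimono[OF adm K n] by blast
  show thesis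
    by (rule that[of "min r1 r2 / 2"]) (use r1 r2 in \<open>auto simp: field_simps\<close>)
qed

text \<open>Induction on the distance \<open>j\<close> of the order of differentiation from \<open>m\<close>: the bound for order
  \<open>m - j\<close> and the Poincare inequality control the oscillation of derivatives of order \<open>m - j - 1\<close>, and
  summing along a chain of balls controls their means. For \<open>j < n\<close> this sum is geometric.\<close>

lemma weak_deriv_small_balls:
  assumes j: "j \<le> m" "j < CARD('n)"
  shows "\<exists>C R. C \<ge> 0 \<and> R > 0 \<and> (\<forall>u\<in>Sobolev_space m q \<alpha> \<beta> \<Omega>. \<forall>ks x r. length ks + j = m \<longrightarrow> 0 < r \<longrightarrow> r \<le> R \<longrightarrow> ball x r \<subseteq> \<Omega> \<longrightarrow>
     (\<integral>\<^sup>+y\<in>ball x r. ennreal \<bar>weak_deriv \<Omega> ks u y\<bar> \<partial>lebesgue) \<le> ennreal (C * Sobolev_norm_real m u * r ^ j / ball_gauge r))"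
  using j
proof (induction j)
  case 0
  show ?case
  proof (rule weak_deriv_integral_bounds)
    fix C R :: real
    assume CR: "C \<ge> 0" "R > 0" and *: "\<And>m u ks x r. u \<in> Sobolev_space m q \<alpha> \<beta> \<Omega> \<Longrightarrow> length ks \<le> m \<Longrightarrow> 0 < r \<Longrightarrow> r \<le> R \<Longrightarrow> ball x r \<subseteq> \<Omega> \<Longrightarrow>
       (\<integral>\<^sup>+y\<in>ball x r. ennreal \<bar>weak_deriv \<Omega> ks u y\<bar> \<partial>lebesgue) \<le> ennreal (C * Sobolev_norm_real m u / ball_gauge r)"
    show ?case
      by (rule exI[of _ C], rule exI[of _ R]) (use CR * in simp)
  qed
next
  case (Suc j)
  define n where "n = CARD('n)"
  have "j \<le> m" "j < CARD('n)" using Suc.prems by auto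
  from Suc.IH[OF this] obtain C R where CR_all: "C \<ge> 0" "R > 0" "\<forall>u\<in>Sobolev_space m q \<alpha> \<beta> \<Omega>. \<forall>ks x r. length ks + j = m \<longrightarrow> 0 < r \<longrightarrow> r \<le> R \<longrightarrow> ball x r \<subseteq> \<Omega> \<longrightarrow>
     (\<integral>\<^sup>+y\<in>ball x r. ennreal \<bar>weak_deriv \<Omega> ks u y\<bar> \<partial>lebesgue) \<le> ennreal (C * Sobolev_norm_real m u * r ^ j / ball_gauge r)"
    by (elim exE conjE)
  note CR = CR_all(1,2) CR_all(3)[rule_format]
  obtain C0 where C0_all: "C0 \<ge> 0" "\<forall>m u ks. u \<in> Sobolev_space m q \<alpha> \<beta> \<Omega> \<longrightarrow> length ks \<le> m \<longrightarrow>
       (\<integral>\<^sup>+y\<in>\<Omega>. ennreal \<bar>weak_deriv \<Omega> ks u y\<bar> \<partial>lebesgue) \<le> ennreal (C0 * Sobolev_norm_real m u)"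
    using weak_deriv_integral_whole by (elim exE conjE)
  note C0 = C0_all(1) C0_all(2)[rule_format]
  obtain R' where R': "R' > 0" "\<And>r. 0 < r \<Longrightarrow> 2 * r \<le> R' \<Longrightarrow> ball_gauge r \<le> 3 / 2 * ball_gauge (2 * r)"
    "\<And>r s. 0 < r \<Longrightarrow> r \<le> s \<Longrightarrow> s \<le> R' \<Longrightarrow> ball_gauge s \<le> ball_gauge r"
    using ball_gauge_comparisons by blast
  define R0 where "R0 = min R R'"
  have R0: "R0 > 0" "R0 \<le> R" "R0 \<le> R'" using CR R' by (auto simp: R0_def)
  \<comment> \<open>The target r^(j+1) / gauge is \<open>H r\<close> times r^n, so H is the natural
    size of means. As e >= 1, doubling multiplies r^(-e) by at most 1/2 and 1/gauge by at most 3/2: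
    this is the decay factor 3/4 of \<open>chain_mean_bound\<close>.\<close>
  define e where "e = n - Suc j"
  have e: "e \<ge> 1" "n = e + Suc j" using Suc.prems by (auto simp: e_def n_def)
  define H where "H r = 1 / (r ^ e * ball_gauge r)" for r
  obtain R1 C' where ch: "0 < R1" "R1 \<le> R0" "C' \<ge> 0"
    "\<And>v A x r. set_integrable lebesgue \<Omega> v \<Longrightarrow> A \<ge> 0 \<Longrightarrow>
      (\<And>y R. 0 < R \<Longrightarrow> R \<le> R0 \<Longrightarrow> ball y R \<subseteq> \<Omega> \<Longrightarrow> oscillation (ball y R) v \<le> A * H R * measure lebesgue (ball y R)) \<Longrightarrow>
      (LINT x:\<Omega>|lebesgue. \<bar>v x\<bar>) \<le> A \<Longrightarrow> 0 < r \<Longrightarrow> r \<le> R1 \<Longrightarrow> ball x r \<subseteq> \<Omega> \<Longrightarrow>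
      \<bar>mean (ball x r) v\<bar> \<le> A * (C' * H r)"
  proof (rule chain_mean_bound[OF John R0(1), of H "3 / 4"])
    show "H r > 0" if "0 < r" "r \<le> R0" for r using that ball_gauge_pos[of r] by (simp add: H_def)
    show "\<exists>D. \<forall>r R. 0 < r \<longrightarrow> \<kappa> * r \<le> R \<longrightarrow> R \<le> 2 * r \<longrightarrow> 2 * r \<le> R0 \<longrightarrow> H R \<le> D * H r" if "0 < \<kappa>" for \<kappa>
    proof (intro exI allI impI)
      fix r R assume r: "0 < r" "\<kappa> * r \<le> R" "R \<le> 2 * r" "2 * r \<le> R0"
      have \<kappa>r: "0 < \<kappa> * r" using r that by simp
      have "ball_gauge (2 * r) \<le> ball_gauge R" using r R0 \<kappa>r by (intro R'(3)) auto
      moreover have "ball_gauge r \<le> 3 / 2 * ball_gauge (2 * r)" using r R0 by (intro R'(2)) auto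
      ultimately have g: "2 / 3 * ball_gauge r \<le> ball_gauge R" by linarith
      have "H R \<le> 1 / ((\<kappa> * r) ^ e * (2 / 3 * ball_gauge r))"
        unfolding H_def using g r \<kappa>r ball_gauge_pos[of r] ball_gauge_pos[of R]
        by (intro divide_left_mono mult_mono power_mono mult_pos_pos) auto
      also have "\<dots> = (3 / 2 / \<kappa> ^ e) * H r"
        by (simp add: H_def power_mult_distrib)
      finally show "H R \<le> (3 / 2 / \<kappa> ^ e) * H r" .
    qed
    show "H (2 * r) \<le> 3 / 4 * H r" if "0 < r" "2 * r \<le> R0" for r
    proof -
      have g: "2 / 3 * ball_gauge r \<le> ball_gauge (2 * r)" using R'(2)[of r] that R0 by auto
      have "(2::real) ^ 1 \<le> 2 ^ e" using e by (intro power_increasing) auto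
      then have p: "2 * r ^ e \<le> (2 * r) ^ e" using that by (simp add: power_mult_distrib)
      have "H (2 * r) \<le> 1 / ((2 * r ^ e) * (2 / 3 * ball_gauge r))"
        unfolding H_def using g p that ball_gauge_pos[of r] ball_gauge_pos[of "2 * r"]
        by (intro divide_left_mono mult_mono mult_pos_pos) auto
      also have "\<dots> = 3 / 4 * H r" by (simp add: H_def)
      finally show ?thesis .
    qed
    show "\<exists>h>0. \<forall>r. \<rho> \<le> r \<longrightarrow> r \<le> R0 \<longrightarrow> h \<le> H r" if "0 < \<rho>" for \<rho>
    proof (intro exI[of _ "1 / (R0 ^ e * ball_gauge \<rho>)"] conjI allI impI)
      show "1 / (R0 ^ e * ball_gauge \<rho>) > 0" using R0 ball_gauge_pos[of \<rho>] by simp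
      fix r assume "\<rho> \<le> r" "r \<le> R0"
      then show "1 / (R0 ^ e * ball_gauge \<rho>) \<le> H r"
        unfolding H_def using that R0 ball_gauge_pos[of r] ball_gauge_pos[of \<rho>]
        by (intro divide_left_mono mult_mono power_mono R'(3) mult_pos_pos) auto
    qed
  qed auto
  \<comment> \<open>One constant for both assumptions on A: the first summand covers the oscillation
    obtained from the Poincare inequality, the second the integral over \<Omega>.\<close>
  define C1 where "C1 = 2 ^ (n + 1) * real n * C / ball_const + C0"
  have C1: "C1 \<ge> 0" "C0 \<le> C1" "2 ^ (n + 1) * real n * C \<le> C1 * ball_const"
    using CR C0 ball_const_pos by (auto simp: C1_def field_simps)
  show ?case
  proof (intro exI conjI ballI allI impI)
    show "C1 * (1 + C') * ball_const \<ge> 0" using C1 ch ball_const_pos by simp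
    show "R1 > 0" by (rule ch)
    fix u x r and ks :: "'n list"
    assume u: "u \<in> Sobolev_space m q \<alpha> \<beta> \<Omega>" and ks: "length ks + Suc j = m" and r: "0 < r" "r \<le> R1" and B: "ball x r \<subseteq> \<Omega>"
    define S where "S = Sobolev_norm_real m u"
    have S: "S \<ge> 0" by (simp add: S_def Sobolev_norm_real_nonneg)
    let ?v = "weak_deriv \<Omega> ks u"
    have v: "has_weak_deriv \<Omega> ks u ?v" "set_integrable lebesgue \<Omega> ?v"
      using weak_deriv_facts[OF u, of ks] ks by auto
    have w: "has_weak_deriv \<Omega> (ks @ [i]) u (weak_deriv \<Omega> (ks @ [i]) u)" "set_integrable lebesgue \<Omega> (weak_deriv \<Omega> (ks @ [i]) u)" for i
      using weak_deriv_facts[OF u, of "ks @ [i]"] ks by auto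
    have osc: "oscillation (ball y \<rho>) ?v \<le> C1 * S * H \<rho> * measure lebesgue (ball y \<rho>)"
      if \<rho>: "0 < \<rho>" "\<rho> \<le> R0" "ball y \<rho> \<subseteq> \<Omega>" for y \<rho>
    proof -
      have "oscillation (ball y \<rho>) ?v \<le> 2 ^ (CARD('n) + 1) * real CARD('n) * \<rho> * (C * S * \<rho> ^ j / ball_gauge \<rho>)"
      proof (rule oscillation_le_partials[OF v(2) w(2) has_weak_deriv_snoc[OF v(1) w(1)] \<rho>(3,1)])
        show "(\<integral>\<^sup>+z\<in>ball y \<rho>. ennreal \<bar>weak_deriv \<Omega> (ks @ [i]) u z\<bar> \<partial>lebesgue) \<le> ennreal (C * S * \<rho> ^ j / ball_gauge \<rho>)" for i
          unfolding S_def using \<rho> R0 ks by (intro CR(3) u) auto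
        show "0 \<le> C * S * \<rho> ^ j / ball_gauge \<rho>" using CR S \<rho> ball_gauge_pos[of \<rho>] by simp
      qed
      also have "\<dots> = (2 ^ (n + 1) * real n * C) * (S * \<rho> ^ Suc j / ball_gauge \<rho>)"
        by (simp add: n_def mult_ac)
      also have "\<dots> \<le> (C1 * ball_const) * (S * \<rho> ^ Suc j / ball_gauge \<rho>)"
        using C1(3) S \<rho> ball_gauge_pos[of \<rho>] by (intro mult_right_mono) auto
      also have "\<dots> = C1 * S * H \<rho> * measure lebesgue (ball y \<rho>)"
      proof -
        have "\<rho> ^ n = \<rho> ^ e * \<rho> ^ Suc j" unfolding e(2) by (rule power_add)
        then have "\<rho> ^ Suc j / ball_gauge \<rho> = H \<rho> * \<rho> ^ n" using \<rho> by (simp add: H_def)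
        then have 1: "S * \<rho> ^ Suc j / ball_gauge \<rho> = S * (H \<rho> * \<rho> ^ n)"
          by (simp only: times_divide_eq_right[symmetric])
        have 2: "measure lebesgue (ball y \<rho>) = ball_const * \<rho> ^ n" using measure_ball_const[of \<rho> y] \<rho> by (simp add: n_def)
        show ?thesis unfolding 1 2 by (simp only: mult_ac)
      qed
      finally show ?thesis .
    qed
    have whole: "(LINT x:\<Omega>|lebesgue. \<bar>?v x\<bar>) \<le> C1 * S"
    proof -
      have int: "integrable lebesgue (\<lambda>x. indicator \<Omega> x * \<bar>?v x\<bar>)"
        using set_integrable_abs[OF v(2)] by (simp add: set_integrable_def)
      have "ennreal (LINT x:\<Omega>|lebesgue. \<bar>?v x\<bar>) = (\<integral>\<^sup>+x. ennreal (indicator \<Omega> x * \<bar>?v x\<bar>) \<partial>lebesgue)"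
        unfolding set_lebesgue_integral_def using nn_integral_eq_integral[OF int] by simp
      also have "\<dots> = (\<integral>\<^sup>+x\<in>\<Omega>. ennreal \<bar>?v x\<bar> \<partial>lebesgue)"
        by (intro nn_integral_cong) (auto simp: indicator_def)
      also have "\<dots> \<le> ennreal (C0 * S)" unfolding S_def using ks by (intro C0(2) u) auto
      finally have "(LINT x:\<Omega>|lebesgue. \<bar>?v x\<bar>) \<le> C0 * S" using C0 S by (simp add: ennreal_le_iff)
      also have "\<dots> \<le> C1 * S" using C1 S by (intro mult_right_mono) auto
      finally show ?thesis .
    qed
    have A: "C1 * S \<ge> 0" using C1 S by simp
    have mean: "\<bar>mean (ball x r) ?v\<bar> \<le> C1 * S * (C' * H r)"
      by (rule ch(4)[OF v(2) A osc whole r B])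
    have Hr: "H r > 0" using r ball_gauge_pos[of r] by (simp add: H_def)
    have mB: "measure lebesgue (ball x r) = ball_const * r ^ n" using measure_ball_const[of r x] r by (simp add: n_def)
    have "(\<integral>\<^sup>+y\<in>ball x r. ennreal \<bar>?v y\<bar> \<partial>lebesgue)
       \<le> (\<integral>\<^sup>+y. ennreal \<bar>?v y - mean (ball x r) ?v\<bar> * indicator (ball x r) y + ennreal \<bar>mean (ball x r) ?v\<bar> * indicator (ball x r) y \<partial>lebesgue)"
    proof (rule nn_integral_mono)
      fix y
      have "ennreal \<bar>?v y\<bar> \<le> ennreal (\<bar>?v y - mean (ball x r) ?v\<bar> + \<bar>mean (ball x r) ?v\<bar>)"
        by (intro ennreal_leI) linarith
      then show "ennreal \<bar>?v y\<bar> * indicator (ball x r) y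
        \<le> ennreal \<bar>?v y - mean (ball x r) ?v\<bar> * indicator (ball x r) y + ennreal \<bar>mean (ball x r) ?v\<bar> * indicator (ball x r) y"
        by (auto simp: indicator_def ennreal_plus)
    qed
    also have "\<dots> = ennreal (oscillation (ball x r) ?v) + ennreal \<bar>mean (ball x r) ?v\<bar> * ennreal (measure lebesgue (ball x r))"
    proof (subst nn_integral_add)
      have "set_integrable lebesgue (ball x r) ?v" by (rule set_integrable_subset[OF v(2) _ B]) simp
      then have "set_integrable lebesgue (ball x r) (\<lambda>y. ?v y - mean (ball x r) ?v)"
        using set_integrable_const_ball by (auto intro: set_integral_diff)
      then have "(\<lambda>y. ennreal \<bar>indicator (ball x r) y *\<^sub>R (?v y - mean (ball x r) ?v)\<bar>) \<in> borel_measurable lebesgue"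
        by (auto simp: set_integrable_def)
      moreover have "(\<lambda>y. ennreal \<bar>indicator (ball x r) y *\<^sub>R (?v y - mean (ball x r) ?v)\<bar>)
          = (\<lambda>y. ennreal \<bar>?v y - mean (ball x r) ?v\<bar> * indicator (ball x r) y)"
        by (auto simp: fun_eq_iff indicator_def)
      ultimately show "(\<lambda>y. ennreal \<bar>?v y - mean (ball x r) ?v\<bar> * indicator (ball x r) y) \<in> borel_measurable lebesgue"
        by (simp only:)
      have [measurable]: "ball x r \<in> sets lebesgue" by simp
      show "(\<lambda>y. ennreal \<bar>mean (ball x r) ?v\<bar> * indicator (ball x r) y) \<in> borel_measurable lebesgue"
        by measurable
      show "(\<integral>\<^sup>+y\<in>ball x r. ennreal \<bar>?v y - mean (ball x r) ?v\<bar> \<partial>lebesgue) + (\<integral>\<^sup>+y. ennreal \<bar>mean (ball x r) ?v\<bar> * indicator (ball x r) y \<partial>lebesgue)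
        = ennreal (oscillation (ball x r) ?v) + ennreal \<bar>mean (ball x r) ?v\<bar> * ennreal (measure lebesgue (ball x r))"
        unfolding nn_integral_eq_oscillation_subset[OF v(2) B]
        by (subst nn_integral_cmult_indicator) (auto simp: emeasure_eq_measure2 lmeasurable_ball simp del: emeasure_completion content_ball)
    qed
    also have "\<dots> = ennreal (oscillation (ball x r) ?v + \<bar>mean (ball x r) ?v\<bar> * measure lebesgue (ball x r))"
    proof -
      have "oscillation (ball x r) ?v \<ge> 0"
        unfolding oscillation_def set_lebesgue_integral_def by (intro integral_nonneg_AE) auto
      then show ?thesis by (simp add: ennreal_mult ennreal_plus del: content_ball)
    qed
    also have "\<dots> \<le> ennreal (C1 * (1 + C') * ball_const * S * r ^ Suc j / ball_gauge r)"
    proof (rule ennreal_leI)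
      have "oscillation (ball x r) ?v \<le> C1 * S * H r * (ball_const * r ^ n)"
        using osc[of r x] r ch(2) B by (simp add: mB del: content_ball)
      moreover have "\<bar>mean (ball x r) ?v\<bar> * measure lebesgue (ball x r) \<le> C1 * S * (C' * H r) * (ball_const * r ^ n)"
        unfolding mB using mean ball_const_pos r by (intro mult_right_mono) auto
      ultimately have "oscillation (ball x r) ?v + \<bar>mean (ball x r) ?v\<bar> * measure lebesgue (ball x r)
          \<le> C1 * (1 + C') * ball_const * S * (H r * r ^ n)"
        by (simp add: algebra_simps del: content_ball)
      also have "H r * r ^ n = r ^ Suc j / ball_gauge r"
      proof -
        have "r ^ n = r ^ e * r ^ Suc j" unfolding e(2) by (rule power_add)
        then show ?thesis using r by (simp add: H_def)
      qed
      finally show "oscillation (ball x r) ?v + \<bar>mean (ball x r) ?v\<bar> * measure lebesgue (ball x r)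
          \<le> C1 * (1 + C') * ball_const * S * r ^ Suc j / ball_gauge r" by simp
    qed
    finally show "(\<integral>\<^sup>+y\<in>ball x r. ennreal \<bar>?v y\<bar> \<partial>lebesgue) \<le> ennreal (C1 * (1 + C') * ball_const * Sobolev_norm_real m u * r ^ Suc j / ball_gauge r)"
      by (simp add: S_def)
  qed
qed

text \<open>First-order derivatives lie m - 1 < n orders below the top, so
  \<open>weak_deriv_small_balls\<close> bounds them on small balls. One more Poincare inequality
  gives oscillation of order r^m / gauge, which after division by |B| is the rate r^(m-n) /
  gauge.\<close>

lemma Sobolev_embedding:
  assumes m: "1 \<le> m" "m \<le> CARD('n)" and \<psi>: "admissible \<psi>" "obeys_near_0 CARD('n) m q \<alpha> \<beta> \<psi>"
  shows "Sobolev_into_Campanato m q \<alpha> \<beta> \<psi> \<Omega>"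
proof -
  define n where "n = CARD('n)"
  have n: "n \<ge> 1" unfolding n_def by (simp add: Suc_leI)
  have VP: "domain_volume > 0" by (rule John_domain_facts)
  \<comment> \<open>The seminorm evaluates \<psi> at |B|^(1/n) = \<theta> r and not at r. Taking K =
    1 / \<open>domain_volume\<close>, the gauge at \<theta> r is
    \<open>ball_gauge r\<close>.\<close>
  define \<theta> where "\<theta> = ball_const powr (1 / real n)"
  have \<theta>: "\<theta> > 0" "\<theta> ^ n = ball_const" using ball_const_pos n by (auto simp: \<theta>_def powr_realpow[symmetric] powr_powr)
  have rad: "(ball_const * r ^ n) powr (1 / real n) = \<theta> * r" if "r > 0" for r
  proof -
    have "(ball_const * r ^ n) powr (1 / real n) = \<theta> * (r ^ n) powr (1 / real n)"
      using ball_const_pos that by (simp add: powr_mult \<theta>_def)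
    also have "(r ^ n) powr (1 / real n) = r" using that n by (simp add: powr_realpow[symmetric] powr_powr)
    finally show ?thesis .
  qed
  have gauge_\<theta>: "lz_gauge q \<alpha> \<beta> (ell (1 / domain_volume * (\<theta> * r) ^ n)) = ball_gauge r" for r
    by (simp add: ball_gauge_def n_def power_mult_distrib \<theta>(2)[unfolded n_def])
  have V1: "1 / domain_volume > 0" using VP by simp
  obtain c r0 where c_all: "c > 0" "r0 > 0" "\<forall>r. 0 < r \<longrightarrow> r < r0 \<longrightarrow>
    r powr (real m - real n) / lz_gauge q \<alpha> \<beta> (ell (1 / domain_volume * r ^ n)) \<le> c * \<psi> r \<and>
    \<psi> r \<le> c * (r powr (real m - real n) / lz_gauge q \<alpha> \<beta> (ell (1 / domain_volume * r ^ n)))"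
    using obeys_near_0_gauge[OF adm V1 n \<psi>(2)[folded n_def]] by (elim exE conjE)
  note c = c_all(1,2) c_all(3)[rule_format, THEN conjunct1]
  have "m - 1 \<le> m" "m - 1 < CARD('n)" using m by auto
  from weak_deriv_small_balls[OF this] obtain C R where CR_all: "C \<ge> 0" "R > 0" "\<forall>u\<in>Sobolev_space m q \<alpha> \<beta> \<Omega>. \<forall>ks x r. length ks + (m - 1) = m \<longrightarrow> 0 < r \<longrightarrow> r \<le> R \<longrightarrow> ball x r \<subseteq> \<Omega> \<longrightarrow>
     (\<integral>\<^sup>+y\<in>ball x r. ennreal \<bar>weak_deriv \<Omega> ks u y\<bar> \<partial>lebesgue) \<le> ennreal (C * Sobolev_norm_real m u * r ^ (m - 1) / ball_gauge r)"
    by (elim exE conjE)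
  note CR = CR_all(1,2) CR_all(3)[rule_format]
  obtain C0 where C0_all: "C0 \<ge> 0" "\<forall>m u ks. u \<in> Sobolev_space m q \<alpha> \<beta> \<Omega> \<longrightarrow> length ks \<le> m \<longrightarrow>
       (\<integral>\<^sup>+y\<in>\<Omega>. ennreal \<bar>weak_deriv \<Omega> ks u y\<bar> \<partial>lebesgue) \<le> ennreal (C0 * Sobolev_norm_real m u)"
    using weak_deriv_integral_whole by (elim exE conjE)
  note C0 = C0_all(1) C0_all(2)[rule_format]
  \<comment> \<open>The factor 2 makes \<theta> r strictly smaller than r0 for all r <= R2.\<close>
  define R2 where "R2 = min R (r0 / (2 * \<theta>))"
  have R2: "R2 > 0" "R2 \<le> R" "R2 \<le> r0 / (2 * \<theta>)" using CR c \<theta> by (auto simp: R2_def)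
  have "\<theta> * R2 > 0" using \<theta> R2 by simp
  from admissible_lower_bound[OF \<psi>(1) this]
  obtain p0 where p0: "p0 > 0" "\<And>r. \<theta> * R2 \<le> r \<Longrightarrow> p0 \<le> \<psi> r"
    by blast
  have \<psi>pos: "\<psi> r > 0" if "r > 0" for r using \<psi>(1) that by (simp add: admissible_def)
  define C1 where "C1 = 2 ^ (n + 1) * real n * C / ball_const * \<theta> powr (real n - real m) * c"
  define C2 where "C2 = 2 * C0 / (p0 * (ball_const * R2 ^ n))"
  define CC where "CC = max C1 C2"
  have C12: "C1 \<ge> 0" "C2 \<ge> 0" using CR C0 ball_const_pos c p0 R2 by (auto simp: C1_def C2_def)
  have main: "Campanato_seminorm \<psi> \<Omega> u \<le> ennreal CC * Sobolev_norm m q \<alpha> \<beta> \<Omega> u"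
    if u: "u \<in> Sobolev_space m q \<alpha> \<beta> \<Omega>" for u
  proof -
    define S where "S = Sobolev_norm_real m u"
    have S: "S \<ge> 0" by (simp add: S_def Sobolev_norm_real_nonneg)
    have SN: "Sobolev_norm m q \<alpha> \<beta> \<Omega> u = ennreal S"
      using Sobolev_norm_finite[OF u] by (simp add: S_def Sobolev_norm_real_def)
    have ui: "set_integrable lebesgue \<Omega> u" by (rule Sobolev_integrable[OF u])
    have uL: "u \<in> L1loc \<Omega>" using weak_deriv_facts(1)[OF u, of "[]"] by (simp add: has_weak_deriv_def)
    have u0: "has_weak_deriv \<Omega> [] u u" using uL by (simp add: has_weak_deriv_def)
    have ball: "ennreal (1 / \<psi> (measure lebesgue (ball x r) powr (1 / CARD('n))))
          * (ennreal (1 / measure lebesgue (ball x r)) * (\<integral>\<^sup>+y\<in>ball x r. ennreal \<bar>u y - mean (ball x r) u\<bar> \<partial>lebesgue))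
        \<le> ennreal (CC * S)" if r: "0 < r" and B: "ball x r \<subseteq> \<Omega>" for x r
    proof -
      have mB: "measure lebesgue (ball x r) = ball_const * r ^ n" using measure_ball_const[of r x] r by (simp add: n_def)
      have mpos: "ball_const * r ^ n > 0" using ball_const_pos r by simp
      let ?\<rho> = "\<theta> * r"
      have \<rho>: "?\<rho> > 0" using \<theta> r by simp
      define osc where "osc = oscillation (ball x r) u"
      have osc0: "osc \<ge> 0" unfolding osc_def oscillation_def set_lebesgue_integral_def by (intro integral_nonneg_AE) auto
      have "osc / (ball_const * r ^ n) / \<psi> ?\<rho> \<le> CC * S"
      proof (cases "r \<le> R2")
        case True
        have "osc \<le> 2 ^ (CARD('n) + 1) * real CARD('n) * r * (C * S * r ^ (m - 1) / ball_gauge r)"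
          unfolding osc_def
        proof (rule oscillation_le_partials[OF ui])
          show "has_weak_deriv \<Omega> [i] u (weak_deriv \<Omega> [i] u)" "set_integrable lebesgue \<Omega> (weak_deriv \<Omega> [i] u)" for i
            using weak_deriv_facts[OF u, of "[i]"] m by auto
          show "(\<integral>\<^sup>+y\<in>ball x r. ennreal \<bar>weak_deriv \<Omega> [i] u y\<bar> \<partial>lebesgue) \<le> ennreal (C * S * r ^ (m - 1) / ball_gauge r)" for i
            unfolding S_def using True R2 m r B by (intro CR(3) u) auto
          show "0 \<le> C * S * r ^ (m - 1) / ball_gauge r" using CR S r ball_gauge_pos[of r] by simp
        qed (use B r in auto)
        also have "\<dots> = 2 ^ (n + 1) * real n * C * S * (r * r ^ (m - 1) / ball_gauge r)" by (simp add: n_def mult_ac)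
        also have "r * r ^ (m - 1) = r ^ m" using m by (cases m) auto
        finally have "osc / (ball_const * r ^ n) \<le> 2 ^ (n + 1) * real n * C * S * (r ^ m / ball_gauge r) / (ball_const * r ^ n)"
          using mpos by (intro divide_right_mono) auto
        also have "\<dots> = 2 ^ (n + 1) * real n * C / ball_const * S * ((r ^ m / r ^ n) / ball_gauge r)" by simp
        also have "r ^ m / r ^ n = r powr (real m - real n)" using r by (simp add: powr_diff powr_realpow)
        also have "r powr (real m - real n) / ball_gauge r = \<theta> powr (real n - real m) * (?\<rho> powr (real m - real n) / ball_gauge r)"
        proof -
          have "\<theta> powr (real n - real m) * \<theta> powr (real m - real n) = 1"
            using \<theta> by (simp add: powr_add[symmetric])
          moreover have "?\<rho> powr (real m - real n) = \<theta> powr (real m - real n) * r powr (real m - real n)"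
            by (rule powr_mult)
          ultimately show ?thesis by (simp add: mult.assoc[symmetric])
        qed
        also have "2 ^ (n + 1) * real n * C / ball_const * S * (\<theta> powr (real n - real m) * (?\<rho> powr (real m - real n) / ball_gauge r))
           \<le> 2 ^ (n + 1) * real n * C / ball_const * S * (\<theta> powr (real n - real m) * (c * \<psi> ?\<rho>))"
        proof (intro mult_left_mono)
          have "\<theta> * r \<le> \<theta> * R2" using \<theta> True by simp
          also have "\<dots> \<le> \<theta> * (r0 / (2 * \<theta>))" using \<theta> R2 by (intro mult_left_mono) auto
          also have "\<dots> < r0" using \<theta> c by simp
          finally have "?\<rho> < r0" .
          from c(3)[OF \<rho> this] show "?\<rho> powr (real m - real n) / ball_gauge r \<le> c * \<psi> ?\<rho>" unfolding gauge_\<theta> .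
        qed (use CR S ball_const_pos in auto)
        also have "\<dots> = C1 * S * \<psi> ?\<rho>" by (simp add: C1_def)
        finally have "osc / (ball_const * r ^ n) / \<psi> ?\<rho> \<le> C1 * S"
          unfolding pos_divide_le_eq[OF \<psi>pos[OF \<rho>]] .
        also have "\<dots> \<le> CC * S" using S by (intro mult_right_mono) (auto simp: CC_def)
        finally show ?thesis .
      next
        \<comment> \<open>On larger balls the oscillation is at most twice the integral of |u|,
          which the norm bounds over all of \<Omega>; |B| and \<psi> are bounded below
          there.\<close>
        case False
        have ub: "set_integrable lebesgue (ball x r) u" by (rule set_integrable_subset[OF ui _ B]) simp
        define I where "I = (LINT y:ball x r|lebesgue. \<bar>u y\<bar>)"
        have uab: "integrable lebesgue (\<lambda>y. indicator (ball x r) y * \<bar>u y\<bar>)"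
          using set_integrable_abs[OF ub] by (simp add: set_integrable_def)
        have "ennreal I = (\<integral>\<^sup>+y. ennreal (indicator (ball x r) y * \<bar>u y\<bar>) \<partial>lebesgue)"
          unfolding I_def set_lebesgue_integral_def using nn_integral_eq_integral[OF uab] by simp
        also have "\<dots> \<le> (\<integral>\<^sup>+y\<in>\<Omega>. ennreal \<bar>weak_deriv \<Omega> [] u y\<bar> \<partial>lebesgue)"
          using Sobolev_integrable(2)[OF u] B
          by (intro nn_integral_mono_AE) (auto simp: indicator_def elim!: eventually_mono)
        also have "\<dots> \<le> ennreal (C0 * S)" unfolding S_def by (intro C0(2) u) auto
        finally have I: "I \<le> C0 * S" using C0 S by (simp add: ennreal_le_iff)
        have "osc \<le> I + \<bar>mean (ball x r) u\<bar> * (ball_const * r ^ n)"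
        proof -
          have ci: "integrable lebesgue (\<lambda>y. indicator (ball x r) y * \<bar>mean (ball x r) u\<bar>)"
            using set_integrable_const_ball[of x r "\<bar>mean (ball x r) u\<bar>"] by (simp add: set_integrable_def)
          have "osc \<le> (\<integral>y. indicator (ball x r) y * \<bar>u y\<bar> + indicator (ball x r) y * \<bar>mean (ball x r) u\<bar> \<partial>lebesgue)"
            unfolding osc_def oscillation_def set_lebesgue_integral_def
          proof (rule integral_mono)
            have "set_integrable lebesgue (ball x r) (\<lambda>y. u y - mean (ball x r) u)"
              using ub set_integrable_const_ball by (auto intro: set_integral_diff)
            from set_integrable_abs[OF this] show "integrable lebesgue (\<lambda>y. indicator (ball x r) y *\<^sub>R \<bar>u y - mean (ball x r) u\<bar>)"
              by (simp add: set_integrable_def)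
            show "integrable lebesgue (\<lambda>y. indicator (ball x r) y * \<bar>u y\<bar> + indicator (ball x r) y * \<bar>mean (ball x r) u\<bar>)"
              using uab ci by simp
          qed (auto simp: indicator_def)
          also have "\<dots> = I + (\<integral>y. indicator (ball x r) y * \<bar>mean (ball x r) u\<bar> \<partial>lebesgue)"
            using uab ci by (simp add: I_def set_lebesgue_integral_def)
          also have "(\<integral>y. indicator (ball x r) y * \<bar>mean (ball x r) u\<bar> \<partial>lebesgue) = \<bar>mean (ball x r) u\<bar> * measure lebesgue (ball x r)"
            by simp
          finally show ?thesis by (simp only: mB)
        qed
        also have "\<bar>mean (ball x r) u\<bar> * (ball_const * r ^ n) \<le> I"
        proof -
          have "\<bar>LINT y:ball x r|lebesgue. u y\<bar> \<le> I"
            unfolding I_def set_lebesgue_integral_def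
            by (rule order_trans[OF integral_abs_bound]) (simp add: abs_mult)
          then show ?thesis
            by (simp only: mean_def mB abs_divide abs_of_pos[OF mpos] times_divide_eq_left
                nonzero_mult_div_cancel_right[OF less_imp_neq[OF mpos, symmetric]])
        qed
        finally have "osc \<le> 2 * (C0 * S)" using I by simp
        moreover have "ball_const * R2 ^ n \<le> ball_const * r ^ n"
          using False R2 ball_const_pos by (intro mult_left_mono power_mono) auto
        moreover have "p0 \<le> \<psi> ?\<rho>" using False \<theta> by (intro p0) auto
        ultimately have "osc / (ball_const * r ^ n * \<psi> ?\<rho>) \<le> 2 * (C0 * S) / (ball_const * R2 ^ n * p0)"
          using p0 R2 ball_const_pos C0 S \<psi>pos[OF \<rho>] mpos by (intro frac_le mult_mono mult_pos_pos) auto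
        also have "\<dots> = C2 * S" by (simp add: C2_def mult_ac)
        also have "\<dots> \<le> CC * S" using S by (intro mult_right_mono) (auto simp: CC_def)
        finally show ?thesis by simp
      qed
      moreover have "ennreal (1 / \<psi> ?\<rho>) * (ennreal (1 / (ball_const * r ^ n)) * ennreal osc) = ennreal (osc / (ball_const * r ^ n) / \<psi> ?\<rho>)"
        using osc0 mpos \<psi>pos[OF \<rho>] by (simp add: ennreal_mult[symmetric] mult_ac)
      ultimately show ?thesis
        unfolding mB nn_integral_eq_oscillation_subset[OF ui B] osc_def[symmetric] n_def[symmetric] rad[OF r]
        by (simp add: ennreal_leI)
    qed
    have "Campanato_seminorm \<psi> \<Omega> u \<le> ennreal (CC * S)"
      unfolding Campanato_seminorm_def using ball by (intro SUP_least) auto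
    then show ?thesis using S C12 by (simp add: SN ennreal_mult CC_def le_max_iff_disj)
  qed
  have "Sobolev_space m q \<alpha> \<beta> \<Omega> \<subseteq> Campanato_space \<psi> \<Omega>"
  proof
    fix u assume u: "u \<in> Sobolev_space m q \<alpha> \<beta> \<Omega>"
    have "u \<in> L1loc \<Omega>" using weak_deriv_facts(1)[OF u, of "[]"] by (simp add: has_weak_deriv_def)
    moreover have "Campanato_seminorm \<psi> \<Omega> u < top"
      using le_less_trans[OF main[OF u]] Sobolev_norm_finite[OF u]
      by (metis ennreal_less_top ennreal_mult_less_top)
    ultimately show "u \<in> Campanato_space \<psi> \<Omega>" by (simp add: Campanato_space_def)
  qed
  then show ?thesis unfolding embeds_def using main by blast
qed

end

section \<open>Optimality\<close>

text \<open>Whatever the mean is, it misses one of the two values by \<epsilon> / 2: if it is at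
  least \<epsilon> / 2 it is far from 0 on P, otherwise far from u on Q.\<close>

lemma oscillation_lower_bound:
  fixes u :: "real^'n \<Rightarrow> real"
  assumes u: "set_integrable lebesgue (ball x r) u"
    and P: "P \<in> sets lebesgue" "P \<subseteq> ball x r" "\<And>y. y \<in> P \<Longrightarrow> u y = 0" "\<kappa> \<le> measure lebesgue P"
    and Q: "Q \<in> sets lebesgue" "Q \<subseteq> ball x r" "\<And>y. y \<in> Q \<Longrightarrow> \<epsilon> \<le> u y" "\<kappa> \<le> measure lebesgue Q"
    and \<epsilon>: "\<epsilon> > 0"
  shows "\<epsilon> / 2 * \<kappa> \<le> oscillation (ball x r) u"
proof -
  let ?B = "ball x r" and ?c = "mean (ball x r) u"
  have "set_integrable lebesgue ?B (\<lambda>y. u y - ?c)"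
    using u set_integrable_const_ball by (auto intro: set_integral_diff)
  from set_integrable_abs[OF this] have int: "integrable lebesgue (\<lambda>y. indicator ?B y *\<^sub>R \<bar>u y - ?c\<bar>)"
    by (simp add: set_integrable_def)
  have key: "\<epsilon> / 2 * \<kappa> \<le> oscillation ?B u"
    if T: "T \<in> sets lebesgue" "T \<subseteq> ?B" "\<kappa> \<le> measure lebesgue T" and le: "\<And>y. y \<in> T \<Longrightarrow> \<epsilon> / 2 \<le> \<bar>u y - ?c\<bar>" for T
  proof -
    have Tl: "T \<in> lmeasurable" by (rule fmeasurableI2[OF ball_lmeasurable T(2,1)])
    have "\<epsilon> / 2 * \<kappa> \<le> \<epsilon> / 2 * measure lebesgue T" using \<epsilon> T by (intro mult_left_mono) auto
    also have "\<dots> = (\<integral>y. indicator T y * (\<epsilon> / 2) \<partial>lebesgue)" using T by simp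
    also have "\<dots> \<le> oscillation ?B u"
      unfolding oscillation_def set_lebesgue_integral_def
    proof (rule integral_mono[OF _ int])
      show "integrable lebesgue (\<lambda>y. indicator T y * (\<epsilon> / 2))"
        using Tl by (intro integrable_mult_left) (simp add: lmeasurable_iff_integrable)
      show "indicator T y * (\<epsilon> / 2) \<le> indicator ?B y *\<^sub>R \<bar>u y - ?c\<bar>" for y
        using le[of y] T(2) by (cases "y \<in> T") auto
    qed
    finally show ?thesis .
  qed
  show ?thesis
  proof (cases "?c \<ge> \<epsilon> / 2")
    case True
    show ?thesis by (rule key[OF P(1,2,4)]) (use True P(3) in auto)
  next
    case False
    show ?thesis
    proof (rule key[OF Q(1,2,4)])
      show "\<epsilon> / 2 \<le> \<bar>u y - ?c\<bar>" if "y \<in> Q" for y using Q(3)[OF that] False by linarith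
    qed
  qed
qed

lemma unit_bump:
  "\<exists>(\<eta> :: real^'n \<Rightarrow> real) z s \<epsilon>. test_function (ball 0 1) \<eta> \<and> s > 0 \<and> \<epsilon> > 0 \<and>
    ball z s \<subseteq> ball 0 1 \<and> (\<forall>x\<in>ball z s. \<eta> x = 0) \<and>
    ball (0::real^'n) s \<subseteq> ball 0 1 \<and> (\<forall>x\<in>ball 0 s. \<epsilon> \<le> \<eta> x)"
proof -
  define n where "n = real CARD('n)"
  have n: "n \<ge> 1" unfolding n_def by (simp add: Suc_leI)
  \<comment> \<open>The cube of half-side d has l1-radius n d = 1 - d, so it lies in the closed ball
    of radius 1 - d and leaves a shell of width d where \<eta> vanishes.\<close>
  define d where "d = 1 / (n + 1)"
  have d: "d > 0" "n * d = 1 - d" using n by (auto simp: d_def field_simps)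
  define a b :: "real^'n" where "a = (\<chi> i. - d)" and "b = (\<chi> i. d)"
  define \<eta> where "\<eta> = box_bump 1 a b"
  have small: "norm x \<le> 1 - d" if "x \<in> cbox a b" for x
  proof -
    have "\<bar>x $ i\<bar> \<le> d" for i
    proof -
      have "- d \<le> x $ i" "x $ i \<le> d" using that by (auto simp: mem_box_cart a_def b_def)
      then show ?thesis by linarith
    qed
    then have "(\<Sum>i\<in>UNIV. \<bar>x $ i\<bar>) \<le> (\<Sum>i\<in>(UNIV::'n set). d)" by (intro sum_mono) auto
    also have "\<dots> = 1 - d" using d(2) by (simp add: n_def)
    finally show ?thesis using norm_le_l1_cart[of x] by linarith
  qed
  have test: "test_function (ball 0 1) \<eta>"
    unfolding \<eta>_def
  proof (rule test_function_box_bump)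
    show "cbox a b \<subseteq> ball 0 1"
    proof
      fix x assume "x \<in> cbox a b"
      from small[OF this] d(1) show "x \<in> ball 0 1" by simp
    qed
  qed simp
  have pos: "\<eta> 0 > 0"
    unfolding \<eta>_def by (subst box_bump_pos_iff) (use d in \<open>auto simp: mem_box_cart a_def b_def\<close>)
  have "continuous_on UNIV (iter_partial [] \<eta>)"
    using test by (intro smooth_continuous) (simp add: test_function_def)
  then have "isCont \<eta> 0" by (simp add: continuous_on_eq_continuous_at)
  then have "eventually (\<lambda>x. \<eta> x > \<eta> 0 / 2) (at 0)"
    using pos by (intro order_tendstoD(1)[of \<eta> "\<eta> 0"]) (auto simp: isCont_def)
  then obtain e where e: "e > 0" "\<And>x. x \<noteq> 0 \<Longrightarrow> dist x 0 < e \<Longrightarrow> \<eta> x > \<eta> 0 / 2"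
    by (auto simp: eventually_at)
  define s where "s = min (min e 1) (d / 2)"
  have s: "s > 0" "s \<le> e" "s \<le> 1" "s \<le> d / 2" using e d by (auto simp: s_def)
  \<comment> \<open>Since z has norm 1 - s, the ball around it stays in the unit ball, and because 2
    s <= d also in the shell outside the cube.\<close>
  define z :: "real^'n" where "z = (1 - s) *\<^sub>R axis (SOME i. True) 1"
  have z: "norm z = 1 - s" using s by (simp add: z_def)
  show ?thesis
  proof (rule exI[of _ \<eta>], rule exI[of _ z], rule exI[of _ s], rule exI[of _ "\<eta> 0 / 2"], intro conjI ballI)
    show "ball z s \<subseteq> ball 0 1"
    proof
      fix x assume "x \<in> ball z s"
      then have "norm (z - x) < s" by (simp add: dist_norm)
      then show "x \<in> ball 0 1" using norm_triangle_ineq2[of x z] z by (simp add: norm_minus_commute)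
    qed
    show "\<eta> x = 0" if "x \<in> ball z s" for x
    proof -
      have "norm (z - x) < s" using that by (simp add: dist_norm)
      then have "norm x > 1 - d" using norm_triangle_ineq2[of z x] z s by linarith
      then have "x \<notin> box a b" using small[of x] box_subset_cbox[of a b] by fastforce
      then show ?thesis using box_bump_pos_iff[of 1 a b x] box_bump_bounds(1)[of 1 a b x] by (simp add: \<eta>_def)
    qed
    show "\<eta> 0 / 2 \<le> \<eta> x" if "x \<in> ball 0 s" for x
      using e(2)[of x] that s pos by (cases "x = 0") auto
  qed (use test s pos in auto)
qed

lemma test_function_weakly_differentiable: "test_function \<Omega> f \<Longrightarrow> weakly_differentiable m \<Omega> f"
  unfolding weakly_differentiable_def using test_function_has_weak_deriv by blast

lemma grad_abs_measurable:
  fixes \<Omega> :: "(real^'n) set"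
  assumes "open \<Omega>" and wd: "weakly_differentiable k \<Omega> f"
  shows "grad_abs k \<Omega> f \<in> borel_measurable (lebesgue_on \<Omega>)"
proof -
  have "weak_deriv \<Omega> ks f \<in> borel_measurable (lebesgue_on \<Omega>)" if "ks \<in> {ks :: 'n list. length ks = k}" for ks
    using has_weak_deriv_weak_deriv[OF wd, of ks] that
    by (intro L1loc_measurable assms(1)) (simp add: has_weak_deriv_def)
  then have "(\<lambda>x. \<Sum>ks\<in>{ks :: 'n list. length ks = k}. (weak_deriv \<Omega> ks f x)\<^sup>2) \<in> borel_measurable (lebesgue_on \<Omega>)"
    by (intro borel_measurable_sum borel_measurable_power)
  then show ?thesis unfolding grad_abs_def[abs_def] by measurable
qed

text \<open>Almost everywhere the weak derivative along \<open>ks\<close> is the classical one along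
  \<open>rev ks\<close>, whence the reversal in M. The Euclidean length is bounded by the sum of the
  components, all of which vanish off the set in the indicator.\<close>

lemma test_function_grad_abs_le:
  fixes f :: "real^'n \<Rightarrow> real"
  assumes "open \<Omega>" and f: "test_function \<Omega> f" and M: "\<And>ks x. length ks = k \<Longrightarrow> \<bar>iter_partial ks f x\<bar> \<le> M ks"
  shows "AE x in lebesgue. x \<in> \<Omega> \<longrightarrow> \<bar>grad_abs k \<Omega> f x\<bar> \<le> (\<Sum>ks\<in>{ks. length ks = k}. M (rev ks)) * indicator {x. \<exists>ks. iter_partial ks f x \<noteq> 0} x"
proof -
  let ?L = "{ks :: 'n list. length ks = k}"
  have fin: "finite ?L"
    using finite_lists_length_eq[of "UNIV :: 'n set" k] by simp
  note w = has_weak_deriv_weak_deriv[OF test_function_weakly_differentiable[OF f] order_refl]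
  have "AE x in lebesgue. x \<in> \<Omega> \<longrightarrow> weak_deriv \<Omega> ks f x = iter_partial (rev ks) f x" for ks
    by (rule has_weak_deriv_unique[OF assms(1) w test_function_has_weak_deriv[OF f]])
  then have "AE x in lebesgue. \<forall>ks\<in>?L. x \<in> \<Omega> \<longrightarrow> weak_deriv \<Omega> ks f x = iter_partial (rev ks) f x"
    by (intro AE_finite_allI fin) auto
  then show "AE x in lebesgue. x \<in> \<Omega> \<longrightarrow> \<bar>grad_abs k \<Omega> f x\<bar> \<le> (\<Sum>ks\<in>?L. M (rev ks)) * indicator {x. \<exists>ks. iter_partial ks f x \<noteq> 0} x"
  proof eventually_elim
    case (elim x)
    show ?case
    proof
      assume x: "x \<in> \<Omega>"
      have "\<bar>grad_abs k \<Omega> f x\<bar> = L2_set (\<lambda>ks. weak_deriv \<Omega> ks f x) ?L"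
        unfolding grad_abs_def L2_set_def by (intro abs_of_nonneg real_sqrt_ge_zero sum_nonneg) auto
      also have "\<dots> \<le> (\<Sum>ks\<in>?L. \<bar>weak_deriv \<Omega> ks f x\<bar>)" by (rule L2_set_le_sum_abs)
      also have "\<dots> = (\<Sum>ks\<in>?L. \<bar>iter_partial (rev ks) f x\<bar>)"
        using elim x by (intro sum.cong) auto
      also have "\<dots> \<le> (\<Sum>ks\<in>?L. M (rev ks)) * indicator {x. \<exists>ks. iter_partial ks f x \<noteq> 0} x"
      proof (cases "\<exists>ks. iter_partial ks f x \<noteq> 0")
        case True
        then show ?thesis using M by (auto intro!: sum_mono)
      qed (auto intro!: sum_nonneg order_trans[OF abs_ge_zero M])
      finally show "\<bar>grad_abs k \<Omega> f x\<bar> \<le> (\<Sum>ks\<in>?L. M (rev ks)) * indicator {x. \<exists>ks. iter_partial ks f x \<noteq> 0} x" .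
    qed
  qed
qed

text \<open>For the bump rescaled to radius r <= 1, all derivatives of order up to m are at most a
  constant times r^(-m) and live on one ball. By \<open>LZ_norm_upper\<close> their norms are at
  most of order r^(-m) r^n times the gauge, while the mean oscillation is bounded below
  independently of r, by the two balls of \<open>unit_bump\<close>.\<close>

lemma extremal_functions:
  fixes \<Omega> :: "(real^'n) set"
  assumes \<Omega>: "open \<Omega>" "x0 \<in> \<Omega>" "\<Omega> \<in> lmeasurable" "measure lebesgue \<Omega> > 0" and adm: "L1_admissible q \<alpha> \<beta>"
  obtains R C \<kappa> where "R > 0" "C > 0" "\<kappa> > 0"
    "\<And>r. 0 < r \<Longrightarrow> r \<le> R \<Longrightarrow> ball x0 r \<subseteq> \<Omega> \<and>
      (\<exists>u\<in>Sobolev_space m q \<alpha> \<beta> \<Omega>. set_integrable lebesgue (ball x0 r) u \<and>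
        Sobolev_norm m q \<alpha> \<beta> \<Omega> u \<le> ennreal (C * (r powr (real CARD('n) - real m)
           * lz_gauge q \<alpha> \<beta> (ell (unit_ball_vol (real CARD('n)) / measure lebesgue \<Omega> * r ^ CARD('n))))) \<and>
        \<kappa> * measure lebesgue (ball x0 r) \<le> oscillation (ball x0 r) u)"
proof -
  define n where "n = CARD('n)"
  have n: "n \<ge> 1" unfolding n_def by (simp add: Suc_leI)
  define V \<omega> where "V = measure lebesgue \<Omega>" and "\<omega> = unit_ball_vol (real n)"
  have V: "V > 0" "\<omega> > 0" using \<Omega> by (auto simp: V_def \<omega>_def)
  have mb: "measure lebesgue (ball (y::real^'n) r) = \<omega> * r ^ n" if "r \<ge> 0" for y r
    using measure_ball_eq[OF that, of y] by (simp add: \<omega>_def n_def)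
  obtain \<eta> :: "real^'n \<Rightarrow> real" and z s \<epsilon> where \<eta>_all: "test_function (ball 0 1) \<eta>" "s > 0" "\<epsilon> > 0"
    "ball z s \<subseteq> ball 0 1" "\<forall>x\<in>ball z s. \<eta> x = 0"
    "ball (0::real^'n) s \<subseteq> ball 0 1" "\<forall>x\<in>ball 0 s. \<epsilon> \<le> \<eta> x"
    using unit_bump by (elim exE conjE)
  note \<eta> = \<eta>_all(1-4) \<eta>_all(5)[rule_format] \<eta>_all(6) \<eta>_all(7)[rule_format]
  have sm: "smooth \<eta>" using \<eta>(1) by (simp add: test_function_def)
  obtain s1 C where sC: "0 < s1" "s1 < 1" "C > 0"
    "\<And>u E K s. u \<in> borel_measurable (lebesgue_on \<Omega>) \<Longrightarrow>
       E \<in> lmeasurable \<Longrightarrow> K \<ge> 0 \<Longrightarrow> AE x in lebesgue. x \<in> \<Omega> \<longrightarrow> \<bar>u x\<bar> \<le> K * indicator E x \<Longrightarrow>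
       0 < s \<Longrightarrow> s \<le> s1 \<Longrightarrow> measure lebesgue E = V * s \<Longrightarrow>
       LZ_norm q \<alpha> \<beta> \<Omega> u \<le> ennreal (K * (C * (s * lz_gauge q \<alpha> \<beta> (ell s))))"
    unfolding V_def using LZ_norm_upper[OF adm \<Omega>(3,4)] by blast
  obtain d where d: "d > 0" "ball x0 d \<subseteq> \<Omega>" using \<Omega>(1,2) open_contains_ball by blast
  have "\<forall>ks. \<exists>N\<ge>0. \<forall>x. \<bar>iter_partial ks \<eta> x\<bar> \<le> N"
    using test_function_iter_partial_bounded[OF \<eta>(1)] by metis
  then obtain N where N: "\<And>ks. N ks \<ge> 0" "\<And>ks x. \<bar>iter_partial ks \<eta> x\<bar> \<le> N ks" by metis
  define M where "M = (\<Sum>k\<le>m. \<Sum>ks\<in>{ks :: 'n list. length ks = k}. N (rev ks))"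
  have Mk: "(\<Sum>ks\<in>{ks :: 'n list. length ks = k}. N (rev ks)) \<le> M" if "k \<le> m" for k
    unfolding M_def by (rule member_le_sum[of k "{..m}" "\<lambda>k. \<Sum>ks\<in>{ks. length ks = k}. N (rev ks)"]) (use that N in \<open>auto intro!: sum_nonneg\<close>)
  have M: "M \<ge> 0" unfolding M_def using N by (intro sum_nonneg) auto
  \<comment> \<open>R <= 1 serves twice: it lets r^(-m) dominate the lower orders, and it gives r^n
    <= r, so that the last entry keeps the relative volume below s1.\<close>
  define R where "R = min (min 1 d) (s1 * V / \<omega>)"
  have R: "R > 0" "R \<le> 1" "R \<le> d" "R \<le> s1 * V / \<omega>" using d sC V by (auto simp: R_def)
  define C' where "C' = (real m + 1) * (M + 1) * C * (\<omega> / V)"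
  show thesis
  proof (rule that[of R C' "\<epsilon> / 2 * s ^ n"])
    show "R > 0" by (rule R)
    show "C' > 0" using M sC V by (simp add: C'_def)
    show "\<epsilon> / 2 * s ^ n > 0" using \<eta> by simp
    fix r assume r: "0 < r" "r \<le> R"
    let ?B = "ball x0 r"
    have B\<Omega>: "?B \<subseteq> \<Omega>" using d R r by (meson order_trans subset_ball)
    \<comment> \<open>Expanded to the form c x + a of the affine lemmas; \<open>arg\<close> restores
      the rescaled difference.\<close>
    define u where "u x = \<eta> ((1 / r) *\<^sub>R x + (- (1 / r)) *\<^sub>R x0)" for x
    have arg: "(1 / r) *\<^sub>R x + (- (1 / r)) *\<^sub>R x0 = (1 / r) *\<^sub>R (x - x0)" for x by (simp add: algebra_simps)
    have scale: "(1 / r) *\<^sub>R (x - x0) \<in> ball y t \<longleftrightarrow> x \<in> ball (x0 + r *\<^sub>R y) (r * t)" for x y t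
    proof -
      have "y - (1 / r) *\<^sub>R (x - x0) = (1 / r) *\<^sub>R (x0 + r *\<^sub>R y - x)" using r by (simp add: algebra_simps)
      then have D: "dist y ((1 / r) *\<^sub>R (x - x0)) = dist (x0 + r *\<^sub>R y) x / r"
        using r by (simp only: dist_norm norm_scaleR) simp
      show ?thesis unfolding mem_ball D using r by (simp add: divide_less_eq mult.commute)
    qed
    have du: "iter_partial ks u = (\<lambda>x. (1 / r) ^ length ks * iter_partial ks \<eta> ((1 / r) *\<^sub>R (x - x0)))" for ks
      using iter_partial_affine[OF sm, of ks "1 / r" "(- (1 / r)) *\<^sub>R x0"] unfolding u_def[abs_def] by (simp only: arg)
    have outside: "iter_partial ks u x = 0" if "x \<notin> ?B" for ks x
    proof -
      have "(1 / r) *\<^sub>R (x - x0) \<notin> ball 0 1" using that scale[of x 0 1] by simp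
      then have "iter_partial ks \<eta> ((1 / r) *\<^sub>R (x - x0)) = 0" by (rule test_function_outside[OF \<eta>(1)])
      then show ?thesis by (simp add: du)
    qed
    have smu: "smooth u" unfolding u_def[abs_def] by (rule smooth_affine[OF sm])
    have tu: "test_function \<Omega> u"
    proof -
      let ?K = "closure {x. \<eta> x \<noteq> 0}" and ?g = "\<lambda>y. x0 + r *\<^sub>R y"
      have K: "compact ?K" "?K \<subseteq> ball 0 1" using \<eta>(1) by (auto simp: test_function_def)
      have gK: "compact (?g ` ?K)" by (intro compact_continuous_image continuous_intros K(1))
      have "{x. u x \<noteq> 0} \<subseteq> ?g ` ?K"
      proof
        fix x assume "x \<in> {x. u x \<noteq> 0}"
        then have "\<eta> ((1 / r) *\<^sub>R (x - x0)) \<noteq> 0" unfolding mem_Collect_eq u_def arg .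
        then have "(1 / r) *\<^sub>R (x - x0) \<in> ?K" by (intro subsetD[OF closure_subset] CollectI)
        moreover have "x = ?g ((1 / r) *\<^sub>R (x - x0))" using r by (simp add: scaleR_diff_right)
        ultimately show "x \<in> ?g ` ?K" by (rule image_eqI[rotated])
      qed
      then have cl: "closure {x. u x \<noteq> 0} \<subseteq> ?g ` ?K" by (intro closure_minimal compact_imp_closed gK)
      have "?g ` ?K \<subseteq> ?B"
      proof
        fix x assume "x \<in> ?g ` ?K"
        then obtain y where y: "y \<in> ?K" "x = ?g y" by blast
        then have "norm y < 1" using K(2) by auto
        then show "x \<in> ?B" using y(2) r by (simp add: dist_norm)
      qed
      moreover have "compact (closure {x. u x \<noteq> 0})"
        unfolding compact_closure using closure_subset[of "{x. u x \<noteq> 0}"] cl gK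
        by (meson bounded_subset compact_imp_bounded order_trans)
      ultimately show ?thesis using smu cl B\<Omega> by (auto simp: test_function_def)
    qed
    let ?s = "\<omega> / V * r ^ n"
    have "r ^ n \<le> r ^ 1" using r R n by (intro power_decreasing) auto
    then have "?s \<le> \<omega> / V * r" using V by (intro mult_left_mono) auto
    also have "\<dots> \<le> \<omega> / V * (s1 * V / \<omega>)" using r R V by (intro mult_left_mono) auto
    also have "\<dots> = s1" using V by simp
    finally have s: "0 < ?s" "?s \<le> s1" using r V by auto
    let ?G = "lz_gauge q \<alpha> \<beta> (ell ?s)"
    have G: "?G > 0" by (rule gauge_pos[OF ell_ge_1])
    have LZ: "LZ_norm q \<alpha> \<beta> \<Omega> (grad_abs k \<Omega> u) \<le> ennreal ((1 / r) ^ m * M * (C * (?s * ?G)))"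
      and meas: "grad_abs k \<Omega> u \<in> borel_measurable (lebesgue_on \<Omega>)" if k: "k \<le> m" for k
    proof -
      have bound: "\<bar>iter_partial ks u x\<bar> \<le> (1 / r) ^ m * N ks" if "length ks = k" for ks x
      proof -
        have "(1 / r) ^ k \<le> (1 / r) ^ m" using k r R by (intro power_increasing) auto
        then show ?thesis unfolding du that
          using N r by (auto simp: abs_mult intro!: mult_mono)
      qed
      have g: "AE x in lebesgue. x \<in> \<Omega> \<longrightarrow> \<bar>grad_abs k \<Omega> u x\<bar> \<le>
          (\<Sum>ks\<in>{ks. length ks = k}. (1 / r) ^ m * N (rev ks)) * indicator {x. \<exists>ks. iter_partial ks u x \<noteq> 0} x"
        by (rule test_function_grad_abs_le[OF \<Omega>(1) tu]) (rule bound)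
      show m: "grad_abs k \<Omega> u \<in> borel_measurable (lebesgue_on \<Omega>)"
        by (rule grad_abs_measurable[OF \<Omega>(1) test_function_weakly_differentiable[OF tu]])
      show "LZ_norm q \<alpha> \<beta> \<Omega> (grad_abs k \<Omega> u) \<le> ennreal ((1 / r) ^ m * M * (C * (?s * ?G)))"
      proof (rule sC(4)[OF m ball_lmeasurable _ _ s])
        show "0 \<le> (1 / r) ^ m * M" using M r by simp
        show "measure lebesgue ?B = V * ?s" using mb[of r x0] r V by (simp del: content_ball)
        show "AE x in lebesgue. x \<in> \<Omega> \<longrightarrow> \<bar>grad_abs k \<Omega> u x\<bar> \<le> (1 / r) ^ m * M * indicator ?B x"
          using g
        proof eventually_elim
          case (elim x)
          have "(\<Sum>ks\<in>{ks :: 'n list. length ks = k}. (1 / r) ^ m * N (rev ks)) = (1 / r) ^ m * (\<Sum>ks\<in>{ks :: 'n list. length ks = k}. N (rev ks))"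
            by (simp add: sum_distrib_left)
          also have "\<dots> \<le> (1 / r) ^ m * M" using Mk[OF k] r by (intro mult_left_mono) auto
          finally have S: "(\<Sum>ks\<in>{ks :: 'n list. length ks = k}. (1 / r) ^ m * N (rev ks)) \<le> (1 / r) ^ m * M" .
          have "(\<Sum>ks\<in>{ks :: 'n list. length ks = k}. (1 / r) ^ m * N (rev ks)) * indicator {x. \<exists>ks. iter_partial ks u x \<noteq> 0} x
             \<le> (1 / r) ^ m * M * indicator ?B x"
          proof (cases "x \<in> ?B")
            case True
            have "(\<Sum>ks\<in>{ks :: 'n list. length ks = k}. (1 / r) ^ m * N (rev ks)) * indicator {x. \<exists>ks. iter_partial ks u x \<noteq> 0} x
               \<le> ((1 / r) ^ m * M) * 1"
              using S M N r by (intro mult_mono) (auto simp: indicator_def)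
            then show ?thesis using True by simp
          next
            case False
            then show ?thesis using outside[OF False] by simp
          qed
          then show ?case using elim by (meson order_trans)
        qed
      qed
    qed
    have us: "u \<in> Sobolev_space m q \<alpha> \<beta> \<Omega>"
      unfolding Sobolev_space_def LZ_space_def
      using LZ meas test_function_weakly_differentiable[OF tu]
      by (auto intro: le_less_trans[OF _ ennreal_less_top])
    have X: "(1 / r) ^ m * M * (C * (?s * ?G)) \<ge> 0"
      using r M sC(3) V G by (intro mult_nonneg_nonneg divide_nonneg_nonneg) auto
    have "Sobolev_norm m q \<alpha> \<beta> \<Omega> u \<le> (\<Sum>k\<le>m. ennreal ((1 / r) ^ m * M * (C * (?s * ?G))))"
      unfolding Sobolev_norm_def using LZ by (intro sum_mono) auto
    also have "\<dots> = ennreal ((real m + 1) * ((1 / r) ^ m * M * (C * (?s * ?G))))"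
      using X by (subst sum_ennreal) (simp_all only: sum_constant card_atMost of_nat_Suc add.commute)
    also have "\<dots> \<le> ennreal (C' * (r powr (real n - real m) * ?G))"
    proof (rule ennreal_leI)
      have e: "(1 / r) ^ m * r ^ n = r powr (real n - real m)"
        using r by (simp add: powr_diff powr_realpow power_one_over divide_inverse power_inverse mult.commute)
      have "(real m + 1) * ((1 / r) ^ m * M * (C * (?s * ?G))) = (real m + 1) * M * C * (\<omega> / V) * (((1 / r) ^ m * r ^ n) * ?G)"
        by (simp add: mult_ac)
      also have "\<dots> \<le> C' * (r powr (real n - real m) * ?G)"
        unfolding e C'_def using M sC V G by (intro mult_right_mono mult_left_mono) auto
      finally show "(real m + 1) * ((1 / r) ^ m * M * (C * (?s * ?G))) \<le> C' * (r powr (real n - real m) * ?G)" .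
    qed
    finally have norm: "Sobolev_norm m q \<alpha> \<beta> \<Omega> u \<le> ennreal (C' * (r powr (real n - real m) * ?G))" .
    have ui: "set_integrable lebesgue ?B u"
    proof -
      have "u absolutely_integrable_on cball x0 r"
        using smooth_L1loc[OF smu, of "[]" UNIV] by (simp add: L1loc_def)
      then show ?thesis by (rule set_integrable_subset) (auto simp: ball_subset_cball)
    qed
    have osc: "\<epsilon> / 2 * (\<omega> * (r * s) ^ n) \<le> oscillation ?B u"
    proof (rule oscillation_lower_bound[OF ui])
      show "ball (x0 + r *\<^sub>R z) (r * s) \<subseteq> ?B"
      proof
        fix y assume "y \<in> ball (x0 + r *\<^sub>R z) (r * s)"
        then have "(1 / r) *\<^sub>R (y - x0) \<in> ball 0 1" using \<eta>(4) unfolding scale[symmetric] by (rule subsetD[rotated])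
        then show "y \<in> ?B" using scale[of y 0 1] by simp
      qed
      show "u y = 0" if "y \<in> ball (x0 + r *\<^sub>R z) (r * s)" for y
        unfolding u_def arg by (rule \<eta>(5)) (use that in \<open>simp only: scale\<close>)
      show "ball x0 (r * s) \<subseteq> ?B"
      proof
        fix y assume "y \<in> ball x0 (r * s)"
        then have "(1 / r) *\<^sub>R (y - x0) \<in> ball 0 s" using scale[of y 0 s] by simp
        then have "(1 / r) *\<^sub>R (y - x0) \<in> ball 0 1" using \<eta>(6) by blast
        then show "y \<in> ?B" using scale[of y 0 1] by simp
      qed
      show "\<epsilon> \<le> u y" if "y \<in> ball x0 (r * s)" for y
        unfolding u_def arg by (rule \<eta>(7)) (use that scale[of y 0 s] in simp)
      show "\<omega> * (r * s) ^ n \<le> measure lebesgue (ball (x0 + r *\<^sub>R z) (r * s))" "\<omega> * (r * s) ^ n \<le> measure lebesgue (ball x0 (r * s))"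
        using mb[of "r * s"] r \<eta>(2) by (simp_all only: mult_nonneg_nonneg less_imp_le order_refl)
    qed (use \<eta>(3) in auto)
    have "\<epsilon> / 2 * s ^ n * measure lebesgue ?B \<le> oscillation ?B u"
      using osc by (simp only: mb[OF less_imp_le[OF r(1)]] power_mult_distrib mult_ac)
    then show "ball x0 r \<subseteq> \<Omega> \<and>
      (\<exists>u\<in>Sobolev_space m q \<alpha> \<beta> \<Omega>. set_integrable lebesgue (ball x0 r) u \<and>
        Sobolev_norm m q \<alpha> \<beta> \<Omega> u \<le> ennreal (C' * (r powr (real CARD('n) - real m)
           * lz_gauge q \<alpha> \<beta> (ell (unit_ball_vol (real CARD('n)) / measure lebesgue \<Omega> * r ^ CARD('n))))) \<and>
        \<epsilon> / 2 * s ^ n * measure lebesgue (ball x0 r) \<le> oscillation (ball x0 r) u)"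
      using B\<Omega> us ui norm by (auto simp: n_def V_def \<omega>_def)
  qed
qed

section \<open>Comparison of Campanato spaces\<close>

lemma measure_ball_powr:
  assumes "r > 0"
  shows "measure lebesgue (ball (x::real^'n) r) powr (1 / real CARD('n)) = unit_ball_vol (real CARD('n)) powr (1 / real CARD('n)) * r"
proof -
  have "(r ^ CARD('n)) powr (1 / real CARD('n)) = r"
    using assms by (simp add: powr_realpow[symmetric] powr_powr)
  then show ?thesis
    by (simp only: measure_ball_eq[OF less_imp_le[OF assms]] powr_mult)
qed

text \<open>Balls contained in \<Omega> have volume at most |\<Omega>|, so the seminorms see \<psi>
  and \<phi> on this range only, and the supremum can be compared ball by ball.\<close>

lemma Campanato_embedding_if_le:
  fixes \<Omega> :: "(real^'n) set"
  assumes \<Omega>: "\<Omega> \<in> lmeasurable" and \<psi>: "admissible \<psi>" and \<phi>: "admissible \<phi>" and A: "A \<ge> 0"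
    and le: "\<And>\<rho>. 0 < \<rho> \<Longrightarrow> \<rho> \<le> measure lebesgue \<Omega> powr (1 / real CARD('n)) \<Longrightarrow> \<psi> \<rho> \<le> A * \<phi> \<rho>"
  shows "Campanato_into_Campanato \<psi> \<phi> \<Omega>"
proof -
  have main: "Campanato_seminorm \<phi> \<Omega> u \<le> ennreal A * Campanato_seminorm \<psi> \<Omega> u" for u
    unfolding Campanato_seminorm_def[of \<phi>]
  proof (rule SUP_least)
    fix B assume "B \<in> {ball x r |x r. 0 < r \<and> ball x r \<subseteq> \<Omega>}"
    then obtain x r where B: "B = ball x r" "0 < r" "ball x r \<subseteq> \<Omega>" by blast
    define \<rho> where "\<rho> = measure lebesgue B powr (1 / CARD('n))"
    let ?I = "ennreal (1 / measure lebesgue B) * (\<integral>\<^sup>+x\<in>B. ennreal \<bar>u x - mean B u\<bar> \<partial>lebesgue)"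
    have mB: "measure lebesgue B > 0" unfolding B by (rule measure_ball_pos[OF B(2)])
    have "measure lebesgue B \<le> measure lebesgue \<Omega>"
      unfolding B by (rule measure_mono_fmeasurable[OF B(3) _ \<Omega>]) simp
    then have \<rho>: "0 < \<rho>" "\<rho> \<le> measure lebesgue \<Omega> powr (1 / real CARD('n))"
      using mB by (auto simp: \<rho>_def intro!: powr_mono2)
    have pos: "\<psi> \<rho> > 0" "\<phi> \<rho> > 0" using \<psi> \<phi> \<rho>(1) by (auto simp: admissible_def)
    have "1 / \<phi> \<rho> \<le> A * (1 / \<psi> \<rho>)" using le[OF \<rho>] pos by (simp add: field_simps)
    then have "ennreal (1 / \<phi> \<rho>) \<le> ennreal A * ennreal (1 / \<psi> \<rho>)"
      using A pos by (simp add: ennreal_mult[symmetric] ennreal_leI del: times_divide_eq_right)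
    then have "ennreal (1 / \<phi> \<rho>) * ?I \<le> (ennreal A * ennreal (1 / \<psi> \<rho>)) * ?I"
      by (rule mult_right_mono) simp
    also have "\<dots> = ennreal A * (ennreal (1 / \<psi> \<rho>) * ?I)" by (rule mult.assoc)
    also have "\<dots> \<le> ennreal A * Campanato_seminorm \<psi> \<Omega> u"
    proof (rule mult_left_mono)
      show "ennreal (1 / \<psi> \<rho>) * ?I \<le> Campanato_seminorm \<psi> \<Omega> u"
        unfolding Campanato_seminorm_def \<rho>_def by (rule SUP_upper) (use B in blast)
    qed simp
    finally show "ennreal (1 / \<phi> (measure lebesgue B powr (1 / CARD('n)))) * ?I \<le> ennreal A * Campanato_seminorm \<psi> \<Omega> u"
      by (simp only: \<rho>_def)
  qed
  have "Campanato_space \<psi> \<Omega> \<subseteq> Campanato_space \<phi> \<Omega>"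
  proof
    fix u assume u: "u \<in> Campanato_space \<psi> \<Omega>"
    then have "ennreal A * Campanato_seminorm \<psi> \<Omega> u < top"
      by (simp add: Campanato_space_def ennreal_mult_less_top)
    then have "Campanato_seminorm \<phi> \<Omega> u < top" by (rule le_less_trans[OF main])
    with u show "u \<in> Campanato_space \<phi> \<Omega>" by (simp add: Campanato_space_def)
  qed
  then show ?thesis unfolding embeds_def using main by blast
qed

text \<open>The assumed embedding, tested with the extremal function of radius r, gives a lower
  bound for \<phi>(\<theta> r) by a multiple of r^(m-n) / gauge, hence of \<psi>(\<theta> r). At
  radii bounded away from 0, \<psi> is bounded and \<phi> has a positive lower bound.\<close>

lemma Campanato_optimality:
  fixes \<Omega> :: "(real^'n) set"
  assumes John: "John_domain \<Omega>" and adm: "L1_admissible q \<alpha> \<beta>"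
    and \<psi>: "admissible \<psi>" "obeys_near_0 CARD('n) m q \<alpha> \<beta> \<psi>" "locally_bounded \<psi>"
    and \<phi>: "admissible \<phi>" "Sobolev_into_Campanato m q \<alpha> \<beta> \<phi> \<Omega>"
  shows "Campanato_into_Campanato \<psi> \<phi> \<Omega>"
proof -
  define n where "n = CARD('n)"
  have n: "n \<ge> 1" unfolding n_def by (simp add: Suc_leI)
  have \<Omega>: "open \<Omega>" "bounded \<Omega>" "\<Omega> \<noteq> {}" using John by (auto simp: John_domain_def)
  note \<Omega>m = bounded_open_lmeasurable[OF \<Omega>]
  obtain x0 where x0: "x0 \<in> \<Omega>" using \<Omega>(3) by blast
  define V \<omega> where "V = measure lebesgue \<Omega>" and "\<omega> = unit_ball_vol (real n)"
  have V: "V > 0" "\<omega> > 0" using \<Omega>m by (auto simp: V_def \<omega>_def)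
  define \<theta> where "\<theta> = \<omega> powr (1 / real n)"
  have \<theta>: "\<theta> > 0" "\<theta> ^ n = \<omega>" using V n by (auto simp: \<theta>_def powr_realpow[symmetric] powr_powr)
  define \<Gamma> where "\<Gamma> r = lz_gauge q \<alpha> \<beta> (ell (\<omega> / V * r ^ n))" for r
  have \<Gamma>: "\<Gamma> r > 0" for r unfolding \<Gamma>_def by (rule gauge_pos[OF ell_ge_1])
  have \<Gamma>\<theta>: "lz_gauge q \<alpha> \<beta> (ell (1 / V * (\<theta> * r) ^ n)) = \<Gamma> r" for r
    by (simp add: \<Gamma>_def power_mult_distrib \<theta>(2))
  obtain R C \<kappa> where ext: "R > 0" "C > 0" "\<kappa> > 0"
    "\<And>r. 0 < r \<Longrightarrow> r \<le> R \<Longrightarrow> ball x0 r \<subseteq> \<Omega> \<and>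
      (\<exists>u\<in>Sobolev_space m q \<alpha> \<beta> \<Omega>. set_integrable lebesgue (ball x0 r) u \<and>
        Sobolev_norm m q \<alpha> \<beta> \<Omega> u \<le> ennreal (C * (r powr (real n - real m) * \<Gamma> r)) \<and>
        \<kappa> * measure lebesgue (ball x0 r) \<le> oscillation (ball x0 r) u)"
  proof (rule extremal_functions[OF \<Omega>(1) x0 \<Omega>m adm, of m, folded n_def, folded \<omega>_def V_def, folded \<Gamma>_def])
    fix R C \<kappa> :: real assume a: "R > 0" "C > 0" "\<kappa> > 0"
    "\<And>r. 0 < r \<Longrightarrow> r \<le> R \<Longrightarrow> ball x0 r \<subseteq> \<Omega> \<and>
      (\<exists>u\<in>Sobolev_space m q \<alpha> \<beta> \<Omega>. set_integrable lebesgue (ball x0 r) u \<and>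
        Sobolev_norm m q \<alpha> \<beta> \<Omega> u \<le> ennreal (C * (r powr (real n - real m) * \<Gamma> r)) \<and>
        \<kappa> * measure lebesgue (ball x0 r) \<le> oscillation (ball x0 r) u)"
    show thesis by (rule that[OF a])
  qed
  \<comment> \<open>The constant in \<open>embeds\<close> is an arbitrary real. A negative one acts
    as 0 under \<open>ennreal\<close>, so it may be replaced by its positive part.\<close>
  obtain C0 where C0_all: "\<forall>u\<in>Sobolev_space m q \<alpha> \<beta> \<Omega>. Campanato_seminorm \<phi> \<Omega> u \<le> ennreal C0 * Sobolev_norm m q \<alpha> \<beta> \<Omega> u"
    "C0 \<ge> 0"
  proof -
    obtain C where C: "\<forall>u\<in>Sobolev_space m q \<alpha> \<beta> \<Omega>. Campanato_seminorm \<phi> \<Omega> u \<le> ennreal C * Sobolev_norm m q \<alpha> \<beta> \<Omega> u"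
      using \<phi>(2) unfolding embeds_def by (elim exE conjE)
    show thesis
    proof (rule that[of "max C 0"])
      show "\<forall>u\<in>Sobolev_space m q \<alpha> \<beta> \<Omega>. Campanato_seminorm \<phi> \<Omega> u \<le> ennreal (max C 0) * Sobolev_norm m q \<alpha> \<beta> \<Omega> u"
      proof
        fix u assume "u \<in> Sobolev_space m q \<alpha> \<beta> \<Omega>"
        with C have "Campanato_seminorm \<phi> \<Omega> u \<le> ennreal C * Sobolev_norm m q \<alpha> \<beta> \<Omega> u" by (rule bspec)
        also have "\<dots> \<le> ennreal (max C 0) * Sobolev_norm m q \<alpha> \<beta> \<Omega> u" by (intro mult_right_mono ennreal_leI) auto
        finally show "Campanato_seminorm \<phi> \<Omega> u \<le> ennreal (max C 0) * Sobolev_norm m q \<alpha> \<beta> \<Omega> u" .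
      qed
    qed simp
  qed
  note C0 = C0_all(2) C0_all(1)[rule_format]
  have V1: "1 / V > 0" using V by simp
  obtain c r0 where c_all: "c > 0" "r0 > 0" "\<forall>r. 0 < r \<longrightarrow> r < r0 \<longrightarrow>
    r powr (real m - real n) / lz_gauge q \<alpha> \<beta> (ell (1 / V * r ^ n)) \<le> c * \<psi> r \<and>
    \<psi> r \<le> c * (r powr (real m - real n) / lz_gauge q \<alpha> \<beta> (ell (1 / V * r ^ n)))"
    using obeys_near_0_gauge[OF adm V1 n \<psi>(2)[folded n_def]] by (elim exE conjE)
  note c = c_all(1,2) c_all(3)[rule_format, THEN conjunct2]
  have \<phi>pos: "\<phi> r > 0" if "r > 0" for r using \<phi>(1) that by (simp add: admissible_def)
  have key: "\<kappa> \<le> C0 * C * (r powr (real n - real m) * \<Gamma> r) * \<phi> (\<theta> * r)" if r: "0 < r" "r \<le> R" for r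
  proof -
    let ?B = "ball x0 r"
    obtain u where B: "?B \<subseteq> \<Omega>" and u: "u \<in> Sobolev_space m q \<alpha> \<beta> \<Omega>" "set_integrable lebesgue ?B u"
      "Sobolev_norm m q \<alpha> \<beta> \<Omega> u \<le> ennreal (C * (r powr (real n - real m) * \<Gamma> r))"
      "\<kappa> * measure lebesgue ?B \<le> oscillation ?B u"
      using ext(4)[OF r] by blast
    have mB: "measure lebesgue ?B > 0" by (rule measure_ball_pos[OF r(1)])
    have \<rho>: "measure lebesgue ?B powr (1 / CARD('n)) = \<theta> * r"
      using measure_ball_powr[OF r(1), of x0] by (simp only: \<theta>_def \<omega>_def n_def)
    have p: "\<phi> (\<theta> * r) > 0" using \<theta> r by (intro \<phi>pos) auto
    have "ennreal (\<kappa> / \<phi> (\<theta> * r)) \<le> ennreal (1 / \<phi> (\<theta> * r) * (1 / measure lebesgue ?B * oscillation ?B u))"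
      using u(4) mB p ext(3) by (intro ennreal_leI) (simp add: field_simps del: content_ball)
    also have "\<dots> = ennreal (1 / \<phi> (\<theta> * r)) * (ennreal (1 / measure lebesgue ?B) * ennreal (oscillation ?B u))"
    proof -
      have "0 \<le> \<kappa> * measure lebesgue ?B" using ext(3) by simp
      then have "oscillation ?B u \<ge> 0" using u(4) by linarith
      then show ?thesis using mB p by (simp only: ennreal_mult divide_nonneg_pos zero_le_one mult_nonneg_nonneg)
    qed
    also have "ennreal (oscillation ?B u) = (\<integral>\<^sup>+y\<in>?B. ennreal \<bar>u y - mean ?B u\<bar> \<partial>lebesgue)"
      by (rule nn_integral_eq_oscillation[symmetric]) (use u in auto)
    also have "ennreal (1 / \<phi> (\<theta> * r)) * (ennreal (1 / measure lebesgue ?B) * (\<integral>\<^sup>+y\<in>?B. ennreal \<bar>u y - mean ?B u\<bar> \<partial>lebesgue))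
        \<le> Campanato_seminorm \<phi> \<Omega> u"
      unfolding Campanato_seminorm_def \<rho>[symmetric] by (rule SUP_upper) (use r B in blast)
    also have "\<dots> \<le> ennreal C0 * Sobolev_norm m q \<alpha> \<beta> \<Omega> u" by (rule C0(2)[OF u(1)])
    also have "\<dots> \<le> ennreal C0 * ennreal (C * (r powr (real n - real m) * \<Gamma> r))"
      using u(3) by (rule mult_left_mono) simp
    also have "\<dots> = ennreal (C0 * (C * (r powr (real n - real m) * \<Gamma> r)))"
      using C0(1) ext(2) \<Gamma>[of r] by (intro ennreal_mult[symmetric]) auto
    finally have "\<kappa> / \<phi> (\<theta> * r) \<le> C0 * (C * (r powr (real n - real m) * \<Gamma> r))"
      using C0(1) ext(2) \<Gamma>[of r] by (subst (asm) ennreal_le_iff) auto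
    then show ?thesis using p by (simp add: divide_le_eq mult_ac)
  qed
  define A1 where "A1 = c * \<theta> powr (real m - real n) * C0 * C / \<kappa>"
  \<comment> \<open>\<theta> R is |B|^(1/n) for a ball of radius R, the largest one with an extremal
    function; halving r0 makes the inequality with r0 strict.\<close>
  define \<rho>1 where "\<rho>1 = min (\<theta> * R) (r0 / 2)"
  have \<rho>1: "\<rho>1 > 0" using \<theta> ext c by (simp add: \<rho>1_def)
  have small: "\<psi> \<rho> \<le> A1 * \<phi> \<rho>" if \<rho>: "0 < \<rho>" "\<rho> \<le> \<rho>1" for \<rho>
  proof -
    define r where "r = \<rho> / \<theta>"
    have r: "0 < r" "r \<le> R" "\<rho> = \<theta> * r"
      using \<rho> \<theta> by (auto simp: r_def \<rho>1_def field_simps)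
    have "\<rho> < r0" using \<rho> c by (simp add: \<rho>1_def)
    from c(3)[OF \<rho>(1) this] have "\<psi> \<rho> \<le> c * ((\<theta> * r) powr (real m - real n) / \<Gamma> r)"
      unfolding r(3) \<Gamma>\<theta> .
    also have "(\<theta> * r) powr (real m - real n) = \<theta> powr (real m - real n) * r powr (real m - real n)"
      by (rule powr_mult)
    also have "c * (\<theta> powr (real m - real n) * r powr (real m - real n) / \<Gamma> r)
        = (c * \<theta> powr (real m - real n) * (r powr (real m - real n) / \<Gamma> r)) * 1" by simp
    also have "\<dots> \<le> (c * \<theta> powr (real m - real n) * (r powr (real m - real n) / \<Gamma> r))
        * (C0 * C * (r powr (real n - real m) * \<Gamma> r) * \<phi> \<rho> / \<kappa>)"
      using key[OF r(1,2)] ext(3) c(1) \<Gamma>[of r] by (intro mult_left_mono) (auto simp: r(3) field_simps)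
    also have "\<dots> = A1 * \<phi> \<rho> * (r powr (real m - real n) * r powr (real n - real m))"
      using \<Gamma>[of r] by (simp add: A1_def)
    also have "r powr (real m - real n) * r powr (real n - real m) = 1"
      using r by (simp add: powr_add[symmetric])
    finally show ?thesis by simp
  qed
  \<comment> \<open>An upper bound for |B|^(1/n) over all balls in \<Omega>, so only the compact
    interval from \<rho>1 to \<open>?D\<close> is left, where local boundedness applies to
    \<psi>.\<close>
  let ?D = "V powr (1 / real n)"
  obtain p where p: "p > 0" "\<And>r. \<rho>1 \<le> r \<Longrightarrow> p \<le> \<phi> r"
    using admissible_lower_bound[OF \<phi>(1) \<rho>1] by blast
  have "bdd_above (\<psi> ` {\<rho>1..?D})" using \<psi>(3) \<rho>1 by (auto simp: locally_bounded_def)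
  then obtain M where M: "\<And>r. \<rho>1 \<le> r \<Longrightarrow> r \<le> ?D \<Longrightarrow> \<psi> r \<le> M"
    unfolding bdd_above_def by fastforce
  have A1: "A1 \<ge> 0" using c C0 ext by (simp add: A1_def)
  define A where "A = max A1 (\<bar>M\<bar> / p)"
  show ?thesis
  proof (rule Campanato_embedding_if_le[OF \<Omega>m(1) \<psi>(1) \<phi>(1), of A])
    show "A \<ge> 0" using A1 by (simp add: A_def le_max_iff_disj)
    fix \<rho> assume \<rho>: "0 < \<rho>" "\<rho> \<le> measure lebesgue \<Omega> powr (1 / real CARD('n))"
    have \<phi>\<rho>: "\<phi> \<rho> > 0" by (rule \<phi>pos[OF \<rho>(1)])
    show "\<psi> \<rho> \<le> A * \<phi> \<rho>"
    proof (cases "\<rho> \<le> \<rho>1")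
      case True
      have "\<psi> \<rho> \<le> A1 * \<phi> \<rho>" by (rule small[OF \<rho>(1) True])
      also have "\<dots> \<le> A * \<phi> \<rho>" using \<phi>\<rho> by (intro mult_right_mono) (auto simp: A_def)
      finally show ?thesis .
    next
      case False
      have "\<psi> \<rho> \<le> \<bar>M\<bar>" using M[of \<rho>] False \<rho> by (simp add: V_def n_def)
      also have "\<dots> = \<bar>M\<bar> / p * p" using p by simp
      also have "\<dots> \<le> A * \<phi> \<rho>" using p False by (intro mult_mono) (auto simp: A_def le_max_iff_disj)
      finally show ?thesis .
    qed
  qed
qed

theorem theorem3p9:
  fixes \<Omega> :: "(real^'n) set" and q :: ennreal and \<alpha> \<beta> :: real
  assumes "CARD('n) \<ge> 2"
    and "John_domain \<Omega>"
    and "L1_admissible q \<alpha> \<beta>"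
  shows
    "(\<forall>\<psi>. admissible \<psi> \<and> obeys_near_0 CARD('n) 1 q \<alpha> \<beta> \<psi> \<longrightarrow>
        Sobolev_into_Campanato 1 q \<alpha> \<beta> \<psi> \<Omega> \<and>
        (locally_bounded \<psi> \<longrightarrow>
          (\<forall>\<phi>. admissible \<phi> \<and> Sobolev_into_Campanato 1 q \<alpha> \<beta> \<phi> \<Omega>
             \<longrightarrow> Campanato_into_Campanato \<psi> \<phi> \<Omega>)))
     \<and>
     (\<forall>m\<in>{2..CARD('n)}. \<forall>\<psi>. admissible \<psi> \<and> obeys_near_0 CARD('n) m q \<alpha> \<beta> \<psi> \<longrightarrow>
        Sobolev_into_Campanato m q \<alpha> \<beta> \<psi> \<Omega> \<and>
        (locally_bounded \<psi> \<longrightarrow>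
          (\<forall>\<phi>. admissible \<phi> \<and> Sobolev_into_Campanato m q \<alpha> \<beta> \<phi> \<Omega>
             \<longrightarrow> Campanato_into_Campanato \<psi> \<phi> \<Omega>)))"
proof -
  \<comment> \<open>Both parts are instances of one statement for 1 <= m <= n.\<close>
  have main: "\<forall>\<psi>. admissible \<psi> \<and> obeys_near_0 CARD('n) m q \<alpha> \<beta> \<psi> \<longrightarrow>
        Sobolev_into_Campanato m q \<alpha> \<beta> \<psi> \<Omega> \<and>
        (locally_bounded \<psi> \<longrightarrow>
          (\<forall>\<phi>. admissible \<phi> \<and> Sobolev_into_Campanato m q \<alpha> \<beta> \<phi> \<Omega>
             \<longrightarrow> Campanato_into_Campanato \<psi> \<phi> \<Omega>))"
    if m: "1 \<le> m" "m \<le> CARD('n)" for m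
  proof (intro allI impI conjI; elim conjE)
    fix \<psi> \<phi> assume \<psi>: "admissible \<psi>" "obeys_near_0 CARD('n) m q \<alpha> \<beta> \<psi>"
    show "Sobolev_into_Campanato m q \<alpha> \<beta> \<psi> \<Omega>"
      by (rule Sobolev_embedding[OF assms(2,3) m \<psi>])
    assume "locally_bounded \<psi>" "admissible \<phi>" "Sobolev_into_Campanato m q \<alpha> \<beta> \<phi> \<Omega>"
    then show "Campanato_into_Campanato \<psi> \<phi> \<Omega>"
      by (rule Campanato_optimality[OF assms(2,3) \<psi>])
  qed
  show ?thesis
  proof (intro conjI ballI)
    fix m assume "m \<in> {2..CARD('n)}"
    then show "\<forall>\<psi>. admissible \<psi> \<and> obeys_near_0 CARD('n) m q \<alpha> \<beta> \<psi> \<longrightarrow>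
        Sobolev_into_Campanato m q \<alpha> \<beta> \<psi> \<Omega> \<and>
        (locally_bounded \<psi> \<longrightarrow>
          (\<forall>\<phi>. admissible \<phi> \<and> Sobolev_into_Campanato m q \<alpha> \<beta> \<phi> \<Omega>
             \<longrightarrow> Campanato_into_Campanato \<psi> \<phi> \<Omega>))"
      by (intro main) auto
  qed (rule main, use assms(1) in auto)
qed

end
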